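(* Let $\mathcal C$ be a triangulated category endowed with a weight structure $w$, with heart $\underline{Hw}$, and let $\mathcal A$ be an abelian category. 1. Let $A:\underline{Hw}\to\mathcal A$ be an additive functor. Choose a weight complex $t(M)=(M^j)$ for each $M\in\mathrm{Obj}\,\mathcal C$, and denote by $H^A(M)$ the zeroth homology of the complex $(A(M^j))$. Then $H^A(-)$ yields a homological functor $\mathcal C\to\mathcal A$ that does not depend on the choices of weight complexes. Moreover, the assignment $A\mapsto H^A$ is natural in $A$. 2. The correspondence $A\mapsto H^A$ is an equivalence of categories between the following (not necessarily locally small) categories of functors: the category of additive functors $\underline{Hw}\to\mathcal A$, and the category of $w$-pure homological functors from $\mathcal C$ into $\mathcal A$. 3. Assume that $w$ is bounded. Then a (co)homological functor $H$ from $\mathcal C$ into $\mathcal A$ is $w$-pure if and only if it annihilates $\mathcal C_{w=i}$ for all $i\ne 0$.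
   Context: A weight structure $w$ on a triangulated category $\mathcal C$ (homological convention) is a pair of classes $\mathcal C_{w\le 0},\mathcal C_{w\ge 0}\subset \mathrm{Obj}\,\mathcal C$ such that: (i) both are closed under retracts in $\mathcal C$; (ii) $\mathcal C_{w\le 0}\subset\mathcal C_{w\le 0}[1]$ and $\mathcal C_{w\ge 0}[1]\subset\mathcal C_{w\ge 0}$; (iii) $\mathcal C(X,Y)=0$ for all $X\in\mathcal C_{w\le 0}$, $Y\in\mathcal C_{w\ge 0}[1]$; (iv) every $M\in\mathrm{Obj}\,\mathcal C$ fits in a distinguished triangle $LM\to M\to RM\to LM[1]$ with $LM\in\mathcal C_{w\le 0}$, $RM\in\mathcal C_{w\ge 0}[1]$. Notation: $\mathcal C_{w\ge i}=\mathcal C_{w\ge 0}[i]$, $\mathcal C_{w\le i}=\mathcal C_{w\le 0}[i]$, $\mathcal C_{w=i}=\mathcal C_{w\ge i}\cap\mathcal C_{w\le i}$. The heart $\underline{Hw}$ is the full subcategory with object class $\mathcal C_{w=0}$. $w$ is bounded if $\bigcup_i\mathcal C_{w\le i}=\mathrm{Obj}\,\mathcal C=\bigcup_i\mathcal C_{w\ge i}$. Weight complexes. For $M\in\mathrm{Obj}\,\mathcal C$ choose for every $i\in\mathbb Z$ a distinguished triangle $w_{\le i}M\xrightarrow{h_i}M\to w_{\ge i+1}M\to w_{\le i}M[1]$ with $w_{\le i}M\in\mathcal C_{w\le i}$, $w_{\ge i+1}M\in\mathcal C_{w\ge i+1}$ (an $i$-weight decomposition). There are unique $j_i:w_{\le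 i}M\to w_{\le i+1}M$ with $h_{i+1}\circ j_i=h_i$. Complete them to distinguished triangles $w_{\le i-1}M\xrightarrow{j_{i-1}}w_{\le i}M\xrightarrow{c_i}M_i\xrightarrow{e_{i-1}}w_{\le i-1}M[1]$ (this datum is a weight Postnikov tower for $M$). Put $M^p=M_{-p}[p]$, which lies in $\mathcal C_{w=0}$, and $d^i=c_{-i-1}[i+1]\circ e_{-i-1}[i]:M^i\to M^{i+1}$. The complex $t(M)=(M^i,d^i)$ over $\underline{Hw}$ is (a choice of) a weight complex of $M$. A covariant (resp. contravariant) additive functor from $\mathcal C$ to an abelian category is homological (resp. cohomological) if it converts distinguished triangles into long exact sequences. A (co)homological functor $H$ from $\mathcal C$ is $w$-pure if it kills both $\mathcal C_{w\ge 1}$ and $\mathcal C_{w\le -1}$. *)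

theory Defs
  imports "HOL-Algebra.Group"
begin

section \<open>Categories and functors\<close>

record ('o, 'm) cat =
  obj :: "'o set"
  arr :: "'m set"
  src :: "'m \<Rightarrow> 'o"
  tgt :: "'m \<Rightarrow> 'o"
  idt :: "'o \<Rightarrow> 'm"
  cmp :: "'m \<Rightarrow> 'm \<Rightarrow> 'm"  (infixl "\<cdot>\<index>" 70)

definition homs :: "('o, 'm, 'z) cat_scheme \<Rightarrow> 'o \<Rightarrow> 'o \<Rightarrow> 'm set" where
  "homs C X Y = {f \<in> arr C. src C f = X \<and> tgt C f = Y}"

text \<open>Composition is written in the usual order and is only constrained on composable arrows.\<close>

locale category =
  fixes C :: "('o, 'm, 'z) cat_scheme" (structure)
  assumes src_obj: "f \<in> arr C \<Longrightarrow> src C f \<in> obj C"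
    and tgt_obj: "f \<in> arr C \<Longrightarrow> tgt C f \<in> obj C"
    and idt_homs: "X \<in> obj C \<Longrightarrow> idt C X \<in> homs C X X"
    and cmp_homs: "f \<in> homs C X Y \<Longrightarrow> g \<in> homs C Y Z \<Longrightarrow> g \<cdot> f \<in> homs C X Z"
    and cmp_idt: "f \<in> homs C X Y \<Longrightarrow> f \<cdot> idt C X = f"
    and idt_cmp: "f \<in> homs C X Y \<Longrightarrow> idt C Y \<cdot> f = f"
    and cmp_assoc: "f \<in> homs C W X \<Longrightarrow> g \<in> homs C X Y \<Longrightarrow> h \<in> homs C Y Z \<Longrightarrow>
      h \<cdot> (g \<cdot> f) = (h \<cdot> g) \<cdot> f"

definition is_iso :: "('o, 'm, 'z) cat_scheme \<Rightarrow> 'm \<Rightarrow> bool" where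
  "is_iso C f \<longleftrightarrow> f \<in> arr C \<and>
    (\<exists>g \<in> homs C (tgt C f) (src C f).
      g \<cdot>\<^bsub>C\<^esub> f = idt C (src C f) \<and> f \<cdot>\<^bsub>C\<^esub> g = idt C (tgt C f))"

definition is_mono :: "('o, 'm, 'z) cat_scheme \<Rightarrow> 'm \<Rightarrow> bool" where
  "is_mono C f \<longleftrightarrow> f \<in> arr C \<and>
    (\<forall>W. \<forall>x \<in> homs C W (src C f). \<forall>y \<in> homs C W (src C f).
      f \<cdot>\<^bsub>C\<^esub> x = f \<cdot>\<^bsub>C\<^esub> y \<longrightarrow> x = y)"

definition is_epi :: "('o, 'm, 'z) cat_scheme \<Rightarrow> 'm \<Rightarrow> bool" where
  "is_epi C f \<longleftrightarrow> f \<in> arr C \<and>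
    (\<forall>W. \<forall>x \<in> homs C (tgt C f) W. \<forall>y \<in> homs C (tgt C f) W.
      x \<cdot>\<^bsub>C\<^esub> f = y \<cdot>\<^bsub>C\<^esub> f \<longrightarrow> x = y)"

definition zero_object :: "('o, 'm, 'z) cat_scheme \<Rightarrow> 'o \<Rightarrow> bool" where
  "zero_object C Z \<longleftrightarrow> Z \<in> obj C \<and>
    (\<forall>X \<in> obj C. (\<exists>!f. f \<in> homs C X Z) \<and> (\<exists>!f. f \<in> homs C Z X))"

definition retract_of :: "('o, 'm, 'z) cat_scheme \<Rightarrow> 'o \<Rightarrow> 'o \<Rightarrow> bool" where
  "retract_of C X Y \<longleftrightarrow> X \<in> obj C \<and> Y \<in> obj C \<and>
    (\<exists>i \<in> homs C X Y. \<exists>p \<in> homs C Y X. p \<cdot>\<^bsub>C\<^esub> i = idt C X)"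

record ('o, 'm, 'p, 'q) cfunctor =
  fobj :: "'o \<Rightarrow> 'p"
  farr :: "'m \<Rightarrow> 'q"

text \<open>Object and arrow maps are extensional (undefined outside the source category), so that
  equality of functors is equality of their values and functors form a genuine category.\<close>

definition is_functor ::
  "('o, 'm, 'y) cat_scheme \<Rightarrow> ('p, 'q, 'z) cat_scheme \<Rightarrow> ('o, 'm, 'p, 'q) cfunctor \<Rightarrow> bool" where
  "is_functor C D F \<longleftrightarrow>
    fobj F \<in> obj C \<rightarrow>\<^sub>E obj D \<and> farr F \<in> arr C \<rightarrow>\<^sub>E arr D \<and>
    (\<forall>f \<in> arr C. src D (farr F f) = fobj F (src C f) \<and> tgt D (farr F f) = fobj F (tgt C f)) \<and>
    (\<forall>X \<in> obj C. farr F (idt C X) = idt D (fobj F X)) \<and>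
    (\<forall>f \<in> arr C. \<forall>g \<in> arr C. tgt C f = src C g \<longrightarrow>
      farr F (g \<cdot>\<^bsub>C\<^esub> f) = farr F g \<cdot>\<^bsub>D\<^esub> farr F f)"

definition id_functor :: "('o, 'm, 'z) cat_scheme \<Rightarrow> ('o, 'm, 'o, 'm) cfunctor" where
  "id_functor C = \<lparr>fobj = (\<lambda>X \<in> obj C. X), farr = (\<lambda>f \<in> arr C. f)\<rparr>"

definition comp_functor ::
  "('o, 'm, 'z) cat_scheme \<Rightarrow> ('p, 'q, 'r, 's) cfunctor \<Rightarrow> ('o, 'm, 'p, 'q) cfunctor
    \<Rightarrow> ('o, 'm, 'r, 's) cfunctor" where
  "comp_functor C G F =
    \<lparr>fobj = compose (obj C) (fobj G) (fobj F), farr = compose (arr C) (farr G) (farr F)\<rparr>"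

definition is_nat ::
  "('o, 'm, 'y) cat_scheme \<Rightarrow> ('p, 'q, 'z) cat_scheme \<Rightarrow> ('o, 'm, 'p, 'q) cfunctor
    \<Rightarrow> ('o, 'm, 'p, 'q) cfunctor \<Rightarrow> ('o \<Rightarrow> 'q) \<Rightarrow> bool" where
  "is_nat C D F G t \<longleftrightarrow> t \<in> extensional (obj C) \<and>
    (\<forall>X \<in> obj C. t X \<in> homs D (fobj F X) (fobj G X)) \<and>
    (\<forall>f \<in> arr C. t (tgt C f) \<cdot>\<^bsub>D\<^esub> farr F f = farr G f \<cdot>\<^bsub>D\<^esub> t (src C f))"

definition is_nat_iso ::
  "('o, 'm, 'y) cat_scheme \<Rightarrow> ('p, 'q, 'z) cat_scheme \<Rightarrow> ('o, 'm, 'p, 'q) cfunctor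
    \<Rightarrow> ('o, 'm, 'p, 'q) cfunctor \<Rightarrow> ('o \<Rightarrow> 'q) \<Rightarrow> bool" where
  "is_nat_iso C D F G t \<longleftrightarrow> is_nat C D F G t \<and> (\<forall>X \<in> obj C. is_iso D (t X))"

text \<open>A natural transformation as an arrow of a functor category carries its source and target.\<close>

record ('o, 'm, 'p, 'q) nattrans =
  nsrc :: "('o, 'm, 'p, 'q) cfunctor"
  ntgt :: "('o, 'm, 'p, 'q) cfunctor"
  ncomp :: "'o \<Rightarrow> 'q"

definition functor_cat ::
  "('o, 'm, 'y) cat_scheme \<Rightarrow> ('p, 'q, 'z) cat_scheme \<Rightarrow> ('o, 'm, 'p, 'q) cfunctor set
    \<Rightarrow> (('o, 'm, 'p, 'q) cfunctor, ('o, 'm, 'p, 'q) nattrans) cat" where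
  "functor_cat C D S = \<lparr>
    obj = S,
    arr = {t. nsrc t \<in> S \<and> ntgt t \<in> S \<and> is_nat C D (nsrc t) (ntgt t) (ncomp t)},
    src = nsrc,
    tgt = ntgt,
    idt = (\<lambda>F. \<lparr>nsrc = F, ntgt = F, ncomp = (\<lambda>X \<in> obj C. idt D (fobj F X))\<rparr>),
    cmp = (\<lambda>t s. \<lparr>nsrc = nsrc s, ntgt = ntgt t,
                   ncomp = (\<lambda>X \<in> obj C. ncomp t X \<cdot>\<^bsub>D\<^esub> ncomp s X)\<rparr>)\<rparr>"

definition equivalence_of_categories ::
  "('o, 'm, 'y) cat_scheme \<Rightarrow> ('p, 'q, 'z) cat_scheme \<Rightarrow> ('o, 'm, 'p, 'q) cfunctor \<Rightarrow> bool" where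
  "equivalence_of_categories C D F \<longleftrightarrow> is_functor C D F \<and>
    (\<exists>G. is_functor D C G \<and>
      (\<exists>s. is_nat_iso C C (id_functor C) (comp_functor C G F) s) \<and>
      (\<exists>t. is_nat_iso D D (comp_functor D F G) (id_functor D) t))"


section \<open>Additive and abelian categories\<close>

record ('o, 'm) precat = "('o, 'm) cat" +
  padd :: "'m \<Rightarrow> 'm \<Rightarrow> 'm"  (infixl "\<boxplus>\<index>" 65)
  pzero :: "'o \<Rightarrow> 'o \<Rightarrow> 'm"

definition hom_group :: "('o, 'm, 'z) precat_scheme \<Rightarrow> 'o \<Rightarrow> 'o \<Rightarrow> 'm monoid" where
  "hom_group C X Y = \<lparr>carrier = homs C X Y, mult = padd C, one = pzero C X Y\<rparr>"

definition pneg :: "('o, 'm, 'z) precat_scheme \<Rightarrow> 'm \<Rightarrow> 'm" where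
  "pneg C f = m_inv (hom_group C (src C f) (tgt C f)) f"

definition op_cat :: "('o, 'm, 'z) precat_scheme \<Rightarrow> ('o, 'm) precat" where
  "op_cat C = \<lparr>obj = obj C, arr = arr C, src = tgt C, tgt = src C, idt = idt C,
    cmp = (\<lambda>g f. f \<cdot>\<^bsub>C\<^esub> g), padd = padd C, pzero = (\<lambda>X Y. pzero C Y X)\<rparr>"

definition full_subcat :: "('o, 'm, 'z) precat_scheme \<Rightarrow> 'o set \<Rightarrow> ('o, 'm) precat" where
  "full_subcat C S = \<lparr>obj = S, arr = {f \<in> arr C. src C f \<in> S \<and> tgt C f \<in> S},
    src = src C, tgt = tgt C, idt = idt C, cmp = cmp C, padd = padd C, pzero = pzero C\<rparr>"

locale additive_category = category C for C :: "('o, 'm, 'z) precat_scheme" (structure) +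
  assumes hom_group: "X \<in> obj C \<Longrightarrow> Y \<in> obj C \<Longrightarrow> comm_group (hom_group C X Y)"
    and cmp_padd: "f \<in> homs C X Y \<Longrightarrow> g \<in> homs C X Y \<Longrightarrow> h \<in> homs C Y Z \<Longrightarrow>
      h \<cdot> (f \<boxplus> g) = (h \<cdot> f) \<boxplus> (h \<cdot> g)"
    and padd_cmp: "e \<in> homs C W X \<Longrightarrow> f \<in> homs C X Y \<Longrightarrow> g \<in> homs C X Y \<Longrightarrow>
      (f \<boxplus> g) \<cdot> e = (f \<cdot> e) \<boxplus> (g \<cdot> e)"
    and ex_zero_object: "\<exists>Z. zero_object C Z"
    and ex_biproduct: "X \<in> obj C \<Longrightarrow> Y \<in> obj C \<Longrightarrow>
      \<exists>S \<in> obj C. \<exists>i \<in> homs C X S. \<exists>j \<in> homs C Y S. \<exists>p \<in> homs C S X. \<exists>q \<in> homs C S Y.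
        p \<cdot> i = idt C X \<and> q \<cdot> j = idt C Y \<and> p \<cdot> j = pzero C Y X \<and> q \<cdot> i = pzero C X Y \<and>
        (i \<cdot> p) \<boxplus> (j \<cdot> q) = idt C S"

definition additive_functors ::
  "('o, 'm, 'y) precat_scheme \<Rightarrow> ('p, 'q, 'z) precat_scheme \<Rightarrow> ('o, 'm, 'p, 'q) cfunctor set" where
  "additive_functors C D = {F. is_functor C D F \<and>
    (\<forall>X \<in> obj C. \<forall>Y \<in> obj C. \<forall>f \<in> homs C X Y. \<forall>g \<in> homs C X Y.
      farr F (f \<boxplus>\<^bsub>C\<^esub> g) = farr F f \<boxplus>\<^bsub>D\<^esub> farr F g)}"

definition is_kernel :: "('o, 'm, 'z) precat_scheme \<Rightarrow> 'm \<Rightarrow> 'm \<Rightarrow> bool" where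
  "is_kernel D f k \<longleftrightarrow> f \<in> arr D \<and> k \<in> arr D \<and> tgt D k = src D f \<and>
    f \<cdot>\<^bsub>D\<^esub> k = pzero D (src D k) (tgt D f) \<and>
    (\<forall>x \<in> arr D. tgt D x = src D f \<and> f \<cdot>\<^bsub>D\<^esub> x = pzero D (src D x) (tgt D f) \<longrightarrow>
      (\<exists>!y. y \<in> homs D (src D x) (src D k) \<and> k \<cdot>\<^bsub>D\<^esub> y = x))"

definition is_cokernel :: "('o, 'm, 'z) precat_scheme \<Rightarrow> 'm \<Rightarrow> 'm \<Rightarrow> bool" where
  "is_cokernel D f q \<longleftrightarrow> f \<in> arr D \<and> q \<in> arr D \<and> src D q = tgt D f \<and>
    q \<cdot>\<^bsub>D\<^esub> f = pzero D (src D f) (tgt D q) \<and>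
    (\<forall>x \<in> arr D. src D x = tgt D f \<and> x \<cdot>\<^bsub>D\<^esub> f = pzero D (src D f) (tgt D x) \<longrightarrow>
      (\<exists>!y. y \<in> homs D (tgt D q) (tgt D x) \<and> y \<cdot>\<^bsub>D\<^esub> q = x))"

locale abelian_category = additive_category D for D :: "('a, 'b, 'z) precat_scheme" (structure) +
  assumes ex_kernel: "f \<in> arr D \<Longrightarrow> \<exists>k. is_kernel D f k"
    and ex_cokernel: "f \<in> arr D \<Longrightarrow> \<exists>q. is_cokernel D f q"
    and mono_kernel: "is_mono D f \<Longrightarrow> \<exists>g. is_kernel D g f"
    and epi_cokernel: "is_epi D f \<Longrightarrow> \<exists>g. is_cokernel D g f"

text \<open>Exactness at the middle term: the image of \<open>f\<close>, i.e. a kernel \<open>k\<close> of a cokernel of \<open>f\<close>,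
  is a kernel of \<open>g\<close>.\<close>

definition exact_pair :: "('a, 'b, 'z) precat_scheme \<Rightarrow> 'b \<Rightarrow> 'b \<Rightarrow> bool" where
  "exact_pair D f g \<longleftrightarrow> (\<exists>q k. is_cokernel D f q \<and> is_kernel D q k \<and> is_kernel D g k)"

text \<open>For composable \<open>f\<close>, \<open>g\<close> with zero composite, the homology at the middle term is the target
  of \<open>q\<close>, where \<open>k\<close> is a kernel of \<open>g\<close> and \<open>q\<close> is a cokernel of the arrow to it induced by \<open>f\<close>.\<close>

definition is_homology :: "('a, 'b, 'z) precat_scheme \<Rightarrow> 'b \<Rightarrow> 'b \<Rightarrow> 'b \<times> 'b \<Rightarrow> bool" where
  "is_homology D f g = (\<lambda>(k, q). is_kernel D g k \<and>
    (\<exists>f' \<in> homs D (src D f) (src D k). k \<cdot>\<^bsub>D\<^esub> f' = f \<and> is_cokernel D f' q))"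

definition homology_data :: "('a, 'b, 'z) precat_scheme \<Rightarrow> 'b \<Rightarrow> 'b \<Rightarrow> 'b \<times> 'b" where
  "homology_data D f g = (SOME kq. is_homology D f g kq)"

definition homology :: "('a, 'b, 'z) precat_scheme \<Rightarrow> 'b \<Rightarrow> 'b \<Rightarrow> 'a" where
  "homology D f g = tgt D (snd (homology_data D f g))"

text \<open>The map on homology induced by the middle component \<open>v\<close> of a morphism of complexes from
  \<open>(f, g)\<close> to \<open>(f', g')\<close>.\<close>

definition homology_map ::
  "('a, 'b, 'z) precat_scheme \<Rightarrow> 'b \<Rightarrow> 'b \<Rightarrow> 'b \<Rightarrow> 'b \<Rightarrow> 'b \<Rightarrow> 'b" where
  "homology_map D f g f' g' v =
    (let (k, q) = homology_data D f g; (k', q') = homology_data D f' g' in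
      THE m. m \<in> homs D (tgt D q) (tgt D q') \<and>
        (\<exists>u \<in> homs D (src D k) (src D k').
          k' \<cdot>\<^bsub>D\<^esub> u = v \<cdot>\<^bsub>D\<^esub> k \<and> m \<cdot>\<^bsub>D\<^esub> q = q' \<cdot>\<^bsub>D\<^esub> u))"


section \<open>Triangulated categories\<close>

record ('o, 'm) tricat = "('o, 'm) precat" +
  shift :: "('o, 'm, 'o, 'm) cfunctor"
  tri :: "('m \<times> 'm \<times> 'm) set"

definition shO :: "('o, 'm, 'z) tricat_scheme \<Rightarrow> int \<Rightarrow> 'o \<Rightarrow> 'o" where
  "shO C n = (if 0 \<le> n then fobj (shift C) ^^ nat n
              else inv_into (obj C) (fobj (shift C)) ^^ nat (- n))"

definition shA :: "('o, 'm, 'z) tricat_scheme \<Rightarrow> int \<Rightarrow> 'm \<Rightarrow> 'm" where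
  "shA C n = (if 0 \<le> n then farr (shift C) ^^ nat n
              else inv_into (arr C) (farr (shift C)) ^^ nat (- n))"

definition is_triangle :: "('o, 'm, 'z) tricat_scheme \<Rightarrow> 'm \<Rightarrow> 'm \<Rightarrow> 'm \<Rightarrow> bool" where
  "is_triangle C f g h \<longleftrightarrow> f \<in> arr C \<and> g \<in> arr C \<and> h \<in> arr C \<and>
    tgt C f = src C g \<and> tgt C g = src C h \<and> tgt C h = shO C 1 (src C f)"

text \<open>The shift is an automorphism of the category, and the last axiom is the octahedral axiom
  for composable \<open>f\<close> and \<open>g\<close>.\<close>

locale triangulated_category = additive_category C
  for C :: "('o, 'm, 'z) tricat_scheme" (structure) +
  assumes shift_additive: "shift C \<in> additive_functors C C"
    and shift_bij_obj: "bij_betw (fobj (shift C)) (obj C) (obj C)"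
    and shift_bij_arr: "bij_betw (farr (shift C)) (arr C) (arr C)"
    and tri_triangle: "(f, g, h) \<in> tri C \<Longrightarrow> is_triangle C f g h"
    and tri_iso: "(f, g, h) \<in> tri C \<Longrightarrow> is_triangle C f' g' h' \<Longrightarrow>
      is_iso C u \<Longrightarrow> is_iso C v \<Longrightarrow> is_iso C w \<Longrightarrow>
      u \<in> homs C (src C f) (src C f') \<Longrightarrow> v \<in> homs C (src C g) (src C g') \<Longrightarrow>
      w \<in> homs C (src C h) (src C h') \<Longrightarrow>
      v \<cdot> f = f' \<cdot> u \<Longrightarrow> w \<cdot> g = g' \<cdot> v \<Longrightarrow> shA C 1 u \<cdot> h = h' \<cdot> w \<Longrightarrow>
      (f', g', h') \<in> tri C"
    and tri_idt: "X \<in> obj C \<Longrightarrow> zero_object C Z \<Longrightarrow>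
      (idt C X, pzero C X Z, pzero C Z (shO C 1 X)) \<in> tri C"
    and tri_cone: "f \<in> arr C \<Longrightarrow> \<exists>g h. (f, g, h) \<in> tri C"
    and tri_rotate: "is_triangle C f g h \<Longrightarrow>
      (f, g, h) \<in> tri C \<longleftrightarrow> (g, h, pneg C (shA C 1 f)) \<in> tri C"
    and tri_morphism: "(f, g, h) \<in> tri C \<Longrightarrow> (f', g', h') \<in> tri C \<Longrightarrow>
      u \<in> homs C (src C f) (src C f') \<Longrightarrow> v \<in> homs C (src C g) (src C g') \<Longrightarrow>
      v \<cdot> f = f' \<cdot> u \<Longrightarrow>
      \<exists>w \<in> homs C (src C h) (src C h'). w \<cdot> g = g' \<cdot> v \<and> shA C 1 u \<cdot> h = h' \<cdot> w"
    and tri_octahedron: "(f, f1, f2) \<in> tri C \<Longrightarrow> (g, g1, g2) \<in> tri C \<Longrightarrow> tgt C f = src C g \<Longrightarrow>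
      (g \<cdot> f, k1, k2) \<in> tri C \<Longrightarrow>
      \<exists>u v. (u, v, shA C 1 f1 \<cdot> g2) \<in> tri C \<and>
        u \<in> homs C (tgt C f1) (tgt C k1) \<and> v \<in> homs C (tgt C k1) (tgt C g1) \<and>
        u \<cdot> f1 = k1 \<cdot> g \<and> k2 \<cdot> u = f2 \<and> v \<cdot> k1 = g1 \<and> g2 \<cdot> v = shA C 1 f \<cdot> k2"

text \<open>The long exact sequence of a triangle \<open>X \<rightarrow> Y \<rightarrow> Z \<rightarrow> X[1]\<close> consists of the values of the
  functor on all shifts of the three arrows.\<close>

definition homological_functors ::
  "('o, 'm, 'y) tricat_scheme \<Rightarrow> ('a, 'b, 'z) precat_scheme \<Rightarrow> ('o, 'm, 'a, 'b) cfunctor set" where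
  "homological_functors C D = {H \<in> additive_functors C D.
    \<forall>(f, g, h) \<in> tri C. \<forall>n.
      exact_pair D (farr H (shA C n f)) (farr H (shA C n g)) \<and>
      exact_pair D (farr H (shA C n g)) (farr H (shA C n h)) \<and>
      exact_pair D (farr H (shA C n h)) (farr H (shA C (n + 1) f))}"

text \<open>Contravariant functors are functors on the opposite category.\<close>

definition cohomological_functors ::
  "('o, 'm, 'y) tricat_scheme \<Rightarrow> ('a, 'b, 'z) precat_scheme \<Rightarrow> ('o, 'm, 'a, 'b) cfunctor set" where
  "cohomological_functors C D = {H \<in> additive_functors (op_cat C) D.
    \<forall>(f, g, h) \<in> tri C. \<forall>n.
      exact_pair D (farr H (shA C (n + 1) f)) (farr H (shA C n h)) \<and>
      exact_pair D (farr H (shA C n h)) (farr H (shA C n g)) \<and>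
      exact_pair D (farr H (shA C n g)) (farr H (shA C n f))}"


section \<open>Weight structures and weight complexes\<close>

record 'o weights =
  wle0 :: "'o set"
  wge0 :: "'o set"

definition wle :: "('o, 'm, 'z) tricat_scheme \<Rightarrow> 'o weights \<Rightarrow> int \<Rightarrow> 'o set" where
  "wle C w i = shO C i ` wle0 w"

definition wge :: "('o, 'm, 'z) tricat_scheme \<Rightarrow> 'o weights \<Rightarrow> int \<Rightarrow> 'o set" where
  "wge C w i = shO C i ` wge0 w"

definition weq :: "('o, 'm, 'z) tricat_scheme \<Rightarrow> 'o weights \<Rightarrow> int \<Rightarrow> 'o set" where
  "weq C w i = wge C w i \<inter> wle C w i"

definition heart :: "('o, 'm, 'z) tricat_scheme \<Rightarrow> 'o weights \<Rightarrow> ('o, 'm) precat" where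
  "heart C w = full_subcat C (weq C w 0)"

definition weight_decomposition ::
  "('o, 'm, 'z) tricat_scheme \<Rightarrow> 'o weights \<Rightarrow> int \<Rightarrow> 'o \<Rightarrow> 'm \<Rightarrow> 'm \<Rightarrow> 'm \<Rightarrow> bool" where
  "weight_decomposition C w i M h r b \<longleftrightarrow> (h, r, b) \<in> tri C \<and>
    src C h \<in> wle C w i \<and> tgt C h = M \<and> tgt C r \<in> wge C w (i + 1)"

locale weight_structure = triangulated_category C
  for C :: "('o, 'm, 'z) tricat_scheme" (structure) +
  fixes w :: "'o weights"
  assumes wle0_obj: "wle0 w \<subseteq> obj C"
    and wge0_obj: "wge0 w \<subseteq> obj C"
    and wle0_retract: "Y \<in> wle0 w \<Longrightarrow> retract_of C X Y \<Longrightarrow> X \<in> wle0 w"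
    and wge0_retract: "Y \<in> wge0 w \<Longrightarrow> retract_of C X Y \<Longrightarrow> X \<in> wge0 w"
    and wle0_shift: "wle0 w \<subseteq> wle C w 1"
    and wge0_shift: "wge C w 1 \<subseteq> wge0 w"
    and orthogonality: "X \<in> wle0 w \<Longrightarrow> Y \<in> wge C w 1 \<Longrightarrow> homs C X Y = {pzero C X Y}"
    and ex_decomposition: "M \<in> obj C \<Longrightarrow> \<exists>h r b. weight_decomposition C w 0 M h r b"

definition bounded_weights :: "('o, 'm, 'z) tricat_scheme \<Rightarrow> 'o weights \<Rightarrow> bool" where
  "bounded_weights C w \<longleftrightarrow> (\<Union>i. wle C w i) = obj C \<and> (\<Union>i. wge C w i) = obj C"

text \<open>A weight Postnikov tower of \<open>M\<close>. Here \<open>th i\<close> is the arrow from the \<open>i\<close>-th truncation to \<open>M\<close>,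
  completed by \<open>tr i\<close> and \<open>tb i\<close> to an \<open>i\<close>-weight decomposition; \<open>tj i\<close> connects the \<open>i\<close>-th and
  \<open>(i + 1)\<close>-st truncations, and \<open>M\<^sub>i\<close> is the target of \<open>tc i\<close>.\<close>

record 'm tower =
  th :: "int \<Rightarrow> 'm"
  tr :: "int \<Rightarrow> 'm"
  tb :: "int \<Rightarrow> 'm"
  tj :: "int \<Rightarrow> 'm"
  tc :: "int \<Rightarrow> 'm"
  te :: "int \<Rightarrow> 'm"

definition weight_tower ::
  "('o, 'm, 'z) tricat_scheme \<Rightarrow> 'o weights \<Rightarrow> 'o \<Rightarrow> 'm tower \<Rightarrow> bool" where
  "weight_tower C w M T \<longleftrightarrow> (\<forall>i.
    weight_decomposition C w i M (th T i) (tr T i) (tb T i) \<and>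
    tj T i \<in> homs C (src C (th T i)) (src C (th T (i + 1))) \<and>
    th T (i + 1) \<cdot>\<^bsub>C\<^esub> tj T i = th T i \<and>
    (tj T (i - 1), tc T i, te T (i - 1)) \<in> tri C)"

definition tower_choice ::
  "('o, 'm, 'z) tricat_scheme \<Rightarrow> 'o weights \<Rightarrow> ('o \<Rightarrow> 'm tower) \<Rightarrow> bool" where
  "tower_choice C w T \<longleftrightarrow> (\<forall>M \<in> obj C. weight_tower C w M (T M))"

definition wc_obj :: "('o, 'm, 'z) tricat_scheme \<Rightarrow> 'm tower \<Rightarrow> int \<Rightarrow> 'o" where
  "wc_obj C T p = shO C p (tgt C (tc T (- p)))"

definition wc_diff :: "('o, 'm, 'z) tricat_scheme \<Rightarrow> 'm tower \<Rightarrow> int \<Rightarrow> 'm" where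
  "wc_diff C T i = shA C (i + 1) (tc T (- i - 1)) \<cdot>\<^bsub>C\<^esub> shA C i (te T (- i - 1))"

text \<open>A morphism over \<open>g\<close> of weight Postnikov towers: \<open>a i\<close> acts on the \<open>i\<close>-th truncations and
  \<open>b i\<close> on the \<open>M\<^sub>i\<close>. The resulting morphism of weight complexes is \<open>wc_map\<close>.\<close>

definition tower_morphism ::
  "('o, 'm, 'z) tricat_scheme \<Rightarrow> 'm tower \<Rightarrow> 'm tower \<Rightarrow> 'm
    \<Rightarrow> (int \<Rightarrow> 'm) \<Rightarrow> (int \<Rightarrow> 'm) \<Rightarrow> bool" where
  "tower_morphism C S T g a b \<longleftrightarrow> (\<forall>i.
    a i \<in> homs C (src C (th S i)) (src C (th T i)) \<and>
    b i \<in> homs C (tgt C (tc S i)) (tgt C (tc T i)) \<and>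
    th T i \<cdot>\<^bsub>C\<^esub> a i = g \<cdot>\<^bsub>C\<^esub> th S i \<and>
    tj T i \<cdot>\<^bsub>C\<^esub> a i = a (i + 1) \<cdot>\<^bsub>C\<^esub> tj S i \<and>
    tc T i \<cdot>\<^bsub>C\<^esub> a i = b i \<cdot>\<^bsub>C\<^esub> tc S i \<and>
    te T (i - 1) \<cdot>\<^bsub>C\<^esub> b i = shA C 1 (a (i - 1)) \<cdot>\<^bsub>C\<^esub> te S (i - 1))"

definition wc_map :: "('o, 'm, 'z) tricat_scheme \<Rightarrow> (int \<Rightarrow> 'm) \<Rightarrow> int \<Rightarrow> 'm" where
  "wc_map C b p = shA C p (b (- p))"


section \<open>Pure functors\<close>

definition pure_obj ::
  "('o, 'm, 'y) tricat_scheme \<Rightarrow> ('a, 'b, 'z) precat_scheme \<Rightarrow> ('o, 'm, 'a, 'b) cfunctor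
    \<Rightarrow> 'm tower \<Rightarrow> 'a" where
  "pure_obj C D A T = homology D (farr A (wc_diff C T (- 1))) (farr A (wc_diff C T 0))"

text \<open>The map on zeroth homology induced by an arrow \<open>v\<close> from the zeroth term of the complex
  \<open>A(t(S))\<close> to that of \<open>B(t(T))\<close>.\<close>

definition pure_map ::
  "('o, 'm, 'y) tricat_scheme \<Rightarrow> ('a, 'b, 'z) precat_scheme
    \<Rightarrow> ('o, 'm, 'a, 'b) cfunctor \<Rightarrow> 'm tower \<Rightarrow> ('o, 'm, 'a, 'b) cfunctor \<Rightarrow> 'm tower
    \<Rightarrow> 'b \<Rightarrow> 'b" where
  "pure_map C D A S B T v =
    homology_map D (farr A (wc_diff C S (- 1))) (farr A (wc_diff C S 0))
                   (farr B (wc_diff C T (- 1))) (farr B (wc_diff C T 0)) v"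

definition pure_functor ::
  "('o, 'm, 'y) tricat_scheme \<Rightarrow> ('a, 'b, 'z) precat_scheme \<Rightarrow> ('o \<Rightarrow> 'm tower)
    \<Rightarrow> ('o, 'm, 'a, 'b) cfunctor \<Rightarrow> ('o, 'm, 'a, 'b) cfunctor" where
  "pure_functor C D T A = \<lparr>
    fobj = (\<lambda>M \<in> obj C. pure_obj C D A (T M)),
    farr = (\<lambda>g \<in> arr C. THE m. \<exists>a b.
      tower_morphism C (T (src C g)) (T (tgt C g)) g a b \<and>
      m = pure_map C D A (T (src C g)) A (T (tgt C g)) (farr A (wc_map C b 0)))\<rparr>"

definition kills :: "('p, 'q, 'z) cat_scheme \<Rightarrow> ('o, 'm, 'p, 'q) cfunctor \<Rightarrow> 'o set \<Rightarrow> bool" where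
  "kills D H S \<longleftrightarrow> (\<forall>X \<in> S. zero_object D (fobj H X))"

definition is_pure ::
  "('o, 'm, 'y) tricat_scheme \<Rightarrow> 'o weights \<Rightarrow> ('p, 'q, 'z) cat_scheme
    \<Rightarrow> ('o, 'm, 'p, 'q) cfunctor \<Rightarrow> bool" where
  "is_pure C w D H \<longleftrightarrow> kills D H (wge C w 1) \<and> kills D H (wle C w (- 1))"

abbreviation additive_functor_cat where
  "additive_functor_cat C w D \<equiv> functor_cat (heart C w) D (additive_functors (heart C w) D)"

abbreviation homological_functor_cat where
  "homological_functor_cat C D \<equiv> functor_cat C D (homological_functors C D)"

abbreviation pure_functor_cat where
  "pure_functor_cat C w D \<equiv> functor_cat C D {H \<in> homological_functors C D. is_pure C w D H}"

text \<open>The assignment sending \<open>A\<close> to its pure functor; a transformation \<open>t\<close> acts on homology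
  through its component at the zeroth term of the weight complex.\<close>

definition pure_assignment ::
  "('o, 'm, 'y) tricat_scheme \<Rightarrow> 'o weights \<Rightarrow> ('a, 'b, 'z) precat_scheme \<Rightarrow> ('o \<Rightarrow> 'm tower)
    \<Rightarrow> (('o, 'm, 'a, 'b) cfunctor, ('o, 'm, 'a, 'b) nattrans,
        ('o, 'm, 'a, 'b) cfunctor, ('o, 'm, 'a, 'b) nattrans) cfunctor" where
  "pure_assignment C w D T = \<lparr>
    fobj = (\<lambda>A \<in> obj (additive_functor_cat C w D). pure_functor C D T A),
    farr = (\<lambda>t \<in> arr (additive_functor_cat C w D). \<lparr>
      nsrc = pure_functor C D T (nsrc t),
      ntgt = pure_functor C D T (ntgt t),
      ncomp = (\<lambda>M \<in> obj C. pure_map C D (nsrc t) (T M) (ntgt t) (T M)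
                             (ncomp t (wc_obj C (T M) 0)))\<rparr>)\<rparr>"

end

theory Submission
  imports Defs
begin

text \<open>A morphism of weight Postnikov towers over the zero arrow is, in degree zero, of the form
  \<open>d y + x d\<close>: orthogonality first makes it factor on truncations and then lets the factors be
  extended to the terms of the weight complexes. As such maps vanish on homology, \<open>H\<^sup>A\<close> is
  well defined on objects and arrows, and the same computation applied to identities shows that
  it is pure. For exactness on a triangle \<open>Y \<rightarrow> Z \<rightarrow> V\<close>, the \<open>3 \<times> 3\<close> lemma builds from towers of \<open>Y\<close>
  and \<open>V\<close> a tower of \<open>Z\<close> whose terms in the relevant degrees are extensions of those of \<open>V\<close> by those
  of \<open>Y\<close>; the extensions split by orthogonality, so \<open>A\<close> preserves them and a diagram chase applies.
  For a pure functor \<open>H\<close> the kernel and cokernel defining the zeroth homology of \<open>H(t(M))\<close> are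
  \<open>H(w\<^bsub>\<le>0\<^esub> M) \<rightarrow> H(M\<^sub>0)\<close> and \<open>H(w\<^bsub>\<le>0\<^esub> M) \<rightarrow> H(M)\<close>, which gives the inverse equivalence.\<close>

section \<open>Additive categories\<close>

text \<open>Weight complexes are functorial only up to maps \<open>d y + x d\<close> in which
  \<open>x\<close> and \<open>y\<close> need not belong to one chain homotopy. This weak relation
  still dies on homology, but it forces comparisons to be made there and not on complexes. Since
  homology is picked by choice, induced maps are handled through the relation \<open>sq_map\<close>
  between an arrow on middle terms and an arrow on subquotients; the former determines the latter,
  so identities between induced maps reduce to identities between middle arrows. The abelian target
  has no elements, so diagram chases run on arrows, and preimages are taken after passage to an
  epimorphic cover. Completing two prescribed outer columns by a middle one meets an obstruction, a
  composite from the desuspended source of \<open>v'\<close> to the target of \<open>y\<close>;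
  orthogonality removes it and later also splits the rows of terms. The tower so built need not be
  the chosen one, and exactness is carried over by the isomorphisms between the homologies of any
  two towers of one object.\<close>

lemma in_homs: "f \<in> homs C X Y \<longleftrightarrow> f \<in> arr C \<and> src C f = X \<and> tgt C f = Y"
  by (simp add: homs_def)

context category
begin

declare src_obj [simp, intro] tgt_obj [simp, intro]

lemma idt_simps [simp]:
  assumes "X \<in> obj C"
  shows "idt C X \<in> arr C" "src C (idt C X) = X" "tgt C (idt C X) = X"
  using idt_homs[OF assms] by (auto simp: in_homs)

lemma cmp_simps [simp]:
  assumes "f \<in> arr C" "g \<in> arr C" "src C g = tgt C f"
  shows "g \<cdot> f \<in> arr C" "src C (g \<cdot> f) = src C f" "tgt C (g \<cdot> f) = tgt C g"
  using cmp_homs[of f "src C f" "tgt C f" g "tgt C g"] assms by (auto simp: in_homs)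

lemma cmp_idt_right [simp]: "f \<in> arr C \<Longrightarrow> src C f = X \<Longrightarrow> f \<cdot> idt C X = f"
  using cmp_idt[of f X "tgt C f"] by (auto simp: in_homs)

lemma cmp_idt_left [simp]: "f \<in> arr C \<Longrightarrow> tgt C f = X \<Longrightarrow> idt C X \<cdot> f = f"
  using idt_cmp[of f "src C f" X] by (auto simp: in_homs)

lemma cmp_assoc_right [simp]:
  assumes "f \<in> arr C" "g \<in> arr C" "h \<in> arr C" "src C g = tgt C f" "src C h = tgt C g"
  shows "h \<cdot> g \<cdot> f = h \<cdot> (g \<cdot> f)"
  using cmp_assoc[of f "src C f" "tgt C f" g "tgt C g" h "tgt C h"] assms by (auto simp: in_homs)

text \<open>Composites are normalised by bracketing to the right, which hides a known product
  \<open>g \<cdot> f\<close> inside \<open>g \<cdot> (f \<cdot> x)\<close>; this is the form in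
  which such equations are applied afterwards.\<close>

lemma cmp_reassoc:
  assumes "g \<cdot> f = k" "f \<in> arr C" "g \<in> arr C" "src C g = tgt C f" "x \<in> arr C" "tgt C x = src C f"
  shows "g \<cdot> (f \<cdot> x) = k \<cdot> x"
  using assms by (metis cmp_assoc_right)

lemma is_monoI:
  assumes "f \<in> arr C"
    and "\<And>x y. \<lbrakk>x \<in> arr C; y \<in> arr C; tgt C x = src C f; tgt C y = src C f; src C x = src C y; f \<cdot> x = f \<cdot> y\<rbrakk> \<Longrightarrow> x = y"
  shows "is_mono C f"
  using assms by (auto simp: is_mono_def in_homs)

lemma is_monoD:
  assumes "is_mono C f" "f \<cdot> x = f \<cdot> y" "x \<in> arr C" "y \<in> arr C"
    "tgt C x = src C f" "tgt C y = src C f" "src C x = src C y"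
  shows "x = y"
proof -
  have "x \<in> homs C (src C x) (src C f)" "y \<in> homs C (src C x) (src C f)"
    using assms by (simp_all add: in_homs)
  then show ?thesis using assms(1,2) unfolding is_mono_def by blast
qed

lemma is_mono_arr: "is_mono C f \<Longrightarrow> f \<in> arr C"
  by (simp add: is_mono_def)

lemma is_epiI:
  assumes "f \<in> arr C"
    and "\<And>x y. \<lbrakk>x \<in> arr C; y \<in> arr C; src C x = tgt C f; src C y = tgt C f; tgt C x = tgt C y; x \<cdot> f = y \<cdot> f\<rbrakk> \<Longrightarrow> x = y"
  shows "is_epi C f"
  using assms by (auto simp: is_epi_def in_homs)

lemma is_epiD:
  assumes "is_epi C f" "x \<cdot> f = y \<cdot> f" "x \<in> arr C" "y \<in> arr C"
    "src C x = tgt C f" "src C y = tgt C f" "tgt C x = tgt C y"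
  shows "x = y"
proof -
  have "x \<in> homs C (tgt C f) (tgt C x)" "y \<in> homs C (tgt C f) (tgt C x)"
    using assms by (simp_all add: in_homs)
  then show ?thesis using assms(1,2) unfolding is_epi_def by blast
qed

lemma is_epi_arr: "is_epi C f \<Longrightarrow> f \<in> arr C"
  by (simp add: is_epi_def)

lemma is_mono_cmp:
  assumes "is_mono C f" "is_mono C g" "src C g = tgt C f"
  shows "is_mono C (g \<cdot> f)"
proof (rule is_monoI)
  have [simp]: "f \<in> arr C" "g \<in> arr C" using assms by (auto simp: is_mono_arr)
  show "g \<cdot> f \<in> arr C" using assms by simp
  fix x y assume "x \<in> arr C" "y \<in> arr C" "tgt C x = src C (g \<cdot> f)" "tgt C y = src C (g \<cdot> f)"
    "src C x = src C y" "g \<cdot> f \<cdot> x = g \<cdot> f \<cdot> y"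
  then have "f \<cdot> x = f \<cdot> y" using is_monoD[OF assms(2), of "f \<cdot> x" "f \<cdot> y"] assms by simp
  then show "x = y" using \<open>x \<in> arr C\<close> \<open>y \<in> arr C\<close> \<open>tgt C x = _\<close> \<open>tgt C y = _\<close> \<open>src C x = _\<close>
    is_monoD[OF assms(1), of x y] assms by simp
qed

lemma is_epi_cmp:
  assumes "is_epi C f" "is_epi C g" "src C g = tgt C f"
  shows "is_epi C (g \<cdot> f)"
proof (rule is_epiI)
  have [simp]: "f \<in> arr C" "g \<in> arr C" using assms by (auto simp: is_epi_arr)
  show "g \<cdot> f \<in> arr C" using assms by simp
  fix x y assume *: "x \<in> arr C" "y \<in> arr C" "src C x = tgt C (g \<cdot> f)" "src C y = tgt C (g \<cdot> f)"
    "tgt C x = tgt C y" "x \<cdot> (g \<cdot> f) = y \<cdot> (g \<cdot> f)"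
  then have "x \<cdot> g \<cdot> f = y \<cdot> g \<cdot> f" using assms by simp
  then have "x \<cdot> g = y \<cdot> g" using is_epiD[OF assms(1), of "x \<cdot> g" "y \<cdot> g"] * assms by simp
  then show "x = y" using * is_epiD[OF assms(2), of x y] assms by simp
qed

lemma split_mono_is_mono:
  assumes "r \<cdot> f = idt C X" "f \<in> arr C" "r \<in> arr C" "src C r = tgt C f" "src C f = X"
  shows "is_mono C f"
proof (rule is_monoI)
  fix x y assume *: "x \<in> arr C" "y \<in> arr C" "tgt C x = src C f" "tgt C y = src C f"
    "src C x = src C y" "f \<cdot> x = f \<cdot> y"
  have "x = r \<cdot> (f \<cdot> x)" using *(1-5) assms by (simp add: cmp_reassoc[OF assms(1)])
  also have "\<dots> = r \<cdot> (f \<cdot> y)" using *(6) by simp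
  also have "\<dots> = y" using *(1-5) assms by (simp add: cmp_reassoc[OF assms(1)])
  finally show "x = y" .
qed fact

lemma split_epi_is_epi:
  assumes "f \<cdot> s = idt C Y" "f \<in> arr C" "s \<in> arr C" "src C f = tgt C s" "tgt C f = Y"
  shows "is_epi C f"
proof (rule is_epiI)
  fix x y assume *: "x \<in> arr C" "y \<in> arr C" "src C x = tgt C f" "src C y = tgt C f"
    "tgt C x = tgt C y" "x \<cdot> f = y \<cdot> f"
  have "x = x \<cdot> f \<cdot> s" using *(1-5) assms by simp
  also have "\<dots> = y \<cdot> f \<cdot> s" using *(6) by simp
  also have "\<dots> = y" using *(1-5) assms by simp
  finally show "x = y" .
qed fact

lemma is_epi_idt: "X \<in> obj C \<Longrightarrow> is_epi C (idt C X)"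
  by (rule is_epiI) simp_all

lemma is_mono_idt: "X \<in> obj C \<Longrightarrow> is_mono C (idt C X)"
  by (rule is_monoI) simp_all

lemma is_isoI:
  assumes "f \<in> arr C" "g \<in> arr C" "src C f = X" "tgt C f = Y" "src C g = Y" "tgt C g = X"
    "g \<cdot> f = idt C X" "f \<cdot> g = idt C Y"
  shows "is_iso C f"
  using assms unfolding is_iso_def by (auto simp: in_homs intro!: bexI[of _ g])

end

definition pdiff :: "('o, 'm, 'z) precat_scheme \<Rightarrow> 'm \<Rightarrow> 'm \<Rightarrow> 'm"  (infixl "\<boxminus>\<index>" 65) where
  "f \<boxminus>\<^bsub>C\<^esub> g = f \<boxplus>\<^bsub>C\<^esub> pneg C g"

context additive_category
begin

lemma hom_group_simps:
  "carrier (Defs.hom_group C X Y) = homs C X Y"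
  "f \<otimes>\<^bsub>Defs.hom_group C X Y\<^esub> g = f \<boxplus> g"
  "\<one>\<^bsub>Defs.hom_group C X Y\<^esub> = pzero C X Y"
  by (simp_all add: hom_group_def)

lemma pzero_simps [simp]:
  assumes "X \<in> obj C" "Y \<in> obj C"
  shows "pzero C X Y \<in> arr C" "src C (pzero C X Y) = X" "tgt C (pzero C X Y) = Y"
proof -
  interpret G: comm_group "Defs.hom_group C X Y" using assms by (rule hom_group)
  show "pzero C X Y \<in> arr C" "src C (pzero C X Y) = X" "tgt C (pzero C X Y) = Y"
    using G.one_closed by (simp_all add: hom_group_simps in_homs)
qed

lemma padd_simps [simp]:
  assumes "f \<in> arr C" "g \<in> arr C" "src C g = src C f" "tgt C g = tgt C f"
  shows "f \<boxplus> g \<in> arr C" "src C (f \<boxplus> g) = src C f" "tgt C (f \<boxplus> g) = tgt C f"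
proof -
  interpret G: comm_group "Defs.hom_group C (src C f) (tgt C f)" using assms by (simp add: hom_group)
  show "f \<boxplus> g \<in> arr C" "src C (f \<boxplus> g) = src C f" "tgt C (f \<boxplus> g) = tgt C f"
    using G.m_closed[of f g] assms by (simp_all add: hom_group_simps in_homs)
qed

lemma pneg_simps [simp]:
  assumes "f \<in> arr C"
  shows "pneg C f \<in> arr C" "src C (pneg C f) = src C f" "tgt C (pneg C f) = tgt C f"
proof -
  interpret G: comm_group "Defs.hom_group C (src C f) (tgt C f)" using assms by (simp add: hom_group)
  show "pneg C f \<in> arr C" "src C (pneg C f) = src C f" "tgt C (pneg C f) = tgt C f"
    using G.inv_closed[of f] assms by (simp_all add: hom_group_simps in_homs pneg_def)
qed

lemma pdiff_simps [simp]:
  assumes "f \<in> arr C" "g \<in> arr C" "src C g = src C f" "tgt C g = tgt C f"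
  shows "f \<boxminus> g \<in> arr C" "src C (f \<boxminus> g) = src C f" "tgt C (f \<boxminus> g) = tgt C f"
  using assms by (simp_all add: pdiff_def)

lemma padd_assoc:
  assumes "f \<in> arr C" "g \<in> arr C" "h \<in> arr C" "src C g = src C f" "tgt C g = tgt C f"
    "src C h = src C f" "tgt C h = tgt C f"
  shows "f \<boxplus> g \<boxplus> h = f \<boxplus> (g \<boxplus> h)"
proof -
  interpret G: comm_group "Defs.hom_group C (src C f) (tgt C f)" using assms by (simp add: hom_group)
  show ?thesis using G.m_assoc[of f g h] assms by (simp add: hom_group_simps in_homs)
qed

lemma padd_comm:
  assumes "f \<in> arr C" "g \<in> arr C" "src C g = src C f" "tgt C g = tgt C f"
  shows "f \<boxplus> g = g \<boxplus> f"
proof -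
  interpret G: comm_group "Defs.hom_group C (src C f) (tgt C f)" using assms by (simp add: hom_group)
  show ?thesis using G.m_comm[of f g] assms by (simp add: hom_group_simps in_homs)
qed

lemma padd_pzero [simp]:
  assumes "f \<in> arr C" "src C f = X" "tgt C f = Y"
  shows "f \<boxplus> pzero C X Y = f" "pzero C X Y \<boxplus> f = f"
proof -
  interpret G: comm_group "Defs.hom_group C X Y" using assms by (auto intro: hom_group)
  show "f \<boxplus> pzero C X Y = f" "pzero C X Y \<boxplus> f = f"
    using G.r_one[of f] G.l_one[of f] assms by (simp_all add: hom_group_simps in_homs)
qed

lemma padd_pneg [simp]:
  assumes "f \<in> arr C"
  shows "f \<boxplus> pneg C f = pzero C (src C f) (tgt C f)" "pneg C f \<boxplus> f = pzero C (src C f) (tgt C f)"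
proof -
  interpret G: comm_group "Defs.hom_group C (src C f) (tgt C f)" using assms by (simp add: hom_group)
  show "f \<boxplus> pneg C f = pzero C (src C f) (tgt C f)" "pneg C f \<boxplus> f = pzero C (src C f) (tgt C f)"
    using G.r_inv[of f] G.l_inv[of f] assms by (simp_all add: hom_group_simps in_homs pneg_def)
qed

lemma padd_left_cancel:
  assumes "f \<boxplus> g = f \<boxplus> h" "f \<in> arr C" "g \<in> arr C" "h \<in> arr C" "src C g = src C f" "tgt C g = tgt C f"
    "src C h = src C f" "tgt C h = tgt C f"
  shows "g = h"
proof -
  interpret G: comm_group "Defs.hom_group C (src C f) (tgt C f)" using assms by (simp add: hom_group)
  show ?thesis using G.Units_l_cancel[of f g h] assms by (simp add: hom_group_simps in_homs)
qed

lemma pneg_unique: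
  assumes "f \<boxplus> g = pzero C X Y" "f \<in> arr C" "g \<in> arr C" "src C f = X" "tgt C f = Y" "src C g = X" "tgt C g = Y"
  shows "g = pneg C f"
  using padd_left_cancel[of f g "pneg C f"] assms by simp

lemma pneg_pneg [simp]: "f \<in> arr C \<Longrightarrow> pneg C (pneg C f) = f"
  by (rule pneg_unique[symmetric]) simp_all

lemma pneg_pzero [simp]: "X \<in> obj C \<Longrightarrow> Y \<in> obj C \<Longrightarrow> pneg C (pzero C X Y) = pzero C X Y"
  by (rule pneg_unique[symmetric]) simp_all

lemma cmp_padd_distrib [simp]:
  assumes "f \<in> arr C" "g \<in> arr C" "h \<in> arr C" "src C g = src C f" "tgt C g = tgt C f" "src C h = tgt C f"
  shows "h \<cdot> (f \<boxplus> g) = h \<cdot> f \<boxplus> h \<cdot> g"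
  using cmp_padd[of f "src C f" "tgt C f" g h "tgt C h"] assms by (simp add: in_homs)

lemma padd_cmp_distrib [simp]:
  assumes "f \<in> arr C" "g \<in> arr C" "h \<in> arr C" "src C g = src C f" "tgt C g = tgt C f" "tgt C h = src C f"
  shows "(f \<boxplus> g) \<cdot> h = f \<cdot> h \<boxplus> g \<cdot> h"
  using padd_cmp[of h "src C h" "src C f" f "tgt C f" g] assms by (simp add: in_homs)

lemma cmp_pzero [simp]:
  assumes "f \<in> arr C" "src C f = Y" "X \<in> obj C"
  shows "f \<cdot> pzero C X Y = pzero C X (tgt C f)"
proof -
  have Y: "Y \<in> obj C" using assms by auto
  have "f \<cdot> pzero C X Y \<boxplus> f \<cdot> pzero C X Y = f \<cdot> (pzero C X Y \<boxplus> pzero C X Y)"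
    using assms Y by (subst cmp_padd_distrib) simp_all
  also have "\<dots> = f \<cdot> pzero C X Y \<boxplus> pzero C X (tgt C f)" using assms Y by simp
  finally show ?thesis
    by (rule padd_left_cancel) (use assms Y in simp_all)
qed

lemma pzero_cmp [simp]:
  assumes "f \<in> arr C" "tgt C f = X" "Y \<in> obj C"
  shows "pzero C X Y \<cdot> f = pzero C (src C f) Y"
proof -
  have X: "X \<in> obj C" using assms by auto
  have "pzero C X Y \<cdot> f \<boxplus> pzero C X Y \<cdot> f = (pzero C X Y \<boxplus> pzero C X Y) \<cdot> f"
    using assms X by (subst padd_cmp_distrib) simp_all
  also have "\<dots> = pzero C X Y \<cdot> f \<boxplus> pzero C (src C f) Y" using assms X by simp
  finally show ?thesis
    by (rule padd_left_cancel) (use assms X in simp_all)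
qed

lemma cmp_pneg [simp]:
  assumes "f \<in> arr C" "g \<in> arr C" "src C g = tgt C f"
  shows "g \<cdot> pneg C f = pneg C (g \<cdot> f)"
proof -
  have "g \<cdot> f \<boxplus> g \<cdot> pneg C f = g \<cdot> (f \<boxplus> pneg C f)"
    by (rule cmp_padd_distrib[symmetric]) (use assms in simp_all)
  also have "\<dots> = pzero C (src C f) (tgt C g)" using assms by simp
  finally show ?thesis by (rule pneg_unique) (use assms in simp_all)
qed

lemma pneg_cmp [simp]:
  assumes "f \<in> arr C" "g \<in> arr C" "src C g = tgt C f"
  shows "pneg C g \<cdot> f = pneg C (g \<cdot> f)"
proof -
  have "g \<cdot> f \<boxplus> pneg C g \<cdot> f = (g \<boxplus> pneg C g) \<cdot> f"
    by (rule padd_cmp_distrib[symmetric]) (use assms in simp_all)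
  also have "\<dots> = pzero C (src C f) (tgt C g)" using assms by simp
  finally show ?thesis by (rule pneg_unique) (use assms in simp_all)
qed

lemma cmp_pdiff [simp]:
  assumes "f \<in> arr C" "g \<in> arr C" "h \<in> arr C" "src C g = src C f" "tgt C g = tgt C f" "src C h = tgt C f"
  shows "h \<cdot> (f \<boxminus> g) = h \<cdot> f \<boxminus> h \<cdot> g"
  using assms by (simp add: pdiff_def)

lemma pdiff_cmp [simp]:
  assumes "f \<in> arr C" "g \<in> arr C" "h \<in> arr C" "src C g = src C f" "tgt C g = tgt C f" "tgt C h = src C f"
  shows "(f \<boxminus> g) \<cdot> h = f \<cdot> h \<boxminus> g \<cdot> h"
  using assms by (simp add: pdiff_def)

lemma pdiff_self [simp]: "f \<in> arr C \<Longrightarrow> src C f = X \<Longrightarrow> tgt C f = Y \<Longrightarrow> f \<boxminus> f = pzero C X Y"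
  by (auto simp: pdiff_def)

lemma pdiff_pzero [simp]: "f \<in> arr C \<Longrightarrow> src C f = X \<Longrightarrow> tgt C f = Y \<Longrightarrow> f \<boxminus> pzero C X Y = f"
  by (auto simp: pdiff_def)

lemma padd_pdiff_cancel:
  assumes "f \<in> arr C" "g \<in> arr C" "src C g = src C f" "tgt C g = tgt C f"
  shows "g \<boxplus> (f \<boxminus> g) = f" "f \<boxminus> g \<boxplus> g = f" "f \<boxplus> g \<boxminus> g = f" "g \<boxplus> f \<boxminus> g = f"
proof -
  show 2: "f \<boxminus> g \<boxplus> g = f" using assms by (simp add: pdiff_def padd_assoc)
  show "f \<boxplus> g \<boxminus> g = f" using assms by (simp add: pdiff_def padd_assoc)
  then show "g \<boxplus> f \<boxminus> g = f" using padd_comm[of f g] assms by simp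
  show "g \<boxplus> (f \<boxminus> g) = f" using padd_comm[of g "f \<boxminus> g"] 2 assms by simp
qed

lemma pdiff_eq_pzero_iff:
  assumes "f \<in> arr C" "g \<in> arr C" "src C f = X" "tgt C f = Y" "src C g = X" "tgt C g = Y"
  shows "f \<boxminus> g = pzero C X Y \<longleftrightarrow> f = g"
proof
  assume "f \<boxminus> g = pzero C X Y"
  then have "g \<boxplus> pzero C X Y = f" using padd_pdiff_cancel(1)[of f g] assms by simp
  then show "f = g" using assms by simp
qed (use assms in simp)

lemma pneg_eq_iff [simp]: "f \<in> arr C \<Longrightarrow> g \<in> arr C \<Longrightarrow> pneg C f = pneg C g \<longleftrightarrow> f = g"
  by (metis pneg_pneg)

lemma pneg_eq_pzero_iff [simp]:
  "f \<in> arr C \<Longrightarrow> X \<in> obj C \<Longrightarrow> Y \<in> obj C \<Longrightarrow> pneg C f = pzero C X Y \<longleftrightarrow> f = pzero C X Y"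
  by (metis pneg_pneg pneg_pzero)

lemma is_epi_zeroI:
  assumes f: "f \<in> arr C"
    and z: "\<And>t. \<lbrakk>t \<in> arr C; src C t = tgt C f; t \<cdot> f = pzero C (src C f) (tgt C t)\<rbrakk> \<Longrightarrow> t = pzero C (tgt C f) (tgt C t)"
  shows "is_epi C f"
proof (rule is_epiI)
  fix x y assume *: "x \<in> arr C" "y \<in> arr C" "src C x = tgt C f" "src C y = tgt C f" "tgt C x = tgt C y" "x \<cdot> f = y \<cdot> f"
  then have "x \<boxminus> y = pzero C (tgt C f) (tgt C x)" using z[of "x \<boxminus> y"] f by simp
  then show "x = y" using * by (simp add: pdiff_eq_pzero_iff)
qed fact

lemma is_mono_zeroI:
  assumes f: "f \<in> arr C"
    and z: "\<And>t. \<lbrakk>t \<in> arr C; tgt C t = src C f; f \<cdot> t = pzero C (src C t) (tgt C f)\<rbrakk> \<Longrightarrow> t = pzero C (src C t) (src C f)"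
  shows "is_mono C f"
proof (rule is_monoI)
  fix x y assume *: "x \<in> arr C" "y \<in> arr C" "tgt C x = src C f" "tgt C y = src C f" "src C x = src C y" "f \<cdot> x = f \<cdot> y"
  then have "x \<boxminus> y = pzero C (src C x) (src C f)" using z[of "x \<boxminus> y"] f by simp
  then show "x = y" using * by (simp add: pdiff_eq_pzero_iff)
qed fact

lemma is_epi_zeroD:
  assumes "is_epi C f" "t \<cdot> f = pzero C (src C f) Y" "t \<in> arr C" "src C t = tgt C f" "tgt C t = Y"
  shows "t = pzero C (tgt C f) Y"
proof -
  have [simp]: "f \<in> arr C" using assms(1) by (rule is_epi_arr)
  have [simp]: "Y \<in> obj C" using assms by auto
  show ?thesis by (rule is_epiD[OF assms(1)]) (use assms(2-) in simp_all)
qed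

lemma is_mono_zeroD:
  assumes "is_mono C f" "f \<cdot> t = pzero C X (tgt C f)" "t \<in> arr C" "tgt C t = src C f" "src C t = X"
  shows "t = pzero C X (src C f)"
proof -
  have [simp]: "f \<in> arr C" using assms(1) by (rule is_mono_arr)
  have [simp]: "X \<in> obj C" using assms by auto
  show ?thesis by (rule is_monoD[OF assms(1)]) (use assms(2-) in simp_all)
qed

text \<open>Any arrow into or out of \<open>Z\<close> absorbs the identity of \<open>Z\<close>, so
  the vanishing of that identity already makes it the zero arrow. Proofs below that an object is
  zero aim at this equation.\<close>

lemma zero_object_iff: "zero_object C Z \<longleftrightarrow> Z \<in> obj C \<and> idt C Z = pzero C Z Z"
proof
  assume "zero_object C Z"
  then show "Z \<in> obj C \<and> idt C Z = pzero C Z Z"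
    unfolding zero_object_def in_homs using idt_simps[of Z] pzero_simps[of Z Z] by blast
next
  assume *: "Z \<in> obj C \<and> idt C Z = pzero C Z Z"
  have "\<exists>!f. f \<in> homs C X Z" "\<exists>!f. f \<in> homs C Z X" if X: "X \<in> obj C" for X
  proof -
    have "f = pzero C X Z" if "f \<in> arr C" "src C f = X" "tgt C f = Z" for f
      using cmp_idt_left[of f Z] pzero_cmp[of f Z Z] that * by simp
    then show "\<exists>!f. f \<in> homs C X Z" using X * by (intro ex1I[of _ "pzero C X Z"]) (auto simp: in_homs)
    have "f = pzero C Z X" if "f \<in> arr C" "src C f = Z" "tgt C f = X" for f
      using cmp_idt_right[of f Z] cmp_pzero[of f Z Z] that * by simp
    then show "\<exists>!f. f \<in> homs C Z X" using X * by (intro ex1I[of _ "pzero C Z X"]) (auto simp: in_homs)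
  qed
  then show "zero_object C Z" using * unfolding zero_object_def by blast
qed

lemma zero_object_eq:
  assumes Z: "zero_object C Z" and f: "f \<in> arr C"
  shows "src C f = X \<Longrightarrow> tgt C f = Z \<Longrightarrow> f = pzero C X Z" "src C f = Z \<Longrightarrow> tgt C f = Y \<Longrightarrow> f = pzero C Z Y"
proof -
  have *: "Z \<in> obj C" "idt C Z = pzero C Z Z" using Z by (simp_all add: zero_object_iff)
  show "f = pzero C X Z" if "src C f = X" "tgt C f = Z"
    using cmp_idt_left[OF f that(2)] pzero_cmp[OF f that(2) *(1)] * that by simp
  show "f = pzero C Z Y" if "src C f = Z" "tgt C f = Y"
    using cmp_idt_right[OF f that(1)] cmp_pzero[OF f that(1) *(1)] * that by simp
qed

end

section \<open>Abelian categories\<close>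

context additive_category
begin

lemma cmp_zero_assoc:
  assumes "g \<cdot> f = pzero C (src C f) (tgt C g)" "f \<in> arr C" "g \<in> arr C" "src C g = tgt C f"
    "x \<in> arr C" "tgt C x = src C f"
  shows "g \<cdot> (f \<cdot> x) = pzero C (src C x) (tgt C g)"
  using cmp_reassoc[OF assms(1-6)] assms(2-6) by simp

lemma is_kernelD:
  assumes "is_kernel C f k"
  shows "f \<in> arr C" "k \<in> arr C" "tgt C k = src C f" "f \<cdot> k = pzero C (src C k) (tgt C f)"
  using assms by (auto simp: is_kernel_def)

lemma kernel_factor:
  assumes "is_kernel C f k" "x \<in> arr C" "tgt C x = src C f" "src C x = W" "f \<cdot> x = pzero C W (tgt C f)"
  obtains y where "y \<in> arr C" "src C y = W" "tgt C y = src C k" "k \<cdot> y = x"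
  using assms unfolding is_kernel_def in_homs by metis

text \<open>The zero arrow and \<open>t\<close> are both factorizations of zero through
  \<open>k\<close>, so the uniqueness clause identifies them.\<close>

lemma kernel_mono:
  assumes "is_kernel C f k"
  shows "is_mono C k"
proof (rule is_mono_zeroI)
  note k = is_kernelD[OF assms]
  show "k \<in> arr C" by fact
  fix t assume t: "t \<in> arr C" "tgt C t = src C k" "k \<cdot> t = pzero C (src C t) (tgt C k)"
  have u: "\<exists>!y. y \<in> homs C (src C x) (src C k) \<and> k \<cdot> y = x"
    if "x \<in> arr C" "tgt C x = src C f" "f \<cdot> x = pzero C (src C x) (tgt C f)" for x
    using assms that unfolding is_kernel_def by blast
  have "\<exists>!y. y \<in> homs C (src C t) (src C k) \<and> k \<cdot> y = pzero C (src C t) (src C f)"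
    using u[of "pzero C (src C t) (src C f)"] k t by simp
  moreover have "t \<in> homs C (src C t) (src C k) \<and> k \<cdot> t = pzero C (src C t) (src C f)"
    using t k by (simp add: in_homs)
  moreover have "pzero C (src C t) (src C k) \<in> homs C (src C t) (src C k) \<and>
      k \<cdot> pzero C (src C t) (src C k) = pzero C (src C t) (src C f)"
    using t k by (simp add: in_homs)
  ultimately show "t = pzero C (src C t) (src C k)" by blast
qed

lemma is_cokernelD:
  assumes "is_cokernel C f q"
  shows "f \<in> arr C" "q \<in> arr C" "src C q = tgt C f" "q \<cdot> f = pzero C (src C f) (tgt C q)"
  using assms by (auto simp: is_cokernel_def)

lemma cokernel_factor:
  assumes "is_cokernel C f q" "x \<in> arr C" "src C x = tgt C f" "tgt C x = W" "x \<cdot> f = pzero C (src C f) W"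
  obtains y where "y \<in> arr C" "src C y = tgt C q" "tgt C y = W" "y \<cdot> q = x"
  using assms unfolding is_cokernel_def in_homs by metis

lemma cokernel_epi:
  assumes "is_cokernel C f q"
  shows "is_epi C q"
proof (rule is_epi_zeroI)
  note q = is_cokernelD[OF assms]
  show "q \<in> arr C" by fact
  fix t assume t: "t \<in> arr C" "src C t = tgt C q" "t \<cdot> q = pzero C (src C q) (tgt C t)"
  have u: "\<exists>!y. y \<in> homs C (tgt C q) (tgt C x) \<and> y \<cdot> q = x"
    if "x \<in> arr C" "src C x = tgt C f" "x \<cdot> f = pzero C (src C f) (tgt C x)" for x
    using assms that unfolding is_cokernel_def by blast
  have "\<exists>!y. y \<in> homs C (tgt C q) (tgt C t) \<and> y \<cdot> q = pzero C (tgt C f) (tgt C t)"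
    using u[of "pzero C (tgt C f) (tgt C t)"] q t by simp
  moreover have "t \<in> homs C (tgt C q) (tgt C t) \<and> t \<cdot> q = pzero C (tgt C f) (tgt C t)"
    using t q by (simp add: in_homs)
  moreover have "pzero C (tgt C q) (tgt C t) \<in> homs C (tgt C q) (tgt C t) \<and>
      pzero C (tgt C q) (tgt C t) \<cdot> q = pzero C (tgt C f) (tgt C t)"
    using t q by (simp add: in_homs)
  ultimately show "t = pzero C (tgt C q) (tgt C t)" by blast
qed

lemma is_kernelI:
  assumes "f \<in> arr C" "is_mono C k" "tgt C k = src C f" "f \<cdot> k = pzero C (src C k) (tgt C f)"
    and ex: "\<And>x. \<lbrakk>x \<in> arr C; tgt C x = src C f; f \<cdot> x = pzero C (src C x) (tgt C f)\<rbrakk> \<Longrightarrow>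
      \<exists>y \<in> arr C. src C y = src C x \<and> tgt C y = src C k \<and> k \<cdot> y = x"
  shows "is_kernel C f k"
  unfolding is_kernel_def
proof (intro conjI ballI impI)
  show "k \<in> arr C" using assms(2) by (rule is_mono_arr)
  fix x assume x: "x \<in> arr C" "tgt C x = src C f \<and> f \<cdot> x = pzero C (src C x) (tgt C f)"
  then obtain y where y: "y \<in> arr C" "src C y = src C x" "tgt C y = src C k" "k \<cdot> y = x"
    using ex[of x] by blast
  show "\<exists>!y. y \<in> homs C (src C x) (src C k) \<and> k \<cdot> y = x"
    using y is_monoD[OF assms(2)] by (intro ex1I[of _ y]) (auto simp: in_homs)
qed fact+

lemma is_cokernelI:
  assumes "f \<in> arr C" "is_epi C q" "src C q = tgt C f" "q \<cdot> f = pzero C (src C f) (tgt C q)"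
    and ex: "\<And>x. \<lbrakk>x \<in> arr C; src C x = tgt C f; x \<cdot> f = pzero C (src C f) (tgt C x)\<rbrakk> \<Longrightarrow>
      \<exists>y \<in> arr C. src C y = tgt C q \<and> tgt C y = tgt C x \<and> y \<cdot> q = x"
  shows "is_cokernel C f q"
  unfolding is_cokernel_def
proof (intro conjI ballI impI)
  show "q \<in> arr C" using assms(2) by (rule is_epi_arr)
  fix x assume x: "x \<in> arr C" "src C x = tgt C f \<and> x \<cdot> f = pzero C (src C f) (tgt C x)"
  then obtain y where y: "y \<in> arr C" "src C y = tgt C q" "tgt C y = tgt C x" "y \<cdot> q = x"
    using ex[of x] by blast
  show "\<exists>!y. y \<in> homs C (tgt C q) (tgt C x) \<and> y \<cdot> q = x"
    using y is_epiD[OF assms(2)] by (intro ex1I[of _ y]) (auto simp: in_homs)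
qed fact+

end

section \<open>Images and epimorphic covers in abelian categories\<close>

context abelian_category
begin

text \<open>If \<open>t \<cdot> e\<close> vanishes, \<open>f\<close> already factors through the
  smaller subobject \<open>m \<cdot> n\<close> with \<open>n\<close> a kernel of \<open>t\<close>.
  As a monomorphism this is a kernel of some \<open>g\<close>; then \<open>g\<close> kills
  \<open>f\<close>, hence factors through \<open>q\<close>, hence kills \<open>m\<close>. So
  \<open>m\<close> factors through \<open>m \<cdot> n\<close>, which splits \<open>n\<close> and
  gives \<open>t = 0\<close>.\<close>

lemma image_factor:
  assumes q: "is_cokernel D f q" and m: "is_kernel D q m"
  obtains e where "e \<in> arr D" "src D e = src D f" "tgt D e = src D m" "m \<cdot> e = f" "is_epi D e"
proof -
  note q' = is_cokernelD[OF q] and m' = is_kernelD[OF m]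
  have mm: "is_mono D m" using m by (rule kernel_mono)
  obtain e where e: "e \<in> arr D" "src D e = src D f" "tgt D e = src D m" "m \<cdot> e = f"
    using kernel_factor[OF m, of f "src D f"] q' by metis
  have "is_epi D e"
  proof (rule is_epi_zeroI)
    fix t assume t: "t \<in> arr D" "src D t = tgt D e" "t \<cdot> e = pzero D (src D e) (tgt D t)"
    obtain n where n: "is_kernel D t n" using ex_kernel[OF t(1)] by blast
    note n' = is_kernelD[OF n]
    have mn: "is_mono D (m \<cdot> n)"
      using is_mono_cmp[OF kernel_mono[OF n] mm] n' t e by simp
    obtain g where g: "is_kernel D g (m \<cdot> n)" using mono_kernel[OF mn] by blast
    note g' = is_kernelD[OF g]
    obtain e' where e': "e' \<in> arr D" "src D e' = src D e" "tgt D e' = src D n" "n \<cdot> e' = e"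
      using kernel_factor[OF n, of e "src D e"] t e by metis
    have sg: "src D g = tgt D m" using g' n' e t m' by simp
    have "g \<cdot> f = g \<cdot> (m \<cdot> n) \<cdot> e'"
      unfolding e(4)[symmetric] e'(4)[symmetric] using e(1-3) e'(1-3) g'(1-3) n'(1-3) m'(1-3) t(1,2) sg by simp
    also have "\<dots> = pzero D (src D f) (tgt D g)"
      unfolding g'(4) using e e' g' n' m' t q' sg by simp
    finally obtain g2 where g2: "g2 \<in> arr D" "src D g2 = tgt D q" "tgt D g2 = tgt D g" "g2 \<cdot> q = g"
      using cokernel_factor[OF q, of g "tgt D g"] g' sg m' q' by metis
    have "g \<cdot> m = g2 \<cdot> (q \<cdot> m)" unfolding g2(4)[symmetric] using g2(1-3) m'(1-3) q' by simp
    also have "\<dots> = pzero D (src D m) (tgt D g)" unfolding m'(4) using g2 m' by simp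
    finally obtain s where s: "s \<in> arr D" "src D s = src D m" "tgt D s = src D n" "m \<cdot> n \<cdot> s = m"
      using kernel_factor[OF g, of m "src D m"] m' sg n' t e by (metis cmp_simps(2))
    have "m \<cdot> (n \<cdot> s) = m \<cdot> idt D (src D m)" using s m' n' t e by simp
    then have ns: "n \<cdot> s = idt D (src D m)"
      using is_monoD[OF mm, of "n \<cdot> s" "idt D (src D m)"] s m' n' t e by simp
    have "t = t \<cdot> (n \<cdot> s)" unfolding ns using t e by simp
    also have "\<dots> = t \<cdot> n \<cdot> s" using t(1,2) e(3) n'(1-3) s(1-3) by simp
    also have "\<dots> = pzero D (tgt D e) (tgt D t)" using t(1,2) n' s(1-3) e(3) by (simp add: cmp_zero_assoc[OF n'(4)])
    finally show "t = pzero D (tgt D e) (tgt D t)" .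
  qed fact
  then show thesis using e that by blast
qed

text \<open>Write \<open>e\<close> as a cokernel of some \<open>g\<close>. Since \<open>g\<close>
  factors through \<open>k\<close>, whatever kills \<open>k\<close> kills \<open>g\<close> and so
  descends along \<open>e\<close>.\<close>

lemma epi_cokernel_of_kernel:
  assumes e: "is_epi D e" and k: "is_kernel D e k"
  shows "is_cokernel D k e"
proof (rule is_cokernelI)
  note k' = is_kernelD[OF k]
  show "k \<in> arr D" "src D e = tgt D k" "e \<cdot> k = pzero D (src D k) (tgt D e)" using k' by simp_all
  obtain g where g: "is_cokernel D g e" using epi_cokernel[OF e] by blast
  note g' = is_cokernelD[OF g]
  obtain g2 where g2: "g2 \<in> arr D" "src D g2 = src D g" "tgt D g2 = src D k" "k \<cdot> g2 = g"
    using kernel_factor[OF k, of g "src D g"] g' by metis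
  fix x assume x: "x \<in> arr D" "src D x = tgt D k" "x \<cdot> k = pzero D (src D k) (tgt D x)"
  have "x \<cdot> g = x \<cdot> k \<cdot> g2" unfolding g2(4)[symmetric] using g2(1-3) x(1,2) k' by simp
  also have "\<dots> = pzero D (src D g) (tgt D x)" unfolding x(3) using x k' g2 by simp
  finally show "\<exists>y\<in>arr D. src D y = tgt D e \<and> tgt D y = tgt D x \<and> y \<cdot> e = x"
    using cokernel_factor[OF g, of x "tgt D x"] x k' g' by metis
qed fact

text \<open>Replaces the choice of preimages in diagram chases: \<open>g\<close> lifts through the
  epimorphism \<open>f\<close> once it is restricted along a further epimorphism
  \<open>p\<close>.\<close>

lemma epi_pullback:
  assumes f: "is_epi D f" and g: "g \<in> arr D" "tgt D g = tgt D f"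
  obtains p h where "is_epi D p" "p \<in> arr D" "tgt D p = src D g" "h \<in> arr D" "src D h = src D p"
    "tgt D h = src D f" "f \<cdot> h = g \<cdot> p"
proof -
  have [simp]: "f \<in> arr D" using f by (rule is_epi_arr)
  obtain S i j pX pY where S: "S \<in> obj D" and "i \<in> homs D (src D f) S" "j \<in> homs D (src D g) S"
    "pX \<in> homs D S (src D f)" "pY \<in> homs D S (src D g)"
    and e: "pX \<cdot> i = idt D (src D f)" "pY \<cdot> j = idt D (src D g)" "pX \<cdot> j = pzero D (src D g) (src D f)"
    "pY \<cdot> i = pzero D (src D f) (src D g)"
    using ex_biproduct[of "src D f" "src D g"] g by auto
  then have h: "i \<in> arr D" "src D i = src D f" "tgt D i = S" "j \<in> arr D" "src D j = src D g" "tgt D j = S"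
    "pX \<in> arr D" "src D pX = S" "tgt D pX = src D f" "pY \<in> arr D" "src D pY = S" "tgt D pY = src D g"
    by (auto simp: in_homs)
  \<comment> \<open>The kernel of this difference on the biproduct is the pullback of
    \<open>f\<close> and \<open>g\<close>. As \<open>\<phi>\<close> restricts to \<open>f\<close>
    along \<open>i\<close>, it is an epimorphism and hence a cokernel of its kernel.\<close>
  define \<phi> where "\<phi> = f \<cdot> pX \<boxminus> g \<cdot> pY"
  have \<phi>: "\<phi> \<in> arr D" "src D \<phi> = S" "tgt D \<phi> = tgt D f" using h g S by (simp_all add: \<phi>_def)
  have \<phi>i: "\<phi> \<cdot> i = f" using h g S e by (simp add: \<phi>_def)
  have epi: "is_epi D \<phi>"
  proof (rule is_epi_zeroI)
    fix t assume t: "t \<in> arr D" "src D t = tgt D \<phi>" "t \<cdot> \<phi> = pzero D (src D \<phi>) (tgt D t)"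
    have "t \<cdot> f = t \<cdot> \<phi> \<cdot> i" unfolding \<phi>i[symmetric] using t(1,2) \<phi> h by simp
    also have "\<dots> = pzero D (src D f) (tgt D t)" using t(1,2) \<phi> h by (simp add: cmp_zero_assoc[OF t(3)])
    finally show "t = pzero D (tgt D \<phi>) (tgt D t)"
      using is_epi_zeroD[OF f, of t "tgt D t"] t \<phi> by simp
  qed fact
  obtain k where k: "is_kernel D \<phi> k" using ex_kernel[OF \<phi>(1)] by blast
  note k' = is_kernelD[OF k]
  have co: "is_cokernel D k \<phi>" using epi k by (rule epi_cokernel_of_kernel)
  have "is_epi D (pY \<cdot> k)"
  proof (rule is_epi_zeroI)
    show "pY \<cdot> k \<in> arr D" using h k' \<phi> by simp
    fix t assume t: "t \<in> arr D" "src D t = tgt D (pY \<cdot> k)" "t \<cdot> (pY \<cdot> k) = pzero D (src D (pY \<cdot> k)) (tgt D t)"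
    have st: "src D t = src D g" using t h k' \<phi> by simp
    have "t \<cdot> pY \<cdot> k = pzero D (src D k) (tgt D t)" using t h k' \<phi> st by simp
    \<comment> \<open>An arrow \<open>t\<close> killing the projection \<open>pY \<cdot> k\<close>
      makes \<open>t \<cdot> pY\<close> descend to the target of \<open>\<phi>\<close>; restriction
      to the first summand, where \<open>pY\<close> vanishes, shows that the descended arrow is
      zero.\<close>
    then obtain s where s: "s \<in> arr D" "src D s = tgt D \<phi>" "tgt D s = tgt D t" "s \<cdot> \<phi> = t \<cdot> pY"
      using cokernel_factor[OF co, of "t \<cdot> pY" "tgt D t"] t h st k' \<phi> by auto
    have "s \<cdot> f = s \<cdot> \<phi> \<cdot> i" unfolding \<phi>i[symmetric] using s(1-3) \<phi> h by simp
    also have "\<dots> = t \<cdot> (pY \<cdot> i)" unfolding s(4) using t st h by simp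
    also have "\<dots> = pzero D (src D f) (tgt D t)" unfolding e using t st by simp
    finally have "s = pzero D (tgt D f) (tgt D t)"
      using is_epi_zeroD[OF f, of s "tgt D t"] s \<phi> by simp
    then have "t \<cdot> pY = pzero D S (tgt D t)" using s(4) t \<phi> by simp
    have "t = t \<cdot> pY \<cdot> j" using t st h e by simp
    also have "\<dots> = pzero D (src D g) (tgt D t)" unfolding \<open>t \<cdot> pY = _\<close> using t h by simp
    finally show "t = pzero D (tgt D (pY \<cdot> k)) (tgt D t)" using st t by simp
  qed
  moreover have "f \<cdot> (pX \<cdot> k) = g \<cdot> (pY \<cdot> k)"
  proof -
    have "f \<cdot> (pX \<cdot> k) \<boxminus> g \<cdot> (pY \<cdot> k) = \<phi> \<cdot> k" using h k' \<phi> g S by (simp add: \<phi>_def)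
    also have "\<dots> = pzero D (src D k) (tgt D f)" using k' \<phi> by simp
    finally show ?thesis using h k' \<phi> g S by (subst (asm) pdiff_eq_pzero_iff) simp_all
  qed
  ultimately show thesis using h k' \<phi> that[of "pY \<cdot> k" "pX \<cdot> k"] by simp
qed

lemma exact_pairD_zero:
  assumes "exact_pair D f g"
  shows "f \<in> arr D" "g \<in> arr D" "src D g = tgt D f" "g \<cdot> f = pzero D (src D f) (tgt D g)"
proof -
  obtain q k where q: "is_cokernel D f q" and kq: "is_kernel D q k" and kg: "is_kernel D g k"
    using assms by (auto simp: exact_pair_def)
  note q' = is_cokernelD[OF q] and kq' = is_kernelD[OF kq] and kg' = is_kernelD[OF kg]
  show 1: "f \<in> arr D" "g \<in> arr D" "src D g = tgt D f" using q' kq' kg' by simp_all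
  obtain e where e: "e \<in> arr D" "src D e = src D f" "tgt D e = src D k" "k \<cdot> e = f"
    using kernel_factor[OF kq, of f "src D f"] q' by metis
  have "g \<cdot> f = g \<cdot> k \<cdot> e" unfolding e(4)[symmetric] using e(1-3) kg'(1-3) by simp
  then show "g \<cdot> f = pzero D (src D f) (tgt D g)" using e(1-3) kg' by (simp add: cmp_zero_assoc[OF kg'(4)])
qed

text \<open>An element \<open>x\<close> killed by \<open>g\<close> lies in the image of
  \<open>f\<close>; pulling back the epimorphism onto the image along it gives an actual preimage on
  the cover \<open>e\<close>.\<close>

lemma exact_pairD_lift:
  assumes "exact_pair D f g" "x \<in> arr D" "tgt D x = tgt D f" "src D x = W" "g \<cdot> x = pzero D W (tgt D g)"
  obtains e y where "is_epi D e" "e \<in> arr D" "tgt D e = W" "y \<in> arr D" "src D y = src D e"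
    "tgt D y = src D f" "x \<cdot> e = f \<cdot> y"
proof -
  obtain q k where q: "is_cokernel D f q" and kq: "is_kernel D q k" and kg: "is_kernel D g k"
    using assms by (auto simp: exact_pair_def)
  note q' = is_cokernelD[OF q] and kq' = is_kernelD[OF kq] and kg' = is_kernelD[OF kg]
  obtain m where m: "m \<in> arr D" "src D m = src D f" "tgt D m = src D k" "k \<cdot> m = f" "is_epi D m"
    using image_factor[OF q kq] by metis
  obtain x' where x': "x' \<in> arr D" "src D x' = W" "tgt D x' = src D k" "k \<cdot> x' = x"
    using kernel_factor[OF kg, of x W] assms q' kq' kg' by metis
  obtain p h where p: "is_epi D p" "p \<in> arr D" "tgt D p = src D x'" "h \<in> arr D" "src D h = src D p"
    "tgt D h = src D m" "m \<cdot> h = x' \<cdot> p"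
    using epi_pullback[OF m(5) x'(1)] x' m by metis
  have "x \<cdot> p = k \<cdot> (m \<cdot> h)" unfolding p(7) x'(4)[symmetric] using x'(1-3) p(1-6) kq' by simp
  also have "\<dots> = k \<cdot> m \<cdot> h" using m(1-3) p kq' by simp
  also have "\<dots> = f \<cdot> h" unfolding m(4) ..
  finally show thesis using that[of p h] p m x' by simp
qed

text \<open>Preimages on covers suffice for exactness: a cokernel \<open>q\<close> of
  \<open>f\<close> kills \<open>x \<cdot> e\<close>, hence \<open>x\<close> because \<open>e\<close>
  is epic, so a kernel of \<open>q\<close> is also a kernel of \<open>g\<close>.\<close>

lemma exact_pairI:
  assumes f: "f \<in> arr D" and g: "g \<in> arr D" "src D g = tgt D f" and z: "g \<cdot> f = pzero D (src D f) (tgt D g)"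
    and ex: "\<And>x. \<lbrakk>x \<in> arr D; tgt D x = tgt D f; g \<cdot> x = pzero D (src D x) (tgt D g)\<rbrakk> \<Longrightarrow>
      \<exists>e y. is_epi D e \<and> tgt D e = src D x \<and> y \<in> arr D \<and> src D y = src D e \<and> tgt D y = src D f \<and> x \<cdot> e = f \<cdot> y"
  shows "exact_pair D f g"
proof -
  obtain q where q: "is_cokernel D f q" using ex_cokernel[OF f] by blast
  note q' = is_cokernelD[OF q]
  obtain k where k: "is_kernel D q k" using ex_kernel[OF q'(2)] by blast
  note k' = is_kernelD[OF k]
  obtain g' where g': "g' \<in> arr D" "src D g' = tgt D q" "tgt D g' = tgt D g" "g' \<cdot> q = g"
    using cokernel_factor[OF q, of g "tgt D g"] g z by metis
  have gk: "g \<cdot> k = pzero D (src D k) (tgt D g)"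
  proof -
    have "g \<cdot> k = g' \<cdot> (q \<cdot> k)" unfolding g'(4)[symmetric] using g'(1-3) k'(1-3) q' by simp
    then show ?thesis using g'(1-3) k' by simp
  qed
  have "is_kernel D g k"
  proof (rule is_kernelI)
    show "is_mono D k" using k by (rule kernel_mono)
    show "tgt D k = src D g" using k' q' g by simp
    fix x assume x: "x \<in> arr D" "tgt D x = src D g" "g \<cdot> x = pzero D (src D x) (tgt D g)"
    then obtain e y where e: "is_epi D e" "tgt D e = src D x" "y \<in> arr D" "src D y = src D e"
      "tgt D y = src D f" "x \<cdot> e = f \<cdot> y" using ex[of x] g by auto
    have [simp]: "e \<in> arr D" using e(1) by (rule is_epi_arr)
    have "q \<cdot> x \<cdot> e = q \<cdot> f \<cdot> y" using x(1,2) e q'(1-3) g by simp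
    also have "\<dots> = pzero D (src D e) (tgt D q)" using e(1-5) f q' by (simp add: cmp_zero_assoc[OF q'(4)])
    finally have "q \<cdot> x = pzero D (src D x) (tgt D q)"
      using is_epi_zeroD[OF e(1), of "q \<cdot> x" "tgt D q"] x q' g e by simp
    then show "\<exists>y\<in>arr D. src D y = src D x \<and> tgt D y = src D k \<and> k \<cdot> y = x"
      using kernel_factor[OF k, of x "src D x"] x q' g by metis
  qed fact+
  then show ?thesis using q k unfolding exact_pair_def by blast
qed

lemma cokernel_lift:
  assumes q: "is_cokernel D f q" and x: "x \<in> arr D" "tgt D x = tgt D f" "src D x = W" "q \<cdot> x = pzero D W (tgt D q)"
  obtains e y where "is_epi D e" "e \<in> arr D" "tgt D e = W" "y \<in> arr D" "src D y = src D e"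
    "tgt D y = src D f" "x \<cdot> e = f \<cdot> y"
proof -
  obtain k where k: "is_kernel D q k" using ex_kernel[OF is_cokernelD(2)[OF q]] by blast
  have "exact_pair D f q" using q k unfolding exact_pair_def by blast
  from exact_pairD_lift[OF this x] that show thesis by blast
qed

text \<open>A monomorphism is the kernel of some \<open>g\<close>; being also epic it forces
  \<open>g = 0\<close>, and then the identity factors through it.\<close>

lemma mono_epi_is_iso:
  assumes "is_mono D f" "is_epi D f"
  shows "is_iso D f"
proof -
  have f: "f \<in> arr D" using assms(1) by (rule is_mono_arr)
  obtain g where g: "is_kernel D g f" using mono_kernel[OF assms(1)] by blast
  note g' = is_kernelD[OF g]
  have "g = pzero D (tgt D f) (tgt D g)"
    using is_epi_zeroD[OF assms(2), of g "tgt D g"] g' by simp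
  then have "g \<cdot> idt D (tgt D f) = pzero D (tgt D f) (tgt D g)" using g' f by simp
  then obtain s where s: "s \<in> arr D" "src D s = tgt D f" "tgt D s = src D f" "f \<cdot> s = idt D (tgt D f)"
    using kernel_factor[OF g, of "idt D (tgt D f)" "tgt D f"] f g' by auto
  have "f \<cdot> (s \<cdot> f) = f \<cdot> idt D (src D f)" using s f by (simp add: cmp_reassoc)
  then have "s \<cdot> f = idt D (src D f)" using is_monoD[OF assms(1), of "s \<cdot> f" "idt D (src D f)"] s f by simp
  then show ?thesis using is_isoI[of f s "src D f" "tgt D f"] s f by simp
qed

end

section \<open>Subquotients and homology\<close>

text \<open>One format for three kinds of objects: chosen homology, an object itself (both arrows
  identities) and, for a pure functor, its value at \<open>M\<close> presented by truncation data.
  Comparisons between them are then instances of one calculus, that of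
  \<open>sq_map\<close>.\<close>

definition subquotient :: "('o, 'm, 'z) precat_scheme \<Rightarrow> 'm \<Rightarrow> 'm \<Rightarrow> bool" where
  "subquotient D k q \<longleftrightarrow> is_mono D k \<and> is_epi D q \<and> src D q = src D k"

text \<open>A relation instead of a chosen induced arrow, so that it can be composed and added
  without reference to the choices made by \<open>homology_data\<close>. For subquotients the arrow
  between the sources of \<open>k\<close> and \<open>k'\<close> is determined by \<open>v\<close>,
  since \<open>k'\<close> is a monomorphism.\<close>

definition sq_map :: "('o, 'm, 'z) precat_scheme \<Rightarrow> 'm \<Rightarrow> 'm \<Rightarrow> 'm \<Rightarrow> 'm \<Rightarrow> 'm \<Rightarrow> 'm \<Rightarrow> bool" where
  "sq_map D k q k' q' v m \<longleftrightarrow> v \<in> homs D (tgt D k) (tgt D k') \<and> m \<in> homs D (tgt D q) (tgt D q') \<and>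
    (\<exists>u \<in> homs D (src D k) (src D k'). k' \<cdot>\<^bsub>D\<^esub> u = v \<cdot>\<^bsub>D\<^esub> k \<and> m \<cdot>\<^bsub>D\<^esub> q = q' \<cdot>\<^bsub>D\<^esub> u)"

definition is_complex :: "('o, 'm, 'z) precat_scheme \<Rightarrow> 'm \<Rightarrow> 'm \<Rightarrow> bool" where
  "is_complex D f g \<longleftrightarrow> f \<in> arr D \<and> g \<in> arr D \<and> src D g = tgt D f \<and> g \<cdot>\<^bsub>D\<^esub> f = pzero D (src D f) (tgt D g)"

text \<open>The outer components of the morphism of complexes are quantified away, as the induced
  map on homology depends on the middle one only.\<close>

definition chain_mid :: "('o, 'm, 'z) precat_scheme \<Rightarrow> 'm \<Rightarrow> 'm \<Rightarrow> 'm \<Rightarrow> 'm \<Rightarrow> 'm \<Rightarrow> bool" where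
  "chain_mid D f g f' g' v \<longleftrightarrow> v \<in> homs D (src D g) (src D g') \<and>
    (\<exists>s \<in> homs D (src D f) (src D f'). v \<cdot>\<^bsub>D\<^esub> f = f' \<cdot>\<^bsub>D\<^esub> s) \<and>
    (\<exists>t \<in> homs D (tgt D g) (tgt D g'). g' \<cdot>\<^bsub>D\<^esub> v = t \<cdot>\<^bsub>D\<^esub> g)"

context abelian_category
begin

lemma subquotientD:
  assumes "subquotient D k q"
  shows "k \<in> arr D" "q \<in> arr D" "src D q = src D k" "is_mono D k" "is_epi D q"
  using assms by (auto simp: subquotient_def is_mono_arr is_epi_arr)

lemma sq_mapE:
  assumes "sq_map D k q k' q' v m"
  obtains u where "u \<in> arr D" "src D u = src D k" "tgt D u = src D k'" "k' \<cdot> u = v \<cdot> k" "m \<cdot> q = q' \<cdot> u"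
  using assms by (auto simp: sq_map_def in_homs)

lemma sq_mapD:
  assumes "sq_map D k q k' q' v m"
  shows "v \<in> arr D" "src D v = tgt D k" "tgt D v = tgt D k'" "m \<in> arr D" "src D m = tgt D q" "tgt D m = tgt D q'"
  using assms by (auto simp: sq_map_def in_homs)

lemma sq_mapI:
  assumes "v \<in> arr D" "src D v = tgt D k" "tgt D v = tgt D k'" "m \<in> arr D" "src D m = tgt D q" "tgt D m = tgt D q'"
    "u \<in> arr D" "src D u = src D k" "tgt D u = src D k'" "k' \<cdot> u = v \<cdot> k" "m \<cdot> q = q' \<cdot> u"
  shows "sq_map D k q k' q' v m"
  using assms by (auto simp: sq_map_def in_homs)

text \<open>The monomorphism \<open>k'\<close> fixes the arrow on subobjects and the epimorphism
  \<open>q\<close> then fixes the arrow on quotients. Equalities between induced maps are derived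
  from this.\<close>

lemma sq_map_unique:
  assumes "subquotient D k q" "subquotient D k' q'" "sq_map D k q k' q' v m" "sq_map D k q k' q' v m'"
  shows "m = m'"
proof -
  note sq = subquotientD[OF assms(1)] and sq' = subquotientD[OF assms(2)]
  obtain u where u: "u \<in> arr D" "src D u = src D k" "tgt D u = src D k'" "k' \<cdot> u = v \<cdot> k" "m \<cdot> q = q' \<cdot> u"
    using assms(3) by (rule sq_mapE)
  obtain u' where u': "u' \<in> arr D" "src D u' = src D k" "tgt D u' = src D k'" "k' \<cdot> u' = v \<cdot> k" "m' \<cdot> q = q' \<cdot> u'"
    using assms(4) by (rule sq_mapE)
  have "u = u'" using is_monoD[OF sq'(4), of u u'] u u' by simp
  then show ?thesis
    using is_epiD[OF sq(5), of m m'] u u' sq_mapD[OF assms(3)] sq_mapD[OF assms(4)] by simp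
qed

lemma sq_map_cmp:
  assumes "subquotient D k q" "subquotient D k' q'" "subquotient D k'' q''"
    "sq_map D k q k' q' v m" "sq_map D k' q' k'' q'' v' m'"
  shows "sq_map D k q k'' q'' (v' \<cdot> v) (m' \<cdot> m)"
proof -
  note sq = subquotientD[OF assms(1)] subquotientD[OF assms(2)] subquotientD[OF assms(3)]
  note m = sq_mapD[OF assms(4)] sq_mapD[OF assms(5)]
  obtain u where u: "u \<in> arr D" "src D u = src D k" "tgt D u = src D k'" "k' \<cdot> u = v \<cdot> k" "m \<cdot> q = q' \<cdot> u"
    using assms(4) by (rule sq_mapE)
  obtain u' where u': "u' \<in> arr D" "src D u' = src D k'" "tgt D u' = src D k''" "k'' \<cdot> u' = v' \<cdot> k'" "m' \<cdot> q' = q'' \<cdot> u'"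
    using assms(5) by (rule sq_mapE)
  have "k'' \<cdot> (u' \<cdot> u) = v' \<cdot> k' \<cdot> u" using u' u(1-3) sq by (simp add: cmp_reassoc del: cmp_assoc_right)
  also have "\<dots> = v' \<cdot> (v \<cdot> k)" unfolding u(4)[symmetric] using u(1-3) sq m by simp
  finally have 1: "k'' \<cdot> (u' \<cdot> u) = v' \<cdot> v \<cdot> k" using sq m by simp
  have "m' \<cdot> m \<cdot> q = m' \<cdot> q' \<cdot> u" using u sq m by simp
  also have "\<dots> = q'' \<cdot> (u' \<cdot> u)" unfolding u'(5) using u(1-3) u'(1-3) sq m by simp
  finally have 2: "m' \<cdot> m \<cdot> q = q'' \<cdot> (u' \<cdot> u)" .
  show ?thesis by (rule sq_mapI[where u = "u' \<cdot> u"]) (use 1 2 sq m u(1-3) u'(1-3) in simp_all)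
qed

lemma sq_map_idt: "subquotient D k q \<Longrightarrow> sq_map D k q k q (idt D (tgt D k)) (idt D (tgt D q))"
  by (rule sq_mapI[where u = "idt D (src D k)"]) (use subquotientD[of k q] in simp_all)

lemma sq_map_padd:
  assumes "subquotient D k q" "subquotient D k' q'" "sq_map D k q k' q' v m" "sq_map D k q k' q' v' m'"
  shows "sq_map D k q k' q' (v \<boxplus> v') (m \<boxplus> m')"
proof -
  note sq = subquotientD[OF assms(1)] subquotientD[OF assms(2)]
  note m = sq_mapD[OF assms(3)] sq_mapD[OF assms(4)]
  obtain u where u: "u \<in> arr D" "src D u = src D k" "tgt D u = src D k'" "k' \<cdot> u = v \<cdot> k" "m \<cdot> q = q' \<cdot> u"
    using assms(3) by (rule sq_mapE)
  obtain u' where u': "u' \<in> arr D" "src D u' = src D k" "tgt D u' = src D k'" "k' \<cdot> u' = v' \<cdot> k" "m' \<cdot> q = q' \<cdot> u'"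
    using assms(4) by (rule sq_mapE)
  show ?thesis by (rule sq_mapI[where u = "u \<boxplus> u'"]) (use sq m u u' in simp_all)
qed

lemma sq_map_pdiff:
  assumes "subquotient D k q" "subquotient D k' q'" "sq_map D k q k' q' v m" "sq_map D k q k' q' v' m'"
  shows "sq_map D k q k' q' (v \<boxminus> v') (m \<boxminus> m')"
proof -
  note sq = subquotientD[OF assms(1)] subquotientD[OF assms(2)]
  note m = sq_mapD[OF assms(3)] sq_mapD[OF assms(4)]
  obtain u where u: "u \<in> arr D" "src D u = src D k" "tgt D u = src D k'" "k' \<cdot> u = v \<cdot> k" "m \<cdot> q = q' \<cdot> u"
    using assms(3) by (rule sq_mapE)
  obtain u' where u': "u' \<in> arr D" "src D u' = src D k" "tgt D u' = src D k'" "k' \<cdot> u' = v' \<cdot> k" "m' \<cdot> q = q' \<cdot> u'"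
    using assms(4) by (rule sq_mapE)
  show ?thesis by (rule sq_mapI[where u = "u \<boxminus> u'"]) (use sq m u u' in simp_all)
qed

lemma is_complexD:
  assumes "is_complex D f g"
  shows "f \<in> arr D" "g \<in> arr D" "src D g = tgt D f" "g \<cdot> f = pzero D (src D f) (tgt D g)"
  using assms by (auto simp: is_complex_def)

lemma ex_homology:
  assumes "is_complex D f g"
  shows "\<exists>k q. is_homology D f g (k, q)"
proof -
  note c = is_complexD[OF assms]
  obtain k where k: "is_kernel D g k" using ex_kernel[OF c(2)] by blast
  obtain f' where f': "f' \<in> arr D" "src D f' = src D f" "tgt D f' = src D k" "k \<cdot> f' = f"
    using kernel_factor[OF k, of f "src D f"] c by metis
  obtain q where "is_cokernel D f' q" using ex_cokernel[OF f'(1)] by blast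
  moreover have "f' \<in> homs D (src D f) (src D k)" using f' by (simp add: in_homs)
  ultimately show ?thesis using k f'(4) unfolding is_homology_def prod.case by blast
qed

lemma is_homologyE:
  assumes "is_homology D f g (k, q)"
  obtains f' where "is_kernel D g k" "f' \<in> arr D" "src D f' = src D f" "tgt D f' = src D k" "k \<cdot> f' = f"
    "is_cokernel D f' q"
  using assms by (auto simp: is_homology_def in_homs)

lemma is_homology_subquotient:
  assumes "is_homology D f g (k, q)"
  shows "subquotient D k q" "tgt D k = src D g"
proof -
  obtain f' where f': "is_kernel D g k" "f' \<in> arr D" "src D f' = src D f" "tgt D f' = src D k" "k \<cdot> f' = f"
    "is_cokernel D f' q" using assms by (rule is_homologyE)
  show "subquotient D k q" "tgt D k = src D g"
    using kernel_mono[OF f'(1)] cokernel_epi[OF f'(6)] is_kernelD[OF f'(1)] is_cokernelD[OF f'(6)] f'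
    by (simp_all add: subquotient_def)
qed

lemma ex_sq_map:
  assumes h: "is_homology D f g (k, q)" and h': "is_homology D f' g' (k', q')"
    and v: "chain_mid D f g f' g' v"
  shows "\<exists>m. sq_map D k q k' q' v m"
proof -
  obtain f1 where f1: "is_kernel D g k" "f1 \<in> arr D" "src D f1 = src D f" "tgt D f1 = src D k" "k \<cdot> f1 = f"
    "is_cokernel D f1 q" using h by (rule is_homologyE)
  obtain f1' where f1': "is_kernel D g' k'" "f1' \<in> arr D" "src D f1' = src D f'" "tgt D f1' = src D k'" "k' \<cdot> f1' = f'"
    "is_cokernel D f1' q'" using h' by (rule is_homologyE)
  note k = is_kernelD[OF f1(1)] and k' = is_kernelD[OF f1'(1)]
  note q = is_cokernelD[OF f1(6)] and q' = is_cokernelD[OF f1'(6)]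
  obtain s t where v': "v \<in> arr D" "src D v = src D g" "tgt D v = src D g'"
    and s: "s \<in> arr D" "src D s = src D f" "tgt D s = src D f'" "v \<cdot> f = f' \<cdot> s"
    and t: "t \<in> arr D" "src D t = tgt D g" "tgt D t = tgt D g'" "g' \<cdot> v = t \<cdot> g"
    using v by (auto simp: chain_mid_def in_homs)
  have "g' \<cdot> (v \<cdot> k) = t \<cdot> g \<cdot> k" using v' k(1-3) k' by (simp add: cmp_reassoc[OF t(4)])
  also have "\<dots> = pzero D (src D k) (tgt D g')" using t(1-3) k by (simp add: cmp_zero_assoc[OF k(4)])
  finally obtain u where u: "u \<in> arr D" "src D u = src D k" "tgt D u = src D k'" "k' \<cdot> u = v \<cdot> k"
    using kernel_factor[OF f1'(1), of "v \<cdot> k" "src D k"] v' k by auto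
  have "k' \<cdot> (u \<cdot> f1) = v \<cdot> k \<cdot> f1" using u f1(2-4) k' by (simp add: cmp_reassoc[OF u(4)])
  also have "\<dots> = f' \<cdot> s" unfolding s(4)[symmetric] f1(5)[symmetric] using v' f1(2-4) k by simp
  also have "\<dots> = k' \<cdot> (f1' \<cdot> s)" unfolding f1'(5)[symmetric] using s(1-3) f1'(2-4) k' by simp
  finally have "u \<cdot> f1 = f1' \<cdot> s"
    using is_monoD[OF kernel_mono[OF f1'(1)], of "u \<cdot> f1" "f1' \<cdot> s"] u(1-3) f1(2-4) s(1-3) f1'(2-4) by simp
  then have "q' \<cdot> u \<cdot> f1 = q' \<cdot> (f1' \<cdot> s)" using u(1-3) f1(2-4) f1'(2-4) q' by simp
  also have "\<dots> = pzero D (src D f1) (tgt D q')" using q' s f1 f1' by (simp add: cmp_zero_assoc[OF q'(4)])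
  finally obtain m where "m \<in> arr D" "src D m = tgt D q" "tgt D m = tgt D q'" "m \<cdot> q = q' \<cdot> u"
    using cokernel_factor[OF f1(6), of "q' \<cdot> u" "tgt D q'"] q' u f1 f1' by auto
  then have "sq_map D k q k' q' v m" using u v' k k' by (intro sq_mapI[where u = u]) simp_all
  then show ?thesis ..
qed

text \<open>On the kernel of \<open>g\<close> the summand \<open>x \<cdot> g\<close> vanishes, while
  \<open>f' \<cdot> y\<close> lands in boundaries. The summands are treated separately, so
  \<open>x\<close> and \<open>y\<close> may be unrelated.\<close>

lemma sq_map_null:
  assumes h: "is_homology D f g (k, q)" and h': "is_homology D f' g' (k', q')" and c: "is_complex D f' g'"
    and y: "y \<in> arr D" "src D y = src D g" "tgt D y = src D f'"
    and x: "x \<in> arr D" "src D x = tgt D g" "tgt D x = src D g'"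
  shows "sq_map D k q k' q' (f' \<cdot> y \<boxplus> x \<cdot> g) (pzero D (tgt D q) (tgt D q'))"
proof -
  obtain f1 where f1: "is_kernel D g k" "f1 \<in> arr D" "src D f1 = src D f" "tgt D f1 = src D k" "k \<cdot> f1 = f"
    "is_cokernel D f1 q" using h by (rule is_homologyE)
  obtain f1' where f1': "is_kernel D g' k'" "f1' \<in> arr D" "src D f1' = src D f'" "tgt D f1' = src D k'" "k' \<cdot> f1' = f'"
    "is_cokernel D f1' q'" using h' by (rule is_homologyE)
  note k = is_kernelD[OF f1(1)] and k' = is_kernelD[OF f1'(1)]
  note q = is_cokernelD[OF f1(6)] and q' = is_cokernelD[OF f1'(6)]
  note c = is_complexD[OF c]
  have "(f' \<cdot> y \<boxplus> x \<cdot> g) \<cdot> k = f' \<cdot> y \<cdot> k \<boxplus> x \<cdot> g \<cdot> k" using x y k(1-3) c by simp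
  also have "x \<cdot> g \<cdot> k = pzero D (src D k) (tgt D x)" using x k by (simp add: cmp_zero_assoc[OF k(4)])
  also have "f' \<cdot> y \<cdot> k \<boxplus> pzero D (src D k) (tgt D x) = f' \<cdot> (y \<cdot> k)" using x y k c by simp
  also have "\<dots> = k' \<cdot> (f1' \<cdot> (y \<cdot> k))" unfolding f1'(5)[symmetric] using y f1'(2-4) k k' by simp
  finally have 1: "k' \<cdot> (f1' \<cdot> (y \<cdot> k)) = (f' \<cdot> y \<boxplus> x \<cdot> g) \<cdot> k" ..
  have 2: "q' \<cdot> (f1' \<cdot> (y \<cdot> k)) = pzero D (tgt D q) (tgt D q') \<cdot> q"
    using q q' y k f1' f1 by (simp add: cmp_zero_assoc[OF q'(4)])
  show ?thesis
    by (rule sq_mapI[where u = "f1' \<cdot> (y \<cdot> k)"]) (use 1 2 x y k k' q q' c f1(2-4) f1'(2-4) in simp_all)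
qed

lemma is_homology_homology_data:
  assumes "is_complex D f g"
  shows "is_homology D f g (fst (homology_data D f g), snd (homology_data D f g))"
  using ex_homology[OF assms] someI_ex[of "is_homology D f g"] unfolding homology_data_def by auto

lemma homology_map_eq:
  assumes c: "is_complex D f g" and c': "is_complex D f' g'"
    and m: "sq_map D (fst (homology_data D f g)) (snd (homology_data D f g))
      (fst (homology_data D f' g')) (snd (homology_data D f' g')) v m"
  shows "homology_map D f g f' g' v = m"
proof -
  let ?k = "fst (homology_data D f g)" let ?q = "snd (homology_data D f g)"
  let ?k' = "fst (homology_data D f' g')" let ?q' = "snd (homology_data D f' g')"
  note s = is_homology_subquotient(1)[OF is_homology_homology_data[OF c]]
  note s' = is_homology_subquotient(1)[OF is_homology_homology_data[OF c']]
  have "homology_map D f g f' g' v = (THE m. m \<in> homs D (tgt D ?q) (tgt D ?q') \<and>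
        (\<exists>u \<in> homs D (src D ?k) (src D ?k'). ?k' \<cdot> u = v \<cdot> ?k \<and> m \<cdot> ?q = ?q' \<cdot> u))"
    by (simp add: homology_map_def split_beta)
  also have "\<dots> = (THE m. sq_map D ?k ?q ?k' ?q' v m)"
    using m by (auto simp: sq_map_def intro!: arg_cong[of _ _ The])
  also have "\<dots> = m" by (rule the_equality) (use m sq_map_unique[OF s s'] in blast)+
  finally show ?thesis .
qed

lemma sq_map_homology_map:
  assumes c: "is_complex D f g" and c': "is_complex D f' g'" and v: "chain_mid D f g f' g' v"
  shows "sq_map D (fst (homology_data D f g)) (snd (homology_data D f g))
      (fst (homology_data D f' g')) (snd (homology_data D f' g')) v (homology_map D f g f' g' v)"
  using ex_sq_map[OF is_homology_homology_data[OF c] is_homology_homology_data[OF c'] v] homology_map_eq[OF c c']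
  by metis

text \<open>Degreewise, the sequence of complexes from \<open>(f, g)\<close> through \<open>(f', g')\<close> to \<open>(f'', g'')\<close> is assumed
  to be exact only as far as needed in the chase.\<close>

lemma exact_on_homology:
  assumes h: "is_homology D f g (k, q)" and h': "is_homology D f' g' (k', q')" and h'': "is_homology D f'' g'' (k'', q'')"
    and c: "is_complex D f g" and c': "is_complex D f' g'" and c'': "is_complex D f'' g''"
    and b: "b \<in> arr D" "src D b = src D g" "tgt D b = src D g'"
    and p: "p \<in> arr D" "src D p = src D g'" "tgt D p = src D g''"
    and r: "r \<in> arr D" "src D r = src D g'" "tgt D r = src D g"
    and bp: "\<And>z. \<lbrakk>z \<in> arr D; tgt D z = src D g'; p \<cdot> z = pzero D (src D z) (src D g'')\<rbrakk> \<Longrightarrow> b \<cdot> (r \<cdot> z) = z"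
    and pb: "p \<cdot> b = pzero D (src D g) (src D g'')"
    and b1: "is_mono D b1" "src D b1 = tgt D g" "tgt D b1 = tgt D g'" "b1 \<cdot> g = g' \<cdot> b"
    and p1: "is_epi D p1" "src D p1 = src D f'" "tgt D p1 = src D f''" "p \<cdot> f' = f'' \<cdot> p1"
    and m: "sq_map D k q k' q' b m" and m': "sq_map D k' q' k'' q'' p m'"
  shows "exact_pair D m m'"
proof (rule exact_pairI)
  note s = is_homology_subquotient[OF h] and s' = is_homology_subquotient[OF h'] and s'' = is_homology_subquotient[OF h'']
  note sq = subquotientD[OF s(1)] subquotientD[OF s'(1)] subquotientD[OF s''(1)]
  note C = is_complexD(1-3)[OF c] is_complexD(1-3)[OF c'] is_complexD(1-3)[OF c'']
  note M = sq_mapD[OF m] sq_mapD[OF m']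
  obtain f1 where f1: "is_kernel D g k" "f1 \<in> arr D" "src D f1 = src D f" "tgt D f1 = src D k" "k \<cdot> f1 = f"
    "is_cokernel D f1 q" using h by (rule is_homologyE)
  obtain f1' where f1': "is_kernel D g' k'" "f1' \<in> arr D" "src D f1' = src D f'" "tgt D f1' = src D k'" "k' \<cdot> f1' = f'"
    "is_cokernel D f1' q'" using h' by (rule is_homologyE)
  obtain f1'' where f1'': "is_kernel D g'' k''" "f1'' \<in> arr D" "src D f1'' = src D f''" "tgt D f1'' = src D k''" "k'' \<cdot> f1'' = f''"
    "is_cokernel D f1'' q''" using h'' by (rule is_homologyE)
  show "m \<in> arr D" "m' \<in> arr D" "src D m' = tgt D m" using M by simp_all
  have [simp]: "b1 \<in> arr D" "p1 \<in> arr D" using b1 p1 by (auto simp: is_mono_arr is_epi_arr)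
  obtain u where u: "u \<in> arr D" "src D u = src D k" "tgt D u = src D k'" "k' \<cdot> u = b \<cdot> k" "m \<cdot> q = q' \<cdot> u"
    using m by (rule sq_mapE)
  obtain u' where u': "u' \<in> arr D" "src D u' = src D k'" "tgt D u' = src D k''" "k'' \<cdot> u' = p \<cdot> k'" "m' \<cdot> q' = q'' \<cdot> u'"
    using m' by (rule sq_mapE)
  have "sq_map D k q k'' q'' (pzero D (tgt D k) (tgt D k'')) (pzero D (tgt D q) (tgt D q''))"
    by (rule sq_mapI[where u = "pzero D (src D k) (src D k'')"]) (use sq in simp_all)
  then show "m' \<cdot> m = pzero D (src D m) (tgt D m')"
    using sq_map_unique[OF s(1) s''(1) sq_map_cmp[OF s(1) s'(1) s''(1) m m']] pb s s' s'' M by simp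
  fix x assume x: "x \<in> arr D" "tgt D x = tgt D m" "m' \<cdot> x = pzero D (src D x) (tgt D m')"
  \<comment> \<open>The class \<open>x\<close> is represented on a cover by a cycle
    \<open>\<zeta>\<close> of the middle complex.\<close>
  obtain e1 \<zeta> where e1: "is_epi D e1" "e1 \<in> arr D" "tgt D e1 = src D x" and
    \<zeta>: "\<zeta> \<in> arr D" "src D \<zeta> = src D e1" "tgt D \<zeta> = src D q'" "q' \<cdot> \<zeta> = x \<cdot> e1"
    by (rule epi_pullback[OF sq(10) x(1)]) (use x M in auto)
  have "q'' \<cdot> (u' \<cdot> \<zeta>) = m' \<cdot> (q' \<cdot> \<zeta>)"
    using \<zeta>(1-3) u' sq M by (simp add: cmp_reassoc[OF u'(5)])
  also have "\<dots> = m' \<cdot> x \<cdot> e1" unfolding \<zeta>(4) using x(1,2) e1 M by simp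
  also have "\<dots> = pzero D (src D e1) (tgt D q'')" unfolding x(3) using x(1,2) e1 M sq by simp
  \<comment> \<open>The image of the cycle has zero class in the third homology, so on a further
    cover it is the boundary of some \<open>v\<close>.\<close>
  finally obtain e2 v where e2: "is_epi D e2" "e2 \<in> arr D" "tgt D e2 = src D e1" and
    v: "v \<in> arr D" "src D v = src D e2" "tgt D v = src D f1''" "u' \<cdot> \<zeta> \<cdot> e2 = f1'' \<cdot> v"
    using cokernel_lift[OF f1''(6), of "u' \<cdot> \<zeta>" "src D e1"] \<zeta> u' sq f1'' by auto
  \<comment> \<open>Lifting \<open>v\<close> along the epimorphism \<open>p1\<close> provides the
    boundary by which the cycle is corrected.\<close>
  obtain e3 z where e3: "is_epi D e3" "e3 \<in> arr D" "tgt D e3 = src D v" and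
    z: "z \<in> arr D" "src D z = src D e3" "tgt D z = src D p1" "p1 \<cdot> z = v \<cdot> e3"
    by (rule epi_pullback[OF p1(1) v(1)]) (use v f1'' p1 in auto)
  note A = C x(1,2) M e1(2-) e2(2-) e3(2-) \<zeta>(1-3) v(1-3) z(1-3) sq f1(2-4) f1'(2-4) f1''(2-4) u(1-3) u'(1-3) b p r b1(2,3) p1(2,3) s(2) s'(2) s''(2)
  \<comment> \<open>The corrected cycle is killed by \<open>p\<close>, so \<open>bp\<close> exhibits
    it as \<open>b\<close> applied to \<open>r \<cdot> z0\<close>. Since \<open>b1\<close> is monic,
    the latter is itself a cycle, and its class is the wanted preimage.\<close>
  define z0 where "z0 = k' \<cdot> (\<zeta> \<cdot> (e2 \<cdot> e3)) \<boxminus> f' \<cdot> z"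
  have z0: "z0 \<in> arr D" "src D z0 = src D e3" "tgt D z0 = src D g'" using A by (simp_all add: z0_def)
  have "p \<cdot> (k' \<cdot> (\<zeta> \<cdot> (e2 \<cdot> e3))) = k'' \<cdot> (u' \<cdot> \<zeta> \<cdot> e2 \<cdot> e3)"
    using A by (simp add: cmp_reassoc[OF u'(4)])
  also have "\<dots> = f'' \<cdot> (v \<cdot> e3)" unfolding v(4) f1''(5)[symmetric] using A by simp
  also have "\<dots> = f'' \<cdot> p1 \<cdot> z" unfolding z(4)[symmetric] using A by simp
  also have "\<dots> = p \<cdot> (f' \<cdot> z)" unfolding p1(4)[symmetric] using A by simp
  finally have "p \<cdot> z0 = pzero D (src D z0) (src D g'')" using A by (simp add: z0_def)
  then have bz: "b \<cdot> (r \<cdot> z0) = z0" using bp z0 by simp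
  have g'k': "g' \<cdot> k' = pzero D (src D k') (tgt D g')" using is_kernelD[OF f1'(1)] by simp
  have g'f': "g' \<cdot> f' = pzero D (src D f') (tgt D g')" using is_complexD[OF c'] by simp
  have "b1 \<cdot> (g \<cdot> (r \<cdot> z0)) = g' \<cdot> (b \<cdot> (r \<cdot> z0))"
    using A z0 by (simp add: cmp_reassoc[OF b1(4)])
  also have "\<dots> = pzero D (src D z0) (tgt D g')" unfolding bz
    using A by (simp add: z0_def cmp_zero_assoc[OF g'k'] cmp_zero_assoc[OF g'f'])
  finally have "g \<cdot> (r \<cdot> z0) = pzero D (src D z0) (tgt D g)"
    using is_mono_zeroD[OF b1(1), of "g \<cdot> (r \<cdot> z0)" "src D z0"] A z0 by simp
  then obtain \<eta> where \<eta>: "\<eta> \<in> arr D" "src D \<eta> = src D z0" "tgt D \<eta> = src D k" "k \<cdot> \<eta> = r \<cdot> z0"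
    using kernel_factor[OF f1(1), of "r \<cdot> z0" "src D z0"] A z0 by auto
  have "k' \<cdot> (u \<cdot> \<eta>) = b \<cdot> (k \<cdot> \<eta>)" using A \<eta>(1-3) by (simp add: cmp_reassoc[OF u(4)])
  also have "\<dots> = z0" using \<eta>(4) bz by simp
  also have "\<dots> = k' \<cdot> (\<zeta> \<cdot> (e2 \<cdot> e3) \<boxminus> f1' \<cdot> z)"
    unfolding z0_def f1'(5)[symmetric] using A by simp
  finally have ue: "u \<cdot> \<eta> = \<zeta> \<cdot> (e2 \<cdot> e3) \<boxminus> f1' \<cdot> z"
    using is_monoD[OF sq(9), of "u \<cdot> \<eta>" "\<zeta> \<cdot> (e2 \<cdot> e3) \<boxminus> f1' \<cdot> z"] A \<eta>(1-3) z0 by simp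
  have q'f: "q' \<cdot> f1' = pzero D (src D f1') (tgt D q')" using is_cokernelD[OF f1'(6)] by simp
  have "m \<cdot> (q \<cdot> \<eta>) = q' \<cdot> (u \<cdot> \<eta>)" using A \<eta>(1-3) by (simp add: cmp_reassoc[OF u(5)])
  also have "\<dots> = q' \<cdot> (\<zeta> \<cdot> (e2 \<cdot> e3))" unfolding ue using A by (simp add: cmp_zero_assoc[OF q'f])
  also have "\<dots> = x \<cdot> (e1 \<cdot> (e2 \<cdot> e3))" using A by (simp add: cmp_reassoc[OF \<zeta>(4)])
  finally have "x \<cdot> (e1 \<cdot> (e2 \<cdot> e3)) = m \<cdot> (q \<cdot> \<eta>)" ..
  moreover have "is_epi D (e1 \<cdot> (e2 \<cdot> e3))"
    using is_epi_cmp[OF is_epi_cmp[OF e3(1) e2(1)] e1(1)] A by simp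
  ultimately show "\<exists>e y. is_epi D e \<and> tgt D e = src D x \<and> y \<in> arr D \<and> src D y = src D e \<and> tgt D y = src D m \<and> x \<cdot> e = m \<cdot> y"
    using A \<eta>(1-3) z0 by (intro exI[of _ "e1 \<cdot> (e2 \<cdot> e3)"] exI[of _ "q \<cdot> \<eta>"]) simp
qed

end

section \<open>Triangulated categories\<close>

text \<open>Taking \<open>S\<close> to be all objects or the objects of the heart covers functors on \<open>C\<close> and on \<open>Hw\<close>
  at once, without having to know that the heart is additive.\<close>

locale additive_functor_on = Dom: additive_category C + Cod: additive_category D
  for C :: "('o, 'm, 'y) precat_scheme" and D :: "('a, 'b, 'z) precat_scheme" +
  fixes S :: "'o set" and F :: "('o, 'm, 'a, 'b) cfunctor"
  assumes sub: "S \<subseteq> obj C" and additive: "F \<in> additive_functors (full_subcat C S) D"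
begin

lemma is_functor: "is_functor (full_subcat C S) D F"
  using additive by (simp add: additive_functors_def)

lemma fobj_closed [simp]: "X \<in> S \<Longrightarrow> fobj F X \<in> obj D"
  using is_functor by (auto simp: is_functor_def full_subcat_def)

lemma farr_simps [simp]:
  assumes "f \<in> arr C" "src C f \<in> S" "tgt C f \<in> S"
  shows "farr F f \<in> arr D" "src D (farr F f) = fobj F (src C f)" "tgt D (farr F f) = fobj F (tgt C f)"
  using is_functor assms by (auto simp: is_functor_def full_subcat_def)

lemma farr_idt [simp]: "X \<in> S \<Longrightarrow> farr F (idt C X) = idt D (fobj F X)"
  using is_functor by (auto simp: is_functor_def full_subcat_def)

lemma farr_cmp:
  assumes "f \<in> arr C" "g \<in> arr C" "src C g = tgt C f" "src C f \<in> S" "tgt C f \<in> S" "tgt C g \<in> S"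
  shows "farr F (g \<cdot>\<^bsub>C\<^esub> f) = farr F g \<cdot>\<^bsub>D\<^esub> farr F f"
  using is_functor assms by (auto simp: is_functor_def full_subcat_def)

lemma farr_padd:
  assumes "f \<in> arr C" "g \<in> arr C" "src C g = src C f" "tgt C g = tgt C f" "src C f \<in> S" "tgt C f \<in> S"
  shows "farr F (f \<boxplus>\<^bsub>C\<^esub> g) = farr F f \<boxplus>\<^bsub>D\<^esub> farr F g"
proof -
  have "f \<in> homs (full_subcat C S) (src C f) (tgt C f)" "g \<in> homs (full_subcat C S) (src C f) (tgt C f)"
    using assms by (simp_all add: in_homs full_subcat_def)
  moreover have "obj (full_subcat C S) = S" "padd (full_subcat C S) = padd C" by (simp_all add: full_subcat_def)
  ultimately show ?thesis using additive assms unfolding additive_functors_def by auto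
qed

lemma farr_pzero [simp]:
  assumes "X \<in> S" "Y \<in> S"
  shows "farr F (pzero C X Y) = pzero D (fobj F X) (fobj F Y)"
proof -
  have [simp]: "X \<in> obj C" "Y \<in> obj C" using assms sub by auto
  have "farr F (pzero C X Y) \<boxplus>\<^bsub>D\<^esub> farr F (pzero C X Y) = farr F (pzero C X Y \<boxplus>\<^bsub>C\<^esub> pzero C X Y)"
    using assms by (subst farr_padd) simp_all
  also have "\<dots> = farr F (pzero C X Y) \<boxplus>\<^bsub>D\<^esub> pzero D (fobj F X) (fobj F Y)"
    using assms by simp
  finally show ?thesis by (rule Cod.padd_left_cancel) (use assms in simp_all)
qed

lemma farr_pneg:
  assumes "f \<in> arr C" "src C f \<in> S" "tgt C f \<in> S"
  shows "farr F (pneg C f) = pneg D (farr F f)"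
proof (rule Cod.pneg_unique)
  show "farr F f \<boxplus>\<^bsub>D\<^esub> farr F (pneg C f) = pzero D (fobj F (src C f)) (fobj F (tgt C f))"
    using assms by (subst farr_padd[symmetric]) simp_all
qed (use assms in simp_all)

lemma farr_pdiff:
  assumes "f \<in> arr C" "g \<in> arr C" "src C g = src C f" "tgt C g = tgt C f" "src C f \<in> S" "tgt C f \<in> S"
  shows "farr F (f \<boxminus>\<^bsub>C\<^esub> g) = farr F f \<boxminus>\<^bsub>D\<^esub> farr F g"
  using assms by (simp add: pdiff_def farr_padd farr_pneg)

end

lemma additive_functors_full_subcat:
  assumes "category C"
  shows "additive_functors (full_subcat C (obj C)) D = additive_functors C D"
proof -
  interpret category C by fact
  have *: "{f \<in> arr C. src C f \<in> obj C \<and> tgt C f \<in> obj C} = arr C" by auto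
  have **: "homs (full_subcat C (obj C)) X Y = homs C X Y" for X Y
    by (auto simp: homs_def full_subcat_def)
  show ?thesis unfolding additive_functors_def is_functor_def **
    by (simp add: full_subcat_def *)
qed

lemma additive_functor_onI:
  assumes "additive_category C" "additive_category D" "F \<in> additive_functors C D"
  shows "additive_functor_on C D (obj C) F"
proof -
  interpret C: additive_category C by fact
  interpret D: additive_category D by fact
  show ?thesis
    by unfold_locales (use assms additive_functors_full_subcat[OF C.category_axioms] in auto)
qed

text \<open>Common shape of \<open>shO\<close> and \<open>shA\<close>; additivity of integer
  iteration is proved once for both.\<close>

definition bij_iter :: "'x set \<Rightarrow> ('x \<Rightarrow> 'x) \<Rightarrow> int \<Rightarrow> 'x \<Rightarrow> 'x" where
  "bij_iter A f n = (if 0 \<le> n then f ^^ nat n else inv_into A f ^^ nat (- n))"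

lemma funpow_closed: "(\<And>x. x \<in> A \<Longrightarrow> f x \<in> A) \<Longrightarrow> x \<in> A \<Longrightarrow> (f ^^ n) x \<in> A"
  by (induction n) auto

lemma bij_iter_closed:
  assumes "bij_betw f A A" "x \<in> A"
  shows "bij_iter A f n x \<in> A"
proof -
  have "f x \<in> A" "inv_into A f x \<in> A" if "x \<in> A" for x
    using assms(1) that bij_betwE bij_betw_imp_surj_on inv_into_into by metis+
  then show ?thesis using assms(2) unfolding bij_iter_def by (auto intro!: funpow_closed)
qed

lemma bij_iter_step:
  assumes "bij_betw f A A" "x \<in> A"
  shows "bij_iter A f (n + 1) x = f (bij_iter A f n x)"
proof (cases "0 \<le> n")
  case True
  then have "nat (n + 1) = Suc (nat n)" by simp
  then show ?thesis using True by (simp add: bij_iter_def)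
next
  case False
  then have "nat (- n) = Suc (nat (- (n + 1)))" by simp
  then have 1: "bij_iter A f n x = inv_into A f ((inv_into A f ^^ nat (- (n + 1))) x)"
    using False by (simp add: bij_iter_def)
  have 2: "(inv_into A f ^^ nat (- (n + 1))) x = bij_iter A f (n + 1) x"
    using False by (cases "n = -1") (auto simp: bij_iter_def)
  have "f (inv_into A f y) = y" if "y \<in> A" for y
    using assms(1) that by (metis bij_betw_imp_surj_on f_inv_into_f)
  then show ?thesis unfolding 1 2 using bij_iter_closed[OF assms] by simp
qed

lemma bij_iter_add:
  assumes "bij_betw f A A" "x \<in> A"
  shows "bij_iter A f (m + n) x = bij_iter A f m (bij_iter A f n x)"
proof (induction m rule: int_induct[where k = 0])
  case base
  then show ?case by (simp add: bij_iter_def)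
next
  case (step1 i)
  have "bij_iter A f (i + 1 + n) x = f (bij_iter A f (i + n) x)"
    using bij_iter_step[OF assms, of "i + n"] by (simp add: algebra_simps)
  then show ?case using step1 bij_iter_step[OF assms(1) bij_iter_closed[OF assms]] by simp
next
  case (step2 i)
  have "f (bij_iter A f (i - 1 + n) x) = bij_iter A f (i + n) x"
    using bij_iter_step[OF assms, of "i - 1 + n"] by (simp add: algebra_simps)
  also have "\<dots> = f (bij_iter A f (i - 1) (bij_iter A f n x))"
    using step2 bij_iter_step[OF assms(1) bij_iter_closed[OF assms], of "i - 1"] by simp
  finally show ?case
    using assms(1) bij_iter_closed[OF assms] bij_iter_closed[OF assms(1) bij_iter_closed[OF assms]]
    by (metis bij_betw_imp_inj_on inj_onD)
qed

section \<open>Integer shifts and Hom-exactness of distinguished triangles\<close>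

context triangulated_category
begin

lemma shift_functor: "additive_functor_on C C (obj C) (shift C)"
  by (rule additive_functor_onI[OF additive_category_axioms additive_category_axioms shift_additive])

interpretation sh: additive_functor_on C C "obj C" "shift C" by (rule shift_functor)

lemma shO_eq: "shO C n = bij_iter (obj C) (fobj (shift C)) n"
  by (simp add: shO_def bij_iter_def)

lemma shA_eq: "shA C n = bij_iter (arr C) (farr (shift C)) n"
  by (simp add: shA_def bij_iter_def)

lemma shO_zero [simp]: "shO C 0 X = X" by (simp add: shO_def)
lemma shA_zero [simp]: "shA C 0 f = f" by (simp add: shA_def)

lemma shO_closed [simp]: "X \<in> obj C \<Longrightarrow> shO C n X \<in> obj C"
  unfolding shO_eq by (rule bij_iter_closed[OF shift_bij_obj])

lemma shA_arr [simp]: "f \<in> arr C \<Longrightarrow> shA C n f \<in> arr C"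
  unfolding shA_eq by (rule bij_iter_closed[OF shift_bij_arr])

lemma shO_shO [simp]: "X \<in> obj C \<Longrightarrow> shO C m (shO C n X) = shO C (m + n) X"
  unfolding shO_eq by (rule bij_iter_add[OF shift_bij_obj, symmetric])

lemma shA_shA [simp]: "f \<in> arr C \<Longrightarrow> shA C m (shA C n f) = shA C (m + n) f"
  unfolding shA_eq by (rule bij_iter_add[OF shift_bij_arr, symmetric])

lemma shO_step: "X \<in> obj C \<Longrightarrow> shO C (n + 1) X = fobj (shift C) (shO C n X)"
  unfolding shO_eq by (rule bij_iter_step[OF shift_bij_obj])

lemma shA_step: "f \<in> arr C \<Longrightarrow> shA C (n + 1) f = farr (shift C) (shA C n f)"
  unfolding shA_eq by (rule bij_iter_step[OF shift_bij_arr])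

lemma shift_inj_obj: "X \<in> obj C \<Longrightarrow> Y \<in> obj C \<Longrightarrow> fobj (shift C) X = fobj (shift C) Y \<longleftrightarrow> X = Y"
  using bij_betw_imp_inj_on[OF shift_bij_obj] by (auto dest: inj_onD)

lemma shift_inj_arr: "f \<in> arr C \<Longrightarrow> g \<in> arr C \<Longrightarrow> farr (shift C) f = farr (shift C) g \<longleftrightarrow> f = g"
  using bij_betw_imp_inj_on[OF shift_bij_arr] by (auto dest: inj_onD)

text \<open>Because the shift is injective, a compatibility at \<open>n\<close> and the one at
  \<open>n + 1\<close> are equivalent; a single equivalence thus serves both directions of integer
  induction.\<close>

lemma shift_induct:
  assumes "P 0" "\<And>n. P (n + 1) \<longleftrightarrow> P n"
  shows "P (n::int)"
proof (induction n rule: int_induct[where k = 0])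
  case (step2 i)
  then show ?case using assms(2)[of "i - 1"] by simp
qed (use assms in auto)

lemma src_tgt_shA:
  assumes "f \<in> arr C"
  shows "src C (shA C n f) = shO C n (src C f) \<and> tgt C (shA C n f) = shO C n (tgt C f)"
  by (rule shift_induct[of "\<lambda>n. src C (shA C n f) = shO C n (src C f) \<and> tgt C (shA C n f) = shO C n (tgt C f)"])
    (use assms in \<open>simp_all add: shA_step shO_step shift_inj_obj\<close>)

lemma src_shA [simp]: "f \<in> arr C \<Longrightarrow> src C (shA C n f) = shO C n (src C f)"
  and tgt_shA [simp]: "f \<in> arr C \<Longrightarrow> tgt C (shA C n f) = shO C n (tgt C f)"
  using src_tgt_shA by auto

lemma shA_idt [simp]: "X \<in> obj C \<Longrightarrow> shA C n (idt C X) = idt C (shO C n X)"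
proof (rule shift_induct[of "\<lambda>n. shA C n (idt C X) = idt C (shO C n X)"])
  fix n assume X: "X \<in> obj C"
  have "farr (shift C) (idt C (shO C n X)) = idt C (shO C (n + 1) X)" using X by (simp add: shO_step)
  then show "(shA C (n + 1) (idt C X) = idt C (shO C (n + 1) X)) \<longleftrightarrow> (shA C n (idt C X) = idt C (shO C n X))"
    using X shift_inj_arr[of "shA C n (idt C X)" "idt C (shO C n X)"] by (simp add: shA_step)
qed simp

lemma shA_cmp [simp]:
  assumes "f \<in> arr C" "g \<in> arr C" "src C g = tgt C f"
  shows "shA C n (g \<cdot> f) = shA C n g \<cdot> shA C n f"
proof (rule shift_induct[of "\<lambda>n. shA C n (g \<cdot> f) = shA C n g \<cdot> shA C n f"])
  fix n
  have "farr (shift C) (shA C n g \<cdot> shA C n f) = shA C (n + 1) g \<cdot> shA C (n + 1) f"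
    using assms by (simp add: shA_step sh.farr_cmp)
  then show "(shA C (n + 1) (g \<cdot> f) = shA C (n + 1) g \<cdot> shA C (n + 1) f) \<longleftrightarrow> (shA C n (g \<cdot> f) = shA C n g \<cdot> shA C n f)"
    using assms shift_inj_arr[of "shA C n (g \<cdot> f)" "shA C n g \<cdot> shA C n f"] by (simp add: shA_step)
qed simp

lemma shA_padd [simp]:
  assumes "f \<in> arr C" "g \<in> arr C" "src C g = src C f" "tgt C g = tgt C f"
  shows "shA C n (f \<boxplus> g) = shA C n f \<boxplus> shA C n g"
proof (rule shift_induct[of "\<lambda>n. shA C n (f \<boxplus> g) = shA C n f \<boxplus> shA C n g"])
  fix n
  have "farr (shift C) (shA C n f \<boxplus> shA C n g) = shA C (n + 1) f \<boxplus> shA C (n + 1) g"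
    using assms by (simp add: shA_step sh.farr_padd)
  then show "(shA C (n + 1) (f \<boxplus> g) = shA C (n + 1) f \<boxplus> shA C (n + 1) g) \<longleftrightarrow> (shA C n (f \<boxplus> g) = shA C n f \<boxplus> shA C n g)"
    using assms shift_inj_arr[of "shA C n (f \<boxplus> g)" "shA C n f \<boxplus> shA C n g"] by (simp add: shA_step)
qed simp

lemma shA_pzero [simp]:
  assumes "X \<in> obj C" "Y \<in> obj C"
  shows "shA C n (pzero C X Y) = pzero C (shO C n X) (shO C n Y)"
proof -
  have "shA C n (pzero C X Y) \<boxplus> shA C n (pzero C X Y) = shA C n (pzero C X Y) \<boxplus> pzero C (shO C n X) (shO C n Y)"
    using assms shA_padd[of "pzero C X Y" "pzero C X Y" n] by simp
  then show ?thesis by (rule padd_left_cancel) (use assms in simp_all)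
qed

lemma shA_pneg [simp]:
  assumes "f \<in> arr C"
  shows "shA C n (pneg C f) = pneg C (shA C n f)"
proof (rule pneg_unique)
  show "shA C n f \<boxplus> shA C n (pneg C f) = pzero C (shO C n (src C f)) (shO C n (tgt C f))"
    using assms shA_padd[of f "pneg C f" n, symmetric] by (simp del: shA_padd)
qed (use assms in simp_all)

lemma shA_eq_iff [simp]: "f \<in> arr C \<Longrightarrow> g \<in> arr C \<Longrightarrow> shA C n f = shA C n g \<longleftrightarrow> f = g"
  using shA_shA[of f "-n" n] shA_shA[of g "-n" n] by (metis add.left_inverse shA_zero)

lemma triD:
  assumes "(f, g, h) \<in> tri C"
  shows "f \<in> arr C" "g \<in> arr C" "h \<in> arr C" "src C g = tgt C f" "src C h = tgt C g" "tgt C h = shO C 1 (src C f)"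
  using tri_triangle[OF assms] by (auto simp: is_triangle_def)

lemma tri_rot: "(f, g, h) \<in> tri C \<Longrightarrow> (g, h, pneg C (shA C 1 f)) \<in> tri C"
  using tri_rotate tri_triangle by blast

lemma tri_unrot:
  assumes "(f, g, h) \<in> tri C"
  shows "(pneg C (shA C (-1) h), f, g) \<in> tri C"
proof -
  note t = triD[OF assms]
  have "is_triangle C (pneg C (shA C (-1) h)) f g" using t by (simp add: is_triangle_def)
  from tri_rotate[OF this] show ?thesis using assms t by simp
qed

lemma tri_fiber:
  assumes "g \<in> arr C"
  obtains f h where "(f, g, h) \<in> tri C"
  using tri_cone[OF assms] tri_unrot by blast

lemma tri_shift1: "(f, g, h) \<in> tri C \<Longrightarrow> (pneg C (shA C 1 f), pneg C (shA C 1 g), pneg C (shA C 1 h)) \<in> tri C"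
  by (intro tri_rot)

lemma tri_unshift1:
  "(f, g, h) \<in> tri C \<Longrightarrow> (pneg C (shA C (-1) f), pneg C (shA C (-1) g), pneg C (shA C (-1) h)) \<in> tri C"
  by (intro tri_unrot)

text \<open>Three rotations shift a triangle by one and negate all its arrows. Only the alternative
  is recorded and not the parity of \<open>n\<close>, since exactness and weight decompositions are
  insensitive to a common sign.\<close>

lemma tri_shift:
  assumes "(f, g, h) \<in> tri C"
  shows "(shA C n f, shA C n g, shA C n h) \<in> tri C \<or>
    (pneg C (shA C n f), pneg C (shA C n g), pneg C (shA C n h)) \<in> tri C" (is "?P n")
proof (rule shift_induct[of ?P])
  fix n
  note t = triD(1-3)[OF assms]
  have *: "- 1 + (n + 1) = n" "1 + n = n + 1" for n :: int by simp_all
  show "?P (n + 1) \<longleftrightarrow> ?P n"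
  proof
    assume "?P (n + 1)"
    then show "?P n"
      using tri_unshift1[of "shA C (n + 1) f" "shA C (n + 1) g" "shA C (n + 1) h"]
        tri_unshift1[of "pneg C (shA C (n + 1) f)" "pneg C (shA C (n + 1) g)" "pneg C (shA C (n + 1) h)"] t
      by (auto simp: *)
  next
    assume "?P n"
    then show "?P (n + 1)"
      using tri_shift1[of "shA C n f" "shA C n g" "shA C n h"]
        tri_shift1[of "pneg C (shA C n f)" "pneg C (shA C n g)" "pneg C (shA C n h)"] t
      by (auto simp: *)
  qed
qed (use assms in simp)

text \<open>The triangle on the identity of \<open>src C f\<close> maps to the given one, which
  makes \<open>g \<cdot> f\<close> factor through a zero object.\<close>

lemma tri_cmp_zero:
  assumes "(f, g, h) \<in> tri C"
  shows "g \<cdot> f = pzero C (src C f) (tgt C g)"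
proof -
  note t = triD[OF assms]
  obtain Z where Z: "zero_object C Z" using ex_zero_object by blast
  then have Zo: "Z \<in> obj C" by (simp add: zero_object_iff)
  have "(idt C (src C f), pzero C (src C f) Z, pzero C Z (shO C 1 (src C f))) \<in> tri C"
    using t Z by (intro tri_idt) auto
  from tri_morphism[OF this assms, of "idt C (src C f)" f] obtain w where
    "w \<in> arr C" "src C w = Z" "tgt C w = tgt C g" "w \<cdot> pzero C (src C f) Z = g \<cdot> f"
    using t Zo by (auto simp: in_homs)
  then show ?thesis using t Zo by simp
qed

text \<open>The morphism axiom completes only the third place. Rotating the identity triangle on
  \<open>W\<close> and the given one moves the wanted arrow there, up to a shift and a sign that
  appears on both sides.\<close>

lemma tri_lift:
  assumes T: "(f, g, h) \<in> tri C" and x: "x \<in> arr C" "tgt C x = src C g" "src C x = W" "g \<cdot> x = pzero C W (tgt C g)"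
  obtains y where "y \<in> arr C" "src C y = W" "tgt C y = src C f" "f \<cdot> y = x"
proof -
  note t = triD[OF T]
  have W: "W \<in> obj C" using x by auto
  obtain Z where Z: "zero_object C Z" using ex_zero_object by blast
  then have Zo: "Z \<in> obj C" by (simp add: zero_object_iff)
  have "(idt C W, pzero C W Z, pzero C Z (shO C 1 W)) \<in> tri C"
    using W Z by (intro tri_idt) auto
  from tri_morphism[OF tri_rot[OF this] tri_rot[OF T], of x "pzero C Z (tgt C g)"] obtain w where
    w: "w \<in> arr C" "src C w = shO C 1 W" "tgt C w = shO C 1 (src C f)"
      "shA C 1 x \<cdot> pneg C (shA C 1 (idt C W)) = pneg C (shA C 1 f) \<cdot> w"
    using t x W Zo by (auto simp: in_homs)
  then have "pneg C (shA C 1 x) = pneg C (shA C 1 f \<cdot> w)" using t x W by simp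
  then have 1: "shA C 1 x = shA C 1 f \<cdot> w" using t x w(1-3) by simp
  have "shA C 1 (f \<cdot> shA C (-1) w) = shA C 1 x" unfolding 1 using t w(1-3) W by simp
  then have "f \<cdot> shA C (-1) w = x" using t w(1-3) W x by (subst (asm) shA_eq_iff) simp_all
  then show thesis using that[of "shA C (-1) w"] w(1-3) W t by simp
qed

lemma tri_extend:
  assumes T: "(f, g, h) \<in> tri C" and x: "x \<in> arr C" "src C x = tgt C f" "tgt C x = W" "x \<cdot> f = pzero C (src C f) W"
  obtains y where "y \<in> arr C" "src C y = tgt C g" "tgt C y = W" "y \<cdot> g = x"
proof -
  note t = triD[OF T]
  have W: "W \<in> obj C" using x by auto
  obtain Z where Z: "zero_object C Z" using ex_zero_object by blast
  then have Zo: "Z \<in> obj C" by (simp add: zero_object_iff)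
  have iZ: "idt C Z = pzero C Z Z" using Z by (simp add: zero_object_iff)
  \<comment> \<open>The shift of \<open>Z\<close> is again a zero object; the identity triangle
    having it as third vertex unrotates to one whose first arrow starts at \<open>Z\<close>, as the
    morphism axiom needs here.\<close>
  have "idt C (shO C 1 Z) = shA C 1 (idt C Z)" using Zo by simp
  also have "\<dots> = pzero C (shO C 1 Z) (shO C 1 Z)" unfolding iZ using Zo by simp
  finally have Z1: "zero_object C (shO C 1 Z)" using Zo by (simp add: zero_object_iff)
  have "(idt C W, pzero C W (shO C 1 Z), pzero C (shO C 1 Z) (shO C 1 W)) \<in> tri C"
    using W Z1 by (intro tri_idt) auto
  from tri_unrot[OF this] have T': "(pzero C Z W, idt C W, pzero C W (shO C 1 Z)) \<in> tri C"
    using W Zo by simp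
  have "\<exists>w \<in> homs C (src C h) (src C (pzero C W (shO C 1 Z))). w \<cdot> g = idt C W \<cdot> x \<and>
      shA C 1 (pzero C (src C f) Z) \<cdot> h = pzero C W (shO C 1 Z) \<cdot> w"
  proof (rule tri_morphism[OF T T'])
    show "pzero C (src C f) Z \<in> homs C (src C f) (src C (pzero C Z W))" using t Zo W by (simp add: in_homs)
    show "x \<in> homs C (src C g) (src C (idt C W))" using t x W by (simp add: in_homs)
    show "x \<cdot> f = pzero C Z W \<cdot> pzero C (src C f) Z" using t x W Zo by simp
  qed
  then obtain w where w: "w \<in> homs C (src C h) (src C (pzero C W (shO C 1 Z)))" "w \<cdot> g = idt C W \<cdot> x" by blast
  then show thesis using that[of w] x t W Zo by (simp add: in_homs)
qed

text \<open>A vanishing third arrow lets the identity of the last vertex lift to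
  \<open>\<sigma>\<close>; what \<open>\<sigma> \<cdot> v\<close> leaves of the middle identity
  factors through \<open>u\<close>, and this factor is \<open>\<rho>\<close>.\<close>

lemma tri_split:
  assumes T: "(u, v, pzero C (tgt C v) (shO C 1 (src C u))) \<in> tri C"
  obtains \<sigma> \<rho> where "\<sigma> \<in> arr C" "src C \<sigma> = tgt C v" "tgt C \<sigma> = src C v" "v \<cdot> \<sigma> = idt C (tgt C v)"
    "\<rho> \<in> arr C" "src C \<rho> = tgt C u" "tgt C \<rho> = src C u" "\<rho> \<cdot> u = idt C (src C u)"
    "idt C (tgt C u) \<boxminus> \<sigma> \<cdot> v = u \<cdot> \<rho>"
proof -
  note t = triD[OF T]
  obtain \<sigma> where \<sigma>: "\<sigma> \<in> arr C" "src C \<sigma> = tgt C v" "tgt C \<sigma> = src C v" "v \<cdot> \<sigma> = idt C (tgt C v)"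
    by (rule tri_lift[OF tri_rot[OF T], of "idt C (tgt C v)" "tgt C v"]) (use t in auto)
  have z: "v \<cdot> (idt C (tgt C u) \<boxminus> \<sigma> \<cdot> v) = pzero C (tgt C u) (tgt C v)"
    using t \<sigma>(1-3) by (simp add: cmp_reassoc[OF \<sigma>(4)])
  obtain \<rho> where \<rho>: "\<rho> \<in> arr C" "src C \<rho> = tgt C u" "tgt C \<rho> = src C u" "u \<cdot> \<rho> = idt C (tgt C u) \<boxminus> \<sigma> \<cdot> v"
    by (rule tri_lift[OF T _ _ _ z]) (use t \<sigma> in simp_all)
  have "u \<cdot> (\<rho> \<cdot> u) = (idt C (tgt C u) \<boxminus> \<sigma> \<cdot> v) \<cdot> u"
    using t \<rho>(1-3) by (simp add: cmp_reassoc[OF \<rho>(4)])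
  also have "\<dots> = u" using t(1-5) \<sigma>(1-3) tri_cmp_zero[OF T] by simp
  finally have z': "u \<cdot> (\<rho> \<cdot> u \<boxminus> idt C (src C u)) = pzero C (src C u) (tgt C u)"
    using t \<rho>(1-3) by simp
  \<comment> \<open>The difference of \<open>\<rho> \<cdot> u\<close> and the identity is killed by
    \<open>u\<close>, hence factors through the desuspended third arrow, which is zero.\<close>
  obtain y where y: "y \<in> arr C" "src C y = src C u" "tgt C y = shO C (-1) (tgt C v)"
      "pneg C (shA C (-1) (pzero C (tgt C v) (shO C 1 (src C u)))) \<cdot> y = \<rho> \<cdot> u \<boxminus> idt C (src C u)"
    by (rule tri_lift[OF tri_unrot[OF T] _ _ _ z']) (use t \<rho>(1-3) in simp_all)
  then have "\<rho> \<cdot> u \<boxminus> idt C (src C u) = pzero C (src C u) (src C u)" using t \<rho>(1-3) by simp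
  then have "\<rho> \<cdot> u = idt C (src C u)" using t \<rho>(1-3) by (subst (asm) pdiff_eq_pzero_iff) simp_all
  then show thesis using \<rho>(4)[symmetric] by (rule that[OF \<sigma> \<rho>(1-3)])
qed

end

section \<open>Weight structures\<close>

context triangulated_category
begin

lemma tri_extend1:
  assumes T: "(f, g, h) \<in> tri C" and x: "x \<in> arr C" "src C x = tgt C g" "tgt C x = W" "x \<cdot> g = pzero C (src C g) W"
  obtains y where "y \<in> arr C" "src C y = shO C 1 (src C f)" "tgt C y = W" "y \<cdot> h = x"
proof -
  note t = triD[OF T]
  show thesis by (rule tri_extend[OF tri_rot[OF T] x]) (use t that in auto)
qed

lemma tri_lift1:
  assumes T: "(f, g, h) \<in> tri C" and x: "x \<in> arr C" "tgt C x = src C h" "src C x = W" "h \<cdot> x = pzero C W (tgt C h)"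
  obtains y where "y \<in> arr C" "src C y = W" "tgt C y = src C g" "g \<cdot> y = x"
  using tri_lift[OF tri_rot[OF T] x] that by blast

lemma tri_lift2:
  assumes T: "(f, g, h) \<in> tri C" and x: "x \<in> arr C" "tgt C x = shO C 1 (src C f)" "src C x = W"
    "shA C 1 f \<cdot> x = pzero C W (shO C 1 (tgt C f))"
  obtains y where "y \<in> arr C" "src C y = W" "tgt C y = src C h" "h \<cdot> y = x"
proof -
  note t = triD[OF T]
  show thesis
  proof (rule tri_lift1[OF tri_rot[OF T]])
    show "pneg C (shA C 1 f) \<cdot> x = pzero C W (tgt C (pneg C (shA C 1 f)))" using t x by auto
  qed (use t x that in auto)
qed

text \<open>Lifting in the unrotated triangle; the sign of its first arrow is absorbed into
  \<open>y\<close>.\<close>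

lemma tri_lift0:
  assumes T: "(f, g, h) \<in> tri C" and x: "x \<in> arr C" "tgt C x = src C f" "src C x = W"
    "f \<cdot> x = pzero C W (tgt C f)"
  obtains y where "y \<in> arr C" "src C y = W" "tgt C y = shO C (-1) (tgt C g)" "shA C (-1) h \<cdot> y = x"
proof -
  note t = triD[OF T]
  have W: "W \<in> obj C" using x by auto
  obtain y where y: "y \<in> arr C" "src C y = W" "tgt C y = shO C (-1) (tgt C g)" "pneg C (shA C (-1) h) \<cdot> y = x"
    by (rule tri_lift[OF tri_unrot[OF T] _ _ _ x(4)]) (use t x in auto)
  show thesis by (rule that[of "pneg C y"]) (use y t W in simp_all)
qed

lemma tri_cmp_zero1: "(f, g, h) \<in> tri C \<Longrightarrow> h \<cdot> g = pzero C (src C g) (tgt C h)"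
  using tri_cmp_zero[OF tri_rot] .

lemma tri_cmp_zero2:
  assumes "(f, g, h) \<in> tri C"
  shows "shA C 1 f \<cdot> h = pzero C (src C h) (shO C 1 (tgt C f))"
  using tri_cmp_zero[OF tri_rot[OF tri_rot[OF assms]]] triD[OF assms] by simp

end

context weight_structure
begin

lemma wle_iff: "X \<in> wle C w i \<longleftrightarrow> X \<in> obj C \<and> shO C (- i) X \<in> wle0 w"
proof
  assume "X \<in> wle C w i"
  then obtain Y where Y: "Y \<in> wle0 w" "X = shO C i Y" by (auto simp: wle_def)
  then have "Y \<in> obj C" using wle0_obj by auto
  then show "X \<in> obj C \<and> shO C (- i) X \<in> wle0 w" using Y by simp
next
  assume *: "X \<in> obj C \<and> shO C (- i) X \<in> wle0 w"
  then have "X = shO C i (shO C (- i) X)" by simp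
  then show "X \<in> wle C w i" unfolding wle_def using * by blast
qed

lemma wge_iff: "X \<in> wge C w i \<longleftrightarrow> X \<in> obj C \<and> shO C (- i) X \<in> wge0 w"
proof
  assume "X \<in> wge C w i"
  then obtain Y where Y: "Y \<in> wge0 w" "X = shO C i Y" by (auto simp: wge_def)
  then have "Y \<in> obj C" using wge0_obj by auto
  then show "X \<in> obj C \<and> shO C (- i) X \<in> wge0 w" using Y by simp
next
  assume *: "X \<in> obj C \<and> shO C (- i) X \<in> wge0 w"
  then have "X = shO C i (shO C (- i) X)" by simp
  then show "X \<in> wge C w i" unfolding wge_def using * by blast
qed

lemma wle_obj: "X \<in> wle C w i \<Longrightarrow> X \<in> obj C" and wge_obj: "X \<in> wge C w i \<Longrightarrow> X \<in> obj C"
  by (simp_all add: wle_iff wge_iff)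

lemma shO_wle_iff: "X \<in> obj C \<Longrightarrow> shO C n X \<in> wle C w i \<longleftrightarrow> X \<in> wle C w (i - n)"
  by (simp add: wle_iff algebra_simps)

lemma shO_wge_iff: "X \<in> obj C \<Longrightarrow> shO C n X \<in> wge C w i \<longleftrightarrow> X \<in> wge C w (i - n)"
  by (simp add: wge_iff algebra_simps)

lemma wle_step: "X \<in> wle C w i \<Longrightarrow> X \<in> wle C w (i + 1)"
  using wle0_shift by (auto simp: wle_iff algebra_simps)

lemma wge_step: "X \<in> wge C w (i + 1) \<Longrightarrow> X \<in> wge C w i"
proof -
  assume X: "X \<in> wge C w (i + 1)"
  then have "shO C (- i) X \<in> wge C w 1" by (simp add: shO_wge_iff wge_obj add.commute)
  then show ?thesis using wge0_shift wge_obj[OF X] by (auto simp: wge_iff)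
qed

lemma wle_mono:
  assumes "X \<in> wle C w i" "i \<le> j"
  shows "X \<in> wle C w j"
  using assms(2) by (induction rule: int_ge_induct) (auto intro: wle_step assms(1))

lemma wge_mono:
  assumes "X \<in> wge C w j" "i \<le> j"
  shows "X \<in> wge C w i"
  using assms(2)
proof (induction rule: int_le_induct)
  case (step i)
  then show ?case using wge_step[of X "i - 1"] by simp
qed (fact assms(1))

lemma weight_orthogonal:
  assumes X: "X \<in> wle C w i" and Y: "Y \<in> wge C w j" and ij: "i < j" and f: "f \<in> arr C" "src C f = X" "tgt C f = Y"
  shows "f = pzero C X Y"
proof -
  have o: "X \<in> obj C" "Y \<in> obj C" using X Y by (auto simp: wle_obj wge_obj)
  have "Y \<in> wge C w (i + 1)" using Y by (rule wge_mono) (use ij in simp)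
  then have 1: "shO C (- i) Y \<in> wge C w 1" "shO C (- i) X \<in> wle0 w"
    using X o by (simp_all add: shO_wge_iff wle_iff add.commute)
  have "shA C (- i) f \<in> homs C (shO C (- i) X) (shO C (- i) Y)" using f by (simp add: in_homs)
  then have "shA C (- i) f = pzero C (shO C (- i) X) (shO C (- i) Y)" using orthogonality[OF 1(2,1)] by simp
  then have "shA C (- i) f = shA C (- i) (pzero C X Y)" using o by simp
  then show ?thesis using f o by (subst (asm) shA_eq_iff) simp_all
qed

lemma ex_weight_decomposition:
  assumes M: "M \<in> obj C"
  obtains h r b where "weight_decomposition C w i M h r b"
proof -
  obtain h r b where d: "weight_decomposition C w 0 (shO C (- i) M) h r b"
    using ex_decomposition[of "shO C (- i) M"] M by auto
  then have T: "(h, r, b) \<in> tri C" and h: "src C h \<in> wle C w 0" "tgt C h = shO C (- i) M" "tgt C r \<in> wge C w 1"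
    by (auto simp: weight_decomposition_def)
  note t = triD[OF T]
  have "src C h \<in> wle C w (i - i)" "tgt C r \<in> wge C w (i + 1 - i)" using h by simp_all
  then have o: "shO C i (src C h) \<in> wle C w i" "shO C i (tgt C r) \<in> wge C w (i + 1)" "shO C i (tgt C h) = M"
    using h(2) t M by (simp_all add: shO_wle_iff shO_wge_iff)
  from tri_shift[OF T, of i] show thesis
  proof
    assume "(shA C i h, shA C i r, shA C i b) \<in> tri C"
    then show thesis using that[of "shA C i h" "shA C i r" "shA C i b"] o t by (simp add: weight_decomposition_def)
  next
    assume "(pneg C (shA C i h), pneg C (shA C i r), pneg C (shA C i b)) \<in> tri C"
    then show thesis using that[of "pneg C (shA C i h)" "pneg C (shA C i r)" "pneg C (shA C i b)"] o t
      by (simp add: weight_decomposition_def)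
  qed
qed

lemma weight_decompositionD:
  assumes "weight_decomposition C w i M h r b"
  shows "(h, r, b) \<in> tri C" "src C h \<in> wle C w i" "tgt C h = M" "tgt C r \<in> wge C w (i + 1)"
  using assms by (auto simp: weight_decomposition_def)

lemma retract_shift:
  assumes "retract_of C X Y"
  shows "retract_of C (shO C n X) (shO C n Y)"
proof -
  obtain i p where ip: "i \<in> homs C X Y" "p \<in> homs C Y X" "p \<cdot> i = idt C X" and o: "X \<in> obj C" "Y \<in> obj C"
    using assms by (auto simp: retract_of_def)
  have "shA C n p \<cdot> shA C n i = shA C n (p \<cdot> i)" using ip(1,2) by (simp add: in_homs)
  also have "\<dots> = idt C (shO C n X)" using ip(3) o by simp
  finally show ?thesis using ip(1,2) o unfolding retract_of_def
    by (intro conjI bexI[of _ "shA C n i"] bexI[of _ "shA C n p"]) (simp_all add: in_homs)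
qed

lemma wle_retract: "Y \<in> wle C w i \<Longrightarrow> retract_of C X Y \<Longrightarrow> X \<in> wle C w i"
  using wle0_retract[OF _ retract_shift[of X Y "- i"]] by (simp add: wle_iff) (simp add: retract_of_def)

lemma wge_retract: "Y \<in> wge C w i \<Longrightarrow> retract_of C X Y \<Longrightarrow> X \<in> wge C w i"
  using wge0_retract[OF _ retract_shift[of X Y "- i"]] by (simp add: wge_iff) (simp add: retract_of_def)

text \<open>The arrow \<open>r\<close> of an \<open>i\<close>-weight decomposition of
  \<open>X\<close> is among the tested ones; once it vanishes, \<open>X\<close> is a retract of its
  truncation. Together with orthogonality this describes the class by the arrows leaving it, whence
  its closure under extensions.\<close>

lemma wleI:
  assumes X: "X \<in> obj C"
    and z: "\<And>f. f \<in> arr C \<Longrightarrow> src C f = X \<Longrightarrow> tgt C f \<in> wge C w (i + 1) \<Longrightarrow> f = pzero C X (tgt C f)"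
  shows "X \<in> wle C w i"
proof -
  obtain h r b where d: "weight_decomposition C w i X h r b" by (rule ex_weight_decomposition[OF X])
  note d = weight_decompositionD[OF d]
  note t = triD[OF d(1)]
  have "r = pzero C X (tgt C r)" using z[of r] t d by simp
  then have *: "r \<cdot> idt C X = pzero C X (tgt C r)" using t d(3) by simp
  obtain s where "s \<in> arr C" "src C s = X" "tgt C s = src C h" "h \<cdot> s = idt C X"
    by (rule tri_lift[OF d(1) _ _ _ *]) (use X t d in simp_all)
  then have "retract_of C X (src C h)"
    unfolding retract_of_def using t d(3) X by (intro conjI bexI[of _ s] bexI[of _ h]) (simp_all add: in_homs)
  then show ?thesis using wle_retract[OF d(2)] by blast
qed

text \<open>Dual argument: here the truncation arrow \<open>h\<close> of index \<open>i - 1\<close>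
  vanishes, and \<open>X\<close> becomes a retract of the complement.\<close>

lemma wgeI:
  assumes X: "X \<in> obj C"
    and z: "\<And>f. f \<in> arr C \<Longrightarrow> tgt C f = X \<Longrightarrow> src C f \<in> wle C w (i - 1) \<Longrightarrow> f = pzero C (src C f) X"
  shows "X \<in> wge C w i"
proof -
  obtain h r b where d: "weight_decomposition C w (i - 1) X h r b" by (rule ex_weight_decomposition[OF X])
  note d = weight_decompositionD[OF d]
  note t = triD[OF d(1)]
  have "h = pzero C (src C h) X" using z[of h] t d by simp
  then have *: "idt C X \<cdot> h = pzero C (src C h) X" using t d(3) by simp
  obtain s where "s \<in> arr C" "src C s = tgt C r" "tgt C s = X" "s \<cdot> r = idt C X"
    by (rule tri_extend[OF d(1) _ _ _ *]) (use X t d in simp_all)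
  then have "retract_of C X (tgt C r)"
    unfolding retract_of_def using t d(3) X by (intro conjI bexI[of _ s] bexI[of _ r]) (simp_all add: in_homs)
  then show ?thesis using wge_retract[OF d(4)] by simp
qed

lemma wle_extension:
  assumes T: "(f, g, h) \<in> tri C" and "src C f \<in> wle C w i" "tgt C g \<in> wle C w i"
  shows "tgt C f \<in> wle C w i"
proof (rule wleI)
  note t = triD[OF T]
  show "tgt C f \<in> obj C" using t by simp
  fix x assume x: "x \<in> arr C" "src C x = tgt C f" "tgt C x \<in> wge C w (i + 1)"
  have *: "x \<cdot> f = pzero C (src C f) (tgt C x)"
    by (rule weight_orthogonal[OF assms(2) x(3)]) (use x t in simp_all)
  obtain y where y: "y \<in> arr C" "src C y = tgt C g" "tgt C y = tgt C x" "y \<cdot> g = x"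
    by (rule tri_extend[OF T x(1,2) refl *])
  have "y = pzero C (tgt C g) (tgt C x)" by (rule weight_orthogonal[OF assms(3) x(3)]) (use y in simp_all)
  then show "x = pzero C (tgt C f) (tgt C x)" using y(4) t x by simp
qed

lemma wge_extension:
  assumes T: "(f, g, h) \<in> tri C" and "src C f \<in> wge C w i" "tgt C g \<in> wge C w i"
  shows "tgt C f \<in> wge C w i"
proof (rule wgeI)
  note t = triD[OF T]
  show "tgt C f \<in> obj C" using t by simp
  fix x assume x: "x \<in> arr C" "tgt C x = tgt C f" "src C x \<in> wle C w (i - 1)"
  have x2: "tgt C x = src C g" using x t by simp
  have *: "g \<cdot> x = pzero C (src C x) (tgt C g)"
    by (rule weight_orthogonal[OF x(3) assms(3)]) (use x t in simp_all)
  obtain y where y: "y \<in> arr C" "src C y = src C x" "tgt C y = src C f" "f \<cdot> y = x"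
    by (rule tri_lift[OF T x(1) x2 refl *])
  have "y = pzero C (src C x) (src C f)" by (rule weight_orthogonal[OF x(3) assms(2)]) (use y in simp_all)
  then show "x = pzero C (src C x) (tgt C f)" using y(4) t x by simp
qed

end

context triangulated_category
begin

lemma is_iso_idt: "X \<in> obj C \<Longrightarrow> is_iso C (idt C X)"
  by (rule is_isoI[of _ "idt C X" X X]) simp_all

lemma is_iso_pneg_idt: "X \<in> obj C \<Longrightarrow> is_iso C (pneg C (idt C X))"
  by (rule is_isoI[of _ "pneg C (idt C X)" X X]) simp_all

lemma tri_neg12:
  assumes T: "(f, g, h) \<in> tri C"
  shows "(pneg C f, pneg C g, h) \<in> tri C"
proof -
  note t = triD[OF T]
  show ?thesis
    by (rule tri_iso[OF T _ is_iso_idt[of "src C f"] is_iso_pneg_idt[of "tgt C f"] is_iso_idt[of "tgt C g"]])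
      (use t in \<open>simp_all add: is_triangle_def in_homs\<close>)
qed

lemma tri_neg13:
  assumes T: "(f, g, h) \<in> tri C"
  shows "(pneg C f, g, pneg C h) \<in> tri C"
proof -
  note t = triD[OF T]
  show ?thesis
    by (rule tri_iso[OF T _ is_iso_pneg_idt[of "src C f"] is_iso_idt[of "tgt C f"] is_iso_idt[of "tgt C g"]])
      (use t in \<open>simp_all add: is_triangle_def in_homs\<close>)
qed

text \<open>A special case of the \<open>3 \<times> 3\<close> lemma, obtained by applying the octahedral axiom three times.\<close>

lemma tri_3x3:
  assumes T: "(\<alpha>, \<beta>, \<gamma>) \<in> tri C" and TY: "(y', y, y'') \<in> tri C" and TV: "(v', v, v'') \<in> tri C"
    and Y: "tgt C y' = src C \<alpha>" and V: "tgt C v' = tgt C \<beta>"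
    and orth: "\<And>x. \<lbrakk>x \<in> arr C; src C x = shO C (-1) (src C v'); tgt C x = tgt C y\<rbrakk> \<Longrightarrow> x = pzero C (src C x) (tgt C x)"
  obtains z' z z'' a' b' c' a b c where
    "(a', b', c') \<in> tri C" "(z', z, z'') \<in> tri C" "(a, b, c) \<in> tri C"
    "src C a' = src C y'" "tgt C a' = src C z'" "tgt C b' = src C v'"
    "tgt C z' = tgt C \<alpha>" "src C a = tgt C y" "tgt C a = tgt C z" "tgt C b = tgt C v"
    "z' \<cdot> a' = \<alpha> \<cdot> y'" "v' \<cdot> b' = \<beta> \<cdot> z'" "z \<cdot> \<alpha> = a \<cdot> y" "b \<cdot> z = v \<cdot> \<beta>"
    "z'' \<cdot> a = shA C 1 a' \<cdot> y''" "v'' \<cdot> b = shA C 1 b' \<cdot> z''"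
proof -
  note t = triD[OF T] triD[OF TY] triD[OF TV]
  \<comment> \<open>The octahedra are built around the fibre of the diagonal
    \<open>v \<cdot> \<beta>\<close>, which the triangle on \<open>j\<close> and \<open>p\<close>
    below places between the sources of \<open>\<alpha>\<close> and of \<open>v'\<close>.\<close>
  obtain i k where I: "(i, v \<cdot> \<beta>, k) \<in> tri C" using tri_fiber[of "v \<cdot> \<beta>"] t V by auto
  note ti = triD[OF I]
  have i: "i \<in> arr C" "tgt C i = tgt C \<alpha>" "k \<in> arr C" "src C k = tgt C v" "tgt C k = shO C 1 (src C i)"
    using ti t V by simp_all
  \<comment> \<open>Octahedron for \<open>\<beta>\<close> followed by \<open>v\<close>, taken on
    rotated triangles; \<open>u\<close> and \<open>w\<close> are therefore shifts of the arrows
    \<open>j\<close> and \<open>p\<close> that are wanted.\<close>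
  obtain u w where W: "(u, w, shA C 1 \<gamma> \<cdot> pneg C (shA C 1 v')) \<in> tri C"
    and u: "u \<in> homs C (tgt C \<gamma>) (tgt C k)" and w: "w \<in> homs C (tgt C k) (tgt C v'')"
    and e1: "u \<cdot> \<gamma> = k \<cdot> v" "pneg C (shA C 1 i) \<cdot> u = pneg C (shA C 1 \<alpha>)" "w \<cdot> k = v''"
      "pneg C (shA C 1 v') \<cdot> w = shA C 1 \<beta> \<cdot> pneg C (shA C 1 i)"
    using tri_octahedron[OF tri_rot[OF T] tri_rot[OF TV] _ tri_rot[OF I]] t V by auto
  define j where "j = shA C (-1) u"
  define p where "p = shA C (-1) w"
  have j: "j \<in> arr C" "src C j = src C \<alpha>" "tgt C j = src C i" and uj: "u = shA C 1 j"
    using u i t by (simp_all add: j_def in_homs)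
  have p: "p \<in> arr C" "src C p = src C i" "tgt C p = src C v'" and wp: "w = shA C 1 p"
    using w i t by (simp_all add: p_def in_homs)
  have ij: "i \<cdot> j = \<alpha>"
  proof -
    have "shA C 1 (i \<cdot> j) = shA C 1 \<alpha>" using e1(2) i j t by (simp add: uj)
    then show ?thesis using i j t by (subst (asm) shA_eq_iff) simp_all
  qed
  have vp: "v' \<cdot> p = \<beta> \<cdot> i"
  proof -
    have "shA C 1 (v' \<cdot> p) = shA C 1 (\<beta> \<cdot> i)" using e1(4) i p t V by (simp add: wp)
    then show ?thesis using i p t V by (subst (asm) shA_eq_iff) simp_all
  qed
  have "(pneg C j, pneg C p, \<gamma> \<cdot> v') \<in> tri C"
    using tri_unshift1[OF W] j p t V by (simp add: uj wp)
  from tri_neg12[OF this] have J: "(j, p, \<gamma> \<cdot> v') \<in> tri C" using j p by simp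
  \<comment> \<open>The obstruction to extending \<open>y\<close> along \<open>j\<close> starts at
    the desuspended source of \<open>v'\<close>, so \<open>orth\<close> kills it. The fibre
    \<open>z1\<close> of the extension \<open>\<rho>\<close>, followed by \<open>i\<close>, is the
    middle column's first arrow.\<close>
  have "y \<cdot> pneg C (shA C (-1) (\<gamma> \<cdot> v')) = pzero C (shO C (-1) (src C v')) (tgt C y)"
    using orth[of "y \<cdot> pneg C (shA C (-1) (\<gamma> \<cdot> v'))"] t V Y by simp
  then obtain \<rho> where \<rho>: "\<rho> \<in> arr C" "src C \<rho> = tgt C j" "tgt C \<rho> = tgt C y" "\<rho> \<cdot> j = y"
    using tri_extend[OF tri_unrot[OF J], of y "tgt C y"] t V Y by auto
  obtain z1 z2 where Z: "(z1, \<rho>, z2) \<in> tri C" using tri_fiber[OF \<rho>(1)] by blast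
  note tz = triD[OF Z]
  have TY': "(\<rho> \<cdot> j, y'', pneg C (shA C 1 y')) \<in> tri C" unfolding \<rho>(4) by (rule tri_rot[OF TY])
  \<comment> \<open>Octahedron for \<open>\<rho> \<cdot> j = y\<close>: it yields the triangle on
    the sources of \<open>y'\<close>, \<open>z'\<close> and \<open>v'\<close>.\<close>
  obtain u2 v2 where W2: "(u2, v2, shA C 1 p \<cdot> pneg C (shA C 1 z1)) \<in> tri C"
    and u2: "u2 \<in> homs C (tgt C p) (tgt C y'')" and v2: "v2 \<in> homs C (tgt C y'') (tgt C z2)"
    and e2: "v2 \<cdot> y'' = z2" "pneg C (shA C 1 z1) \<cdot> v2 = shA C 1 j \<cdot> pneg C (shA C 1 y')"
    using tri_octahedron[OF J tri_rot[OF Z] _ TY'] \<rho> by metis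
  define a' where "a' = shA C (-1) v2"
  have a': "a' \<in> arr C" "src C a' = src C y'" "tgt C a' = src C z1" and va: "v2 = shA C 1 a'"
    using v2 tz t by (simp_all add: a'_def in_homs)
  have u2': "u2 \<in> arr C" "src C u2 = src C v'" "tgt C u2 = shO C 1 (src C y')"
    using u2 p t by (simp_all add: in_homs)
  have z1a: "z1 \<cdot> a' = j \<cdot> y'"
  proof -
    have "shA C 1 (z1 \<cdot> a') = shA C 1 (j \<cdot> y')" using e2(2) tz a' j t Y by (simp add: va)
    then show ?thesis using tz a' j t Y by (subst (asm) shA_eq_iff) simp_all
  qed
  have sz: "src C p = tgt C z1" using p tz \<rho> j by simp
  have "(pneg C a', p \<cdot> z1, u2) \<in> tri C"
    using tri_unshift1[OF tri_rot[OF W2]] a' p tz u2' sz by (simp add: va)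
  from tri_neg13[OF this] have A: "(a', p \<cdot> z1, pneg C u2) \<in> tri C" using a' by simp
  have iz: "src C i = tgt C z1" using sz p by simp
  obtain z z'' where Z': "(i \<cdot> z1, z, z'') \<in> tri C" using tri_cone[of "i \<cdot> z1"] iz i tz by auto
  note tz' = triD[OF Z']
  \<comment> \<open>Octahedron for \<open>i \<cdot> z1\<close>: it yields the triangle on the
    targets of \<open>y\<close>, \<open>z\<close> and \<open>v\<close>.\<close>
  obtain a b where W3: "(a, b, shA C 1 \<rho> \<cdot> k) \<in> tri C"
    and a: "a \<in> homs C (tgt C \<rho>) (tgt C z)" and b: "b \<in> homs C (tgt C z) (tgt C (v \<cdot> \<beta>))"
    and e3: "a \<cdot> \<rho> = z \<cdot> i" "z'' \<cdot> a = z2" "b \<cdot> z = v \<cdot> \<beta>" "k \<cdot> b = shA C 1 z1 \<cdot> z''"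
    using tri_octahedron[OF Z I _ Z'] iz by metis
  have ab: "a \<in> arr C" "src C a = tgt C y" "tgt C a = tgt C z" "b \<in> arr C" "src C b = tgt C z" "tgt C b = tgt C v"
    using a b \<rho> t V by (simp_all add: in_homs)
  have zz: "z \<in> arr C" "z'' \<in> arr C" "src C z = tgt C \<alpha>" "src C z'' = tgt C z" "tgt C z'' = shO C 1 (src C z1)"
    using tz' iz i tz by simp_all
  show thesis
  proof (rule that[OF A Z' W3])
    show "i \<cdot> z1 \<cdot> a' = \<alpha> \<cdot> y'"
    proof -
      have "i \<cdot> z1 \<cdot> a' = i \<cdot> (j \<cdot> y')" unfolding z1a[symmetric] using i iz tz a' by simp
      also have "\<dots> = \<alpha> \<cdot> y'" by (rule cmp_reassoc[OF ij]) (use i j t Y in simp_all)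
      finally show ?thesis .
    qed
    show "v' \<cdot> (p \<cdot> z1) = \<beta> \<cdot> (i \<cdot> z1)"
    proof -
      have "v' \<cdot> (p \<cdot> z1) = \<beta> \<cdot> i \<cdot> z1" by (rule cmp_reassoc[OF vp]) (use p sz tz t in simp_all)
      then show ?thesis using i iz tz t by simp
    qed
    show "z \<cdot> \<alpha> = a \<cdot> y"
    proof -
      have "z \<cdot> \<alpha> = z \<cdot> i \<cdot> j" unfolding ij[symmetric] using zz i j by simp
      also have "\<dots> = a \<cdot> \<rho> \<cdot> j" unfolding e3(1) ..
      also have "\<dots> = a \<cdot> y" unfolding \<rho>(4)[symmetric] using ab(1-3) \<rho>(1-3) j by simp
      finally show ?thesis .
    qed
    show "b \<cdot> z = v \<cdot> \<beta>" by fact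
    show "z'' \<cdot> a = shA C 1 a' \<cdot> y''" using e3(2) e2(1) va by simp
    show "v'' \<cdot> b = shA C 1 (p \<cdot> z1) \<cdot> z''"
    proof -
      have "v'' \<cdot> b = w \<cdot> (k \<cdot> b)" unfolding e1(3)[symmetric] using w i ab by (simp add: in_homs)
      also have "\<dots> = shA C 1 p \<cdot> (shA C 1 z1 \<cdot> z'')" unfolding e3(4) wp ..
      also have "\<dots> = shA C 1 (p \<cdot> z1) \<cdot> z''" using p sz tz zz by simp
      finally show ?thesis .
    qed
  qed (use i iz tz a' p sz ab in simp_all)
qed

end

section \<open>Weight Postnikov towers\<close>

context weight_structure
begin

text \<open>The obstruction \<open>r \<cdot> x\<close> goes from weight at most \<open>i\<close> to
  weight at least \<open>j + 1\<close>, so \<open>i \<le> j\<close> is enough for existence.\<close>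

lemma weight_lift:
  assumes d: "weight_decomposition C w j M h r b" and K: "K \<in> wle C w i" and ij: "i \<le> j"
    and x: "x \<in> arr C" "src C x = K" "tgt C x = M"
  obtains y where "y \<in> arr C" "src C y = K" "tgt C y = src C h" "h \<cdot> y = x"
proof -
  note d = weight_decompositionD[OF d]
  note t = triD[OF d(1)]
  have z: "r \<cdot> x = pzero C K (tgt C r)"
    by (rule weight_orthogonal[OF K d(4)]) (use x t d(3) ij in simp_all)
  show thesis by (rule tri_lift[OF d(1) _ _ _ z]) (use x t d(3) that in simp_all)
qed

text \<open>Two lifts differ by an arrow through the desuspended complement. This lies in weights at
  least \<open>j\<close>, one less than the complement, hence the strict inequality. Squares
  involving \<open>tj\<close> commute by this uniqueness, as \<open>tj\<close> raises the index by
  one.\<close>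

lemma weight_lift_unique:
  assumes d: "weight_decomposition C w j M h r b" and K: "K \<in> wle C w i" and ij: "i < j"
    and x: "x \<in> arr C" "src C x = K" "tgt C x = src C h" and y: "y \<in> arr C" "src C y = K" "tgt C y = src C h"
    and eq: "h \<cdot> x = h \<cdot> y"
  shows "x = y"
proof -
  note d = weight_decompositionD[OF d]
  note t = triD[OF d(1)]
  have Ko: "K \<in> obj C" using K by (rule wle_obj)
  have z: "h \<cdot> (x \<boxminus> y) = pzero C K (tgt C h)" using x y t eq by simp
  obtain v where v: "v \<in> arr C" "src C v = K" "tgt C v = shO C (-1) (tgt C r)" "shA C (-1) b \<cdot> v = x \<boxminus> y"
    by (rule tri_lift0[OF d(1) _ _ _ z]) (use x y in simp_all)
  have "shO C (-1) (tgt C r) \<in> wge C w j" using d(4) t by (simp add: shO_wge_iff)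
  then have "v = pzero C K (shO C (-1) (tgt C r))" by (rule weight_orthogonal[OF K _ ij]) (use v in simp_all)
  then have "x \<boxminus> y = pzero C K (src C h)" using v(4) t Ko by simp
  then show ?thesis using x y by (subst (asm) pdiff_eq_pzero_iff) simp_all
qed

lemma weight_towerD:
  assumes "weight_tower C w M T"
  shows "weight_decomposition C w i M (th T i) (tr T i) (tb T i)"
    "tj T i \<in> arr C" "src C (tj T i) = src C (th T i)" "tgt C (tj T i) = src C (th T (i + 1))"
    "th T (i + 1) \<cdot> tj T i = th T i"
    "(tj T (i - 1), tc T i, te T (i - 1)) \<in> tri C"
  using assms by (auto simp: weight_tower_def in_homs)

lemma weight_towerD_th:
  assumes "weight_tower C w M T"
  shows "th T i \<in> arr C" "src C (th T i) \<in> wle C w i" "tgt C (th T i) = M" "src C (th T i) \<in> obj C" "M \<in> obj C"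
proof -
  note d = weight_decompositionD[OF weight_towerD(1)[OF assms, of i]]
  note t = triD[OF d(1)]
  show "th T i \<in> arr C" "src C (th T i) \<in> wle C w i" "tgt C (th T i) = M" "src C (th T i) \<in> obj C" "M \<in> obj C"
    using d t src_obj[OF t(1)] tgt_obj[OF t(1)] by simp_all
qed

lemma weight_towerD_tc:
  assumes "weight_tower C w M T"
  shows "tc T i \<in> arr C" "src C (tc T i) = src C (th T i)" "te T i \<in> arr C" "src C (te T i) = tgt C (tc T (i + 1))"
    "tgt C (te T i) = shO C 1 (src C (th T i))" "tgt C (tc T i) \<in> obj C"
  using triD[OF weight_towerD(6)[OF assms, of i]] triD[OF weight_towerD(6)[OF assms, of "i + 1"]]
    weight_towerD[OF assms, of i] weight_towerD[OF assms, of "i - 1"]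
  by simp_all

text \<open>The upper bound is closure under extensions. For the lower one an arrow \<open>x\<close>
  from weight at most \<open>i - 1\<close> is tested: its image in the shifted truncation dies in
  the shift of \<open>M\<close>, so it comes from the complement of weight at least \<open>i\<close>
  and vanishes by orthogonality. Hence \<open>x\<close> lifts to the \<open>i\<close>-th truncation,
  and by uniqueness of lifts even to the one of index \<open>i - 1\<close>, whose image
  \<open>tc T i\<close> kills.\<close>

lemma weight_tower_term:
  assumes T: "weight_tower C w M T"
  shows "tgt C (tc T i) \<in> wle C w i" "tgt C (tc T i) \<in> wge C w i"
proof -
  note th = weight_towerD_th[OF T] and tc = weight_towerD_tc[OF T] and D = weight_towerD[OF T]
  have t: "(tj T (i - 1), tc T i, te T (i - 1)) \<in> tri C" by (rule D(6))
  note te = tc(3-5)[of "i - 1", simplified]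
  show "tgt C (tc T i) \<in> wle C w i"
    by (rule wle_extension[OF tri_rot[OF t]]) (use tc te th(2)[of i] th(2)[of "i - 1"] th(4) in \<open>simp_all add: shO_wle_iff\<close>)
  show "tgt C (tc T i) \<in> wge C w i"
  proof (rule wgeI)
    show "tgt C (tc T i) \<in> obj C" using tc by simp
    fix x assume x: "x \<in> arr C" "tgt C x = tgt C (tc T i)" "src C x \<in> wle C w (i - 1)"
    define K where "K = src C x"
    have K: "src C x = K" "K \<in> wle C w (i - 1)" "K \<in> obj C" using x by (simp_all add: K_def)
    note d = weight_decompositionD[OF D(1)[of "i - 1"], simplified]
    have hj: "shA C 1 (th T (i - 1)) = shA C 1 (th T i) \<cdot> shA C 1 (tj T (i - 1))"
      using D(5)[of "i - 1"] D(2-4)[of "i - 1"] th(1)[of i] by (simp flip: shA_cmp)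
    have "shA C 1 (th T (i - 1)) \<cdot> (te T (i - 1) \<cdot> x)
        = shA C 1 (th T i) \<cdot> (shA C 1 (tj T (i - 1)) \<cdot> (te T (i - 1) \<cdot> x))"
      unfolding hj using D(2-4)[of "i - 1"] th(1)[of i] te x K by simp
    also have "\<dots> = pzero C K (shO C 1 M)"
      using tri_cmp_zero2[OF t] D(2-4)[of "i - 1"] th(1,3)[of i] te x K by (simp add: cmp_zero_assoc)
    finally have z: "shA C 1 (th T (i - 1)) \<cdot> (te T (i - 1) \<cdot> x) = pzero C K (shO C 1 (tgt C (th T (i - 1))))"
      using th by simp
    obtain v where v: "v \<in> arr C" "src C v = K" "tgt C v = src C (tb T (i - 1))" "tb T (i - 1) \<cdot> v = te T (i - 1) \<cdot> x"
      by (rule tri_lift2[OF d(1) _ _ _ z]) (use x te K in simp_all)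
    have "src C (tb T (i - 1)) \<in> wge C w i" using d(4) triD[OF d(1)] by simp
    then have "v = pzero C K (src C (tb T (i - 1)))"
      by (rule weight_orthogonal[OF K(2)]) (use v in simp_all)
    then have z2: "te T (i - 1) \<cdot> x = pzero C K (tgt C (te T (i - 1)))"
      using v(4) triD[OF d(1)] te K by simp
    obtain y where y: "y \<in> arr C" "src C y = K" "tgt C y = src C (tc T i)" "tc T i \<cdot> y = x"
      by (rule tri_lift1[OF t _ _ _ z2]) (use x te K in simp_all)
    have y2: "tgt C y = src C (th T i)" using y tc by simp
    obtain y' where y': "y' \<in> arr C" "src C y' = K" "tgt C y' = src C (th T (i - 1))" "th T (i - 1) \<cdot> y' = th T i \<cdot> y"
      by (rule weight_lift[OF D(1)[of "i - 1"] K(2) order_refl, of "th T i \<cdot> y"]) (use y y2 th in auto)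
    have "th T i \<cdot> y = th T i \<cdot> (tj T (i - 1) \<cdot> y')"
      using y'(1-3) D(2-4)[of "i - 1"] th(1)[of i] cmp_reassoc[OF D(5)[of "i - 1"], of y'] y'(4) by simp
    then have "y = tj T (i - 1) \<cdot> y'"
      by (rule weight_lift_unique[OF D(1)[of i] K(2), rotated -1])
        (use y y2 y'(1-3) D(2-4)[of "i - 1"] in simp_all)
    then show "x = pzero C (src C x) (tgt C (tc T i))"
      using y(4) tri_cmp_zero[OF t] y'(1-3) D(2-4)[of "i - 1"] tc K by (simp add: cmp_zero_assoc)
  qed
qed

lemma tower_morphismD:
  assumes "tower_morphism C S T g a b"
  shows "a i \<in> arr C" "src C (a i) = src C (th S i)" "tgt C (a i) = src C (th T i)"
    "b i \<in> arr C" "src C (b i) = tgt C (tc S i)" "tgt C (b i) = tgt C (tc T i)"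
    "th T i \<cdot> a i = g \<cdot> th S i" "tj T i \<cdot> a i = a (i + 1) \<cdot> tj S i" "tc T i \<cdot> a i = b i \<cdot> tc S i"
    "te T (i - 1) \<cdot> b i = shA C 1 (a (i - 1)) \<cdot> te S (i - 1)"
  using assms by (auto simp: tower_morphism_def in_homs)

text \<open>The horseshoe construction produces only a few levels of a tower; the others are filled
  in by arbitrary choices. With \<open>I\<close> and \<open>J\<close> empty this is the existence of
  towers. An index in \<open>J\<close> belongs to a connecting arrow, whose cone carries the next
  index, hence \<open>c (i + 1)\<close>.\<close>

lemma ex_weight_tower_extending:
  assumes M: "M \<in> obj C"
    and I: "\<And>i. i \<in> I \<Longrightarrow> weight_decomposition C w i M (h i) (r i) (b i)"
    and J: "\<And>i. i \<in> J \<Longrightarrow> i \<in> I \<and> i + 1 \<in> I \<and> j i \<in> homs C (src C (h i)) (src C (h (i + 1))) \<and>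
      h (i + 1) \<cdot> j i = h i \<and> (j i, c (i + 1), e i) \<in> tri C"
  obtains T where "weight_tower C w M T" "\<forall>i\<in>I. th T i = h i" "\<forall>i\<in>J. tc T (i + 1) = c (i + 1) \<and> te T i = e i"
proof -
  have "\<exists>d. weight_decomposition C w i M (fst d) (fst (snd d)) (snd (snd d)) \<and> (i \<in> I \<longrightarrow> fst d = h i)" for i
  proof (cases "i \<in> I")
    case True
    then show ?thesis using I[of i] by (intro exI[of _ "(h i, r i, b i)"]) simp
  next
    case False
    then show ?thesis using ex_weight_decomposition[OF M, of i] by (metis fst_conv snd_conv)
  qed
  then obtain d where d: "\<And>i. weight_decomposition C w i M (fst (d i)) (fst (snd (d i))) (snd (snd (d i)))"
    "\<And>i. i \<in> I \<Longrightarrow> fst (d i) = h i" by metis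
  have "\<exists>x. x \<in> homs C (src C (fst (d i))) (src C (fst (d (i + 1)))) \<and> fst (d (i + 1)) \<cdot> x = fst (d i)
    \<and> (i \<in> J \<longrightarrow> x = j i)" for i
  proof (cases "i \<in> J")
    case True
    then show ?thesis using J[OF True] d(2) by auto
  next
    case False
    note di = weight_decompositionD[OF d(1)[of i]]
    obtain y where "y \<in> arr C" "src C y = src C (fst (d i))" "tgt C y = src C (fst (d (i + 1)))"
      "fst (d (i + 1)) \<cdot> y = fst (d i)"
      by (rule weight_lift[OF d(1)[of "i + 1"] di(2), of "fst (d i)"]) (use di triD[OF di(1)] in auto)
    then show ?thesis using False by (auto simp: in_homs)
  qed
  then obtain x where x: "\<And>i. x i \<in> homs C (src C (fst (d i))) (src C (fst (d (i + 1))))"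
    "\<And>i. fst (d (i + 1)) \<cdot> x i = fst (d i)" "\<And>i. i \<in> J \<Longrightarrow> x i = j i" by metis
  have "\<exists>y. (x i, fst y, snd y) \<in> tri C \<and> (i \<in> J \<longrightarrow> y = (c (i + 1), e i))" for i
  proof (cases "i \<in> J")
    case True
    then show ?thesis using J[OF True] x(3)[OF True] by auto
  next
    case False
    then show ?thesis using tri_cone[of "x i"] x(1)[of i] by (auto simp: in_homs)
  qed
  then obtain y where y: "\<And>i. (x i, fst (y i), snd (y i)) \<in> tri C" "\<And>i. i \<in> J \<Longrightarrow> y i = (c (i + 1), e i)" by metis
  define T where "T = \<lparr>th = \<lambda>i. fst (d i), tr = \<lambda>i. fst (snd (d i)), tb = \<lambda>i. snd (snd (d i)), tj = x,
    tc = \<lambda>i. fst (y (i - 1)), te = \<lambda>i. snd (y i)\<rparr>"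
  show thesis
  proof (rule that[of T])
    show "weight_tower C w M T" using d(1) x(1,2) y(1) by (simp add: weight_tower_def T_def)
  qed (use d(2) y(2) in \<open>auto simp: T_def\<close>)
qed

text \<open>Again only some levels are prescribed by the horseshoe. Truncation maps exist because
  \<open>g \<cdot> th S i\<close> lifts, they commute with \<open>tj\<close> by uniqueness of lifts
  from index \<open>i\<close> to \<open>i + 1\<close>, and the maps of cones come from the morphism
  axiom.\<close>

lemma ex_tower_morphism_extending:
  assumes S: "weight_tower C w M S" and T: "weight_tower C w N T" and g: "g \<in> arr C" "src C g = M" "tgt C g = N"
    and I: "\<And>i. i \<in> I \<Longrightarrow> a0 i \<in> homs C (src C (th S i)) (src C (th T i)) \<and> th T i \<cdot> a0 i = g \<cdot> th S i"
    and J: "\<And>i. i \<in> J \<Longrightarrow> i \<in> I \<and> i - 1 \<in> I \<and> b0 i \<in> homs C (tgt C (tc S i)) (tgt C (tc T i)) \<and>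
      tc T i \<cdot> a0 i = b0 i \<cdot> tc S i \<and> te T (i - 1) \<cdot> b0 i = shA C 1 (a0 (i - 1)) \<cdot> te S (i - 1)"
  obtains a b where "tower_morphism C S T g a b" "\<forall>i\<in>J. b i = b0 i"
proof -
  note thS = weight_towerD_th[OF S] and tcS = weight_towerD_tc[OF S] and DS = weight_towerD[OF S]
  note thT = weight_towerD_th[OF T] and tcT = weight_towerD_tc[OF T] and DT = weight_towerD[OF T]
  have "\<exists>x. x \<in> homs C (src C (th S i)) (src C (th T i)) \<and> th T i \<cdot> x = g \<cdot> th S i \<and> (i \<in> I \<longrightarrow> x = a0 i)" for i
  proof (cases "i \<in> I")
    case False
    obtain y where "y \<in> arr C" "src C y = src C (th S i)" "tgt C y = src C (th T i)" "th T i \<cdot> y = g \<cdot> th S i"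
      by (rule weight_lift[OF DT(1)[of i] thS(2)[of i] order_refl, of "g \<cdot> th S i"]) (use g thS in auto)
    then show ?thesis using False by (auto simp: in_homs)
  qed (use I in auto)
  then obtain a where a': "\<And>i. a i \<in> homs C (src C (th S i)) (src C (th T i))"
    "\<And>i. th T i \<cdot> a i = g \<cdot> th S i" "\<And>i. i \<in> I \<Longrightarrow> a i = a0 i" by metis
  have a: "a i \<in> arr C" "src C (a i) = src C (th S i)" "tgt C (a i) = src C (th T i)" for i
    using a'(1) by (simp_all add: in_homs)
  have j: "tj T i \<cdot> a i = a (i + 1) \<cdot> tj S i" for i
  proof (rule weight_lift_unique[OF DT(1)[of "i + 1"] thS(2)[of i]])
    have "th T (i + 1) \<cdot> (tj T i \<cdot> a i) = g \<cdot> th S i"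
      using cmp_reassoc[OF DT(5)[of i], of "a i"] DT(2-4)[of i] a thT a'(2) by simp
    also have "\<dots> = g \<cdot> th S (i + 1) \<cdot> tj S i" unfolding DS(5)[of i, symmetric] using DS(2-4)[of i] thS g by simp
    also have "\<dots> = th T (i + 1) \<cdot> (a (i + 1) \<cdot> tj S i)"
      unfolding a'(2)[of "i + 1", symmetric] using DS(2-4)[of i] a thT by simp
    finally show "th T (i + 1) \<cdot> (tj T i \<cdot> a i) = th T (i + 1) \<cdot> (a (i + 1) \<cdot> tj S i)" .
  qed (use DT(2-4)[of i] DS(2-4)[of i] a in simp_all)
  have "\<exists>x. x \<in> homs C (tgt C (tc S i)) (tgt C (tc T i)) \<and> tc T i \<cdot> a i = x \<cdot> tc S i \<and>
    te T (i - 1) \<cdot> x = shA C 1 (a (i - 1)) \<cdot> te S (i - 1) \<and> (i \<in> J \<longrightarrow> x = b0 i)" for i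
  proof (cases "i \<in> J")
    case True
    then show ?thesis using J[OF True] a'(3)[of i] a'(3)[of "i - 1"] by auto
  next
    case False
    have tS: "src C (te S (i - 1)) = tgt C (tc S i)" "src C (te T (i - 1)) = tgt C (tc T i)"
      using tcS(4)[of "i - 1"] tcT(4)[of "i - 1"] by simp_all
    have "\<exists>w\<in>homs C (src C (te S (i - 1))) (src C (te T (i - 1))).
       w \<cdot> tc S i = tc T i \<cdot> a i \<and> shA C 1 (a (i - 1)) \<cdot> te S (i - 1) = te T (i - 1) \<cdot> w"
    proof (rule tri_morphism[OF DS(6)[of i] DT(6)[of i]])
      show "a (i - 1) \<in> homs C (src C (tj S (i - 1))) (src C (tj T (i - 1)))"
        using a DS(2-4)[of "i - 1"] DT(2-4)[of "i - 1"] by (simp add: in_homs)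
      show "a i \<in> homs C (src C (tc S i)) (src C (tc T i))" using a tcS tcT by (simp add: in_homs)
      show "a i \<cdot> tj S (i - 1) = tj T (i - 1) \<cdot> a (i - 1)" using j[of "i - 1"] by simp
    qed
    then show ?thesis using False unfolding tS by metis
  qed
  then obtain b where b: "\<And>i. b i \<in> homs C (tgt C (tc S i)) (tgt C (tc T i))"
    "\<And>i. tc T i \<cdot> a i = b i \<cdot> tc S i" "\<And>i. te T (i - 1) \<cdot> b i = shA C 1 (a (i - 1)) \<cdot> te S (i - 1)"
    "\<And>i. i \<in> J \<Longrightarrow> b i = b0 i" by metis
  show thesis
    by (rule that[of a b]) (use a'(1,2) j b in \<open>auto simp: tower_morphism_def\<close>)
qed

lemma ex_tower_choice: "\<exists>T. tower_choice C w T"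
proof -
  have "\<exists>T. weight_tower C w M T" if "M \<in> obj C" for M
    by (rule ex_weight_tower_extending[OF that, of "{}" _ _ _ "{}"]) auto
  then show ?thesis unfolding tower_choice_def by metis
qed

lemma ex_tower_morphism:
  assumes "weight_tower C w M S" "weight_tower C w N T" "g \<in> arr C" "src C g = M" "tgt C g = N"
  obtains a b where "tower_morphism C S T g a b"
  by (rule ex_tower_morphism_extending[OF assms, of "{}" _ "{}"]) (use that in auto)

lemma tower_morphism_idt:
  assumes T: "weight_tower C w M T"
  shows "tower_morphism C T T (idt C M) (\<lambda>i. idt C (src C (th T i))) (\<lambda>i. idt C (tgt C (tc T i)))"
proof -
  note th = weight_towerD_th[OF T] and tc = weight_towerD_tc[OF T] and D = weight_towerD[OF T]
  show ?thesis unfolding tower_morphism_def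
    using th tc D(2-4) tc(3-5)[of "_ - 1", simplified] by (simp add: in_homs)
qed

lemma tower_morphism_cmp:
  assumes S: "weight_tower C w M S" and T: "weight_tower C w N T" and U: "weight_tower C w P U"
    and f: "f \<in> arr C" "src C f = M" "tgt C f = N" and g: "g \<in> arr C" "src C g = N" "tgt C g = P"
    and ab: "tower_morphism C S T f a b" and ab': "tower_morphism C T U g a' b'"
  shows "tower_morphism C S U (g \<cdot> f) (\<lambda>i. a' i \<cdot> a i) (\<lambda>i. b' i \<cdot> b i)"
  unfolding tower_morphism_def
proof (intro allI conjI)
  fix i
  note S' = weight_towerD_th(1-4)[OF S] weight_towerD_tc[OF S] weight_towerD(2-4)[OF S] weight_towerD_tc(3-5)[OF S, of "i - 1", simplified]
  note T' = weight_towerD_th(1-4)[OF T] weight_towerD_tc[OF T] weight_towerD(2-4)[OF T] weight_towerD_tc(3-5)[OF T, of "i - 1", simplified]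
  note U' = weight_towerD_th(1-4)[OF U] weight_towerD_tc[OF U] weight_towerD(2-4)[OF U] weight_towerD_tc(3-5)[OF U, of "i - 1", simplified]
  note m = tower_morphismD(1-6)[OF ab] tower_morphismD(1-6)[OF ab']
  note e = tower_morphismD(7-10)[OF ab] note e' = tower_morphismD(7-10)[OF ab']
  show "a' i \<cdot> a i \<in> homs C (src C (th S i)) (src C (th U i))" "b' i \<cdot> b i \<in> homs C (tgt C (tc S i)) (tgt C (tc U i))"
    using m by (simp_all add: in_homs)
  have "th U i \<cdot> (a' i \<cdot> a i) = g \<cdot> th T i \<cdot> a i"
    by (rule cmp_reassoc[OF e'(1)]) (use m U' in simp_all)
  then show "th U i \<cdot> (a' i \<cdot> a i) = g \<cdot> f \<cdot> th S i" using m S' T' f g e(1)[of i] by simp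
  have "tj U i \<cdot> (a' i \<cdot> a i) = a' (i + 1) \<cdot> tj T i \<cdot> a i"
    by (rule cmp_reassoc[OF e'(2)]) (use m U' in simp_all)
  then show "tj U i \<cdot> (a' i \<cdot> a i) = a' (i + 1) \<cdot> a (i + 1) \<cdot> tj S i" using m S' T' e(2)[of i] by simp
  have "tc U i \<cdot> (a' i \<cdot> a i) = b' i \<cdot> tc T i \<cdot> a i"
    by (rule cmp_reassoc[OF e'(3)]) (use m U' in simp_all)
  then show "tc U i \<cdot> (a' i \<cdot> a i) = b' i \<cdot> b i \<cdot> tc S i" using m S' T' e(3)[of i] by simp
  have "te U (i - 1) \<cdot> (b' i \<cdot> b i) = shA C 1 (a' (i - 1)) \<cdot> te T (i - 1) \<cdot> b i"
    by (rule cmp_reassoc[OF e'(4)]) (use m U' in simp_all)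
  then show "te U (i - 1) \<cdot> (b' i \<cdot> b i) = shA C 1 (a' (i - 1) \<cdot> a (i - 1)) \<cdot> te S (i - 1)"
    using m S' T' e(4)[of i] by simp
qed

lemma tower_morphism_padd:
  assumes S: "weight_tower C w M S" and T: "weight_tower C w N T"
    and f: "f \<in> arr C" "src C f = M" "tgt C f = N" and g: "g \<in> arr C" "src C g = M" "tgt C g = N"
    and ab: "tower_morphism C S T f a b" and ab': "tower_morphism C S T g a' b'"
  shows "tower_morphism C S T (f \<boxplus> g) (\<lambda>i. a i \<boxplus> a' i) (\<lambda>i. b i \<boxplus> b' i)"
  unfolding tower_morphism_def
proof (intro allI conjI)
  fix i
  note S' = weight_towerD_th(1-4)[OF S] weight_towerD_tc[OF S] weight_towerD(2-4)[OF S] weight_towerD_tc(3-5)[OF S, of "i - 1", simplified]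
  note T' = weight_towerD_th(1-4)[OF T] weight_towerD_tc[OF T] weight_towerD(2-4)[OF T] weight_towerD_tc(3-5)[OF T, of "i - 1", simplified]
  note m = tower_morphismD(1-6)[OF ab] tower_morphismD(1-6)[OF ab']
  note e = tower_morphismD(7-10)[OF ab] tower_morphismD(7-10)[OF ab']
  show "a i \<boxplus> a' i \<in> homs C (src C (th S i)) (src C (th T i))" "b i \<boxplus> b' i \<in> homs C (tgt C (tc S i)) (tgt C (tc T i))"
    using m by (simp_all add: in_homs)
  show "th T i \<cdot> (a i \<boxplus> a' i) = (f \<boxplus> g) \<cdot> th S i" using m S' T' f g e by simp
  show "tj T i \<cdot> (a i \<boxplus> a' i) = (a (i + 1) \<boxplus> a' (i + 1)) \<cdot> tj S i" using m S' T' e by simp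
  show "tc T i \<cdot> (a i \<boxplus> a' i) = (b i \<boxplus> b' i) \<cdot> tc S i" using m S' T' e by simp
  show "te T (i - 1) \<cdot> (b i \<boxplus> b' i) = shA C 1 (a (i - 1) \<boxplus> a' (i - 1)) \<cdot> te S (i - 1)" using m S' T' e by simp
qed

text \<open>Two morphisms over the same arrow differ by one over zero; the two relations kept here
  are those from which a null-homotopy is built.\<close>

lemma tower_morphism_pdiff:
  assumes S: "weight_tower C w M S" and T: "weight_tower C w N T"
    and g: "g \<in> arr C" "src C g = M" "tgt C g = N"
    and ab: "tower_morphism C S T g a b" and ab': "tower_morphism C S T g a' b'"
  shows "th T i \<cdot> (a i \<boxminus> a' i) = pzero C (src C (th S i)) N" "tc T i \<cdot> (a i \<boxminus> a' i) = (b i \<boxminus> b' i) \<cdot> tc S i"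
proof -
  note S' = weight_towerD_th(1-4)[OF S] weight_towerD_tc[OF S]
  note T' = weight_towerD_th(1-4)[OF T] weight_towerD_tc[OF T]
  note m = tower_morphismD(1-6)[OF ab] tower_morphismD(1-6)[OF ab']
  note e = tower_morphismD(7,9)[OF ab] tower_morphismD(7,9)[OF ab']
  show "th T i \<cdot> (a i \<boxminus> a' i) = pzero C (src C (th S i)) N" using m S' T' g e by simp
  show "tc T i \<cdot> (a i \<boxminus> a' i) = (b i \<boxminus> b' i) \<cdot> tc S i" using m S' T' g e by simp
qed

section \<open>Weight complexes and null-homotopies in degree zero\<close>

lemma wc_diff_simps:
  assumes T: "weight_tower C w M T"
  shows "wc_diff C T i \<in> arr C" "src C (wc_diff C T i) = wc_obj C T i" "tgt C (wc_diff C T i) = wc_obj C T (i + 1)"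
    "wc_obj C T i \<in> obj C"
proof -
  note tc = weight_towerD_tc[OF T] and th = weight_towerD_th[OF T]
  have e: "te T (- i - 1) \<in> arr C" "src C (te T (- i - 1)) = tgt C (tc T (- i))"
    "tgt C (te T (- i - 1)) = shO C 1 (src C (th T (- i - 1)))"
    using tc(3-5)[of "- i - 1"] by simp_all
  show "wc_diff C T i \<in> arr C" "src C (wc_diff C T i) = wc_obj C T i" "tgt C (wc_diff C T i) = wc_obj C T (i + 1)"
    "wc_obj C T i \<in> obj C"
    using e tc th by (simp_all add: wc_diff_def wc_obj_def)
qed

lemma wc_obj_weq:
  assumes T: "weight_tower C w M T"
  shows "wc_obj C T i \<in> weq C w 0"
  using weight_tower_term[OF T, of "- i"] weight_towerD_tc(6)[OF T]
  by (simp add: weq_def wc_obj_def shO_wle_iff shO_wge_iff)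

lemma wc_diff_zero:
  assumes T: "weight_tower C w M T"
  shows "wc_diff C T (i + 1) \<cdot> wc_diff C T i = pzero C (wc_obj C T i) (wc_obj C T (i + 2))"
proof -
  note tc = weight_towerD_tc[OF T] and th = weight_towerD_th[OF T]
  \<comment> \<open>In terms of \<open>k\<close> the product of the differentials contains a shift
    of \<open>te T k\<close> applied after \<open>tc T (k + 1)\<close>, two consecutive arrows of
    one triangle.\<close>
  define k where "k = - i - 2"
  have k: "- (i + 1) - 1 = k" "- i - 1 = k + 1" "- i = k + 2" "- (i + 2) = k" by (simp_all add: k_def)
  have "te T k \<cdot> tc T (k + 1) = pzero C (src C (th T (k + 1))) (shO C 1 (src C (th T k)))"
    using tri_cmp_zero1[OF weight_towerD(6)[OF T, of "k + 1"]] tc[of "k + 1"] tc[of k] by simp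
  then have "shA C (i + 1) (te T k) \<cdot> shA C (i + 1) (tc T (k + 1)) = pzero C (shO C (i + 1) (src C (th T (k + 1)))) (shO C (i + 2) (src C (th T k)))"
    using tc[of k] tc[of "k + 1"] th by (simp add: add.commute flip: shA_cmp)
  then have z: "shA C (i + 1) (te T k) \<cdot> (shA C (i + 1) (tc T (k + 1)) \<cdot> x) = pzero C (src C x) (shO C (i + 2) (src C (th T k)))"
    if "x \<in> arr C" "tgt C x = shO C (i + 1) (src C (th T (k + 1)))" for x
    using cmp_zero_assoc[of "shA C (i + 1) (te T k)" "shA C (i + 1) (tc T (k + 1))" x] that tc[of k] tc[of "k + 1"] th by (simp add: add.commute)
  have "wc_diff C T (i + 1) \<cdot> wc_diff C T i = shA C (i + 2) (tc T k) \<cdot>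
      (shA C (i + 1) (te T k) \<cdot> (shA C (i + 1) (tc T (k + 1)) \<cdot> shA C i (te T (k + 1))))"
    unfolding wc_diff_def k using tc[of k] tc[of "k + 1"] th by (simp add: add.commute)
  also have "\<dots> = pzero C (wc_obj C T i) (wc_obj C T (i + 2))"
    using tc[of k] tc[of "k + 1"] tc(6)[of "k + 2"] th unfolding wc_obj_def k by (subst z) (simp_all add: add.commute)
  finally show ?thesis .
qed

lemma wc_diff_zero_left: "wc_diff C T 0 = shA C 1 (tc T (-1)) \<cdot> te T (-1)"
  and wc_diff_minus_one: "wc_diff C T (-1) = tc T 0 \<cdot> shA C (-1) (te T 0)"
  by (simp_all add: wc_diff_def)

lemma tower_morphism_wc_map:
  assumes S: "weight_tower C w M S" and T: "weight_tower C w N T" and ab: "tower_morphism C S T g a b"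
  shows "wc_map C b i \<in> arr C" "src C (wc_map C b i) = wc_obj C S i" "tgt C (wc_map C b i) = wc_obj C T i"
    "wc_diff C T i \<cdot> wc_map C b i = wc_map C b (i + 1) \<cdot> wc_diff C S i"
proof -
  note m = tower_morphismD(1-6)[OF ab]
  show "wc_map C b i \<in> arr C" "src C (wc_map C b i) = wc_obj C S i" "tgt C (wc_map C b i) = wc_obj C T i"
    using m weight_towerD_tc[OF S] weight_towerD_tc[OF T] by (simp_all add: wc_map_def wc_obj_def)
  define k where "k = - i - 1"
  have k: "- i - 1 = k" "- i = k + 1" "- (i + 1) = k" by (simp_all add: k_def)
  note tcS = weight_towerD_tc[OF S] note tcT = weight_towerD_tc[OF T]
  note th = weight_towerD_th[OF S] weight_towerD_th[OF T]
  have e: "te T k \<cdot> b (k + 1) = shA C 1 (a k) \<cdot> te S k" "tc T k \<cdot> a k = b k \<cdot> tc S k"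
    using tower_morphismD(10)[OF ab, of "k + 1"] tower_morphismD(9)[OF ab, of k] by simp_all
  have "wc_diff C T i \<cdot> wc_map C b i = shA C (i + 1) (tc T k) \<cdot> shA C i (te T k \<cdot> b (k + 1))"
    unfolding wc_diff_def wc_map_def k using m tcT[of k] th by (simp add: add.commute)
  also have "\<dots> = shA C (i + 1) (tc T k \<cdot> a k) \<cdot> shA C i (te S k)"
    unfolding e(1) using m tcT[of k] tcS[of k] th by (simp add: add.commute)
  also have "\<dots> = wc_map C b (i + 1) \<cdot> wc_diff C S i"
    unfolding e(2) wc_diff_def wc_map_def k using m tcS[of k] th by (simp add: add.commute)
  finally show "wc_diff C T i \<cdot> wc_map C b i = wc_map C b (i + 1) \<cdot> wc_diff C S i" .
qed

text \<open>Killing \<open>tc S 0\<close> makes \<open>\<beta>\<close> factor through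
  \<open>te S (-1)\<close>, that is, through the shifted truncation of index \<open>-1\<close>.
  Desuspended, this factor has a target of weight at least \<open>-1\<close>, so it vanishes on the
  truncation of index \<open>-2\<close> and descends to the term of index \<open>-1\<close>.\<close>

lemma factor_through_wc_diff:
  assumes S: "weight_tower C w M S"
    and \<beta>: "\<beta> \<in> arr C" "src C \<beta> = tgt C (tc S 0)" "tgt C \<beta> \<in> wge C w 0"
    and z: "\<beta> \<cdot> tc S 0 = pzero C (src C (th S 0)) (tgt C \<beta>)"
  obtains x where "x \<in> arr C" "src C x = wc_obj C S 1" "tgt C x = tgt C \<beta>" "\<beta> = x \<cdot> wc_diff C S 0"
proof -
  note tc = weight_towerD_tc[OF S] and th = weight_towerD_th[OF S] and D = weight_towerD[OF S]
  have t0: "(tj S (-1), tc S 0, te S (-1)) \<in> tri C" "(tj S (-2), tc S (-1), te S (-2)) \<in> tri C"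
    using D(6)[of 0] D(6)[of "-1"] by simp_all
  have z': "\<beta> \<cdot> tc S 0 = pzero C (src C (tc S 0)) (tgt C \<beta>)" using z tc by simp
  obtain x' where x': "x' \<in> arr C" "src C x' = shO C 1 (src C (tj S (-1)))" "tgt C x' = tgt C \<beta>" "x' \<cdot> te S (-1) = \<beta>"
    by (rule tri_extend1[OF t0(1) \<beta>(1,2) refl z'])
  have W: "src C (tj S (-2)) \<in> wle C w (-2)" "shO C (-1) (tgt C \<beta>) \<in> wge C w (-1)"
    using \<beta> D(3)[of "-2"] th(2)[of "-2"] by (simp_all add: shO_wge_iff)
  have j: "tj S (-2) \<in> arr C" "tgt C (tj S (-2)) = src C (th S (-1))" "src C (tj S (-1)) = src C (th S (-1))"
    using D(2,4)[of "-2"] D(3)[of "-1"] by simp_all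
  have z2: "shA C (-1) x' \<cdot> tj S (-2) = pzero C (src C (tj S (-2))) (shO C (-1) (tgt C \<beta>))"
    by (rule weight_orthogonal[OF W]) (use x' j th in simp_all)
  obtain x where x: "x \<in> arr C" "src C x = tgt C (tc S (-1))" "tgt C x = shO C (-1) (tgt C \<beta>)" "x \<cdot> tc S (-1) = shA C (-1) x'"
    by (rule tri_extend[OF t0(2) _ _ _ z2]) (use x' j th in simp_all)
  have tc': "tc S (-1) \<in> arr C" "src C (tc S (-1)) = src C (th S (-1))" "te S (-1) \<in> arr C"
    "tgt C (te S (-1)) = shO C 1 (src C (th S (-1)))" "tgt C (tc S (-1)) \<in> obj C" "src C (te S (-1)) = tgt C (tc S 0)"
    using tc[of "-1"] by simp_all
  have "shA C 1 (x \<cdot> tc S (-1)) = x'" unfolding x(4) using x'(1) by simp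
  then have e: "shA C 1 x \<cdot> shA C 1 (tc S (-1)) = x'" using x(1-3) tc' by simp
  have "shA C 1 x \<cdot> (shA C 1 (tc S (-1)) \<cdot> te S (-1)) = x' \<cdot> te S (-1)"
    by (rule cmp_reassoc[OF e]) (use x(1-3) tc' in simp_all)
  then have "\<beta> = shA C 1 x \<cdot> wc_diff C S 0" unfolding wc_diff_zero_left x'(4) ..
  then show thesis by (rule that[rotated -1]) (use x(1-3) \<beta> tc' in \<open>simp_all add: wc_obj_def wge_obj\<close>)
qed

text \<open>Phrased for a bare pair \<open>\<alpha>\<close>, \<open>\<beta>\<close> in degree zero
  and not for a morphism of towers, so that it also applies to pairs built by hand, such as an
  identity minus a composite.\<close>

lemma null_homotopy:
  assumes S: "weight_tower C w M S" and T: "weight_tower C w N T"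
    and \<alpha>: "\<alpha> \<in> arr C" "src C \<alpha> = src C (th S 0)" "tgt C \<alpha> = src C (th T 0)"
    and \<beta>: "\<beta> \<in> arr C" "src C \<beta> = tgt C (tc S 0)" "tgt C \<beta> = tgt C (tc T 0)"
    and z: "th T 0 \<cdot> \<alpha> = pzero C (src C (th S 0)) N" and \<alpha>\<beta>: "tc T 0 \<cdot> \<alpha> = \<beta> \<cdot> tc S 0"
  obtains x y where "x \<in> arr C" "src C x = wc_obj C S 1" "tgt C x = wc_obj C T 0"
    "y \<in> arr C" "src C y = wc_obj C S 0" "tgt C y = wc_obj C T (-1)"
    "\<beta> = wc_diff C T (-1) \<cdot> y \<boxplus> x \<cdot> wc_diff C S 0"
proof -
  note tcS = weight_towerD_tc[OF S] and thS = weight_towerD_th[OF S] and DS = weight_towerD[OF S]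
  note tcT = weight_towerD_tc[OF T] and thT = weight_towerD_th[OF T] and DT = weight_towerD[OF T]
  have j: "tj T 0 \<in> arr C" "src C (tj T 0) = src C (th T 0)" "tgt C (tj T 0) = src C (th T 1)" "th T 1 \<cdot> tj T 0 = th T 0"
    "(tj T 0, tc T 1, te T 0) \<in> tri C"
    using DT(2-5)[of 0] DT(6)[of 1] by simp_all
  \<comment> \<open>Lifts from weight at most \<open>0\<close> are unique only along
    \<open>th T 1\<close>, not along \<open>th T 0\<close>; so it is
    \<open>tj T 0 \<cdot> \<alpha>\<close> that vanishes, and \<open>\<alpha>\<close> itself factors
    through the desuspended term of index \<open>1\<close>.\<close>
  have "tj T 0 \<cdot> \<alpha> = pzero C (src C (th S 0)) (src C (th T 1))"
  proof (rule weight_lift_unique[OF DT(1)[of 1] thS(2)[of 0]])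
    show "th T 1 \<cdot> (tj T 0 \<cdot> \<alpha>) = th T 1 \<cdot> pzero C (src C (th S 0)) (src C (th T 1))"
      using cmp_reassoc[OF j(4), of \<alpha>] z \<alpha> j(1-3) thT thS by simp
  qed (use j \<alpha> thS thT in simp_all)
  then have z1: "tj T 0 \<cdot> \<alpha> = pzero C (src C (th S 0)) (tgt C (tj T 0))" using j by simp
  obtain \<nu> where \<nu>: "\<nu> \<in> arr C" "src C \<nu> = src C (th S 0)" "tgt C \<nu> = shO C (-1) (tgt C (tc T 1))" "shA C (-1) (te T 0) \<cdot> \<nu> = \<alpha>"
    by (rule tri_lift0[OF j(5) _ _ _ z1]) (use \<alpha> j in simp_all)
  have t0: "(tj S (-1), tc S 0, te S (-1)) \<in> tri C" using DS(6)[of 0] by simp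
  have jS: "tj S (-1) \<in> arr C" "src C (tj S (-1)) = src C (th S (-1))" "tgt C (tj S (-1)) = src C (th S 0)"
    using DS(2-4)[of "-1"] by simp_all
  have W: "src C (tj S (-1)) \<in> wle C w (-1)" "shO C (-1) (tgt C (tc T 1)) \<in> wge C w 0"
    using jS thS(2)[of "-1"] weight_tower_term(2)[OF T, of 1] tcT by (simp_all add: shO_wge_iff)
  have z2: "\<nu> \<cdot> tj S (-1) = pzero C (src C (tj S (-1))) (shO C (-1) (tgt C (tc T 1)))"
    by (rule weight_orthogonal[OF W]) (use \<nu> jS in simp_all)
  \<comment> \<open>The target of \<open>\<nu>\<close> has weight at least \<open>0\<close>, so
    \<open>\<nu>\<close> vanishes on the truncation of index \<open>-1\<close> and extends over the
    zeroth term of \<open>S\<close>.\<close>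
  obtain y where y: "y \<in> arr C" "src C y = tgt C (tc S 0)" "tgt C y = shO C (-1) (tgt C (tc T 1))" "y \<cdot> tc S 0 = \<nu>"
    by (rule tri_extend[OF t0 _ _ _ z2]) (use \<nu> jS in simp_all)
  note d = wc_diff_simps[OF T, of "-1", simplified]
  have o: "wc_obj C S 0 = tgt C (tc S 0)" "wc_obj C T 0 = tgt C (tc T 0)" "wc_obj C T (-1) = shO C (-1) (tgt C (tc T 1))"
    by (simp_all add: wc_obj_def)
  \<comment> \<open>What remains after the removal of \<open>d y\<close> kills
    \<open>tc S 0\<close>, which is the situation of \<open>factor_through_wc_diff\<close>.\<close>
  define \<beta>' where "\<beta>' = \<beta> \<boxminus> wc_diff C T (-1) \<cdot> y"
  have \<beta>': "\<beta>' \<in> arr C" "src C \<beta>' = tgt C (tc S 0)" "tgt C \<beta>' = tgt C (tc T 0)"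
    using \<beta> d y o by (simp_all add: \<beta>'_def)
  have "wc_diff C T (-1) \<cdot> y \<cdot> tc S 0 = tc T 0 \<cdot> (shA C (-1) (te T 0) \<cdot> (y \<cdot> tc S 0))"
    unfolding wc_diff_minus_one using y(1-3) tcS tcT[of 0] thT by simp
  also have "\<dots> = \<beta> \<cdot> tc S 0" unfolding y(4) \<nu>(4) by (rule \<alpha>\<beta>)
  finally have z3: "\<beta>' \<cdot> tc S 0 = pzero C (src C (th S 0)) (tgt C \<beta>')"
    using \<beta> d y(1-3) o tcS tcT by (simp add: \<beta>'_def)
  obtain x where x: "x \<in> arr C" "src C x = wc_obj C S 1" "tgt C x = tgt C \<beta>'" "\<beta>' = x \<cdot> wc_diff C S 0"
    by (rule factor_through_wc_diff[OF S _ _ _ z3]) (use \<beta>' weight_tower_term(2)[OF T, of 0] in simp_all)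
  have "\<beta> = wc_diff C T (-1) \<cdot> y \<boxplus> x \<cdot> wc_diff C S 0"
    unfolding x(4)[symmetric] \<beta>'_def using padd_pdiff_cancel(1)[of \<beta> "wc_diff C T (-1) \<cdot> y"] \<beta> d y o by simp
  then show thesis using that[of x y] x(1-3) y(1-3) o \<beta>' by simp
qed

end

section \<open>Pure functors\<close>

locale pure_setting = weight_structure C w + D: abelian_category D
  for C :: "('o, 'm) tricat" (structure) and w :: "'o weights" and D :: "('a, 'b) precat"
begin

lemma weq_obj: "weq C w i \<subseteq> obj C"
  by (auto simp: weq_def intro: wle_obj)

lemma wc_obj_zero: "wc_obj C T 0 = tgt C (tc T 0)"
  by (simp add: wc_obj_def)

lemma wc_map_zero: "wc_map C b 0 = b 0"
  by (simp add: wc_map_def)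

end

locale heart_functor = pure_setting C w D
  for C :: "('o, 'm) tricat" (structure) and w :: "'o weights" and D :: "('a, 'b) precat" +
  fixes A :: "('o, 'm, 'a, 'b) cfunctor"
  assumes A_additive: "A \<in> additive_functors (heart C w) D"

sublocale heart_functor \<subseteq> A: additive_functor_on C D "weq C w 0" A
proof unfold_locales
  show "weq C w 0 \<subseteq> obj C" by (rule weq_obj)
  show "A \<in> additive_functors (full_subcat C (weq C w 0)) D" using A_additive by (simp add: heart_def)
qed

context heart_functor
begin

definition dm :: "'m tower \<Rightarrow> 'b" where "dm T = farr A (wc_diff C T (-1))"
definition d0 :: "'m tower \<Rightarrow> 'b" where "d0 T = farr A (wc_diff C T 0)"
definition hK :: "'m tower \<Rightarrow> 'b" where "hK T = fst (homology_data D (dm T) (d0 T))"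
definition hQ :: "'m tower \<Rightarrow> 'b" where "hQ T = snd (homology_data D (dm T) (d0 T))"

text \<open>The action on arrows for two arbitrary towers instead of a fixed choice; with
  \<open>g\<close> an identity it compares two towers of one object.\<close>

definition pmap :: "'m tower \<Rightarrow> 'm tower \<Rightarrow> 'm \<Rightarrow> 'b" where
  "pmap S T g = (THE m. \<exists>a b. tower_morphism C S T g a b \<and> m = pure_map C D A S A T (farr A (wc_map C b 0)))"

lemma pure_obj_eq: "pure_obj C D A T = tgt D (hQ T)"
  by (simp add: pure_obj_def homology_def hQ_def dm_def d0_def)

lemma complex_arrs:
  assumes T: "weight_tower C w M T"
  shows "dm T \<in> arr D" "src D (dm T) = fobj A (wc_obj C T (-1))" "tgt D (dm T) = fobj A (tgt C (tc T 0))"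
    "d0 T \<in> arr D" "src D (d0 T) = fobj A (tgt C (tc T 0))" "tgt D (d0 T) = fobj A (wc_obj C T 1)"
  using wc_diff_simps[OF T, of "-1"] wc_diff_simps[OF T, of 0] wc_obj_weq[OF T, of "-1"] wc_obj_weq[OF T, of 0]
    wc_obj_weq[OF T, of 1]
  by (simp_all add: dm_def d0_def wc_obj_zero)

lemma is_complex:
  assumes T: "weight_tower C w M T"
  shows "is_complex D (dm T) (d0 T)"
proof -
  have "wc_diff C T 0 \<cdot> wc_diff C T (-1) = pzero C (wc_obj C T (-1)) (wc_obj C T 1)"
    using wc_diff_zero[OF T, of "-1"] by simp
  then have "d0 T \<cdot>\<^bsub>D\<^esub> dm T = pzero D (fobj A (wc_obj C T (-1))) (fobj A (wc_obj C T 1))"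
    using wc_diff_simps[OF T, of "-1"] wc_diff_simps[OF T, of 0] wc_obj_weq[OF T]
      A.farr_cmp[of "wc_diff C T (-1)" "wc_diff C T 0"] by (simp add: dm_def d0_def)
  then show ?thesis using complex_arrs[OF T] by (simp add: is_complex_def)
qed

lemma homology_data: "weight_tower C w M T \<Longrightarrow> is_homology D (dm T) (d0 T) (hK T, hQ T)"
  unfolding hK_def hQ_def by (rule D.is_homology_homology_data[OF is_complex])

lemma subquotient:
  assumes T: "weight_tower C w M T"
  shows "subquotient D (hK T) (hQ T)" "hK T \<in> arr D" "tgt D (hK T) = fobj A (tgt C (tc T 0))"
    "hQ T \<in> arr D" "src D (hQ T) = src D (hK T)" "is_mono D (hK T)" "is_epi D (hQ T)" "tgt D (hQ T) \<in> obj D"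
  using D.is_homology_subquotient[OF homology_data[OF T]] D.subquotientD[of "hK T" "hQ T"] complex_arrs[OF T]
  by auto

lemma term_weq: "weight_tower C w M T \<Longrightarrow> tgt C (tc T 0) \<in> weq C w 0"
  using wc_obj_weq[of M T 0] by (simp add: wc_obj_zero)

lemma tower_morphism_chain:
  assumes S: "weight_tower C w M S" and T: "weight_tower C w N T" and ab: "tower_morphism C S T g a b"
  shows "d0 T \<cdot>\<^bsub>D\<^esub> farr A (b 0) = farr A (wc_map C b 1) \<cdot>\<^bsub>D\<^esub> d0 S"
    "farr A (b 0) \<cdot>\<^bsub>D\<^esub> dm S = dm T \<cdot>\<^bsub>D\<^esub> farr A (wc_map C b (-1))"
    "farr A (wc_map C b (-1)) \<in> homs D (src D (dm S)) (src D (dm T))"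
    "farr A (wc_map C b 1) \<in> homs D (tgt D (d0 S)) (tgt D (d0 T))"
    "farr A (b 0) \<in> homs D (src D (d0 S)) (src D (d0 T))"
proof -
  note m0 = tower_morphism_wc_map[OF S T ab, of 0, unfolded wc_map_zero wc_obj_zero, simplified]
  note m1 = tower_morphism_wc_map(1-3)[OF S T ab, of 1]
  note mm = tower_morphism_wc_map[OF S T ab, of "-1", simplified, unfolded wc_map_zero]
  note dS = wc_diff_simps[OF S, of 0, simplified, unfolded wc_obj_zero] wc_diff_simps[OF S, of "-1", simplified, unfolded wc_obj_zero]
  note dT = wc_diff_simps[OF T, of 0, simplified, unfolded wc_obj_zero] wc_diff_simps[OF T, of "-1", simplified, unfolded wc_obj_zero]
  note o = wc_obj_weq[OF S, of 1] wc_obj_weq[OF S, of "-1"] term_weq[OF S]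
    wc_obj_weq[OF T, of 1] wc_obj_weq[OF T, of "-1"] term_weq[OF T]
  have "farr A (wc_diff C T 0) \<cdot>\<^bsub>D\<^esub> farr A (b 0) = farr A (wc_diff C T 0 \<cdot> b 0)"
    by (rule A.farr_cmp[symmetric]) (use m0(1-3) dT o in simp_all)
  also have "\<dots> = farr A (wc_map C b 1) \<cdot>\<^bsub>D\<^esub> farr A (wc_diff C S 0)"
    unfolding m0(4) by (rule A.farr_cmp) (use m1 dS o in simp_all)
  finally show "d0 T \<cdot>\<^bsub>D\<^esub> farr A (b 0) = farr A (wc_map C b 1) \<cdot>\<^bsub>D\<^esub> d0 S" unfolding d0_def .
  have "dm T \<cdot>\<^bsub>D\<^esub> farr A (wc_map C b (-1)) = farr A (wc_diff C T (-1) \<cdot> wc_map C b (-1))"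
    unfolding dm_def by (rule A.farr_cmp[symmetric]) (use mm(1-3) dT o in simp_all)
  also have "\<dots> = farr A (b 0) \<cdot>\<^bsub>D\<^esub> dm S"
    unfolding mm(4) dm_def by (rule A.farr_cmp) (use m0(1-3) dS o in simp_all)
  finally show "farr A (b 0) \<cdot>\<^bsub>D\<^esub> dm S = dm T \<cdot>\<^bsub>D\<^esub> farr A (wc_map C b (-1))" ..
  note c = complex_arrs[OF S] complex_arrs[OF T]
  show "farr A (wc_map C b (-1)) \<in> homs D (src D (dm S)) (src D (dm T))"
    "farr A (wc_map C b 1) \<in> homs D (tgt D (d0 S)) (tgt D (d0 T))"
    "farr A (b 0) \<in> homs D (src D (d0 S)) (src D (d0 T))"
    using c m0(1-3) m1 mm(1-3) o by (simp_all add: in_homs)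
qed

lemma chain_mid_tower_morphism:
  assumes S: "weight_tower C w M S" and T: "weight_tower C w N T" and ab: "tower_morphism C S T g a b"
  shows "chain_mid D (dm S) (d0 S) (dm T) (d0 T) (farr A (b 0))"
  unfolding chain_mid_def using tower_morphism_chain[OF assms] by blast

lemma sq_map_pure_map:
  assumes S: "weight_tower C w M S" and T: "weight_tower C w N T" and ab: "tower_morphism C S T g a b"
  shows "sq_map D (hK S) (hQ S) (hK T) (hQ T) (farr A (b 0)) (pure_map C D A S A T (farr A (wc_map C b 0)))"
  using D.sq_map_homology_map[OF is_complex[OF S] is_complex[OF T] chain_mid_tower_morphism[OF S T ab]]
  by (simp add: pure_map_def hK_def hQ_def dm_def d0_def wc_map_zero)

text \<open>The vanishing criterion behind independence of choices, purity and invertibility of the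
  comparison with \<open>A\<close> on the heart: \<open>A\<close> carries \<open>d y + x d\<close>
  to an expression of the same form, which is zero on homology.\<close>

lemma null_map:
  assumes S: "weight_tower C w M S" and T: "weight_tower C w N T"
    and \<alpha>: "\<alpha> \<in> arr C" "src C \<alpha> = src C (th S 0)" "tgt C \<alpha> = src C (th T 0)"
    and \<beta>: "\<beta> \<in> arr C" "src C \<beta> = tgt C (tc S 0)" "tgt C \<beta> = tgt C (tc T 0)"
    and z: "th T 0 \<cdot> \<alpha> = pzero C (src C (th S 0)) N" and \<alpha>\<beta>: "tc T 0 \<cdot> \<alpha> = \<beta> \<cdot> tc S 0"
    and m: "sq_map D (hK S) (hQ S) (hK T) (hQ T) (farr A \<beta>) m"
  shows "m = pzero D (tgt D (hQ S)) (tgt D (hQ T))"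
proof -
  obtain x y where x: "x \<in> arr C" "src C x = wc_obj C S 1" "tgt C x = wc_obj C T 0"
    and y: "y \<in> arr C" "src C y = wc_obj C S 0" "tgt C y = wc_obj C T (-1)"
    and e: "\<beta> = wc_diff C T (-1) \<cdot> y \<boxplus> x \<cdot> wc_diff C S 0"
    by (rule null_homotopy[OF S T \<alpha> \<beta> z \<alpha>\<beta>])
  note dS = wc_diff_simps[OF S] and dT = wc_diff_simps[OF T, of "-1", simplified]
  note oS = wc_obj_weq[OF S] and oT = wc_obj_weq[OF T]
  have "farr A \<beta> = dm T \<cdot>\<^bsub>D\<^esub> farr A y \<boxplus>\<^bsub>D\<^esub> farr A x \<cdot>\<^bsub>D\<^esub> d0 S"
    unfolding e dm_def d0_def using x y dS[of 0] dT oS oT by (simp add: A.farr_cmp A.farr_padd)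
  moreover have "sq_map D (hK S) (hQ S) (hK T) (hQ T) (dm T \<cdot>\<^bsub>D\<^esub> farr A y \<boxplus>\<^bsub>D\<^esub> farr A x \<cdot>\<^bsub>D\<^esub> d0 S)
      (pzero D (tgt D (hQ S)) (tgt D (hQ T)))"
    by (rule D.sq_map_null[OF homology_data[OF S] homology_data[OF T] is_complex[OF T]])
      (use x y complex_arrs[OF S] complex_arrs[OF T] oS oT in \<open>simp_all flip: wc_obj_zero\<close>)
  ultimately show ?thesis
    using D.sq_map_unique[OF subquotient(1)[OF S] subquotient(1)[OF T] m] by simp
qed

lemma pure_map_unique:
  assumes S: "weight_tower C w M S" and T: "weight_tower C w N T" and g: "g \<in> arr C" "src C g = M" "tgt C g = N"
    and ab: "tower_morphism C S T g a b" and ab': "tower_morphism C S T g a' b'"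
  shows "pure_map C D A S A T (farr A (wc_map C b 0)) = pure_map C D A S A T (farr A (wc_map C b' 0))" (is "?m = ?m'")
proof -
  note m = sq_map_pure_map[OF S T ab] and m' = sq_map_pure_map[OF S T ab']
  note t = tower_morphismD(1-6)[OF ab, of 0] tower_morphismD(1-6)[OF ab', of 0]
  note p = tower_morphism_pdiff[OF S T g ab ab', of 0]
  note o = wc_obj_weq[OF S, of 0] wc_obj_weq[OF T, of 0]
  have e: "farr A (b 0 \<boxminus> b' 0) = farr A (b 0) \<boxminus>\<^bsub>D\<^esub> farr A (b' 0)"
    using t o by (subst A.farr_pdiff) (simp_all add: wc_obj_zero)
  have "?m \<boxminus>\<^bsub>D\<^esub> ?m' = pzero D (tgt D (hQ S)) (tgt D (hQ T))"
  proof (rule null_map[OF S T _ _ _ _ _ _ p])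
    show "sq_map D (hK S) (hQ S) (hK T) (hQ T) (farr A (b 0 \<boxminus> b' 0)) (?m \<boxminus>\<^bsub>D\<^esub> ?m')"
      unfolding e by (rule D.sq_map_pdiff[OF subquotient(1)[OF S] subquotient(1)[OF T] m m'])
  qed (use t in simp_all)
  then show ?thesis
    using D.sq_mapD(4-6)[OF m] D.sq_mapD(4-6)[OF m'] by (subst (asm) D.pdiff_eq_pzero_iff) simp_all
qed

lemma pmap_eq:
  assumes S: "weight_tower C w M S" and T: "weight_tower C w N T" and g: "g \<in> arr C" "src C g = M" "tgt C g = N"
    and ab: "tower_morphism C S T g a b"
  shows "pmap S T g = pure_map C D A S A T (farr A (wc_map C b 0))"
  unfolding pmap_def by (rule the_equality) (use ab pure_map_unique[OF S T g] in blast)+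

lemma sq_map_pmap:
  assumes S: "weight_tower C w M S" and T: "weight_tower C w N T" and g: "g \<in> arr C" "src C g = M" "tgt C g = N"
    and ab: "tower_morphism C S T g a b"
  shows "sq_map D (hK S) (hQ S) (hK T) (hQ T) (farr A (b 0)) (pmap S T g)"
  unfolding pmap_eq[OF assms] by (rule sq_map_pure_map[OF S T ab])

lemma pmap_eqI:
  assumes S: "weight_tower C w M S" and T: "weight_tower C w N T" and g: "g \<in> arr C" "src C g = M" "tgt C g = N"
    and ab: "tower_morphism C S T g a b" and m: "sq_map D (hK S) (hQ S) (hK T) (hQ T) (farr A (b 0)) m"
  shows "pmap S T g = m"
  by (rule D.sq_map_unique[OF subquotient(1)[OF S] subquotient(1)[OF T] sq_map_pmap[OF S T g ab] m])

lemma pmap_simps: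
  assumes S: "weight_tower C w M S" and T: "weight_tower C w N T" and g: "g \<in> arr C" "src C g = M" "tgt C g = N"
  shows "pmap S T g \<in> arr D" "src D (pmap S T g) = tgt D (hQ S)" "tgt D (pmap S T g) = tgt D (hQ T)"
proof -
  obtain a b where ab: "tower_morphism C S T g a b" by (rule ex_tower_morphism[OF S T g])
  show "pmap S T g \<in> arr D" "src D (pmap S T g) = tgt D (hQ S)" "tgt D (pmap S T g) = tgt D (hQ T)"
    using D.sq_mapD[OF sq_map_pmap[OF S T g ab]] by simp_all
qed

lemma pmap_idt:
  assumes T: "weight_tower C w M T"
  shows "pmap T T (idt C M) = idt D (tgt D (hQ T))"
proof (rule pmap_eqI[OF T T _ _ _ tower_morphism_idt[OF T]])
  have "farr A (idt C (tgt C (tc T 0))) = idt D (tgt D (hK T))"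
    using wc_obj_weq[OF T, of 0] subquotient(3)[OF T] by (simp add: wc_obj_zero)
  then show "sq_map D (hK T) (hQ T) (hK T) (hQ T) (farr A (idt C (tgt C (tc T 0)))) (idt D (tgt D (hQ T)))"
    using D.sq_map_idt[OF subquotient(1)[OF T]] by simp
qed (use weight_towerD_th[OF T] in simp_all)

lemma pmap_cmp:
  assumes S: "weight_tower C w M S" and T: "weight_tower C w N T" and U: "weight_tower C w P U"
    and f: "f \<in> arr C" "src C f = M" "tgt C f = N" and g: "g \<in> arr C" "src C g = N" "tgt C g = P"
  shows "pmap S U (g \<cdot> f) = pmap T U g \<cdot>\<^bsub>D\<^esub> pmap S T f"
proof -
  obtain a b where ab: "tower_morphism C S T f a b" by (rule ex_tower_morphism[OF S T f])
  obtain a' b' where ab': "tower_morphism C T U g a' b'" by (rule ex_tower_morphism[OF T U g])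
  note t = tower_morphismD(4-6)[OF ab, of 0] tower_morphismD(4-6)[OF ab', of 0]
  note o = wc_obj_weq[OF S, of 0] wc_obj_weq[OF T, of 0] wc_obj_weq[OF U, of 0]
  have e: "farr A (b' 0 \<cdot> b 0) = farr A (b' 0) \<cdot>\<^bsub>D\<^esub> farr A (b 0)"
    using t o by (subst A.farr_cmp) (simp_all add: wc_obj_zero)
  show ?thesis
  proof (rule pmap_eqI[OF S U _ _ _ tower_morphism_cmp[OF S T U f g ab ab']])
    show "sq_map D (hK S) (hQ S) (hK U) (hQ U) (farr A (b' 0 \<cdot> b 0)) (pmap T U g \<cdot>\<^bsub>D\<^esub> pmap S T f)"
      unfolding e by (rule D.sq_map_cmp[OF subquotient(1)[OF S] subquotient(1)[OF T] subquotient(1)[OF U]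
          sq_map_pmap[OF S T f ab] sq_map_pmap[OF T U g ab']])
  qed (use f g in simp_all)
qed

lemma pmap_padd:
  assumes S: "weight_tower C w M S" and T: "weight_tower C w N T"
    and f: "f \<in> arr C" "src C f = M" "tgt C f = N" and g: "g \<in> arr C" "src C g = M" "tgt C g = N"
  shows "pmap S T (f \<boxplus> g) = pmap S T f \<boxplus>\<^bsub>D\<^esub> pmap S T g"
proof -
  obtain a b where ab: "tower_morphism C S T f a b" by (rule ex_tower_morphism[OF S T f])
  obtain a' b' where ab': "tower_morphism C S T g a' b'" by (rule ex_tower_morphism[OF S T g])
  note t = tower_morphismD(4-6)[OF ab, of 0] tower_morphismD(4-6)[OF ab', of 0]
  note o = wc_obj_weq[OF S, of 0] wc_obj_weq[OF T, of 0]
  have e: "farr A (b 0 \<boxplus> b' 0) = farr A (b 0) \<boxplus>\<^bsub>D\<^esub> farr A (b' 0)"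
    using t o by (subst A.farr_padd) (simp_all add: wc_obj_zero)
  show ?thesis
  proof (rule pmap_eqI[OF S T _ _ _ tower_morphism_padd[OF S T f g ab ab']])
    show "sq_map D (hK S) (hQ S) (hK T) (hQ T) (farr A (b 0 \<boxplus> b' 0)) (pmap S T f \<boxplus>\<^bsub>D\<^esub> pmap S T g)"
      unfolding e by (rule D.sq_map_padd[OF subquotient(1)[OF S] subquotient(1)[OF T]
          sq_map_pmap[OF S T f ab] sq_map_pmap[OF S T g ab']])
  qed (use f g in simp_all)
qed

lemma pmap_change:
  assumes S: "weight_tower C w M S" and T: "weight_tower C w M T"
  shows "pmap T S (idt C M) \<cdot>\<^bsub>D\<^esub> pmap S T (idt C M) = idt D (tgt D (hQ S))"
    "is_iso D (pmap S T (idt C M))"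
proof -
  have M: "M \<in> obj C" using weight_towerD_th[OF S] by simp
  have i: "idt C M \<in> arr C" "src C (idt C M) = M" "tgt C (idt C M) = M" using M by simp_all
  have *: "pmap T S (idt C M) \<cdot>\<^bsub>D\<^esub> pmap S T (idt C M) = idt D (tgt D (hQ S))"
    if S: "weight_tower C w M S" and T: "weight_tower C w M T" for S T
    using pmap_cmp[OF S T S i i] pmap_idt[OF S] i by simp
  show "pmap T S (idt C M) \<cdot>\<^bsub>D\<^esub> pmap S T (idt C M) = idt D (tgt D (hQ S))" by (rule *[OF S T])
  show "is_iso D (pmap S T (idt C M))"
    using D.is_isoI[of "pmap S T (idt C M)" "pmap T S (idt C M)" "tgt D (hQ S)" "tgt D (hQ T)"]
      pmap_simps[OF S T i] pmap_simps[OF T S i] *[OF S T] *[OF T S] by simp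
qed

lemma pure_functor_simps:
  shows "M \<in> obj C \<Longrightarrow> fobj (pure_functor C D T A) M = tgt D (hQ (T M))"
    "g \<in> arr C \<Longrightarrow> farr (pure_functor C D T A) g = pmap (T (src C g)) (T (tgt C g)) g"
  by (simp_all add: pure_functor_def pure_obj_eq pmap_def)

lemma tower_choiceD: "tower_choice C w T \<Longrightarrow> M \<in> obj C \<Longrightarrow> weight_tower C w M (T M)"
  by (simp add: tower_choice_def)

lemma pure_functor_additive:
  assumes T: "tower_choice C w T"
  shows "pure_functor C D T A \<in> additive_functors C D"
proof -
  note tT = tower_choiceD[OF T]
  have "is_functor C D (pure_functor C D T A)"
    unfolding is_functor_def
  proof (intro conjI ballI impI)
    show "fobj (pure_functor C D T A) \<in> obj C \<rightarrow>\<^sub>E obj D"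
      using subquotient(8)[OF tT] by (auto simp: pure_functor_def pure_obj_eq)
    show "farr (pure_functor C D T A) \<in> arr C \<rightarrow>\<^sub>E arr D"
    proof (rule PiE_I)
      fix g assume g: "g \<in> arr C"
      show "farr (pure_functor C D T A) g \<in> arr D"
        using g pmap_simps(1)[OF tT[OF src_obj[OF g]] tT[OF tgt_obj[OF g]] g] by (simp add: pure_functor_simps)
    qed (simp add: pure_functor_def)
    fix g assume g: "g \<in> arr C"
    show "src D (farr (pure_functor C D T A) g) = fobj (pure_functor C D T A) (src C g)"
      "tgt D (farr (pure_functor C D T A) g) = fobj (pure_functor C D T A) (tgt C g)"
      using g pmap_simps(2,3)[OF tT[OF src_obj[OF g]] tT[OF tgt_obj[OF g]] g] by (simp_all add: pure_functor_simps)
    fix f assume f: "f \<in> arr C" "tgt C g = src C f"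
    show "farr (pure_functor C D T A) (f \<cdot> g) = farr (pure_functor C D T A) f \<cdot>\<^bsub>D\<^esub> farr (pure_functor C D T A) g"
      using g f pmap_cmp[OF tT[OF src_obj[OF g]] tT[OF tgt_obj[OF g]] tT[OF tgt_obj[OF f(1)]] g refl refl f(1) f(2)[symmetric] refl]
      by (simp add: pure_functor_simps)
  next
    fix X assume X: "X \<in> obj C"
    show "farr (pure_functor C D T A) (idt C X) = idt D (fobj (pure_functor C D T A) X)"
      using X pmap_idt[OF tT[OF X]] by (simp add: pure_functor_simps)
  qed
  moreover have "farr (pure_functor C D T A) (f \<boxplus> g) = farr (pure_functor C D T A) f \<boxplus>\<^bsub>D\<^esub> farr (pure_functor C D T A) g"
    if X: "X \<in> obj C" and Y: "Y \<in> obj C" and "f \<in> homs C X Y" "g \<in> homs C X Y" for X Y f g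
  proof -
    have h: "f \<in> arr C" "src C f = X" "tgt C f = Y" "g \<in> arr C" "src C g = X" "tgt C g = Y"
      using that by (simp_all add: in_homs)
    show ?thesis using h pmap_padd[OF tT[OF X] tT[OF Y] h] by (simp add: pure_functor_simps)
  qed
  ultimately show ?thesis by (simp add: additive_functors_def)
qed

lemma pure_functor_choice_iso:
  assumes T: "tower_choice C w T" and T': "tower_choice C w T'"
  shows "is_nat_iso C D (pure_functor C D T A) (pure_functor C D T' A) (\<lambda>M \<in> obj C. pmap (T M) (T' M) (idt C M))"
proof -
  note tT = tower_choiceD[OF T] and tT' = tower_choiceD[OF T']
  show ?thesis unfolding is_nat_iso_def is_nat_def
  proof (intro conjI ballI)
    fix M assume M: "M \<in> obj C"
    show "(\<lambda>M \<in> obj C. pmap (T M) (T' M) (idt C M)) M \<in> homs D (fobj (pure_functor C D T A) M) (fobj (pure_functor C D T' A) M)"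
      using M pmap_simps[OF tT[OF M] tT'[OF M], of "idt C M"] by (simp add: in_homs pure_functor_simps)
    show "is_iso D ((\<lambda>M \<in> obj C. pmap (T M) (T' M) (idt C M)) M)"
      using M pmap_change(2)[OF tT[OF M] tT'[OF M]] by simp
  next
    fix f assume f: "f \<in> arr C"
    note o = src_obj[OF f] tgt_obj[OF f]
    have "pmap (T (tgt C f)) (T' (tgt C f)) (idt C (tgt C f)) \<cdot>\<^bsub>D\<^esub> pmap (T (src C f)) (T (tgt C f)) f
        = pmap (T (src C f)) (T' (tgt C f)) (idt C (tgt C f) \<cdot> f)"
      by (rule pmap_cmp[OF tT[OF o(1)] tT[OF o(2)] tT'[OF o(2)], symmetric]) (use f o in simp_all)
    also have "\<dots> = pmap (T (src C f)) (T' (tgt C f)) (f \<cdot> idt C (src C f))" using f by simp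
    also have "\<dots> = pmap (T' (src C f)) (T' (tgt C f)) f \<cdot>\<^bsub>D\<^esub> pmap (T (src C f)) (T' (src C f)) (idt C (src C f))"
      by (rule pmap_cmp[OF tT[OF o(1)] tT'[OF o(1)] tT'[OF o(2)]]) (use f o in simp_all)
    finally show "(\<lambda>M \<in> obj C. pmap (T M) (T' M) (idt C M)) (tgt C f) \<cdot>\<^bsub>D\<^esub> farr (pure_functor C D T A) f =
        farr (pure_functor C D T' A) f \<cdot>\<^bsub>D\<^esub> (\<lambda>M \<in> obj C. pmap (T M) (T' M) (idt C M)) (src C f)"
      using f by (simp add: pure_functor_simps)
  qed simp
qed

text \<open>\<open>M\<close> receives only zero arrows from weight at most \<open>0\<close>, so
  \<open>th T 0\<close> vanishes and the pair of identities is admissible in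
  \<open>null_map\<close>; the identity of the homology is thus zero.\<close>

lemma pure_obj_wge:
  assumes T: "weight_tower C w M T" and M: "M \<in> wge C w 1"
  shows "zero_object D (tgt D (hQ T))"
proof -
  note th = weight_towerD_th(1-4)[OF T, of 0] and tc = weight_towerD_tc[OF T, of 0]
  have "th T 0 = pzero C (src C (th T 0)) M" by (rule weight_orthogonal[OF th(2) M]) (use th in simp_all)
  then have z: "th T 0 \<cdot> idt C (src C (th T 0)) = pzero C (src C (th T 0)) M" using th by simp
  have o: "tgt C (tc T 0) \<in> weq C w 0" using wc_obj_weq[OF T, of 0] by (simp add: wc_obj_zero)
  have "idt D (tgt D (hQ T)) = pzero D (tgt D (hQ T)) (tgt D (hQ T))"
  proof (rule null_map[OF T T _ _ _ _ _ _ z])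
    show "sq_map D (hK T) (hQ T) (hK T) (hQ T) (farr A (idt C (tgt C (tc T 0)))) (idt D (tgt D (hQ T)))"
      using D.sq_map_idt[OF subquotient(1)[OF T]] subquotient(3)[OF T] o by simp
  qed (use th tc in simp_all)
  then show ?thesis using subquotient(8)[OF T] by (simp add: D.zero_object_iff)
qed

text \<open>The arrow \<open>th T (-1)\<close> has a section \<open>\<sigma>\<close>. Removing from
  the identity of the zeroth truncation the part that passes through index \<open>-1\<close> leaves
  \<open>\<alpha>\<close>, which dies in \<open>M\<close> but still lies over the identity of the
  zeroth term, as \<open>tc T 0\<close> kills \<open>tj T (-1)\<close>.\<close>

lemma pure_obj_wle:
  assumes T: "weight_tower C w M T" and M: "M \<in> wle C w (-1)"
  shows "zero_object D (tgt D (hQ T))"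
proof -
  note th = weight_towerD_th[OF T] and tc = weight_towerD_tc[OF T, of 0]
  have Mo: "M \<in> obj C" using th by simp
  obtain \<sigma> where \<sigma>: "\<sigma> \<in> arr C" "src C \<sigma> = M" "tgt C \<sigma> = src C (th T (-1))" "th T (-1) \<cdot> \<sigma> = idt C M"
    by (rule weight_lift[OF weight_towerD(1)[OF T, of "-1"] M order_refl, of "idt C M"]) (use Mo in auto)
  have j: "tj T (-1) \<in> arr C" "src C (tj T (-1)) = src C (th T (-1))" "tgt C (tj T (-1)) = src C (th T 0)"
    "th T 0 \<cdot> tj T (-1) = th T (-1)" "(tj T (-1), tc T 0, te T (-1)) \<in> tri C"
    using weight_towerD(2-5)[OF T, of "-1"] weight_towerD(6)[OF T, of 0] by simp_all
  define \<alpha> where "\<alpha> = idt C (src C (th T 0)) \<boxminus> tj T (-1) \<cdot> (\<sigma> \<cdot> th T 0)"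
  have \<alpha>: "\<alpha> \<in> arr C" "src C \<alpha> = src C (th T 0)" "tgt C \<alpha> = src C (th T 0)"
    using \<sigma> j(1-3) th by (simp_all add: \<alpha>_def)
  have "th T 0 \<cdot> (tj T (-1) \<cdot> (\<sigma> \<cdot> th T 0)) = th T 0"
    using cmp_reassoc[OF j(4), of "\<sigma> \<cdot> th T 0"] cmp_reassoc[OF \<sigma>(4), of "th T 0"] \<sigma>(1-3) j(1-3) th by simp
  then have z: "th T 0 \<cdot> \<alpha> = pzero C (src C (th T 0)) M" using \<sigma>(1-3) j(1-3) th by (simp add: \<alpha>_def)
  have cj: "tc T 0 \<cdot> tj T (-1) = pzero C (src C (tj T (-1))) (tgt C (tc T 0))" by (rule tri_cmp_zero[OF j(5)])
  have e: "tc T 0 \<cdot> \<alpha> = idt C (tgt C (tc T 0)) \<cdot> tc T 0"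
    using \<sigma>(1-3) j(1-3) th tc by (simp add: \<alpha>_def cmp_zero_assoc[OF cj])
  have o: "tgt C (tc T 0) \<in> weq C w 0" using wc_obj_weq[OF T, of 0] by (simp add: wc_obj_zero)
  have "idt D (tgt D (hQ T)) = pzero D (tgt D (hQ T)) (tgt D (hQ T))"
  proof (rule null_map[OF T T \<alpha> _ _ _ z e])
    show "sq_map D (hK T) (hQ T) (hK T) (hQ T) (farr A (idt C (tgt C (tc T 0)))) (idt D (tgt D (hQ T)))"
      using D.sq_map_idt[OF subquotient(1)[OF T]] subquotient(3)[OF T] o by simp
  qed (use tc in simp_all)
  then show ?thesis using subquotient(8)[OF T] by (simp add: D.zero_object_iff)
qed

lemma pure_functor_pure:
  assumes T: "tower_choice C w T"
  shows "is_pure C w D (pure_functor C D T A)"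
  unfolding is_pure_def kills_def
  using pure_obj_wge[OF tower_choiceD[OF T]] pure_obj_wle[OF tower_choiceD[OF T]]
  by (simp add: pure_functor_simps wge_obj wle_obj)

end

section \<open>The horseshoe construction\<close>

context weight_structure
begin

text \<open>By the octahedral axiom a cone of \<open>h \<cdot> j\<close> is an extension of the
  cones of \<open>j\<close> and \<open>h\<close>, both of weight at least \<open>i\<close>.\<close>

lemma weight_decomposition_cmp:
  assumes d: "weight_decomposition C w i M h r b" and t: "(j, c, e) \<in> tri C"
    and j: "tgt C j = src C h" "src C j \<in> wle C w (i - 1)" "tgt C c \<in> wge C w i"
  obtains r' b' where "weight_decomposition C w (i - 1) M (h \<cdot> j) r' b'"
proof -
  note d = weight_decompositionD[OF d]
  note D = triD[OF d(1)] triD[OF t]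
  obtain k1 k2 where k: "(h \<cdot> j, k1, k2) \<in> tri C" using tri_cone[of "h \<cdot> j"] D j by auto
  note D' = triD[OF k]
  obtain u v where uv: "(u, v, shA C 1 c \<cdot> b) \<in> tri C" "u \<in> homs C (tgt C c) (tgt C k1)" "v \<in> homs C (tgt C k1) (tgt C r)"
    using tri_octahedron[OF t d(1) j(1) k] by metis
  have "tgt C r \<in> wge C w i" by (rule wge_mono[OF d(4)]) simp
  then have "tgt C u \<in> wge C w i"
    using uv(2,3) j(3) by (intro wge_extension[OF uv(1)]) (simp_all add: in_homs)
  then have "weight_decomposition C w (i - 1) M (h \<cdot> j) k1 k2"
    using k D D' d(3) j uv(2) by (simp add: weight_decomposition_def in_homs)
  then show thesis by (rule that)
qed

text \<open>The invariant carried down the tower of the middle term of a triangle on \<open>f\<close> and \<open>g\<close>.\<close>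

definition horseshoe :: "'m tower \<Rightarrow> 'm tower \<Rightarrow> 'm \<Rightarrow> 'm \<Rightarrow> int \<Rightarrow> 'm \<Rightarrow> 'm \<Rightarrow> 'm \<Rightarrow> bool" where
  "horseshoe S U f g i h \<alpha> \<beta> \<longleftrightarrow> (\<exists>r b. weight_decomposition C w i (tgt C f) h r b) \<and> (\<exists>\<gamma>. (\<alpha>, \<beta>, \<gamma>) \<in> tri C) \<and>
    src C \<alpha> = src C (th S i) \<and> tgt C \<alpha> = src C h \<and> tgt C \<beta> = src C (th U i) \<and>
    h \<cdot> \<alpha> = f \<cdot> th S i \<and> th U i \<cdot> \<beta> = g \<cdot> h"

text \<open>The 3 x 3 lemma on \<open>i\<close>-weight decompositions of the outer objects; its
  middle column decomposes the middle object because both weight classes are closed under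
  extensions.\<close>

lemma horseshoe_start:
  assumes S: "weight_tower C w (src C f) S" and U: "weight_tower C w (tgt C g) U" and T: "(f, g, k) \<in> tri C"
  obtains h \<alpha> \<beta> where "horseshoe S U f g i h \<alpha> \<beta>"
proof -
  note dS = weight_decompositionD[OF weight_towerD(1)[OF S, of i]]
  note dU = weight_decompositionD[OF weight_towerD(1)[OF U, of i]]
  note t = triD[OF T] triD[OF dS(1)] triD[OF dU(1)]
  obtain z' z z'' a' b' c' a b c where
    R: "(a', b', c') \<in> tri C" "(z', z, z'') \<in> tri C" "(a, b, c) \<in> tri C"
    "src C a' = src C (th S i)" "tgt C a' = src C z'" "tgt C b' = src C (th U i)"
    "tgt C z' = tgt C f" "src C a = tgt C (tr S i)" "tgt C a = tgt C z" "tgt C b = tgt C (tr U i)"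
    "z' \<cdot> a' = f \<cdot> th S i" "th U i \<cdot> b' = g \<cdot> z'" "z \<cdot> f = a \<cdot> tr S i" "b \<cdot> z = tr U i \<cdot> g"
    "z'' \<cdot> a = shA C 1 a' \<cdot> tb S i" "tb U i \<cdot> b = shA C 1 b' \<cdot> z''"
  proof (rule tri_3x3[OF T dS(1) dU(1)])
    fix x assume x: "x \<in> arr C" "src C x = shO C (-1) (src C (th U i))" "tgt C x = tgt C (tr S i)"
    have "shO C (-1) (src C (th U i)) \<in> wle C w (i - 1)" using dU(2) t by (simp add: shO_wle_iff)
    then show "x = pzero C (src C x) (tgt C x)" unfolding x(2,3)
      by (rule weight_orthogonal[OF _ dS(4)]) (use x in simp_all)
  qed (use t dS(3) dU(3) in simp_all)
  note t' = triD[OF R(1)] triD[OF R(2)] triD[OF R(3)]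
  have "tgt C a' \<in> wle C w i" by (rule wle_extension[OF R(1)]) (use R dS dU in simp_all)
  moreover have "tgt C a \<in> wge C w (i + 1)" by (rule wge_extension[OF R(3)]) (use R dS dU in simp_all)
  ultimately have "weight_decomposition C w i (tgt C f) z' z z''"
    using R by (simp add: weight_decomposition_def)
  then have "horseshoe S U f g i z' a' b'" unfolding horseshoe_def using R by blast
  then show thesis by (rule that)
qed

text \<open>The 3 x 3 lemma again, now with the truncations of index \<open>i\<close> as the given
  row and the triangles on \<open>tj\<close>, \<open>tc\<close>, \<open>te\<close> as columns. The
  row of sources continues the invariant one level down, the row of targets relates the
  \<open>i\<close>-th terms.\<close>

lemma horseshoe_step:
  assumes S: "weight_tower C w (src C f) S" and U: "weight_tower C w (tgt C g) U" and T: "(f, g, k) \<in> tri C"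
    and hs: "horseshoe S U f g i h \<alpha> \<beta>"
  obtains j c e \<alpha>' \<beta>' b b' \<delta> where "horseshoe S U f g (i - 1) (h \<cdot> j) \<alpha>' \<beta>'" "(j, c, e) \<in> tri C"
    "tgt C j = src C h" "(b, b', \<delta>) \<in> tri C" "src C b = tgt C (tc S i)" "tgt C b = tgt C c"
    "tgt C b' = tgt C (tc U i)" "c \<cdot> \<alpha> = b \<cdot> tc S i" "tc U i \<cdot> \<beta> = b' \<cdot> c"
    "e \<cdot> b = shA C 1 \<alpha>' \<cdot> te S (i - 1)" "te U (i - 1) \<cdot> b' = shA C 1 \<beta>' \<cdot> e"
proof -
  obtain r s \<gamma> where d: "weight_decomposition C w i (tgt C f) h r s" and A: "(\<alpha>, \<beta>, \<gamma>) \<in> tri C"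
    and H: "src C \<alpha> = src C (th S i)" "tgt C \<alpha> = src C h" "tgt C \<beta> = src C (th U i)"
      "h \<cdot> \<alpha> = f \<cdot> th S i" "th U i \<cdot> \<beta> = g \<cdot> h"
    using hs unfolding horseshoe_def by (elim conjE exE)
  note dD = weight_decompositionD[OF d]
  note thS = weight_towerD_th[OF S] note thU = weight_towerD_th[OF U]
  note jS = weight_towerD(2-5)[OF S, of "i - 1", simplified] note jU = weight_towerD(2-5)[OF U, of "i - 1", simplified]
  note tS = weight_towerD(6)[OF S, of i] note tU = weight_towerD(6)[OF U, of i]
  note t = triD[OF T] triD[OF tS] triD[OF tU] triD[OF A] triD[OF dD(1)]
  obtain z' z z'' a' b' c' a b c where
    R: "(a', b', c') \<in> tri C" "(z', z, z'') \<in> tri C" "(a, b, c) \<in> tri C"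
    "src C a' = src C (tj S (i - 1))" "tgt C a' = src C z'" "tgt C b' = src C (tj U (i - 1))"
    "tgt C z' = tgt C \<alpha>" "src C a = tgt C (tc S i)" "tgt C a = tgt C z" "tgt C b = tgt C (tc U i)"
    "z' \<cdot> a' = \<alpha> \<cdot> tj S (i - 1)" "tj U (i - 1) \<cdot> b' = \<beta> \<cdot> z'" "z \<cdot> \<alpha> = a \<cdot> tc S i" "b \<cdot> z = tc U i \<cdot> \<beta>"
    "z'' \<cdot> a = shA C 1 a' \<cdot> te S (i - 1)" "te U (i - 1) \<cdot> b = shA C 1 b' \<cdot> z''"
  proof (rule tri_3x3[OF A tS tU])
    fix x assume x: "x \<in> arr C" "src C x = shO C (-1) (src C (tj U (i - 1)))" "tgt C x = tgt C (tc S i)"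
    have "src C (tj U (i - 1)) \<in> wle C w (i - 1)" using jU(2) thU(2)[of "i - 1"] by simp
    then have "shO C (-1) (src C (tj U (i - 1))) \<in> wle C w (i - 2)" using t by (simp add: shO_wle_iff)
    then show "x = pzero C (src C x) (tgt C x)" unfolding x(2,3)
      by (rule weight_orthogonal[OF _ weight_tower_term(2)[OF S]]) (use x in simp_all)
  qed (use jS jU H in simp_all)
  note t' = triD[OF R(1)] triD[OF R(2)] triD[OF R(3)]
  have "tgt C a' \<in> wle C w (i - 1)"
    by (rule wle_extension[OF R(1)]) (use R jS jU thS(2)[of "i - 1"] thU(2)[of "i - 1"] in simp_all)
  then have z': "src C z' \<in> wle C w (i - 1)" "tgt C z' = src C h" using R H by simp_all
  have "tgt C a \<in> wge C w i"
    by (rule wge_extension[OF R(3)]) (use R weight_tower_term(2)[OF S] weight_tower_term(2)[OF U] in simp_all)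
  then have z: "tgt C z \<in> wge C w i" using R by simp
  obtain r' s' where d': "weight_decomposition C w (i - 1) (tgt C f) (h \<cdot> z') r' s'"
    by (rule weight_decomposition_cmp[OF d R(2) z'(2,1) z])
  have "h \<cdot> z' \<cdot> a' = h \<cdot> (\<alpha> \<cdot> tj S (i - 1))" unfolding R(11)[symmetric] using t t' R(5) z'(2) by simp
  also have "\<dots> = f \<cdot> th S i \<cdot> tj S (i - 1)" by (rule cmp_reassoc[OF H(4)]) (use t H jS in simp_all)
  also have "\<dots> = f \<cdot> th S (i - 1)" unfolding jS(4)[symmetric] using t jS(1-3) thS by simp
  finally have e1: "h \<cdot> z' \<cdot> a' = f \<cdot> th S (i - 1)" .
  have "th U (i - 1) \<cdot> b' = th U i \<cdot> (tj U (i - 1) \<cdot> b')"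
    unfolding jU(4)[symmetric] using jU(1-3) thU(1) t' R(6) by simp
  also have "\<dots> = g \<cdot> h \<cdot> z'" unfolding R(12) by (rule cmp_reassoc[OF H(5)]) (use t t' R(7) H thU in simp_all)
  also have "\<dots> = g \<cdot> (h \<cdot> z')" using t t' z'(2) dD(3) by simp
  finally have e2: "th U (i - 1) \<cdot> b' = g \<cdot> (h \<cdot> z')" .
  have "src C (h \<cdot> z') = src C z'" using t t' z'(2) by simp
  then have "horseshoe S U f g (i - 1) (h \<cdot> z') a' b'"
    unfolding horseshoe_def using d' R(1,4-6) jS(2) jU(2) e1 e2 by auto
  then show thesis by (rule that[OF _ R(2) z'(2) R(3) R(8-10) R(13) R(14)[symmetric] R(15,16)])
qed

lemma horseshoe_lemma:
  assumes S: "weight_tower C w (src C f) S" and U: "weight_tower C w (tgt C g) U" and T: "(f, g, k) \<in> tri C"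
  obtains Z a b a' b' where "weight_tower C w (tgt C f) Z" "tower_morphism C S Z f a b" "tower_morphism C Z U g a' b'"
    "\<forall>i \<in> {-1, 0, 1}. (b i, b' i, pzero C (tgt C (b' i)) (shO C 1 (src C (b i)))) \<in> tri C"
proof -
  note t = triD[OF T]
  \<comment> \<open>Homology in degree zero involves the terms of index \<open>1\<close>,
    \<open>0\<close> and \<open>-1\<close>, whose triangles use the truncations from
    \<open>-2\<close> to \<open>1\<close>; hence a start at level \<open>1\<close> and three steps
    down.\<close>
  obtain h3 \<alpha>3 \<beta>3 where H3: "horseshoe S U f g 1 h3 \<alpha>3 \<beta>3" by (rule horseshoe_start[OF assms])
  obtain j2 c3 e2 \<alpha>2 \<beta>2 b3 b'3 \<delta>3 where H2: "horseshoe S U f g (1 - 1) (h3 \<cdot> j2) \<alpha>2 \<beta>2" and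
    R3: "(j2, c3, e2) \<in> tri C" "tgt C j2 = src C h3" "(b3, b'3, \<delta>3) \<in> tri C" "src C b3 = tgt C (tc S 1)" "tgt C b3 = tgt C c3"
    "tgt C b'3 = tgt C (tc U 1)" "c3 \<cdot> \<alpha>3 = b3 \<cdot> tc S 1" "tc U 1 \<cdot> \<beta>3 = b'3 \<cdot> c3"
    "e2 \<cdot> b3 = shA C 1 \<alpha>2 \<cdot> te S (1 - 1)" "te U (1 - 1) \<cdot> b'3 = shA C 1 \<beta>2 \<cdot> e2"
    by (rule horseshoe_step[OF assms H3])
  define h2 where "h2 = h3 \<cdot> j2"
  have H2: "horseshoe S U f g 0 h2 \<alpha>2 \<beta>2" using H2 by (simp add: h2_def)
  obtain j1 c2 e1 \<alpha>1 \<beta>1 b2 b'2 \<delta>2 where H1: "horseshoe S U f g (0 - 1) (h2 \<cdot> j1) \<alpha>1 \<beta>1" and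
    R2: "(j1, c2, e1) \<in> tri C" "tgt C j1 = src C h2" "(b2, b'2, \<delta>2) \<in> tri C" "src C b2 = tgt C (tc S 0)" "tgt C b2 = tgt C c2"
    "tgt C b'2 = tgt C (tc U 0)" "c2 \<cdot> \<alpha>2 = b2 \<cdot> tc S 0" "tc U 0 \<cdot> \<beta>2 = b'2 \<cdot> c2"
    "e1 \<cdot> b2 = shA C 1 \<alpha>1 \<cdot> te S (0 - 1)" "te U (0 - 1) \<cdot> b'2 = shA C 1 \<beta>1 \<cdot> e1"
    by (rule horseshoe_step[OF assms H2])
  define h1 where "h1 = h2 \<cdot> j1"
  have H1: "horseshoe S U f g (-1) h1 \<alpha>1 \<beta>1" using H1 by (simp add: h1_def)
  obtain j0 c1 e0 \<alpha>0 \<beta>0 b1 b'1 \<delta>1 where H0: "horseshoe S U f g (-1 - 1) (h1 \<cdot> j0) \<alpha>0 \<beta>0" and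
    R1: "(j0, c1, e0) \<in> tri C" "tgt C j0 = src C h1" "(b1, b'1, \<delta>1) \<in> tri C" "src C b1 = tgt C (tc S (-1))" "tgt C b1 = tgt C c1"
    "tgt C b'1 = tgt C (tc U (-1))" "c1 \<cdot> \<alpha>1 = b1 \<cdot> tc S (-1)" "tc U (-1) \<cdot> \<beta>1 = b'1 \<cdot> c1"
    "e0 \<cdot> b1 = shA C 1 \<alpha>0 \<cdot> te S (-1 - 1)" "te U (-1 - 1) \<cdot> b'1 = shA C 1 \<beta>0 \<cdot> e0"
    by (rule horseshoe_step[OF assms H1])
  define h0 where "h0 = h1 \<cdot> j0"
  have H0: "horseshoe S U f g (-2) h0 \<alpha>0 \<beta>0" using H0 by (simp add: h0_def)
  \<comment> \<open>The levels are assembled into functions of the index. Repeated or borrowed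
    entries, such as \<open>j0\<close> in \<open>sel j0 c1 c2 c3\<close>, are fillers at indices
    outside the range concerned.\<close>
  define sel :: "'m \<Rightarrow> 'm \<Rightarrow> 'm \<Rightarrow> 'm \<Rightarrow> int \<Rightarrow> 'm" where
    "sel x0 x1 x2 x3 i = (if i = 1 then x3 else if i = 0 then x2 else if i = -1 then x1 else x0)" for x0 x1 x2 x3 i
  have sel: "sel x0 x1 x2 x3 1 = x3" "sel x0 x1 x2 x3 0 = x2" "sel x0 x1 x2 x3 (-1) = x1" "sel x0 x1 x2 x3 (-2) = x0"
    for x0 x1 x2 x3 by (simp_all add: sel_def)
  let ?h = "sel h0 h1 h2 h3" let ?\<alpha> = "sel \<alpha>0 \<alpha>1 \<alpha>2 \<alpha>3" let ?\<beta> = "sel \<beta>0 \<beta>1 \<beta>2 \<beta>3"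
  have HH: "horseshoe S U f g i (?h i) (?\<alpha> i) (?\<beta> i)" if "i \<in> {-2, -1, 0, 1}" for i
    using that H0 H1 H2 H3 by (auto simp: sel)
  define r where "r i = (SOME r. \<exists>b. weight_decomposition C w i (tgt C f) (?h i) r b)" for i
  define s where "s i = (SOME b. weight_decomposition C w i (tgt C f) (?h i) (r i) b)" for i
  have dec: "weight_decomposition C w i (tgt C f) (?h i) (r i) (s i)" if "i \<in> {-2, -1, 0, 1}" for i
  proof -
    have "\<exists>r b. weight_decomposition C w i (tgt C f) (?h i) r b" using HH[OF that] by (simp add: horseshoe_def)
    then have "\<exists>b. weight_decomposition C w i (tgt C f) (?h i) (r i) b" unfolding r_def by (rule someI_ex)
    then show ?thesis unfolding s_def by (rule someI_ex)
  qed
  note D3 = triD[OF R3(1)] triD[OF R3(3)] and D2 = triD[OF R2(1)] triD[OF R2(3)] and D1 = triD[OF R1(1)] triD[OF R1(3)]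
  have hD: "?h i \<in> arr C" "tgt C (?h i) = tgt C f" if "i \<in> {-2, -1, 0, 1}" for i
    using weight_decompositionD[OF dec[OF that]] triD(1)[OF weight_decompositionD(1)[OF dec[OF that]]] by simp_all
  have h: "h3 \<in> arr C" "h2 \<in> arr C" "h1 \<in> arr C" "h0 \<in> arr C" using hD(1)[of 1] hD(1)[of 0] hD(1)[of "-1"] hD(1)[of "-2"] by (simp_all add: sel)
  have sh: "src C h2 = src C j2" "src C h1 = src C j1" "src C h0 = src C j0"
    using h D3 D2 D1 R3(2) R2(2) R1(2) by (simp_all add: h2_def h1_def h0_def)
  obtain Z where Z0: "weight_tower C w (tgt C f) Z" "\<forall>i\<in>{-2, -1, 0, 1}. th Z i = ?h i"
    "\<forall>i\<in>{-2, -1, 0}. tc Z (i + 1) = sel j0 c1 c2 c3 (i + 1) \<and> te Z i = sel e0 e1 e2 e2 i"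
  proof (rule ex_weight_tower_extending[OF tgt_obj[OF t(1)] dec])
    fix i :: int assume "i \<in> {-2, -1, 0}"
    then consider "i = -2" | "i = -1" | "i = 0" by auto
    then show "i \<in> {-2, -1, 0, 1} \<and> i + 1 \<in> {-2, -1, 0, 1} \<and>
        sel j0 j1 j2 j2 i \<in> homs C (src C (?h i)) (src C (?h (i + 1))) \<and>
        ?h (i + 1) \<cdot> sel j0 j1 j2 j2 i = ?h i \<and> (sel j0 j1 j2 j2 i, sel j0 c1 c2 c3 (i + 1), sel e0 e1 e2 e2 i) \<in> tri C"
      by cases (use sh D1 D2 D3 R1 R2 R3 in \<open>simp_all add: sel in_homs flip: h0_def h1_def h2_def\<close>)
  qed (assumption, rule that)
  note Z = Z0(1) bspec[OF Z0(2)] bspec[OF Z0(3)]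
  have thZ: "th Z (-2) = h0" "th Z (-1) = h1" "th Z 0 = h2" "th Z 1 = h3"
    and tcZ: "tc Z (-1) = c1" "tc Z 0 = c2" "tc Z 1 = c3" "te Z (-2) = e0" "te Z (-1) = e1" "te Z 0 = e2"
    using Z(2) Z(3)[of "-2"] Z(3)[of "-1"] Z(3)[of 0] by (simp_all add: sel)
  note tcS = weight_towerD_tc[OF S] and tcU = weight_towerD_tc[OF U] and tcZ' = weight_towerD_tc[OF Z(1)]
  have A: "?\<alpha> i \<in> arr C" "?\<beta> i \<in> arr C" "src C (?\<alpha> i) = src C (th S i)" "tgt C (?\<alpha> i) = src C (?h i)"
    "src C (?\<beta> i) = src C (?h i)" "tgt C (?\<beta> i) = src C (th U i)"
    "?h i \<cdot> ?\<alpha> i = f \<cdot> th S i" "th U i \<cdot> ?\<beta> i = g \<cdot> ?h i" if i: "i \<in> {-2, -1, 0, 1}" for i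
  proof -
    obtain \<gamma> where "(?\<alpha> i, ?\<beta> i, \<gamma>) \<in> tri C" "src C (?\<alpha> i) = src C (th S i)" "tgt C (?\<alpha> i) = src C (?h i)"
      "tgt C (?\<beta> i) = src C (th U i)" "?h i \<cdot> ?\<alpha> i = f \<cdot> th S i" "th U i \<cdot> ?\<beta> i = g \<cdot> ?h i"
      using HH[OF i] unfolding horseshoe_def by (elim conjE exE)
    moreover note triD[OF this(1)]
    ultimately show "?\<alpha> i \<in> arr C" "?\<beta> i \<in> arr C" "src C (?\<alpha> i) = src C (th S i)" "tgt C (?\<alpha> i) = src C (?h i)"
      "src C (?\<beta> i) = src C (?h i)" "tgt C (?\<beta> i) = src C (th U i)"
      "?h i \<cdot> ?\<alpha> i = f \<cdot> th S i" "th U i \<cdot> ?\<beta> i = g \<cdot> ?h i" by simp_all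
  qed
  obtain a b where ab: "tower_morphism C S Z f a b" "\<forall>i\<in>{-1, 0, 1}. b i = sel b1 b1 b2 b3 i"
  proof (rule ex_tower_morphism_extending[OF S Z(1) t(1) refl refl])
    fix i :: int assume i: "i \<in> {-2, -1, 0, 1}"
    show "?\<alpha> i \<in> homs C (src C (th S i)) (src C (th Z i)) \<and> th Z i \<cdot> ?\<alpha> i = f \<cdot> th S i"
      unfolding Z(2)[OF i] using A[OF i] by (simp add: in_homs)
  next
    fix i :: int assume "i \<in> {-1, 0, 1}"
    then consider "i = -1" | "i = 0" | "i = 1" by auto
    then show "i \<in> {-2, -1, 0, 1} \<and> i - 1 \<in> {-2, -1, 0, 1} \<and> sel b1 b1 b2 b3 i \<in> homs C (tgt C (tc S i)) (tgt C (tc Z i)) \<and>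
      tc Z i \<cdot> ?\<alpha> i = sel b1 b1 b2 b3 i \<cdot> tc S i \<and> te Z (i - 1) \<cdot> sel b1 b1 b2 b3 i = shA C 1 (?\<alpha> (i - 1)) \<cdot> te S (i - 1)"
      by cases (use D1 D2 D3 R1 R2 R3 in \<open>simp_all add: sel in_homs tcZ\<close>)
  qed (rule that)
  obtain a' b' where ab': "tower_morphism C Z U g a' b'" "\<forall>i\<in>{-1, 0, 1}. b' i = sel b'1 b'1 b'2 b'3 i"
  proof (rule ex_tower_morphism_extending[OF Z(1) U t(2) t(4) refl])
    fix i :: int assume i: "i \<in> {-2, -1, 0, 1}"
    show "?\<beta> i \<in> homs C (src C (th Z i)) (src C (th U i)) \<and> th U i \<cdot> ?\<beta> i = g \<cdot> th Z i"
      unfolding Z(2)[OF i] using A[OF i] by (simp add: in_homs)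
  next
    fix i :: int assume "i \<in> {-1, 0, 1}"
    then consider "i = -1" | "i = 0" | "i = 1" by auto
    then show "i \<in> {-2, -1, 0, 1} \<and> i - 1 \<in> {-2, -1, 0, 1} \<and> sel b'1 b'1 b'2 b'3 i \<in> homs C (tgt C (tc Z i)) (tgt C (tc U i)) \<and>
      tc U i \<cdot> ?\<beta> i = sel b'1 b'1 b'2 b'3 i \<cdot> tc Z i \<and> te U (i - 1) \<cdot> sel b'1 b'1 b'2 b'3 i = shA C 1 (?\<beta> (i - 1)) \<cdot> te Z (i - 1)"
      by cases (use D1 D2 D3 R1 R2 R3 in \<open>simp_all add: sel in_homs tcZ\<close>)
  qed (rule that)
  show thesis
  proof (rule that[OF Z(1) ab(1) ab'(1)], rule ballI)
    fix i :: int assume i: "i \<in> {-1, 0, 1}"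
    then consider "i = -1" | "i = 0" | "i = 1" by auto
    then have "\<exists>\<delta>. (b i, b' i, \<delta>) \<in> tri C \<and> src C (b i) = tgt C (tc S i) \<and> tgt C (b' i) = tgt C (tc U i)"
      by cases (use bspec[OF ab(2) i] bspec[OF ab'(2) i] R1 R2 R3 in \<open>auto simp: sel\<close>)
    then obtain \<delta> where \<delta>: "(b i, b' i, \<delta>) \<in> tri C" "src C (b i) = tgt C (tc S i)" "tgt C (b' i) = tgt C (tc U i)" by blast
    note D = triD[OF \<delta>(1)]
    \<comment> \<open>The connecting arrow goes from weight at most \<open>i\<close> to weight at
      least \<open>i + 1\<close>, so it vanishes and the triangle of terms splits.\<close>
    have "shO C 1 (src C (b i)) \<in> wge C w (i + 1)"
      using \<delta>(2) weight_tower_term(2)[OF S, of i] tcS(6) by (simp add: shO_wge_iff)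
    moreover have "tgt C (b' i) \<in> wle C w i" using \<delta>(3) weight_tower_term(1)[OF U, of i] by simp
    ultimately have "\<delta> = pzero C (tgt C (b' i)) (shO C 1 (src C (b i)))"
      using D by (intro weight_orthogonal[of "tgt C (b' i)" i _ "i + 1"]) simp_all
    then show "(b i, b' i, pzero C (tgt C (b' i)) (shO C 1 (src C (b i)))) \<in> tri C" using \<delta>(1) by simp
  qed
qed

end

section \<open>Exact pairs under isomorphisms and signs, and exactness of the pure functor\<close>

context abelian_category
begin

lemma exact_pair_iso:
  assumes e: "exact_pair D f g" and \<phi>: "\<phi> \<in> arr D" "src D \<phi> = tgt D f" and \<psi>: "\<psi> \<in> arr D" "src D \<psi> = tgt D \<phi>" "tgt D \<psi> = tgt D f"
    and i: "\<psi> \<cdot> \<phi> = idt D (tgt D f)" "\<phi> \<cdot> \<psi> = idt D (tgt D \<phi>)"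
  shows "exact_pair D (\<phi> \<cdot> f) (g \<cdot> \<psi>)"
proof (rule exact_pairI)
  note z = exact_pairD_zero[OF e]
  show "\<phi> \<cdot> f \<in> arr D" "g \<cdot> \<psi> \<in> arr D" "src D (g \<cdot> \<psi>) = tgt D (\<phi> \<cdot> f)" using z \<phi> \<psi> by simp_all
  have "g \<cdot> \<psi> \<cdot> (\<phi> \<cdot> f) = g \<cdot> f" using z(1-3) \<phi> \<psi> by (simp add: cmp_reassoc[OF i(1)])
  then show "g \<cdot> \<psi> \<cdot> (\<phi> \<cdot> f) = pzero D (src D (\<phi> \<cdot> f)) (tgt D (g \<cdot> \<psi>))" using z \<phi> \<psi> by simp
  fix x assume x: "x \<in> arr D" "tgt D x = tgt D (\<phi> \<cdot> f)" "g \<cdot> \<psi> \<cdot> x = pzero D (src D x) (tgt D (g \<cdot> \<psi>))"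
  have x2: "tgt D x = tgt D \<phi>" using x z \<phi> by simp
  have zx: "g \<cdot> (\<psi> \<cdot> x) = pzero D (src D x) (tgt D g)" using x(1,3) x2 z(1-3) \<phi> \<psi> by simp
  obtain p y where p: "is_epi D p" "p \<in> arr D" "tgt D p = src D x" "y \<in> arr D" "src D y = src D p"
    "tgt D y = src D f" "\<psi> \<cdot> x \<cdot> p = f \<cdot> y"
    by (rule exact_pairD_lift[OF e _ _ _ zx]) (use x(1) x2 \<psi> in simp_all)
  have "x \<cdot> p = \<phi> \<cdot> (\<psi> \<cdot> x \<cdot> p)" using x(1) x2 p(1-3) \<phi> \<psi> by (simp add: cmp_reassoc[OF i(2)])
  also have "\<dots> = \<phi> \<cdot> f \<cdot> y" unfolding p(7) using p(4-6) z \<phi> by simp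
  finally show "\<exists>e y. is_epi D e \<and> tgt D e = src D x \<and> y \<in> arr D \<and> src D y = src D e \<and> tgt D y = src D (\<phi> \<cdot> f) \<and> x \<cdot> e = \<phi> \<cdot> f \<cdot> y"
    using p z \<phi> by (intro exI[of _ p] exI[of _ y]) simp
qed

lemma exact_pair_pneg_right:
  assumes e: "exact_pair D f (pneg D g)" and g: "g \<in> arr D"
  shows "exact_pair D f g"
proof (rule exact_pairI)
  note z = exact_pairD_zero[OF e]
  show "f \<in> arr D" "g \<in> arr D" "src D g = tgt D f" using z g by simp_all
  then show "g \<cdot> f = pzero D (src D f) (tgt D g)" using z(4) by simp
  fix x assume x: "x \<in> arr D" "tgt D x = tgt D f" "g \<cdot> x = pzero D (src D x) (tgt D g)"
  have zx: "pneg D g \<cdot> x = pzero D (src D x) (tgt D (pneg D g))" using x z g by simp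
  obtain p y where p: "is_epi D p" "p \<in> arr D" "tgt D p = src D x" "y \<in> arr D" "src D y = src D p"
    "tgt D y = src D f" "x \<cdot> p = f \<cdot> y"
    by (rule exact_pairD_lift[OF e x(1,2) refl zx])
  then show "\<exists>e y. is_epi D e \<and> tgt D e = src D x \<and> y \<in> arr D \<and> src D y = src D e \<and> tgt D y = src D f \<and> x \<cdot> e = f \<cdot> y"
    by (intro exI[of _ p] exI[of _ y] conjI)
qed

lemma exact_pair_pneg_left:
  assumes e: "exact_pair D (pneg D f) g" and f: "f \<in> arr D"
  shows "exact_pair D f g"
proof (rule exact_pairI)
  note z = exact_pairD_zero[OF e]
  show "f \<in> arr D" "g \<in> arr D" "src D g = tgt D f" using z f by simp_all
  then show "g \<cdot> f = pzero D (src D f) (tgt D g)" using z(4) by simp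
  fix x assume x: "x \<in> arr D" "tgt D x = tgt D f" "g \<cdot> x = pzero D (src D x) (tgt D g)"
  have x2: "tgt D x = tgt D (pneg D f)" using x f by simp
  obtain p y where p: "is_epi D p" "p \<in> arr D" "tgt D p = src D x" "y \<in> arr D" "src D y = src D p"
    "tgt D y = src D (pneg D f)" "x \<cdot> p = pneg D f \<cdot> y"
    by (rule exact_pairD_lift[OF e x(1) x2 refl x(3)])
  show "\<exists>e y. is_epi D e \<and> tgt D e = src D x \<and> y \<in> arr D \<and> src D y = src D e \<and> tgt D y = src D f \<and> x \<cdot> e = f \<cdot> y"
    using p f by (intro exI[of _ p] exI[of _ "pneg D y"]) simp
qed

end

context pure_setting
begin

text \<open>Rotations of a triangle are triangles, so exactness at one place for all triangles
  covers the other places; the signs brought in by rotations and shifts do not affect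
  exactness.\<close>

lemma homologicalI:
  assumes H: "H \<in> additive_functors C D"
    and ex: "\<And>f g h. (f, g, h) \<in> tri C \<Longrightarrow> exact_pair D (farr H f) (farr H g)"
  shows "H \<in> homological_functors C D"
proof -
  interpret H: additive_functor_on C D "obj C" H
    by (rule additive_functor_onI[OF additive_category_axioms D.additive_category_axioms H])
  have 1: "exact_pair D (farr H (shA C n f)) (farr H (shA C n g))" if T: "(f, g, h) \<in> tri C" for f g h n
    using tri_shift[OF T, of n]
  proof
    assume "(shA C n f, shA C n g, shA C n h) \<in> tri C"
    then show ?thesis by (rule ex)
  next
    assume *: "(pneg C (shA C n f), pneg C (shA C n g), pneg C (shA C n h)) \<in> tri C"
    note t = triD[OF T]
    have "exact_pair D (pneg D (farr H (shA C n f))) (pneg D (farr H (shA C n g)))"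
      using ex[OF *] t by (simp add: H.farr_pneg)
    then have "exact_pair D (pneg D (farr H (shA C n f))) (farr H (shA C n g))"
      by (rule D.exact_pair_pneg_right) (use t in simp)
    then show ?thesis by (rule D.exact_pair_pneg_left) (use t in simp)
  qed
  have "exact_pair D (farr H (shA C n h)) (farr H (shA C (n + 1) f))" if T: "(f, g, h) \<in> tri C" for f g h n
  proof -
    note t = triD[OF T]
    have "exact_pair D (farr H (shA C n h)) (pneg D (farr H (shA C (n + 1) f)))"
      using 1[OF tri_rot[OF tri_rot[OF T]], of n] t by (simp add: H.farr_pneg)
    then show ?thesis by (rule D.exact_pair_pneg_right) (use t in simp)
  qed
  note 2 = this
  show ?thesis unfolding homological_functors_def
  proof (intro CollectI conjI H ballI)
    fix x assume "x \<in> tri C"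
    then obtain f g h where x: "x = (f, g, h)" and T: "(f, g, h) \<in> tri C" by (cases x) auto
    show "case x of (f, g, h) \<Rightarrow> \<forall>n. exact_pair D (farr H (shA C n f)) (farr H (shA C n g)) \<and>
      exact_pair D (farr H (shA C n g)) (farr H (shA C n h)) \<and> exact_pair D (farr H (shA C n h)) (farr H (shA C (n + 1) f))"
      unfolding x prod.case by (intro allI conjI 1[OF T] 1[OF tri_rot[OF T]] 2[OF T])
  qed
qed

end

context heart_functor
begin

lemma exact_pmap_horseshoe:
  assumes S: "weight_tower C w (src C f) S" and U: "weight_tower C w (tgt C g) U" and T: "(f, g, k) \<in> tri C"
  obtains Z where "weight_tower C w (tgt C f) Z" "exact_pair D (pmap S Z f) (pmap Z U g)"
proof -
  note t = triD[OF T]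
  obtain Z a b a' b' where Z: "weight_tower C w (tgt C f) Z" and ab: "tower_morphism C S Z f a b"
    and ab': "tower_morphism C Z U g a' b'"
    and sp': "\<forall>i\<in>{-1, 0, 1}. (b i, b' i, pzero C (tgt C (b' i)) (shO C 1 (src C (b i)))) \<in> tri C"
    by (rule horseshoe_lemma[OF S U T])
  note sp = bspec[OF sp']
  note c = complex_arrs[OF S] complex_arrs[OF Z] complex_arrs[OF U]
  note ch = tower_morphism_chain[OF S Z ab] and ch' = tower_morphism_chain[OF Z U ab']
  note m = tower_morphismD(4-6)[OF ab] note m' = tower_morphismD(4-6)[OF ab']
  note o = term_weq[OF S] term_weq[OF Z] term_weq[OF U] weight_towerD_tc(6)[OF S] weight_towerD_tc(6)[OF Z] weight_towerD_tc(6)[OF U]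
  \<comment> \<open>\<open>A\<close> preserves these splittings. In degree zero both halves give
    exactness in the middle; index \<open>1\<close> is cohomological degree \<open>-1\<close>, where
    a section yields an epimorphism, and index \<open>-1\<close> is degree \<open>1\<close>, where a
    retraction yields a monomorphism.\<close>
  obtain \<sigma> \<rho> where \<sigma>: "\<sigma> \<in> arr C" "src C \<sigma> = tgt C (b' 0)" "tgt C \<sigma> = src C (b' 0)" and
    \<rho>: "\<rho> \<in> arr C" "src C \<rho> = tgt C (b 0)" "tgt C \<rho> = src C (b 0)" and
    e: "idt C (tgt C (b 0)) \<boxminus> \<sigma> \<cdot> b' 0 = b 0 \<cdot> \<rho>"
    by (rule tri_split[OF sp[of 0]]) auto
  obtain \<sigma>1 where \<sigma>1: "\<sigma>1 \<in> arr C" "src C \<sigma>1 = tgt C (b' 1)" "tgt C \<sigma>1 = src C (b' 1)" "b' 1 \<cdot> \<sigma>1 = idt C (tgt C (b' 1))"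
    by (rule tri_split[OF sp[of 1]]) auto
  obtain \<rho>1 where \<rho>1: "\<rho>1 \<in> arr C" "src C \<rho>1 = tgt C (b (-1))" "tgt C \<rho>1 = src C (b (-1))" "\<rho>1 \<cdot> b (-1) = idt C (src C (b (-1)))"
    by (rule tri_split[OF sp[of "-1"]]) auto
  have "exact_pair D (pmap S Z f) (pmap Z U g)"
  proof (rule D.exact_on_homology[OF homology_data[OF S] homology_data[OF Z] homology_data[OF U]
        is_complex[OF S] is_complex[OF Z] is_complex[OF U]])
    show "sq_map D (hK S) (hQ S) (hK Z) (hQ Z) (farr A (b 0)) (pmap S Z f)"
      by (rule sq_map_pmap[OF S Z t(1) refl refl ab])
    show "sq_map D (hK Z) (hQ Z) (hK U) (hQ U) (farr A (b' 0)) (pmap Z U g)"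
      by (rule sq_map_pmap[OF Z U t(2) t(4) refl ab'])
    show "farr A (b 0) \<in> arr D" "src D (farr A (b 0)) = src D (d0 S)" "tgt D (farr A (b 0)) = src D (d0 Z)"
      using ch(5) by (simp_all add: in_homs)
    show "farr A (b' 0) \<in> arr D" "src D (farr A (b' 0)) = src D (d0 Z)" "tgt D (farr A (b' 0)) = src D (d0 U)"
      using ch'(5) by (simp_all add: in_homs)
    show "farr A \<rho> \<in> arr D" "src D (farr A \<rho>) = src D (d0 Z)" "tgt D (farr A \<rho>) = src D (d0 S)"
      using \<rho> m[of 0] o c by simp_all
    have e': "farr A (b 0) \<cdot>\<^bsub>D\<^esub> farr A \<rho> = idt D (fobj A (tgt C (b 0))) \<boxminus>\<^bsub>D\<^esub> farr A \<sigma> \<cdot>\<^bsub>D\<^esub> farr A (b' 0)"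
      using arg_cong[OF e, of "farr A"] \<rho> \<sigma> m[of 0] m'[of 0] o by (simp add: A.farr_cmp A.farr_pdiff)
    fix z assume z: "z \<in> arr D" "tgt D z = src D (d0 Z)" "farr A (b' 0) \<cdot>\<^bsub>D\<^esub> z = pzero D (src D z) (src D (d0 U))"
    have "farr A (b 0) \<cdot>\<^bsub>D\<^esub> (farr A \<rho> \<cdot>\<^bsub>D\<^esub> z) = (idt D (fobj A (tgt C (b 0))) \<boxminus>\<^bsub>D\<^esub> farr A \<sigma> \<cdot>\<^bsub>D\<^esub> farr A (b' 0)) \<cdot>\<^bsub>D\<^esub> z"
      by (rule D.cmp_reassoc[OF e']) (use z(1,2) \<rho> m[of 0] m'[of 0] o c in simp_all)
    also have "\<dots> = z" using z \<sigma> m[of 0] m'[of 0] o c by simp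
    finally show "farr A (b 0) \<cdot>\<^bsub>D\<^esub> (farr A \<rho> \<cdot>\<^bsub>D\<^esub> z) = z" .
  next
    have "b' 0 \<cdot> b 0 = pzero C (src C (b 0)) (tgt C (b' 0))" by (rule tri_cmp_zero[OF sp[of 0]]) simp
    then have "farr A (b' 0 \<cdot> b 0) = farr A (pzero C (src C (b 0)) (tgt C (b' 0)))" by simp
    then show "farr A (b' 0) \<cdot>\<^bsub>D\<^esub> farr A (b 0) = pzero D (src D (d0 S)) (src D (d0 U))"
      using m[of 0] m'[of 0] o c by (subst (asm) A.farr_cmp) simp_all
  next
    have oo: "shO C 1 (src C (b (-1))) = wc_obj C S 1" "shO C 1 (tgt C (b (-1))) = wc_obj C Z 1"
      using m[of "-1"] by (simp_all add: wc_obj_def)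
    have "farr A (shA C 1 \<rho>1) \<cdot>\<^bsub>D\<^esub> farr A (shA C 1 (b (-1))) = farr A (shA C 1 (\<rho>1 \<cdot> b (-1)))"
      using \<rho>1(1-3) m[of "-1"] oo wc_obj_weq[OF S, of 1] wc_obj_weq[OF Z, of 1] by (simp add: A.farr_cmp)
    also have "\<dots> = idt D (fobj A (wc_obj C S 1))" unfolding \<rho>1(4) using m[of "-1"] oo o wc_obj_weq[OF S, of 1] by simp
    finally show "is_mono D (farr A (wc_map C b 1))"
      unfolding wc_map_def
      by (rule D.split_mono_is_mono)
        (use \<rho>1(1-3) m[of "-1"] oo wc_obj_weq[OF S, of 1] wc_obj_weq[OF Z, of 1] in simp_all)
    show "src D (farr A (wc_map C b 1)) = tgt D (d0 S)" "tgt D (farr A (wc_map C b 1)) = tgt D (d0 Z)"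
      using ch(4) by (simp_all add: in_homs)
    show "farr A (wc_map C b 1) \<cdot>\<^bsub>D\<^esub> d0 S = d0 Z \<cdot>\<^bsub>D\<^esub> farr A (b 0)" using ch(1) by simp
  next
    have oo: "shO C (-1) (src C (b' 1)) = wc_obj C Z (-1)" "shO C (-1) (tgt C (b' 1)) = wc_obj C U (-1)"
      using m'[of 1] by (simp_all add: wc_obj_def)
    have "farr A (shA C (-1) (b' 1)) \<cdot>\<^bsub>D\<^esub> farr A (shA C (-1) \<sigma>1) = farr A (shA C (-1) (b' 1 \<cdot> \<sigma>1))"
      using \<sigma>1(1-3) m'[of 1] oo wc_obj_weq[OF Z, of "-1"] wc_obj_weq[OF U, of "-1"] by (simp add: A.farr_cmp)
    also have "\<dots> = idt D (fobj A (wc_obj C U (-1)))" unfolding \<sigma>1(4) using m'[of 1] oo o wc_obj_weq[OF U, of "-1"] by simp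
    finally show "is_epi D (farr A (wc_map C b' (-1)))"
      unfolding wc_map_def minus_minus
      by (rule D.split_epi_is_epi)
        (use \<sigma>1(1-3) m'[of 1] oo wc_obj_weq[OF Z, of "-1"] wc_obj_weq[OF U, of "-1"] in simp_all)
    show "src D (farr A (wc_map C b' (-1))) = src D (dm Z)" "tgt D (farr A (wc_map C b' (-1))) = src D (dm U)"
      using ch'(3) by (simp_all add: in_homs)
    show "farr A (b' 0) \<cdot>\<^bsub>D\<^esub> dm Z = dm U \<cdot>\<^bsub>D\<^esub> farr A (wc_map C b' (-1))" by (rule ch'(2))
  qed
  then show thesis by (rule that[OF Z])
qed

text \<open>The horseshoe tower of the middle object need not be the given \<open>Z\<close>; the
  isomorphism that the identity induces between their homologies carries exactness over.\<close>

lemma exact_pmap: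
  assumes S: "weight_tower C w (src C f) S" and Z: "weight_tower C w (tgt C f) Z" and U: "weight_tower C w (tgt C g) U"
    and T: "(f, g, k) \<in> tri C"
  shows "exact_pair D (pmap S Z f) (pmap Z U g)"
proof -
  note t = triD[OF T]
  obtain Z' where Z': "weight_tower C w (tgt C f) Z'" "exact_pair D (pmap S Z' f) (pmap Z' U g)"
    by (rule exact_pmap_horseshoe[OF S U T])
  let ?i = "idt C (tgt C f)"
  have i: "?i \<in> arr C" "src C ?i = tgt C f" "tgt C ?i = tgt C f" using t by simp_all
  note p = pmap_simps[OF S Z'(1) t(1) refl refl] pmap_simps[OF Z'(1) Z i] pmap_simps[OF Z Z'(1) i]
  have "exact_pair D (pmap Z' Z ?i \<cdot>\<^bsub>D\<^esub> pmap S Z' f) (pmap Z' U g \<cdot>\<^bsub>D\<^esub> pmap Z Z' ?i)"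
    by (rule D.exact_pair_iso[OF Z'(2)]) (use p pmap_change(1)[OF Z'(1) Z] pmap_change(1)[OF Z Z'(1)] in simp_all)
  moreover have "pmap Z' Z ?i \<cdot>\<^bsub>D\<^esub> pmap S Z' f = pmap S Z f"
    using pmap_cmp[OF S Z'(1) Z t(1) refl refl i] t by simp
  moreover have "pmap Z' U g \<cdot>\<^bsub>D\<^esub> pmap Z Z' ?i = pmap Z U g"
    using pmap_cmp[OF Z Z'(1) U i t(2) t(4) refl] t by simp
  ultimately show ?thesis by simp
qed

lemma pure_functor_homological:
  assumes T: "tower_choice C w T"
  shows "pure_functor C D T A \<in> homological_functors C D"
proof (rule homologicalI[OF pure_functor_additive[OF T]])
  fix f g h assume *: "(f, g, h) \<in> tri C"
  note t = triD[OF *] and tT = tower_choiceD[OF T]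
  show "exact_pair D (farr (pure_functor C D T A) f) (farr (pure_functor C D T A) g)"
    using exact_pmap[OF tT tT tT *] t by (simp add: pure_functor_simps)
qed

end

section \<open>Functor categories\<close>

lemma is_functorD:
  assumes "is_functor C D F"
  shows "X \<in> obj C \<Longrightarrow> fobj F X \<in> obj D"
    "f \<in> arr C \<Longrightarrow> farr F f \<in> arr D"
    "f \<in> arr C \<Longrightarrow> src D (farr F f) = fobj F (src C f)"
    "f \<in> arr C \<Longrightarrow> tgt D (farr F f) = fobj F (tgt C f)"
    "X \<in> obj C \<Longrightarrow> farr F (idt C X) = idt D (fobj F X)"
    "f \<in> arr C \<Longrightarrow> g \<in> arr C \<Longrightarrow> tgt C f = src C g \<Longrightarrow> farr F (g \<cdot>\<^bsub>C\<^esub> f) = farr F g \<cdot>\<^bsub>D\<^esub> farr F f"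
  using assms by (auto simp: is_functor_def)

lemma is_natD:
  assumes "is_nat C D F G t"
  shows "X \<in> obj C \<Longrightarrow> t X \<in> arr D" "X \<in> obj C \<Longrightarrow> src D (t X) = fobj F X" "X \<in> obj C \<Longrightarrow> tgt D (t X) = fobj G X"
    "f \<in> arr C \<Longrightarrow> t (tgt C f) \<cdot>\<^bsub>D\<^esub> farr F f = farr G f \<cdot>\<^bsub>D\<^esub> t (src C f)"
    "t \<in> extensional (obj C)"
  using assms by (auto simp: is_nat_def in_homs)

lemma is_nat_cmp:
  assumes "category C" "category D" "is_functor C D F" "is_functor C D G" "is_functor C D H"
    "is_nat C D F G t" "is_nat C D G H s"
  shows "is_nat C D F H (\<lambda>X \<in> obj C. s X \<cdot>\<^bsub>D\<^esub> t X)"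
  unfolding is_nat_def
proof (intro conjI ballI)
  interpret C: category C by fact
  interpret D: category D by fact
  note F = is_functorD[OF assms(3)] and G = is_functorD[OF assms(4)] and H = is_functorD[OF assms(5)]
  note t = is_natD[OF assms(6)] and s = is_natD[OF assms(7)]
  show "(\<lambda>X \<in> obj C. s X \<cdot>\<^bsub>D\<^esub> t X) X \<in> homs D (fobj F X) (fobj H X)" if "X \<in> obj C" for X
    using that t s by (simp add: in_homs)
  fix f assume f: "f \<in> arr C"
  have "s (tgt C f) \<cdot>\<^bsub>D\<^esub> t (tgt C f) \<cdot>\<^bsub>D\<^esub> farr F f = s (tgt C f) \<cdot>\<^bsub>D\<^esub> (farr G f \<cdot>\<^bsub>D\<^esub> t (src C f))"
    unfolding t(4)[OF f, symmetric] using f t(1-3) s(1-3) F by simp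
  also have "\<dots> = farr H f \<cdot>\<^bsub>D\<^esub> s (src C f) \<cdot>\<^bsub>D\<^esub> t (src C f)"
    by (rule D.cmp_reassoc[OF s(4)[OF f]]) (use f t(1-3) s(1-3) G in simp_all)
  also have "\<dots> = farr H f \<cdot>\<^bsub>D\<^esub> (s (src C f) \<cdot>\<^bsub>D\<^esub> t (src C f))"
    using f t(1-3) s(1-3) H by simp
  finally show "(\<lambda>X \<in> obj C. s X \<cdot>\<^bsub>D\<^esub> t X) (tgt C f) \<cdot>\<^bsub>D\<^esub> farr F f =
      farr H f \<cdot>\<^bsub>D\<^esub> (\<lambda>X \<in> obj C. s X \<cdot>\<^bsub>D\<^esub> t X) (src C f)" using f by simp
qed simp

lemma is_nat_idt:
  assumes "category C" "category D" "is_functor C D F"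
  shows "is_nat C D F F (\<lambda>X \<in> obj C. idt D (fobj F X))"
proof -
  interpret C: category C by fact
  interpret D: category D by fact
  note F = is_functorD[OF assms(3)]
  show ?thesis unfolding is_nat_def using F by (simp add: in_homs)
qed

lemma is_nat_iso_inverse:
  assumes "category C" "category D" "is_functor C D F" "is_functor C D G" "is_nat_iso C D F G t"
  obtains s where "is_nat_iso C D G F s" "\<forall>X \<in> obj C. s X \<cdot>\<^bsub>D\<^esub> t X = idt D (fobj F X)"
    "\<forall>X \<in> obj C. t X \<cdot>\<^bsub>D\<^esub> s X = idt D (fobj G X)"
proof -
  interpret C: category C by fact
  interpret D: category D by fact
  note F = is_functorD[OF assms(3)] and G = is_functorD[OF assms(4)]
  have nt: "is_nat C D F G t" using assms(5) by (simp add: is_nat_iso_def)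
  note t = is_natD[OF nt]
  define y where "y X = (SOME y. y \<in> homs D (tgt D (t X)) (src D (t X)) \<and>
    y \<cdot>\<^bsub>D\<^esub> t X = idt D (src D (t X)) \<and> t X \<cdot>\<^bsub>D\<^esub> y = idt D (tgt D (t X)))" for X
  have y: "y X \<in> arr D" "src D (y X) = fobj G X" "tgt D (y X) = fobj F X" "y X \<cdot>\<^bsub>D\<^esub> t X = idt D (fobj F X)"
    "t X \<cdot>\<^bsub>D\<^esub> y X = idt D (fobj G X)" if X: "X \<in> obj C" for X
  proof -
    have "is_iso D (t X)" using assms(5) X by (simp add: is_nat_iso_def)
    then have "\<exists>y. y \<in> homs D (tgt D (t X)) (src D (t X)) \<and>
      y \<cdot>\<^bsub>D\<^esub> t X = idt D (src D (t X)) \<and> t X \<cdot>\<^bsub>D\<^esub> y = idt D (tgt D (t X))"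
      unfolding is_iso_def by blast
    from someI_ex[OF this] show "y X \<in> arr D" "src D (y X) = fobj G X" "tgt D (y X) = fobj F X"
      "y X \<cdot>\<^bsub>D\<^esub> t X = idt D (fobj F X)" "t X \<cdot>\<^bsub>D\<^esub> y X = idt D (fobj G X)"
      unfolding y_def[symmetric] using t(2,3)[OF X] by (simp_all add: in_homs)
  qed
  show thesis
  proof (rule that[of "\<lambda>X \<in> obj C. y X"])
    show "is_nat_iso C D G F (\<lambda>X \<in> obj C. y X)"
      unfolding is_nat_iso_def is_nat_def
    proof (intro conjI ballI)
      fix X assume X: "X \<in> obj C"
      show "(\<lambda>X \<in> obj C. y X) X \<in> homs D (fobj G X) (fobj F X)" using X y by (simp add: in_homs)
      show "is_iso D ((\<lambda>X \<in> obj C. y X) X)"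
        using X y t(1-3)[OF X] D.is_isoI[of "y X" "t X" "fobj G X" "fobj F X"] by simp
    next
      fix f assume f: "f \<in> arr C"
      note o = C.src_obj[OF f] C.tgt_obj[OF f]
      have "y (tgt C f) \<cdot>\<^bsub>D\<^esub> farr G f = y (tgt C f) \<cdot>\<^bsub>D\<^esub> (farr G f \<cdot>\<^bsub>D\<^esub> (t (src C f) \<cdot>\<^bsub>D\<^esub> y (src C f)))"
        using y(5)[OF o(1)] y(1-3)[OF o(2)] G f by simp
      also have "\<dots> = y (tgt C f) \<cdot>\<^bsub>D\<^esub> (t (tgt C f) \<cdot>\<^bsub>D\<^esub> farr F f \<cdot>\<^bsub>D\<^esub> y (src C f))"
        unfolding t(4)[OF f] using y(1-3)[OF o(1)] t(1-3)[OF o(1)] G f by simp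
      also have "\<dots> = y (tgt C f) \<cdot>\<^bsub>D\<^esub> t (tgt C f) \<cdot>\<^bsub>D\<^esub> (farr F f \<cdot>\<^bsub>D\<^esub> y (src C f))"
        using y(1-3)[OF o(1)] y(1-3)[OF o(2)] t(1-3)[OF o(2)] F f by simp
      also have "\<dots> = farr F f \<cdot>\<^bsub>D\<^esub> y (src C f)"
        unfolding y(4)[OF o(2)] using y(1-3)[OF o(1)] F f by simp
      finally show "(\<lambda>X \<in> obj C. y X) (tgt C f) \<cdot>\<^bsub>D\<^esub> farr G f = farr F f \<cdot>\<^bsub>D\<^esub> (\<lambda>X \<in> obj C. y X) (src C f)"
        using o by simp
    qed simp
  qed (use y in simp_all)
qed

lemma functor_cat_simps [simp]:
  "obj (functor_cat C D S) = S" "src (functor_cat C D S) = nsrc" "tgt (functor_cat C D S) = ntgt"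
  "idt (functor_cat C D S) F = \<lparr>nsrc = F, ntgt = F, ncomp = (\<lambda>X \<in> obj C. idt D (fobj F X))\<rparr>"
  "cmp (functor_cat C D S) t s = \<lparr>nsrc = nsrc s, ntgt = ntgt t, ncomp = (\<lambda>X \<in> obj C. ncomp t X \<cdot>\<^bsub>D\<^esub> ncomp s X)\<rparr>"
  "t \<in> arr (functor_cat C D S) \<longleftrightarrow> nsrc t \<in> S \<and> ntgt t \<in> S \<and> is_nat C D (nsrc t) (ntgt t) (ncomp t)"
  by (simp_all add: functor_cat_def)

lemma nattrans_eqI:
  assumes "nsrc t = nsrc s" "ntgt t = ntgt s" "ncomp t \<in> extensional A" "ncomp s \<in> extensional A"
    "\<And>X. X \<in> A \<Longrightarrow> ncomp t X = ncomp s X"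
  shows "t = (s :: ('o, 'm, 'p, 'q) nattrans)"
proof -
  have "ncomp t = ncomp s" using assms(3-5) by (rule extensionalityI)
  with assms(1,2) show ?thesis by simp
qed

lemma category_functor_cat:
  assumes "category C" "category D" and S: "\<And>F. F \<in> S \<Longrightarrow> is_functor C D F"
  shows "category (functor_cat C D S)"
proof -
  interpret C: category C by fact
  interpret D: category D by fact
  show ?thesis
  proof
    fix f assume "f \<in> arr (functor_cat C D S)"
    then show "src (functor_cat C D S) f \<in> obj (functor_cat C D S)" "tgt (functor_cat C D S) f \<in> obj (functor_cat C D S)"
      by simp_all
  next
    fix F assume F: "F \<in> obj (functor_cat C D S)"
    then have "is_nat C D F F (\<lambda>X \<in> obj C. idt D (fobj F X))" by (intro is_nat_idt[OF assms(1,2)] S) simp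
    then show "idt (functor_cat C D S) F \<in> homs (functor_cat C D S) F F" using F by (simp add: in_homs)
  next
    fix t F G s H assume "t \<in> homs (functor_cat C D S) F G" "s \<in> homs (functor_cat C D S) G H"
    then have n: "is_nat C D F G (ncomp t)" "is_nat C D G H (ncomp s)" "F \<in> S" "G \<in> S" "H \<in> S"
      "nsrc t = F" "ntgt t = G" "nsrc s = G" "ntgt s = H" by (auto simp: in_homs)
    have "is_nat C D F H (\<lambda>X \<in> obj C. ncomp s X \<cdot>\<^bsub>D\<^esub> ncomp t X)"
      by (rule is_nat_cmp[OF assms(1,2) S[OF n(3)] S[OF n(4)] S[OF n(5)] n(1,2)])
    then show "s \<cdot>\<^bsub>functor_cat C D S\<^esub> t \<in> homs (functor_cat C D S) F H"
      using n(3-) by (simp add: in_homs)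
  next
    fix t F G assume t: "t \<in> homs (functor_cat C D S) F G"
    then have n: "is_nat C D F G (ncomp t)" "nsrc t = F" "ntgt t = G" by (auto simp: in_homs)
    note n' = is_natD[OF n(1)]
    show "t \<cdot>\<^bsub>functor_cat C D S\<^esub> idt (functor_cat C D S) F = t"
      by (rule nattrans_eqI[where A = "obj C"]) (simp_all add: n(2,3) n' D.cmp_idt_right)
    show "idt (functor_cat C D S) G \<cdot>\<^bsub>functor_cat C D S\<^esub> t = t"
      by (rule nattrans_eqI[where A = "obj C"]) (simp_all add: n(2,3) n' D.cmp_idt_left)
  next
    fix t F G s H r K
    assume "t \<in> homs (functor_cat C D S) F G" "s \<in> homs (functor_cat C D S) G H" "r \<in> homs (functor_cat C D S) H K"
    then have n: "is_nat C D F G (ncomp t)" "is_nat C D G H (ncomp s)" "is_nat C D H K (ncomp r)"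
      "nsrc t = F" "ntgt r = K" by (auto simp: in_homs)
    note n' = is_natD(1-3)[OF n(1)] is_natD(1-3)[OF n(2)] is_natD(1-3)[OF n(3)]
    show "r \<cdot>\<^bsub>functor_cat C D S\<^esub> (s \<cdot>\<^bsub>functor_cat C D S\<^esub> t) = r \<cdot>\<^bsub>functor_cat C D S\<^esub> s \<cdot>\<^bsub>functor_cat C D S\<^esub> t"
      by (rule nattrans_eqI[where A = "obj C"]) (simp_all add: n(4,5) n' D.cmp_assoc_right)
  qed
qed

lemma functor_cat_iso:
  assumes "category C" "category D" "F \<in> S" "G \<in> S" and S: "\<And>F. F \<in> S \<Longrightarrow> is_functor C D F" and t: "is_nat_iso C D F G t"
  shows "is_iso (functor_cat C D S) \<lparr>nsrc = F, ntgt = G, ncomp = t\<rparr>"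
proof -
  interpret FC: category "functor_cat C D S" by (rule category_functor_cat[OF assms(1,2) S])
  obtain s where s: "is_nat_iso C D G F s" "\<forall>X \<in> obj C. s X \<cdot>\<^bsub>D\<^esub> t X = idt D (fobj F X)"
    "\<forall>X \<in> obj C. t X \<cdot>\<^bsub>D\<^esub> s X = idt D (fobj G X)"
    by (rule is_nat_iso_inverse[OF assms(1,2) S[OF assms(3)] S[OF assms(4)] t])
  have n: "is_nat C D F G t" "is_nat C D G F s" using t s(1) by (simp_all add: is_nat_iso_def)
  show ?thesis
    by (rule FC.is_isoI[of _ "\<lparr>nsrc = G, ntgt = F, ncomp = s\<rparr>" F G])
      (use n s(2,3) assms(3,4) in \<open>auto intro!: restrict_ext\<close>)
qed

context category
begin

lemma is_isoE:
  assumes "is_iso C f"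
  obtains g where "g \<in> arr C" "src C g = tgt C f" "tgt C g = src C f" "g \<cdot> f = idt C (src C f)" "f \<cdot> g = idt C (tgt C f)"
proof -
  obtain g where g: "g \<in> homs C (tgt C f) (src C f)" "g \<cdot> f = idt C (src C f)" "f \<cdot> g = idt C (tgt C f)"
    using assms unfolding is_iso_def by blast
  show thesis using that[OF _ _ _ g(2,3)] g(1) by (simp add: in_homs)
qed

end

section \<open>Exact pairs as kernels and cokernels\<close>

context abelian_category
begin

lemma exact_zero_mono:
  assumes "exact_pair D f g" "zero_object D (src D f)"
  shows "is_mono D g"
proof (rule is_mono_zeroI)
  note z = exact_pairD_zero[OF assms(1)]
  show "g \<in> arr D" by (rule z)
  fix t assume t: "t \<in> arr D" "tgt D t = src D g" "g \<cdot> t = pzero D (src D t) (tgt D g)"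
  have t2: "tgt D t = tgt D f" using t z by simp
  obtain e y where e: "is_epi D e" "e \<in> arr D" "tgt D e = src D t" "y \<in> arr D" "src D y = src D e"
    "tgt D y = src D f" "t \<cdot> e = f \<cdot> y"
    by (rule exact_pairD_lift[OF assms(1) t(1) t2 refl t(3)])
  have "y = pzero D (src D e) (src D f)" using zero_object_eq(1)[OF assms(2) e(4)] e by simp
  then have "t \<cdot> e = pzero D (src D e) (tgt D t)" using e z t2 by simp
  then show "t = pzero D (src D t) (src D g)" using is_epi_zeroD[OF e(1), of t "tgt D t"] e t by simp
qed

lemma exact_zero_epi:
  assumes "exact_pair D f g" "zero_object D (tgt D g)"
  shows "is_epi D f"
proof (rule is_epi_zeroI)
  note z = exact_pairD_zero[OF assms(1)]
  show "f \<in> arr D" by (rule z)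
  fix t assume t: "t \<in> arr D" "src D t = tgt D f" "t \<cdot> f = pzero D (src D f) (tgt D t)"
  have i: "g \<cdot> idt D (tgt D f) = pzero D (tgt D f) (tgt D g)"
    using zero_object_eq(1)[OF assms(2) z(2)] z by simp
  obtain e y where e: "is_epi D e" "e \<in> arr D" "tgt D e = tgt D f" "y \<in> arr D" "src D y = src D e"
    "tgt D y = src D f" "idt D (tgt D f) \<cdot> e = f \<cdot> y"
    by (rule exact_pairD_lift[OF assms(1) _ _ _ i]) (use z in simp_all)
  have "t \<cdot> e = t \<cdot> (f \<cdot> y)" using e by simp
  also have "\<dots> = pzero D (src D e) (tgt D t)" using t e z by (simp add: cmp_zero_assoc)
  finally show "t = pzero D (tgt D f) (tgt D t)" using is_epi_zeroD[OF e(1), of t "tgt D t"] e t by simp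
qed

lemma exact_zero_zero:
  assumes "exact_pair D f g" "zero_object D (src D f)" "zero_object D (tgt D g)"
  shows "zero_object D (tgt D f)"
proof -
  note z = exact_pairD_zero[OF assms(1)]
  have "f = pzero D (src D f) (tgt D f)" using zero_object_eq(2)[OF assms(2) z(1)] by simp
  then have "idt D (tgt D f) \<cdot> f = pzero D (src D f) (tgt D f)" using z(1) by simp
  then have "idt D (tgt D f) = pzero D (tgt D f) (tgt D f)"
    using is_epi_zeroD[OF exact_zero_epi[OF assms(1,3)], of "idt D (tgt D f)" "tgt D f"] z(1) by simp
  then show ?thesis using z(1) by (simp add: zero_object_iff)
qed

text \<open>The factor \<open>l\<close> of \<open>f\<close> through its image is epic by
  construction and monic because \<open>f\<close> is, hence invertible; so \<open>f\<close> itself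
  serves as the kernel of \<open>g\<close>.\<close>

lemma exact_mono_kernel:
  assumes e: "exact_pair D f g" and m: "is_mono D f"
  shows "is_kernel D g f"
proof -
  obtain q k where q: "is_cokernel D f q" and kq: "is_kernel D q k" and kg: "is_kernel D g k"
    using e by (auto simp: exact_pair_def)
  note z = exact_pairD_zero[OF e] and k = is_kernelD[OF kg]
  obtain l where l: "l \<in> arr D" "src D l = src D f" "tgt D l = src D k" "k \<cdot> l = f" "is_epi D l"
    by (rule image_factor[OF q kq])
  have "is_mono D l"
  proof (rule is_mono_zeroI)
    fix t assume t: "t \<in> arr D" "tgt D t = src D l" "l \<cdot> t = pzero D (src D t) (tgt D l)"
    have "f \<cdot> t = k \<cdot> (l \<cdot> t)" unfolding l(4)[symmetric] using l(1-3) t(1,2) k by simp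
    also have "\<dots> = pzero D (src D t) (tgt D f)" unfolding t(3) using l(1-3) t(1,2) k z by simp
    finally show "t = pzero D (src D t) (src D l)" using is_mono_zeroD[OF m, of t "src D t"] t l by simp
  qed (rule l)
  from mono_epi_is_iso[OF this l(5)] obtain j where j: "j \<in> arr D" "src D j = tgt D l" "tgt D j = src D l" "l \<cdot> j = idt D (tgt D l)"
    by (rule is_isoE)
  show ?thesis
  proof (rule is_kernelI[OF z(2) m z(3)[symmetric] z(4)])
    fix x assume x: "x \<in> arr D" "tgt D x = src D g" "g \<cdot> x = pzero D (src D x) (tgt D g)"
    obtain y where y: "y \<in> arr D" "src D y = src D x" "tgt D y = src D k" "k \<cdot> y = x"
      by (rule kernel_factor[OF kg x(1,2) refl x(3)])
    have "f \<cdot> (j \<cdot> y) = k \<cdot> (l \<cdot> (j \<cdot> y))" unfolding l(4)[symmetric] using l(1-3) j(1-3) y k by simp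
    also have "\<dots> = x" using l(1-3) j(1-3) y k by (simp add: cmp_reassoc[OF j(4)])
    finally show "\<exists>y\<in>arr D. src D y = src D x \<and> tgt D y = src D f \<and> f \<cdot> y = x"
      using l(1-3) j(1-3) y by (intro bexI[of _ "j \<cdot> y"]) simp_all
  qed
qed

text \<open>The arrow \<open>l\<close> from a cokernel of \<open>f\<close> to the target of
  \<open>g\<close> is epic because \<open>g\<close> is. It is monic since an element of its kernel
  lifts on a cover to one killed by \<open>g\<close>, which by exactness comes from \<open>f\<close>
  on a further cover.\<close>

lemma exact_epi_cokernel:
  assumes e: "exact_pair D f g" and m: "is_epi D g"
  shows "is_cokernel D f g"
proof -
  obtain q where q: "is_cokernel D f q" using e by (auto simp: exact_pair_def)
  note z = exact_pairD_zero[OF e] and q' = is_cokernelD[OF q]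
  obtain l where l: "l \<in> arr D" "src D l = tgt D q" "tgt D l = tgt D g" "l \<cdot> q = g"
    by (rule cokernel_factor[OF q z(2,3) refl z(4)])
  have "is_epi D l"
  proof (rule is_epi_zeroI)
    fix t assume t: "t \<in> arr D" "src D t = tgt D l" "t \<cdot> l = pzero D (src D l) (tgt D t)"
    have "t \<cdot> g = t \<cdot> l \<cdot> q" unfolding l(4)[symmetric] using l(1-3) t(1,2) q' by simp
    also have "\<dots> = pzero D (src D g) (tgt D t)" unfolding t(3) using l(1-3) t(1,2) q' z by simp
    finally show "t = pzero D (tgt D l) (tgt D t)" using is_epi_zeroD[OF m, of t "tgt D t"] t l by simp
  qed (rule l)
  moreover have "is_mono D l"
  proof (rule is_mono_zeroI)
    fix t assume t: "t \<in> arr D" "tgt D t = src D l" "l \<cdot> t = pzero D (src D t) (tgt D l)"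
    obtain p s where p: "is_epi D p" "p \<in> arr D" "tgt D p = src D t" "s \<in> arr D" "src D s = src D p"
      "tgt D s = src D q" "q \<cdot> s = t \<cdot> p"
      by (rule epi_pullback[OF cokernel_epi[OF q] t(1)]) (use t l in auto)
    have "g \<cdot> s = l \<cdot> (t \<cdot> p)" unfolding l(4)[symmetric] p(7)[symmetric] using l(1-3) p(4-6) q' by simp
    also have "\<dots> = pzero D (src D s) (tgt D g)" using l(1-3) p(2-5) t(1,2) by (simp add: cmp_zero_assoc[OF t(3)])
    finally have gs: "g \<cdot> s = pzero D (src D s) (tgt D g)" .
    obtain e1 y where y: "is_epi D e1" "e1 \<in> arr D" "tgt D e1 = src D s" "y \<in> arr D" "src D y = src D e1"
      "tgt D y = src D f" "s \<cdot> e1 = f \<cdot> y"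
      by (rule exact_pairD_lift[OF e p(4) _ refl gs]) (use p q' in auto)
    have "t \<cdot> (p \<cdot> e1) = q \<cdot> s \<cdot> e1" unfolding p(7) using p(1-3,5) t(1,2) y(2,3) by simp
    also have "\<dots> = q \<cdot> (f \<cdot> y)" unfolding y(7)[symmetric] using p(4-6) y(2,3) q' by simp
    also have "\<dots> = pzero D (src D e1) (tgt D q)" using y(4-6) q' z by (simp add: cmp_zero_assoc[OF q'(4)])
    finally have "t \<cdot> (p \<cdot> e1) = pzero D (src D (p \<cdot> e1)) (tgt D q)" using p y by simp
    then show "t = pzero D (src D t) (src D l)"
      using is_epi_zeroD[OF is_epi_cmp[OF y(1) p(1)], of t "tgt D q"] p y t l by simp
  qed (rule l)
  ultimately have "is_iso D l" by (intro mono_epi_is_iso)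
  then obtain j where j: "j \<in> arr D" "src D j = tgt D l" "tgt D j = src D l" "j \<cdot> l = idt D (src D l)"
    by (rule is_isoE)
  show ?thesis
  proof (rule is_cokernelI[OF z(1) m z(3) z(4)])
    fix x assume x: "x \<in> arr D" "src D x = tgt D f" "x \<cdot> f = pzero D (src D f) (tgt D x)"
    obtain y where y: "y \<in> arr D" "src D y = tgt D q" "tgt D y = tgt D x" "y \<cdot> q = x"
      by (rule cokernel_factor[OF q x(1,2) refl x(3)])
    have "y \<cdot> j \<cdot> g = y \<cdot> (j \<cdot> (l \<cdot> q))" unfolding l(4) using y(1-3) j(1-3) l(1-3) z by simp
    also have "\<dots> = x" using y j(1-3) l(1-3) q' by (simp add: cmp_reassoc[OF j(4)])
    finally show "\<exists>y\<in>arr D. src D y = tgt D g \<and> tgt D y = tgt D x \<and> y \<cdot> g = x"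
      using y(1-3) j(1-3) l(1-3) by (intro bexI[of _ "y \<cdot> j"]) simp_all
  qed
qed

lemma mono_cmp_zero_iff:
  assumes "is_mono D m" "g \<in> arr D" "src D m = tgt D g" "x \<in> arr D" "tgt D x = src D g"
  shows "m \<cdot> g \<cdot> x = pzero D (src D x) (tgt D m) \<longleftrightarrow> g \<cdot> x = pzero D (src D x) (tgt D g)"
  using is_mono_zeroD[OF assms(1), of "g \<cdot> x" "src D x"] is_mono_arr[OF assms(1)] assms(2-) by auto

lemma is_kernel_mono_cmp:
  assumes k: "is_kernel D g k" and m: "is_mono D m" "src D m = tgt D g"
  shows "is_kernel D (m \<cdot> g) k"
proof (rule is_kernelI)
  note k' = is_kernelD[OF k] and m' = is_mono_arr[OF m(1)]
  show "m \<cdot> g \<in> arr D" "is_mono D k" "tgt D k = src D (m \<cdot> g)" using k' m m' kernel_mono[OF k] by simp_all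
  show "m \<cdot> g \<cdot> k = pzero D (src D k) (tgt D (m \<cdot> g))"
    using mono_cmp_zero_iff[OF m(1) k'(1) m(2) k'(2,3)] k' m m' by simp
  fix x assume x: "x \<in> arr D" "tgt D x = src D (m \<cdot> g)" "m \<cdot> g \<cdot> x = pzero D (src D x) (tgt D (m \<cdot> g))"
  have x2: "tgt D x = src D g" using x k' m m' by simp
  have "g \<cdot> x = pzero D (src D x) (tgt D g)"
    using mono_cmp_zero_iff[OF m(1) k'(1) m(2) x(1) x2] x k' m m' by simp
  from kernel_factor[OF k x(1) x2 refl this] show "\<exists>y\<in>arr D. src D y = src D x \<and> tgt D y = src D k \<and> k \<cdot> y = x"
    by blast
qed

lemma exact_pair_mono_cmp:
  assumes e: "exact_pair D f g" and m: "is_mono D m" "src D m = tgt D g"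
  shows "exact_pair D f (m \<cdot> g)"
  using e is_kernel_mono_cmp[OF _ m] unfolding exact_pair_def by blast

text \<open>Used to identify the homology picked by \<open>homology_data\<close> with an explicit
  presentation, through an isomorphism lying over the identity of the middle term.\<close>

lemma homology_comparison:
  assumes c: "is_complex D f g" and h: "is_homology D f g (k, q)" and h': "is_homology D f g (k', q')"
  obtains m where "sq_map D k q k' q' (idt D (src D g)) m" "is_iso D m"
proof -
  note s = is_homology_subquotient[OF h] and s' = is_homology_subquotient[OF h']
  note c' = is_complexD[OF c]
  have ch: "chain_mid D f g f g (idt D (src D g))"
    unfolding chain_mid_def in_homs
    using c' by (intro conjI bexI[of _ "idt D (src D f)"] bexI[of _ "idt D (tgt D g)"]) (simp_all add: in_homs)
  obtain m where m: "sq_map D k q k' q' (idt D (src D g)) m" using ex_sq_map[OF h h' ch] by blast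
  obtain n where n: "sq_map D k' q' k q (idt D (src D g)) n" using ex_sq_map[OF h' h ch] by blast
  have i: "idt D (src D g) \<cdot> idt D (src D g) = idt D (src D g)" using c' by simp
  have "n \<cdot> m = idt D (tgt D q)"
    by (rule sq_map_unique[OF s(1) s(1) sq_map_cmp[OF s(1) s'(1) s(1) m n]])
      (use sq_map_idt[OF s(1)] s(2) c' in simp)
  moreover have "m \<cdot> n = idt D (tgt D q')"
    by (rule sq_map_unique[OF s'(1) s'(1) sq_map_cmp[OF s'(1) s(1) s'(1) n m]])
      (use sq_map_idt[OF s'(1)] s'(2) c' in simp)
  ultimately have "is_iso D m"
    using is_isoI[of m n "tgt D q" "tgt D q'"] sq_mapD[OF m] sq_mapD[OF n] by simp
  with m show thesis by (rule that)
qed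

end

context pure_setting
begin

lemma category_heart: "category (heart C w)"
proof
  fix f assume "f \<in> arr (heart C w)"
  then show "src (heart C w) f \<in> obj (heart C w)" "tgt (heart C w) f \<in> obj (heart C w)"
    by (simp_all add: heart_def full_subcat_def)
next
  fix X assume "X \<in> obj (heart C w)"
  then show "idt (heart C w) X \<in> homs (heart C w) X X"
    using subsetD[OF weq_obj, of X 0] by (simp add: heart_def full_subcat_def in_homs)
qed (auto simp: heart_def full_subcat_def in_homs)

lemma heart_simps [simp]:
  "obj (heart C w) = weq C w 0" "f \<in> arr (heart C w) \<longleftrightarrow> f \<in> arr C \<and> src C f \<in> weq C w 0 \<and> tgt C f \<in> weq C w 0"
  "src (heart C w) = src C" "tgt (heart C w) = tgt C" "idt (heart C w) = idt C" "cmp (heart C w) = cmp C" "padd (heart C w) = padd C"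
  by (simp_all add: heart_def full_subcat_def)

lemma heart_functorI: "A \<in> additive_functors (heart C w) D \<Longrightarrow> heart_functor C w D A"
  by unfold_locales

end

section \<open>Restriction to the heart\<close>

context abelian_category
begin

lemma subquotient_idt: "X \<in> obj D \<Longrightarrow> subquotient D (idt D X) (idt D X)"
  by (simp add: subquotient_def is_mono_idt is_epi_idt)

lemma sq_map_of_arr:
  assumes "f \<in> arr D" "src D f = X" "tgt D f = Y"
  shows "sq_map D (idt D X) (idt D X) (idt D Y) (idt D Y) f f"
proof -
  have "X \<in> obj D" "Y \<in> obj D" using assms by auto
  then show ?thesis by (intro sq_mapI[where u = f]) (use assms in simp_all)
qed

end

section \<open>Transformations between functors on the heart\<close>

locale heart_transformation = A: heart_functor C w D A + B: heart_functor C w D B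
  for C :: "('o, 'm) tricat" (structure) and w :: "'o weights" and D :: "('a, 'b) precat" and A B +
  fixes t :: "'o \<Rightarrow> 'b"
  assumes natural: "is_nat (heart C w) D A B t"
begin

text \<open>The component, at an object with tower \<open>T\<close>, of the transformation of pure
  functors induced by \<open>t\<close>.\<close>

definition nmap :: "'m tower \<Rightarrow> 'b" where
  "nmap T = pure_map C D A T B T (t (wc_obj C T 0))"

lemma t_simps:
  assumes "P \<in> weq C w 0"
  shows "t P \<in> arr D" "src D (t P) = fobj A P" "tgt D (t P) = fobj B P"
  using is_natD(1-3)[OF natural] assms by simp_all

lemma t_natural:
  assumes "f \<in> arr C" "src C f \<in> weq C w 0" "tgt C f \<in> weq C w 0"
  shows "t (tgt C f) \<cdot>\<^bsub>D\<^esub> farr A f = farr B f \<cdot>\<^bsub>D\<^esub> t (src C f)"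
  using is_natD(4)[OF natural, of f] assms by simp

lemma sq_map_nmap:
  assumes T: "weight_tower C w M T"
  shows "sq_map D (A.hK T) (A.hQ T) (B.hK T) (B.hQ T) (t (tgt C (tc T 0))) (nmap T)"
proof -
  note o = A.wc_obj_weq[OF T] A.term_weq[OF T]
  note d = A.wc_diff_simps[OF T, of 0, simplified] A.wc_diff_simps[OF T, of "-1", simplified]
  note c = A.complex_arrs[OF T] B.complex_arrs[OF T]
  have 1: "t (wc_obj C T 1) \<cdot>\<^bsub>D\<^esub> A.d0 T = B.d0 T \<cdot>\<^bsub>D\<^esub> t (tgt C (tc T 0))"
    using t_natural[of "wc_diff C T 0"] d o by (simp add: A.d0_def B.d0_def A.wc_obj_zero)
  have 2: "t (tgt C (tc T 0)) \<cdot>\<^bsub>D\<^esub> A.dm T = B.dm T \<cdot>\<^bsub>D\<^esub> t (wc_obj C T (-1))"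
    using t_natural[of "wc_diff C T (-1)"] d o by (simp add: A.dm_def B.dm_def A.wc_obj_zero)
  have h: "t (tgt C (tc T 0)) \<in> homs D (src D (A.d0 T)) (src D (B.d0 T))"
    "t (wc_obj C T (-1)) \<in> homs D (src D (A.dm T)) (src D (B.dm T))"
    "t (wc_obj C T 1) \<in> homs D (tgt D (A.d0 T)) (tgt D (B.d0 T))"
    using t_simps[OF o(1)] t_simps[OF A.term_weq[OF T]] c by (simp_all add: in_homs)
  have "chain_mid D (A.dm T) (A.d0 T) (B.dm T) (B.d0 T) (t (tgt C (tc T 0)))"
    unfolding chain_mid_def using h 2 1[symmetric] by blast
  from A.D.sq_map_homology_map[OF A.is_complex[OF T] B.is_complex[OF T] this]
  show ?thesis
    by (simp add: nmap_def pure_map_def A.hK_def A.hQ_def B.hK_def B.hQ_def A.dm_def A.d0_def B.dm_def B.d0_def A.wc_obj_zero)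
qed

lemma nmap_eqI:
  assumes T: "weight_tower C w M T" and m: "sq_map D (A.hK T) (A.hQ T) (B.hK T) (B.hQ T) (t (tgt C (tc T 0))) m"
  shows "nmap T = m"
  by (rule A.D.sq_map_unique[OF A.subquotient(1)[OF T] B.subquotient(1)[OF T] sq_map_nmap[OF T] m])

lemma nmap_simps:
  assumes T: "weight_tower C w M T"
  shows "nmap T \<in> arr D" "src D (nmap T) = tgt D (A.hQ T)" "tgt D (nmap T) = tgt D (B.hQ T)"
  using A.D.sq_mapD[OF sq_map_nmap[OF T]] by simp_all

text \<open>Both composites are induced by the same arrow on zeroth terms, by naturality of
  \<open>t\<close> at \<open>b 0\<close>.\<close>

lemma nmap_natural:
  assumes S: "weight_tower C w M S" and T: "weight_tower C w N T" and g: "g \<in> arr C" "src C g = M" "tgt C g = N"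
  shows "nmap T \<cdot>\<^bsub>D\<^esub> A.pmap S T g = B.pmap S T g \<cdot>\<^bsub>D\<^esub> nmap S"
proof -
  obtain a b where ab: "tower_morphism C S T g a b" by (rule A.ex_tower_morphism[OF S T g])
  note m = A.tower_morphismD(4-6)[OF ab, of 0]
  have "t (tgt C (tc T 0)) \<cdot>\<^bsub>D\<^esub> farr A (b 0) = farr B (b 0) \<cdot>\<^bsub>D\<^esub> t (tgt C (tc S 0))"
    using t_natural[of "b 0"] m A.term_weq[OF S] A.term_weq[OF T] by simp
  then show ?thesis
    using A.D.sq_map_cmp[OF A.subquotient(1)[OF S] A.subquotient(1)[OF T] B.subquotient(1)[OF T] A.sq_map_pmap[OF S T g ab] sq_map_nmap[OF T]]
      A.D.sq_map_cmp[OF A.subquotient(1)[OF S] B.subquotient(1)[OF S] B.subquotient(1)[OF T] sq_map_nmap[OF S] B.sq_map_pmap[OF S T g ab]]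
      A.D.sq_map_unique[OF A.subquotient(1)[OF S] B.subquotient(1)[OF T]] by metis
qed

end

section \<open>Comparison of a functor on the heart with the restriction of its pure functor\<close>

context pure_setting
begin

text \<open>For a tower of an object of the heart this is the augmentation of the weight complex,
  from its zeroth term to the object; one such arrow is fixed by choice.\<close>

definition proj :: "'m tower \<Rightarrow> 'm" where
  "proj T = (SOME p. p \<in> homs C (tgt C (tc T 0)) (tgt C (th T 0)) \<and> p \<cdot> tc T 0 = th T 0)"

text \<open>As \<open>P\<close> has weight at least \<open>0\<close>, \<open>th T (-1)\<close>
  vanishes; so \<open>th T 0\<close> kills \<open>tj T (-1)\<close> and descends to its
  cone.\<close>

lemma proj:
  assumes T: "weight_tower C w P T" and P: "P \<in> weq C w 0"
  shows "proj T \<in> arr C" "src C (proj T) = tgt C (tc T 0)" "tgt C (proj T) = P" "proj T \<cdot> tc T 0 = th T 0"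
proof -
  note th = weight_towerD_th[OF T]
  have j: "tj T (-1) \<in> arr C" "src C (tj T (-1)) = src C (th T (-1))" "tgt C (tj T (-1)) = src C (th T 0)"
    "th T 0 \<cdot> tj T (-1) = th T (-1)" "(tj T (-1), tc T 0, te T (-1)) \<in> tri C"
    using weight_towerD(2-5)[OF T, of "-1"] weight_towerD(6)[OF T, of 0] by simp_all
  have P0: "P \<in> wge C w 0" using P by (simp add: weq_def)
  have "th T (-1) = pzero C (src C (th T (-1))) P"
    by (rule weight_orthogonal[OF th(2) P0]) (use th in simp_all)
  then have z: "th T 0 \<cdot> tj T (-1) = pzero C (src C (tj T (-1))) P" using j by simp
  obtain p where p: "p \<in> arr C" "src C p = tgt C (tc T 0)" "tgt C p = P" "p \<cdot> tc T 0 = th T 0"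
    by (rule tri_extend[OF j(5) _ _ _ z]) (use th j in simp_all)
  then have "\<exists>p. p \<in> homs C (tgt C (tc T 0)) (tgt C (th T 0)) \<and> p \<cdot> tc T 0 = th T 0"
    using th by (auto simp: in_homs)
  from someI_ex[OF this] show "proj T \<in> arr C" "src C (proj T) = tgt C (tc T 0)" "tgt C (proj T) = P" "proj T \<cdot> tc T 0 = th T 0"
    unfolding proj_def[symmetric] using th by (simp_all add: in_homs)
qed

text \<open>\<open>P\<close> also has weight at most \<open>0\<close>, so its identity lifts along
  \<open>th T 0\<close>.\<close>

lemma heart_section:
  assumes T: "weight_tower C w P T" and P: "P \<in> weq C w 0"
  obtains s where "s \<in> arr C" "src C s = P" "tgt C s = src C (th T 0)" "th T 0 \<cdot> s = idt C P"
proof -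
  have P0: "P \<in> wle C w 0" "P \<in> obj C" using P weq_obj by (auto simp: weq_def)
  show thesis
    by (rule weight_lift[OF weight_towerD(1)[OF T, of 0] P0(1) order_refl, of "idt C P"]) (use P0 that in auto)
qed

lemma wc_diff_cmp_tc:
  assumes T: "weight_tower C w M T"
  shows "wc_diff C T 0 \<cdot> tc T 0 = pzero C (src C (th T 0)) (wc_obj C T 1)"
proof -
  have z: "te T (-1) \<cdot> tc T 0 = pzero C (src C (tc T 0)) (tgt C (te T (-1)))"
    using tri_cmp_zero1[OF weight_towerD(6)[OF T, of 0]] by simp
  note tc = weight_towerD_tc[OF T, of "-1"] weight_towerD_tc[OF T, of 0]
  show ?thesis
    unfolding wc_diff_zero_left using tc z weight_towerD_th(4)[OF T]
    by (simp add: wc_obj_def)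
qed

text \<open>\<open>th T 0\<close> factors through \<open>tj T 0\<close>, and up to sign the
  desuspended \<open>te T 0\<close> precedes \<open>tj T 0\<close> in a triangle.\<close>

lemma th_cmp_te:
  assumes T: "weight_tower C w M T"
  shows "th T 0 \<cdot> shA C (-1) (te T 0) = pzero C (wc_obj C T (-1)) M"
proof -
  note tc = weight_towerD_tc[OF T, of 0] weight_towerD_tc[OF T, of 1]
  note j = weight_towerD(2-5)[OF T, of 0, simplified]
  have t: "(tj T 0, tc T 1, te T 0) \<in> tri C" using weight_towerD(6)[OF T, of 1] by simp
  have "tj T 0 \<cdot> pneg C (shA C (-1) (te T 0)) = pzero C (wc_obj C T (-1)) (src C (th T 1))"
    using tri_cmp_zero[OF tri_unrot[OF t]] tc j by (simp add: wc_obj_def)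
  then have z: "tj T 0 \<cdot> shA C (-1) (te T 0) = pzero C (wc_obj C T (-1)) (src C (th T 1))"
    using tc j weight_towerD_th(4)[OF T] by (simp add: wc_obj_def)
  have "th T 0 \<cdot> shA C (-1) (te T 0) = th T 1 \<cdot> (tj T 0 \<cdot> shA C (-1) (te T 0))"
    unfolding j(4)[symmetric] using tc j(1-3) weight_towerD_th[OF T] by simp
  then show ?thesis unfolding z using weight_towerD_th[OF T] tc by (simp add: wc_obj_def)
qed

lemma proj_wc_diff:
  assumes T: "weight_tower C w P T" and P: "P \<in> weq C w 0"
  shows "proj T \<cdot> wc_diff C T (-1) = pzero C (wc_obj C T (-1)) P"
proof -
  note p = proj[OF T P] and tc = weight_towerD_tc[OF T, of 0] weight_towerD_tc[OF T, of 1]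
  have "proj T \<cdot> wc_diff C T (-1) = proj T \<cdot> tc T 0 \<cdot> shA C (-1) (te T 0)"
    unfolding wc_diff_minus_one using p(1-3) tc weight_towerD_th[OF T] by simp
  then show ?thesis unfolding p(4) th_cmp_te[OF T] .
qed

end

context heart_functor
begin

text \<open>The map from the homology to \<open>A\<close> of the object induced by the augmentation.
  The object is recovered as the target of \<open>th T 0\<close>, and its value under
  \<open>A\<close> is presented as a subquotient of itself by identities.\<close>

definition rho :: "'m tower \<Rightarrow> 'b" where
  "rho T = (SOME r. sq_map D (hK T) (hQ T) (idt D (fobj A (tgt C (th T 0)))) (idt D (fobj A (tgt C (th T 0)))) (farr A (proj T)) r)"

lemma sq_map_rho:
  assumes T: "weight_tower C w P T" and P: "P \<in> weq C w 0"
  shows "sq_map D (hK T) (hQ T) (idt D (fobj A P)) (idt D (fobj A P)) (farr A (proj T)) (rho T)"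
proof -
  note p = proj[OF T P] and sq = subquotient[OF T] and c = complex_arrs[OF T] and o = term_weq[OF T] wc_obj_weq[OF T]
  note d = wc_diff_simps[OF T, of "-1", simplified]
  obtain f1 where f1: "is_kernel D (d0 T) (hK T)" "f1 \<in> arr D" "src D f1 = src D (dm T)" "tgt D f1 = src D (hK T)"
    "hK T \<cdot>\<^bsub>D\<^esub> f1 = dm T" "is_cokernel D f1 (hQ T)"
    using homology_data[OF T] by (rule D.is_homologyE)
  have "farr A (proj T) \<cdot>\<^bsub>D\<^esub> dm T = farr A (proj T \<cdot> wc_diff C T (-1))"
    unfolding dm_def by (rule A.farr_cmp[symmetric]) (use p d o P in \<open>simp_all add: wc_obj_zero\<close>)
  then have z: "farr A (proj T) \<cdot>\<^bsub>D\<^esub> dm T = pzero D (src D (dm T)) (fobj A P)"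
    unfolding proj_wc_diff[OF T P] using o P c by simp
  have "farr A (proj T) \<cdot>\<^bsub>D\<^esub> hK T \<cdot>\<^bsub>D\<^esub> f1 = farr A (proj T) \<cdot>\<^bsub>D\<^esub> dm T"
    unfolding f1(5)[symmetric] using f1(2-4) p P o sq by simp
  then have z1: "farr A (proj T) \<cdot>\<^bsub>D\<^esub> hK T \<cdot>\<^bsub>D\<^esub> f1 = pzero D (src D f1) (fobj A P)" unfolding z f1(3) .
  obtain m where m: "m \<in> arr D" "src D m = tgt D (hQ T)" "tgt D m = fobj A P" "m \<cdot>\<^bsub>D\<^esub> hQ T = farr A (proj T) \<cdot>\<^bsub>D\<^esub> hK T"
    by (rule D.cokernel_factor[OF f1(6) _ _ _ z1]) (use f1(2-4) p P o sq in simp_all)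
  have "sq_map D (hK T) (hQ T) (idt D (fobj A P)) (idt D (fobj A P)) (farr A (proj T)) m"
    by (rule D.sq_mapI[where u = "farr A (proj T) \<cdot>\<^bsub>D\<^esub> hK T"]) (use m p P o sq in simp_all)
  then have "sq_map D (hK T) (hQ T) (idt D (fobj A (tgt C (th T 0)))) (idt D (fobj A (tgt C (th T 0)))) (farr A (proj T)) m"
    using weight_towerD_th(3)[OF T] by simp
  then have "sq_map D (hK T) (hQ T) (idt D (fobj A (tgt C (th T 0)))) (idt D (fobj A (tgt C (th T 0)))) (farr A (proj T)) (rho T)"
    unfolding rho_def by (rule someI)
  then show ?thesis using weight_towerD_th(3)[OF T] by simp
qed

text \<open>The inverse is induced by \<open>v\<close>, a section of \<open>th T 0\<close> followed
  by \<open>tc T 0\<close>. One composite is the identity already on \<open>P\<close>; the other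
  differs from the identity by the map induced by \<open>\<beta>\<close>, which is null-homotopic
  because it lies under \<open>\<alpha>\<close>, an arrow that dies in \<open>P\<close>.\<close>

lemma rho_iso:
  assumes T: "weight_tower C w P T" and P: "P \<in> weq C w 0"
  shows "is_iso D (rho T)"
proof -
  note p = proj[OF T P] and sq = subquotient[OF T] and c = complex_arrs[OF T] and o = term_weq[OF T] wc_obj_weq[OF T]
  note tc = weight_towerD_tc[OF T, of 0] and th = weight_towerD_th[OF T]
  note d = wc_diff_simps[OF T, of 0, simplified]
  have Po: "P \<in> obj C" "fobj A P \<in> obj D" using P weq_obj by auto
  obtain s where s: "s \<in> arr C" "src C s = P" "tgt C s = src C (th T 0)" "th T 0 \<cdot> s = idt C P"
    by (rule heart_section[OF T P])
  define v where "v = tc T 0 \<cdot> s"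
  have v: "v \<in> arr C" "src C v = P" "tgt C v = tgt C (tc T 0)" using s tc by (simp_all add: v_def)
  have kk: "is_kernel D (d0 T) (hK T)" using homology_data[OF T] by (rule D.is_homologyE)
  have "wc_diff C T 0 \<cdot> v = wc_diff C T 0 \<cdot> tc T 0 \<cdot> s"
    unfolding v_def using s tc d by (simp add: wc_obj_zero)
  also have "\<dots> = pzero C P (wc_obj C T 1)" unfolding wc_diff_cmp_tc[OF T] using s th wc_diff_simps(4)[OF T, of 1] by simp
  finally have dv: "wc_diff C T 0 \<cdot> v = pzero C P (wc_obj C T 1)" .
  have "d0 T \<cdot>\<^bsub>D\<^esub> farr A v = farr A (wc_diff C T 0 \<cdot> v)"
    unfolding d0_def by (rule A.farr_cmp[symmetric]) (use v d o P in \<open>simp_all add: wc_obj_zero\<close>)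
  then have z: "d0 T \<cdot>\<^bsub>D\<^esub> farr A v = pzero D (fobj A P) (tgt D (d0 T))" unfolding dv using P o c by simp
  obtain u where u: "u \<in> arr D" "src D u = fobj A P" "tgt D u = src D (hK T)" "hK T \<cdot>\<^bsub>D\<^esub> u = farr A v"
    by (rule D.kernel_factor[OF kk _ _ _ z]) (use v P o c in simp_all)
  have m: "sq_map D (idt D (fobj A P)) (idt D (fobj A P)) (hK T) (hQ T) (farr A v) (hQ T \<cdot>\<^bsub>D\<^esub> u)"
    by (rule D.sq_mapI[where u = u]) (use u v P Po o sq in simp_all)
  note r = sq_map_rho[OF T P] and si = D.subquotient_idt[OF Po(2)]
  note rD = D.sq_mapD[OF r] and mD = D.sq_mapD[OF m]
  have "proj T \<cdot> v = th T 0 \<cdot> s"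
    unfolding v_def by (rule cmp_reassoc[OF p(4)]) (use p s tc in simp_all)
  then have pv: "proj T \<cdot> v = idt C P" using s(4) by simp
  have "farr A (proj T) \<cdot>\<^bsub>D\<^esub> farr A v = farr A (proj T \<cdot> v)"
    by (rule A.farr_cmp[symmetric]) (use p v P o in simp_all)
  then have e: "farr A (proj T) \<cdot>\<^bsub>D\<^esub> farr A v = idt D (fobj A P)" unfolding pv using P by simp
  have 1: "rho T \<cdot>\<^bsub>D\<^esub> (hQ T \<cdot>\<^bsub>D\<^esub> u) = idt D (fobj A P)"
    by (rule D.sq_map_unique[OF si si D.sq_map_cmp[OF si sq(1) si m r]])
      (use e D.sq_map_of_arr[of "idt D (fobj A P)"] Po in simp)
  define \<beta> where "\<beta> = idt C (tgt C (tc T 0)) \<boxminus> v \<cdot> proj T"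
  define \<alpha> where "\<alpha> = idt C (src C (th T 0)) \<boxminus> s \<cdot> th T 0"
  have \<beta>: "\<beta> \<in> arr C" "src C \<beta> = tgt C (tc T 0)" "tgt C \<beta> = tgt C (tc T 0)" using v p tc by (simp_all add: \<beta>_def)
  have \<alpha>: "\<alpha> \<in> arr C" "src C \<alpha> = src C (th T 0)" "tgt C \<alpha> = src C (th T 0)" using s th by (simp_all add: \<alpha>_def)
  have "th T 0 \<cdot> (s \<cdot> th T 0) = th T 0" using s(1-3) th by (simp add: cmp_reassoc[OF s(4)])
  then have z1: "th T 0 \<cdot> \<alpha> = pzero C (src C (th T 0)) P" using s th by (simp add: \<alpha>_def)
  have z2: "tc T 0 \<cdot> \<alpha> = \<beta> \<cdot> tc T 0"
    using s(1-3) th tc p by (simp add: \<alpha>_def \<beta>_def v_def)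
  have "farr A \<beta> = idt D (tgt D (hK T)) \<boxminus>\<^bsub>D\<^esub> farr A v \<cdot>\<^bsub>D\<^esub> farr A (proj T)"
    using v p o P tc sq by (simp add: \<beta>_def A.farr_pdiff A.farr_cmp)
  then have "sq_map D (hK T) (hQ T) (hK T) (hQ T) (farr A \<beta>) (idt D (tgt D (hQ T)) \<boxminus>\<^bsub>D\<^esub> hQ T \<cdot>\<^bsub>D\<^esub> u \<cdot>\<^bsub>D\<^esub> rho T)"
    using D.sq_map_pdiff[OF sq(1) sq(1) D.sq_map_idt[OF sq(1)] D.sq_map_cmp[OF sq(1) si sq(1) r m]] by simp
  from null_map[OF T T \<alpha> \<beta> z1 z2 this]
  have 2: "hQ T \<cdot>\<^bsub>D\<^esub> u \<cdot>\<^bsub>D\<^esub> rho T = idt D (tgt D (hQ T))"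
    using rD mD Po sq by (subst (asm) D.pdiff_eq_pzero_iff) simp_all
  show ?thesis
    by (rule D.is_isoI[of _ "hQ T \<cdot>\<^bsub>D\<^esub> u" "tgt D (hQ T)" "fobj A P"]) (use 1 2 rD mD Po in simp_all)
qed

text \<open>The augmentations commute with \<open>b 0\<close> and \<open>f\<close> only up to
  \<open>\<beta>\<close>. This difference kills \<open>tc S 0\<close>, hence factors through the
  outgoing differential and vanishes on cycles.\<close>

lemma rho_natural:
  assumes S: "weight_tower C w P S" and T: "weight_tower C w Q T" and P: "P \<in> weq C w 0" and Q: "Q \<in> weq C w 0"
    and f: "f \<in> arr C" "src C f = P" "tgt C f = Q"
  shows "rho T \<cdot>\<^bsub>D\<^esub> pmap S T f = farr A f \<cdot>\<^bsub>D\<^esub> rho S"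
proof -
  note pS = proj[OF S P] and pT = proj[OF T Q] and sS = subquotient[OF S] and sT = subquotient[OF T]
  note o = term_weq[OF S] term_weq[OF T]
  have Po: "fobj A P \<in> obj D" "fobj A Q \<in> obj D" using P Q by simp_all
  note si = D.subquotient_idt[OF Po(1)] D.subquotient_idt[OF Po(2)]
  obtain a b where ab: "tower_morphism C S T f a b" by (rule ex_tower_morphism[OF S T f])
  note m = tower_morphismD(1-6)[OF ab, of 0] and e = tower_morphismD(7,9)[OF ab, of 0]
  note thS = weight_towerD_th[OF S] and thT = weight_towerD_th[OF T] and tcS = weight_towerD_tc[OF S, of 0] and tcT = weight_towerD_tc[OF T, of 0]
  note r1 = D.sq_map_cmp[OF sS(1) sT(1) si(2) sq_map_pmap[OF S T f ab] sq_map_rho[OF T Q]]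
  have "sq_map D (idt D (fobj A P)) (idt D (fobj A P)) (idt D (fobj A Q)) (idt D (fobj A Q)) (farr A f) (farr A f)"
    by (rule D.sq_map_of_arr) (use f P Q in simp_all)
  note r2 = D.sq_map_cmp[OF sS(1) si(1) si(2) sq_map_rho[OF S P] this]
  define \<beta> where "\<beta> = proj T \<cdot> b 0 \<boxminus> f \<cdot> proj S"
  have \<beta>: "\<beta> \<in> arr C" "src C \<beta> = tgt C (tc S 0)" "tgt C \<beta> = Q" using pS pT m f by (simp_all add: \<beta>_def)
  have "proj T \<cdot> (b 0 \<cdot> tc S 0) = th T 0 \<cdot> a 0"
    unfolding e(2)[symmetric] by (rule cmp_reassoc[OF pT(4)]) (use pT m tcT in simp_all)
  then have "\<beta> \<cdot> tc S 0 = pzero C (src C (th S 0)) Q"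
    using pS pT m f tcS thS thT e(1) by (simp add: \<beta>_def)
  then have z: "\<beta> \<cdot> tc S 0 = pzero C (src C (th S 0)) (tgt C \<beta>)" using \<beta> by simp
  obtain x where x: "x \<in> arr C" "src C x = wc_obj C S 1" "tgt C x = tgt C \<beta>" "\<beta> = x \<cdot> wc_diff C S 0"
    by (rule factor_through_wc_diff[OF S _ _ _ z]) (use \<beta> Q in \<open>simp_all add: weq_def\<close>)
  have e1: "farr A \<beta> = farr A (proj T) \<cdot>\<^bsub>D\<^esub> farr A (b 0) \<boxminus>\<^bsub>D\<^esub> farr A f \<cdot>\<^bsub>D\<^esub> farr A (proj S)"
    using pS pT m f o P Q by (simp add: \<beta>_def A.farr_pdiff A.farr_cmp)
  have e2: "farr A \<beta> = farr A x \<cdot>\<^bsub>D\<^esub> d0 S"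
    unfolding x(4) d0_def using x(1-3) \<beta> Q wc_diff_simps[OF S, of 0] wc_obj_weq[OF S]
    by (subst A.farr_cmp) simp_all
  have kk: "is_kernel D (d0 S) (hK S)" using homology_data[OF S] by (rule D.is_homologyE)
  note k = D.is_kernelD[OF kk]
  have "farr A x \<in> arr D" "src D (farr A x) = tgt D (d0 S)" "tgt D (farr A x) = fobj A Q"
    using x \<beta> Q wc_obj_weq[OF S, of 1] complex_arrs[OF S] by simp_all
  then have "sq_map D (hK S) (hQ S) (idt D (fobj A Q)) (idt D (fobj A Q)) (farr A \<beta>) (pzero D (tgt D (hQ S)) (fobj A Q))"
    unfolding e2 using k sS Po
    by (intro D.sq_mapI[where u = "pzero D (src D (hK S)) (fobj A Q)"]) (simp_all add: D.cmp_zero_assoc[OF k(4)])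
  then have "rho T \<cdot>\<^bsub>D\<^esub> pmap S T f \<boxminus>\<^bsub>D\<^esub> farr A f \<cdot>\<^bsub>D\<^esub> rho S = pzero D (tgt D (hQ S)) (fobj A Q)"
    using D.sq_map_unique[OF sS(1) si(2) D.sq_map_pdiff[OF sS(1) si(2) r1 r2]] unfolding e1 by blast
  then show ?thesis
    using D.sq_mapD(4-6)[OF r1] D.sq_mapD(4-6)[OF r2] Po by (subst (asm) D.pdiff_eq_pzero_iff) simp_all
qed

end

context heart_transformation
begin

lemma rho_natural_transformation:
  assumes T: "weight_tower C w P T" and P: "P \<in> weq C w 0"
  shows "B.rho T \<cdot>\<^bsub>D\<^esub> nmap T = t P \<cdot>\<^bsub>D\<^esub> A.rho T"
proof -
  have Po: "fobj A P \<in> obj D" "fobj B P \<in> obj D" using P by simp_all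
  note si = A.D.subquotient_idt[OF Po(1)] A.D.subquotient_idt[OF Po(2)]
  note p = A.proj[OF T P]
  have "sq_map D (idt D (fobj A P)) (idt D (fobj A P)) (idt D (fobj B P)) (idt D (fobj B P)) (t P) (t P)"
    by (rule A.D.sq_map_of_arr) (use t_simps[OF P] in simp_all)
  note r1 = A.D.sq_map_cmp[OF A.subquotient(1)[OF T] si(1) si(2) A.sq_map_rho[OF T P] this]
  note r2 = A.D.sq_map_cmp[OF A.subquotient(1)[OF T] B.subquotient(1)[OF T] si(2) sq_map_nmap[OF T] B.sq_map_rho[OF T P]]
  have "t P \<cdot>\<^bsub>D\<^esub> farr A (A.proj T) = farr B (A.proj T) \<cdot>\<^bsub>D\<^esub> t (tgt C (tc T 0))"
    using t_natural[of "A.proj T"] p P A.term_weq[OF T] by simp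
  then show ?thesis using A.D.sq_map_unique[OF A.subquotient(1)[OF T] si(2) r2] r1 by simp
qed

end

definition restrict_functor :: "('o, 'm, 'z) tricat_scheme \<Rightarrow> 'o weights \<Rightarrow> ('o, 'm, 'a, 'b) cfunctor \<Rightarrow> ('o, 'm, 'a, 'b) cfunctor" where
  "restrict_functor C w H = \<lparr>fobj = restrict (fobj H) (weq C w 0), farr = restrict (farr H) (arr (heart C w))\<rparr>"

context pure_setting
begin

lemma restrict_functor_additive:
  assumes H: "H \<in> additive_functors C D"
  shows "restrict_functor C w H \<in> additive_functors (heart C w) D"
proof -
  interpret H: additive_functor_on C D "obj C" H
    by (rule additive_functor_onI[OF additive_category_axioms D.additive_category_axioms H])
  have o: "X \<in> obj C" if "X \<in> weq C w 0" for X using that weq_obj by blast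
  have "is_functor (heart C w) D (restrict_functor C w H)"
    unfolding is_functor_def by (auto simp: restrict_functor_def o H.farr_cmp)
  moreover have "farr (restrict_functor C w H) (f \<boxplus> g) = farr (restrict_functor C w H) f \<boxplus>\<^bsub>D\<^esub> farr (restrict_functor C w H) g"
    if "X \<in> weq C w 0" "Y \<in> weq C w 0" "f \<in> homs (heart C w) X Y" "g \<in> homs (heart C w) X Y" for X Y f g
    using that by (auto simp: restrict_functor_def in_homs H.farr_padd)
  ultimately show ?thesis by (simp add: additive_functors_def)
qed

end

section \<open>Recovery of a pure functor from its restriction to the heart\<close>

locale pure_homological = pure_setting C w D
  for C :: "('o, 'm) tricat" (structure) and w :: "'o weights" and D :: "('a, 'b) precat" +
  fixes H :: "('o, 'm, 'a, 'b) cfunctor"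
  assumes homological: "H \<in> homological_functors C D" and pure: "is_pure C w D H"

sublocale pure_homological \<subseteq> H: additive_functor_on C D "obj C" H
proof (rule additive_functor_onI)
  show "additive_category C" "additive_category D" by (rule additive_category_axioms D.additive_category_axioms)+
  show "H \<in> additive_functors C D" using homological by (simp add: homological_functors_def)
qed

sublocale pure_homological \<subseteq> R: heart_functor C w D "restrict_functor C w H"
proof unfold_locales
  show "restrict_functor C w H \<in> additive_functors (heart C w) D"
    using homological by (intro restrict_functor_additive) (simp add: homological_functors_def)
qed

context pure_homological
begin

lemma exact:
  assumes "(f, g, h) \<in> tri C"
  shows "exact_pair D (farr H f) (farr H g)" "exact_pair D (farr H g) (farr H h)"
    "exact_pair D (farr H (shA C n f)) (farr H (shA C n g))" "exact_pair D (farr H (shA C n g)) (farr H (shA C n h))"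
    "exact_pair D (farr H (shA C n h)) (farr H (shA C (n + 1) f))"
proof -
  have *: "exact_pair D (farr H (shA C n f)) (farr H (shA C n g)) \<and> exact_pair D (farr H (shA C n g)) (farr H (shA C n h)) \<and>
    exact_pair D (farr H (shA C n h)) (farr H (shA C (n + 1) f))" for n
    using homological assms unfolding homological_functors_def by blast
  show "exact_pair D (farr H (shA C n f)) (farr H (shA C n g))" "exact_pair D (farr H (shA C n g)) (farr H (shA C n h))"
    "exact_pair D (farr H (shA C n h)) (farr H (shA C (n + 1) f))" using * by simp_all
  show "exact_pair D (farr H f) (farr H g)" "exact_pair D (farr H g) (farr H h)" using *[of 0] by simp_all
qed

lemma kills_wge: "X \<in> wge C w 1 \<Longrightarrow> zero_object D (fobj H X)"
  and kills_wle: "X \<in> wle C w (-1) \<Longrightarrow> zero_object D (fobj H X)"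
  using pure by (simp_all add: is_pure_def kills_def)

lemma restrict_simps:
  "X \<in> weq C w 0 \<Longrightarrow> fobj (restrict_functor C w H) X = fobj H X"
  "f \<in> arr C \<Longrightarrow> src C f \<in> weq C w 0 \<Longrightarrow> tgt C f \<in> weq C w 0 \<Longrightarrow> farr (restrict_functor C w H) f = farr H f"
  by (simp_all add: restrict_functor_def)

text \<open>\<open>H\<close> kills weights at most \<open>-1\<close>, so it makes
  \<open>tc T 0\<close> and the shifted \<open>tc T (-1)\<close> monic; the kernel of the outgoing
  differential is then that of \<open>te T (-1)\<close>, namely \<open>tc T 0\<close>. It also kills
  weights at least \<open>1\<close>, so \<open>th T 0\<close> becomes epic and \<open>th T 1\<close>
  monic, and exactness at the zeroth truncation turns \<open>th T 0\<close> into a cokernel.\<close>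

lemma is_homology_pure:
  assumes T: "weight_tower C w M T"
  shows "is_homology D (R.dm T) (R.d0 T) (farr H (tc T 0), farr H (th T 0))"
proof -
  note th = weight_towerD_th[OF T] and tc0 = weight_towerD_tc[OF T, of 0] and tc1 = weight_towerD_tc[OF T, of "-1", simplified]
    and tc2 = weight_towerD_tc[OF T, of 1]
  note d = wc_diff_simps[OF T, of 0, simplified] wc_diff_simps[OF T, of "-1", simplified]
  note o = wc_obj_weq[OF T]
  have t0: "(tj T (-1), tc T 0, te T (-1)) \<in> tri C" and t1: "(tj T (-2), tc T (-1), te T (-2)) \<in> tri C"
    and t2: "(tj T 0, tc T 1, te T 0) \<in> tri C"
    using weight_towerD(6)[OF T, of 0] weight_towerD(6)[OF T, of "-1"] weight_towerD(6)[OF T, of 1] by simp_all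
  note j0 = weight_towerD(2-5)[OF T, of "-1", simplified] and j1 = weight_towerD(2-5)[OF T, of "-2", simplified]
    and j2 = weight_towerD(2-5)[OF T, of 0, simplified]
  have m0: "is_mono D (farr H (tc T 0))"
    by (rule D.exact_zero_mono[OF exact(1)[OF t0]]) (use kills_wle[OF th(2)[of "-1"]] j0 th in simp)
  have "shO C 1 (src C (th T (-2))) \<in> wle C w (-1)" using th(2)[of "-2"] th(4) by (simp add: shO_wle_iff)
  then have m1: "is_mono D (farr H (shA C 1 (tc T (-1))))"
    by (intro D.exact_zero_mono[OF exact(3)[OF t1]]) (use kills_wle j1 th in simp)
  have e0: "R.d0 T = farr H (shA C 1 (tc T (-1))) \<cdot>\<^bsub>D\<^esub> farr H (te T (-1))"
  proof -
    have "R.d0 T = farr H (wc_diff C T 0)" unfolding R.d0_def by (rule restrict_simps) (use d o in simp_all)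
    then show ?thesis unfolding wc_diff_zero_left using tc1 tc0 th by (simp add: H.farr_cmp)
  qed
  have k0: "is_kernel D (farr H (te T (-1))) (farr H (tc T 0))"
    by (rule D.exact_mono_kernel[OF exact(2)[OF t0] m0])
  have k: "is_kernel D (R.d0 T) (farr H (tc T 0))"
    unfolding e0 by (rule D.is_kernel_mono_cmp[OF k0 m1]) (use tc1 tc0 th in simp)
  have em: "R.dm T = farr H (tc T 0) \<cdot>\<^bsub>D\<^esub> farr H (shA C (-1) (te T 0))"
  proof -
    have "R.dm T = farr H (wc_diff C T (-1))" unfolding R.dm_def by (rule restrict_simps) (use d o in simp_all)
    then show ?thesis unfolding wc_diff_minus_one using tc0 tc2 th by (simp add: H.farr_cmp)
  qed
  note D0 = weight_decompositionD[OF weight_towerD(1)[OF T, of 0], simplified] and D1 = weight_decompositionD[OF weight_towerD(1)[OF T, of 1], simplified]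
  note tD0 = triD[OF D0(1)] and tD1 = triD[OF D1(1)]
  have h0: "is_epi D (farr H (th T 0))"
    by (rule D.exact_zero_epi[OF exact(1)[OF D0(1)]]) (use kills_wge[OF D0(4)] tD0 in simp)
  \<comment> \<open>The index \<open>1\<close> is what makes this arrow monic: its complement has
    weight at least \<open>2\<close> and stays in the killed range after desuspension.\<close>
  have "exact_pair D (farr H (shA C (-1) (tb T 1))) (farr H (th T 1))" using exact(5)[OF D1(1), of "-1"] by simp
  moreover have "zero_object D (src D (farr H (shA C (-1) (tb T 1))))"
  proof -
    have "shO C (-1) (tgt C (tr T 1)) \<in> wge C w 1" using D1(4) tD1(2) by (simp add: shO_wge_iff)
    then have "zero_object D (fobj H (shO C (-1) (src C (tb T 1))))" unfolding tD1(5) by (rule kills_wge)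
    moreover have "src D (farr H (shA C (-1) (tb T 1))) = fobj H (src C (shA C (-1) (tb T 1)))"
      by (rule H.farr_simps(2)) (use shA_arr[OF tD1(3), of "-1"] in blast)+
    ultimately show ?thesis using tD1(3) by simp
  qed
  ultimately have h1: "is_mono D (farr H (th T 1))" by (rule D.exact_zero_mono)
  have "exact_pair D (farr H (shA C (-1) (te T 0))) (farr H (tj T 0))" using exact(5)[OF t2, of "-1"] by simp
  then have "exact_pair D (farr H (shA C (-1) (te T 0))) (farr H (th T 1) \<cdot>\<^bsub>D\<^esub> farr H (tj T 0))"
    by (rule D.exact_pair_mono_cmp[OF _ h1]) (use j2 th in simp)
  moreover have "farr H (th T 1) \<cdot>\<^bsub>D\<^esub> farr H (tj T 0) = farr H (th T 0)"
    unfolding j2(4)[symmetric] by (rule H.farr_cmp[symmetric]) (use j2(1-3) th in simp_all)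
  ultimately have "is_cokernel D (farr H (shA C (-1) (te T 0))) (farr H (th T 0))"
    using D.exact_epi_cokernel h0 by simp
  then show ?thesis
    unfolding is_homology_def prod.case using k em tc0 tc2 th
    by (intro conjI bexI[of _ "farr H (shA C (-1) (te T 0))"]) (simp_all add: in_homs)
qed

text \<open>The comparison from the homology of the weight complex under \<open>H\<close> to the
  value of \<open>H\<close> at the object itself; \<open>homology_comparison\<close> guarantees an
  invertible choice.\<close>

definition theta :: "'m tower \<Rightarrow> 'b" where
  "theta T = (SOME m. sq_map D (R.hK T) (R.hQ T) (farr H (tc T 0)) (farr H (th T 0)) (idt D (src D (R.d0 T))) m \<and> is_iso D m)"

lemma theta:
  assumes T: "weight_tower C w M T"
  shows "sq_map D (R.hK T) (R.hQ T) (farr H (tc T 0)) (farr H (th T 0)) (idt D (fobj H (tgt C (tc T 0)))) (theta T)"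
    "is_iso D (theta T)"
    "theta T \<in> arr D" "src D (theta T) = tgt D (R.hQ T)" "tgt D (theta T) = fobj H M"
proof -
  have "\<exists>m. sq_map D (R.hK T) (R.hQ T) (farr H (tc T 0)) (farr H (th T 0)) (idt D (src D (R.d0 T))) m \<and> is_iso D m"
    using D.homology_comparison[OF R.is_complex[OF T] R.homology_data[OF T] is_homology_pure[OF T]] by blast
  from someI_ex[OF this]
  have *: "sq_map D (R.hK T) (R.hQ T) (farr H (tc T 0)) (farr H (th T 0)) (idt D (src D (R.d0 T))) (theta T)" "is_iso D (theta T)"
    unfolding theta_def[symmetric] by simp_all
  have "src D (R.d0 T) = fobj H (tgt C (tc T 0))"
    using R.complex_arrs[OF T] R.term_weq[OF T] by (simp add: restrict_simps)
  with * show "sq_map D (R.hK T) (R.hQ T) (farr H (tc T 0)) (farr H (th T 0)) (idt D (fobj H (tgt C (tc T 0)))) (theta T)"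
    "is_iso D (theta T)" by simp_all
  show "theta T \<in> arr D" "src D (theta T) = tgt D (R.hQ T)" "tgt D (theta T) = fobj H M"
    using D.sq_mapD[OF *(1)] weight_towerD_th[OF T] by simp_all
qed

lemma subquotient_pure:
  assumes T: "weight_tower C w M T"
  shows "subquotient D (farr H (tc T 0)) (farr H (th T 0))"
  by (rule D.is_homology_subquotient[OF is_homology_pure[OF T]])

text \<open>The truncation map \<open>a 0\<close> shows that \<open>farr H g\<close> is induced by
  \<open>farr H (b 0)\<close>, the arrow that also induces \<open>R.pmap S T g\<close>.\<close>

lemma theta_natural:
  assumes S: "weight_tower C w M S" and T: "weight_tower C w N T" and g: "g \<in> arr C" "src C g = M" "tgt C g = N"
  shows "theta T \<cdot>\<^bsub>D\<^esub> R.pmap S T g = farr H g \<cdot>\<^bsub>D\<^esub> theta S"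
proof -
  obtain a b where ab: "tower_morphism C S T g a b" by (rule ex_tower_morphism[OF S T g])
  note m = tower_morphismD(1-6)[OF ab, of 0] and e = tower_morphismD(7,9)[OF ab, of 0]
  note thS = weight_towerD_th[OF S] and thT = weight_towerD_th[OF T] and tcS = weight_towerD_tc[OF S, of 0] and tcT = weight_towerD_tc[OF T, of 0]
  note sS = subquotient_pure[OF S] and sT = subquotient_pure[OF T]
  have b: "farr (restrict_functor C w H) (b 0) = farr H (b 0)"
    by (rule restrict_simps) (use m R.term_weq[OF S] R.term_weq[OF T] in simp_all)
  have e1: "farr H (tc T 0) \<cdot>\<^bsub>D\<^esub> farr H (a 0) = farr H (b 0) \<cdot>\<^bsub>D\<^esub> farr H (tc S 0)"
    using arg_cong[OF e(2), of "farr H"] m tcS tcT thS thT by (simp add: H.farr_cmp)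
  have e2: "farr H g \<cdot>\<^bsub>D\<^esub> farr H (th S 0) = farr H (th T 0) \<cdot>\<^bsub>D\<^esub> farr H (a 0)"
    using arg_cong[OF e(1), of "farr H"] m thS thT g by (simp add: H.farr_cmp)
  have "sq_map D (farr H (tc S 0)) (farr H (th S 0)) (farr H (tc T 0)) (farr H (th T 0)) (farr H (b 0)) (farr H g)"
    by (rule D.sq_mapI[where u = "farr H (a 0)"]) (use e1 e2 m tcS tcT thS thT g in simp_all)
  note r1 = D.sq_map_cmp[OF R.subquotient(1)[OF S] sS sT theta(1)[OF S] this]
  note r2 = D.sq_map_cmp[OF R.subquotient(1)[OF S] R.subquotient(1)[OF T] sT R.sq_map_pmap[OF S T g ab] theta(1)[OF T]]
  have "farr H (b 0) \<cdot>\<^bsub>D\<^esub> idt D (fobj H (tgt C (tc S 0))) = idt D (fobj H (tgt C (tc T 0))) \<cdot>\<^bsub>D\<^esub> farr (restrict_functor C w H) (b 0)"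
    unfolding b using m tcS tcT by simp
  then show ?thesis using D.sq_map_unique[OF R.subquotient(1)[OF S] sT r2] r1 by simp
qed

end

section \<open>The equivalence of categories\<close>

lemma additive_functors_is_functor: "A \<in> additive_functors C D \<Longrightarrow> is_functor C D A"
  by (simp add: additive_functors_def)

lemma is_functor_comp:
  assumes "category C" "is_functor C D F" "is_functor D E G"
  shows "is_functor C E (comp_functor C G F)"
proof -
  interpret C: category C by fact
  note F = is_functorD[OF assms(2)] and G = is_functorD[OF assms(3)]
  show ?thesis unfolding is_functor_def
  proof (intro conjI ballI impI)
    show "fobj (comp_functor C G F) \<in> obj C \<rightarrow>\<^sub>E obj E" "farr (comp_functor C G F) \<in> arr C \<rightarrow>\<^sub>E arr E"
      using F(1,2) G(1,2) by (auto simp: comp_functor_def compose_def)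
    fix f assume f: "f \<in> arr C"
    show "src E (farr (comp_functor C G F) f) = fobj (comp_functor C G F) (src C f)"
      "tgt E (farr (comp_functor C G F) f) = fobj (comp_functor C G F) (tgt C f)"
      using f F(2-4)[OF f] G(3,4)[OF F(2)[OF f]] by (simp_all add: comp_functor_def compose_def)
    fix g assume g: "g \<in> arr C" "tgt C f = src C g"
    then show "farr (comp_functor C G F) (g \<cdot>\<^bsub>C\<^esub> f) = farr (comp_functor C G F) g \<cdot>\<^bsub>E\<^esub> farr (comp_functor C G F) f"
      using f F(6)[OF f g] G(6)[OF F(2)[OF f] F(2)[OF g(1)]] F(4)[OF f] F(3)[OF g(1)]
      by (simp add: comp_functor_def compose_def)
  next
    fix X assume X: "X \<in> obj C"
    then show "farr (comp_functor C G F) (idt C X) = idt E (fobj (comp_functor C G F) X)"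
      using F(5)[OF X] G(5)[OF F(1)[OF X]] by (simp add: comp_functor_def compose_def)
  qed
qed

lemma is_functor_id:
  assumes "category C"
  shows "is_functor C C (id_functor C)"
proof -
  interpret C: category C by fact
  show ?thesis by (simp add: is_functor_def id_functor_def)
qed

context pure_setting
begin

lemma homological_is_functor: "H \<in> homological_functors C D \<Longrightarrow> is_functor C D H"
  by (simp add: homological_functors_def additive_functors_def)

lemma tower_choice_weight_tower: "tower_choice C w T \<Longrightarrow> M \<in> obj C \<Longrightarrow> weight_tower C w M (T M)"
  by (simp add: tower_choice_def)

lemma heart_transformationI:
  assumes "A \<in> additive_functors (heart C w) D" "B \<in> additive_functors (heart C w) D" "is_nat (heart C w) D A B t"
  shows "heart_transformation C w D A B t"
proof -
  interpret A: heart_functor C w D A by (rule heart_functorI[OF assms(1)])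
  interpret B: heart_functor C w D B by (rule heart_functorI[OF assms(2)])
  show ?thesis by unfold_locales (rule assms(3))
qed

lemma pure_functor_is_nat:
  assumes T: "tower_choice C w T" and t: "t \<in> arr (additive_functor_cat C w D)"
  shows "is_nat C D (pure_functor C D T (nsrc t)) (pure_functor C D T (ntgt t))
    (ncomp (farr (pure_assignment C w D T) t))"
proof -
  interpret t: heart_transformation C w D "nsrc t" "ntgt t" "ncomp t"
    by (rule heart_transformationI) (use t in simp_all)
  note tT = tower_choice_weight_tower[OF T]
  have c: "ncomp (farr (pure_assignment C w D T) t) = (\<lambda>M \<in> obj C. t.nmap (T M))"
    unfolding pure_assignment_def t.nmap_def using t by (simp del: functor_cat_simps)
  show ?thesis unfolding c is_nat_def
  proof (intro conjI ballI)
    fix M assume M: "M \<in> obj C"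
    show "(\<lambda>M \<in> obj C. t.nmap (T M)) M \<in> homs D (fobj (pure_functor C D T (nsrc t)) M) (fobj (pure_functor C D T (ntgt t)) M)"
      using t.nmap_simps[OF tT[OF M]] M by (simp add: in_homs t.A.pure_functor_simps t.B.pure_functor_simps)
  next
    fix f assume f: "f \<in> arr C"
    show "(\<lambda>M \<in> obj C. t.nmap (T M)) (tgt C f) \<cdot>\<^bsub>D\<^esub> farr (pure_functor C D T (nsrc t)) f =
      farr (pure_functor C D T (ntgt t)) f \<cdot>\<^bsub>D\<^esub> (\<lambda>M \<in> obj C. t.nmap (T M)) (src C f)"
      using t.nmap_natural[OF tT[OF src_obj[OF f]] tT[OF tgt_obj[OF f]] f refl refl] f
      by (simp add: t.A.pure_functor_simps t.B.pure_functor_simps)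
  qed simp
qed

lemma pure_assignment_simps:
  "A \<in> additive_functors (heart C w) D \<Longrightarrow> fobj (pure_assignment C w D T) A = pure_functor C D T A"
  "t \<in> arr (additive_functor_cat C w D) \<Longrightarrow> nsrc (farr (pure_assignment C w D T) t) = pure_functor C D T (nsrc t)"
  "t \<in> arr (additive_functor_cat C w D) \<Longrightarrow> ntgt (farr (pure_assignment C w D T) t) = pure_functor C D T (ntgt t)"
  "t \<in> arr (additive_functor_cat C w D) \<Longrightarrow> ncomp (farr (pure_assignment C w D T) t) =
    (\<lambda>M \<in> obj C. pure_map C D (nsrc t) (T M) (ntgt t) (T M) (ncomp t (wc_obj C (T M) 0)))"
  by (simp_all add: pure_assignment_def)

text \<open>\<open>S\<close> is kept open so that all homological functors and the pure ones are
  both covered as targets. Functoriality rests on the uniqueness of induced maps.\<close>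

lemma is_functor_pure_assignment:
  assumes T: "tower_choice C w T" and S: "\<And>A. A \<in> additive_functors (heart C w) D \<Longrightarrow> pure_functor C D T A \<in> S"
  shows "is_functor (additive_functor_cat C w D) (functor_cat C D S) (pure_assignment C w D T)"
proof -
  let ?F = "pure_assignment C w D T" and ?X = "additive_functor_cat C w D" and ?Y = "functor_cat C D S"
  note tT = tower_choice_weight_tower[OF T]
  show ?thesis unfolding is_functor_def
  proof (intro conjI ballI impI)
    show "fobj ?F \<in> obj ?X \<rightarrow>\<^sub>E obj ?Y" using S by (auto simp: pure_assignment_def)
    show "farr ?F \<in> arr ?X \<rightarrow>\<^sub>E arr ?Y"
    proof (rule PiE_I)
      fix t assume t: "t \<in> arr ?X"
      then have "nsrc t \<in> additive_functors (heart C w) D" "ntgt t \<in> additive_functors (heart C w) D" by simp_all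
      then show "farr ?F t \<in> arr ?Y"
        using pure_functor_is_nat[OF T t] S pure_assignment_simps(2,3)[OF t] by simp
    qed (simp add: pure_assignment_def del: functor_cat_simps)
    fix t assume t: "t \<in> arr ?X"
    then have n: "nsrc t \<in> additive_functors (heart C w) D" "ntgt t \<in> additive_functors (heart C w) D"
      "is_nat (heart C w) D (nsrc t) (ntgt t) (ncomp t)" by simp_all
    show "src ?Y (farr ?F t) = fobj ?F (src ?X t)" "tgt ?Y (farr ?F t) = fobj ?F (tgt ?X t)"
      using n pure_assignment_simps(2,3)[OF t] by (simp_all add: pure_assignment_simps(1))
    fix s assume s: "s \<in> arr ?X" and st: "tgt ?X t = src ?X s"
    then have n': "ntgt s \<in> additive_functors (heart C w) D" "is_nat (heart C w) D (ntgt t) (ntgt s) (ncomp s)"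
      and st': "nsrc s = ntgt t" by simp_all
    interpret FX: category ?X
      by (rule category_functor_cat[OF category_heart D.category_axioms additive_functors_is_functor])
    have sta: "s \<cdot>\<^bsub>?X\<^esub> t \<in> arr ?X" using FX.cmp_simps(1)[OF t s] st by simp
    interpret t: heart_transformation C w D "nsrc t" "ntgt t" "ncomp t" by (rule heart_transformationI[OF n])
    interpret s: heart_transformation C w D "ntgt t" "ntgt s" "ncomp s" by (rule heart_transformationI[OF n(2) n'])
    interpret st: heart_transformation C w D "nsrc t" "ntgt s" "\<lambda>X \<in> weq C w 0. ncomp s X \<cdot>\<^bsub>D\<^esub> ncomp t X"
      by (rule heart_transformationI[OF n(1) n'(1)]) (use sta st' in simp)
    have c: "st.nmap (T M) = s.nmap (T M) \<cdot>\<^bsub>D\<^esub> t.nmap (T M)" if M: "M \<in> obj C" for M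
    proof (rule st.nmap_eqI[OF tT[OF M]])
      have "(\<lambda>X \<in> weq C w 0. ncomp s X \<cdot>\<^bsub>D\<^esub> ncomp t X) (tgt C (tc (T M) 0))
          = ncomp s (tgt C (tc (T M) 0)) \<cdot>\<^bsub>D\<^esub> ncomp t (tgt C (tc (T M) 0))"
        using t.A.term_weq[OF tT[OF M]] by simp
      then show "sq_map D (t.A.hK (T M)) (t.A.hQ (T M)) (s.B.hK (T M)) (s.B.hQ (T M))
        ((\<lambda>X \<in> weq C w 0. ncomp s X \<cdot>\<^bsub>D\<^esub> ncomp t X) (tgt C (tc (T M) 0))) (s.nmap (T M) \<cdot>\<^bsub>D\<^esub> t.nmap (T M))"
        using D.sq_map_cmp[OF t.A.subquotient(1)[OF tT[OF M]] t.B.subquotient(1)[OF tT[OF M]] s.B.subquotient(1)[OF tT[OF M]]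
          t.sq_map_nmap[OF tT[OF M]] s.sq_map_nmap[OF tT[OF M]]] by simp
    qed
    show "farr ?F (s \<cdot>\<^bsub>?X\<^esub> t) = farr ?F s \<cdot>\<^bsub>?Y\<^esub> farr ?F t"
    proof (rule nattrans_eqI[where A = "obj C"])
      fix M assume M: "M \<in> obj C"
      show "ncomp (farr ?F (s \<cdot>\<^bsub>?X\<^esub> t)) M = ncomp (farr ?F s \<cdot>\<^bsub>?Y\<^esub> farr ?F t) M"
        using M c[OF M] st' pure_assignment_simps(4)[OF sta] pure_assignment_simps(4)[OF s] pure_assignment_simps(4)[OF t]
        by (simp add: t.nmap_def s.nmap_def st.nmap_def)
    qed (use pure_assignment_simps(2-4)[OF sta] pure_assignment_simps(2-4)[OF s] pure_assignment_simps(2-4)[OF t] in simp_all)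
  next
    fix A assume "A \<in> obj ?X"
    then have A: "A \<in> additive_functors (heart C w) D" by simp
    interpret FX: category ?X
      by (rule category_functor_cat[OF category_heart D.category_axioms additive_functors_is_functor])
    have i: "idt ?X A \<in> arr ?X" using FX.idt_simps(1)[of A] A by simp
    interpret t: heart_transformation C w D A A "\<lambda>X \<in> weq C w 0. idt D (fobj A X)"
      by (rule heart_transformationI[OF A A]) (use i in simp)
    have c: "t.nmap (T M) = idt D (tgt D (t.A.hQ (T M)))" if M: "M \<in> obj C" for M
      by (rule t.nmap_eqI[OF tT[OF M]])
        (use D.sq_map_idt[OF t.A.subquotient(1)[OF tT[OF M]]] t.A.term_weq[OF tT[OF M]] t.A.subquotient(3)[OF tT[OF M]] in simp)
    show "farr ?F (idt ?X A) = idt ?Y (fobj ?F A)"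
    proof (rule nattrans_eqI[where A = "obj C"])
      fix M assume M: "M \<in> obj C"
      show "ncomp (farr ?F (idt ?X A)) M = ncomp (idt ?Y (fobj ?F A)) M"
        using M c[OF M] A pure_assignment_simps(4)[OF i]
        by (simp add: t.nmap_def pure_assignment_simps(1) t.A.pure_functor_simps)
    qed (use A pure_assignment_simps(2-4)[OF i] in \<open>simp_all add: pure_assignment_simps(1)\<close>)
  qed
qed

text \<open>The quasi-inverse of \<open>pure_assignment\<close>.\<close>

definition restriction :: "(('o, 'm, 'a, 'b) cfunctor, ('o, 'm, 'a, 'b) nattrans,
    ('o, 'm, 'a, 'b) cfunctor, ('o, 'm, 'a, 'b) nattrans) cfunctor" where
  "restriction = \<lparr>
    fobj = (\<lambda>H \<in> obj (pure_functor_cat C w D). restrict_functor C w H),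
    farr = (\<lambda>t \<in> arr (pure_functor_cat C w D). \<lparr>nsrc = restrict_functor C w (nsrc t),
      ntgt = restrict_functor C w (ntgt t), ncomp = restrict (ncomp t) (weq C w 0)\<rparr>)\<rparr>"

lemma restrict_nat:
  assumes "is_nat C D H H' t"
  shows "is_nat (heart C w) D (restrict_functor C w H) (restrict_functor C w H') (restrict t (weq C w 0))"
proof -
  have o: "X \<in> obj C" if "X \<in> weq C w 0" for X using that weq_obj by blast
  show ?thesis
    using is_natD(1-3)[OF assms o] is_natD(4)[OF assms] by (simp add: is_nat_def restrict_functor_def in_homs)
qed

lemma is_functor_restriction:
  "is_functor (pure_functor_cat C w D) (additive_functor_cat C w D) restriction"
proof -
  let ?Y = "pure_functor_cat C w D" and ?X = "additive_functor_cat C w D"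
  interpret Y: category ?Y
    by (rule category_functor_cat[OF category_axioms D.category_axioms]) (simp add: homological_is_functor)
  have r: "restrict_functor C w H \<in> additive_functors (heart C w) D" if "H \<in> homological_functors C D" for H
    using that by (intro restrict_functor_additive) (simp add: homological_functors_def)
  have o: "X \<in> obj C" if "X \<in> weq C w 0" for X using that weq_obj by blast
  have s: "fobj restriction H = restrict_functor C w H" if "H \<in> obj ?Y" for H
    using that by (simp add: restriction_def)
  have f: "farr restriction t = \<lparr>nsrc = restrict_functor C w (nsrc t),
      ntgt = restrict_functor C w (ntgt t), ncomp = restrict (ncomp t) (weq C w 0)\<rparr>" if "t \<in> arr ?Y" for t
    using that by (simp add: restriction_def del: functor_cat_simps)
  show ?thesis unfolding is_functor_def
  proof (intro conjI ballI impI)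
    show "fobj restriction \<in> obj ?Y \<rightarrow>\<^sub>E obj ?X" using r by (auto simp: restriction_def)
    show "farr restriction \<in> arr ?Y \<rightarrow>\<^sub>E arr ?X"
    proof (rule PiE_I)
      fix t assume t: "t \<in> arr ?Y"
      then have n: "nsrc t \<in> homological_functors C D" "ntgt t \<in> homological_functors C D"
        "is_nat C D (nsrc t) (ntgt t) (ncomp t)" by simp_all
      show "farr restriction t \<in> arr ?X" unfolding f[OF t] using r[OF n(1)] r[OF n(2)] restrict_nat[OF n(3)] by simp
    qed (simp add: restriction_def del: functor_cat_simps)
    fix t assume t: "t \<in> arr ?Y"
    then have n: "nsrc t \<in> obj ?Y" "ntgt t \<in> obj ?Y" by simp_all
    show "src ?X (farr restriction t) = fobj restriction (src ?Y t)" "tgt ?X (farr restriction t) = fobj restriction (tgt ?Y t)"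
      using s[OF n(1)] s[OF n(2)] f[OF t] by simp_all
    fix u assume u: "u \<in> arr ?Y" and tu: "tgt ?Y t = src ?Y u"
    have ut: "u \<cdot>\<^bsub>?Y\<^esub> t \<in> arr ?Y" using Y.cmp_simps(1)[OF t u] tu by simp
    show "farr restriction (u \<cdot>\<^bsub>?Y\<^esub> t) = farr restriction u \<cdot>\<^bsub>?X\<^esub> farr restriction t"
      unfolding f[OF t] f[OF u] f[OF ut] by (auto simp: o intro!: ext)
  next
    fix H assume H: "H \<in> obj ?Y"
    have i: "idt ?Y H \<in> arr ?Y" using Y.idt_simps(1)[OF H] .
    show "farr restriction (idt ?Y H) = idt ?X (fobj restriction H)"
      unfolding f[OF i] s[OF H] by (auto simp: o restrict_functor_def intro!: ext)
  qed
qed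

text \<open>Naturality of \<open>theta\<close> in the functor: evaluating \<open>t\<close> at the
  zeroth truncation shows that \<open>t M\<close> is induced by the component of \<open>t\<close> at
  the zeroth term.\<close>

lemma theta_natural_transformation:
  assumes H: "H \<in> homological_functors C D \<and> is_pure C w D H" and H': "H' \<in> homological_functors C D \<and> is_pure C w D H'"
    and n: "is_nat C D H H' t" and T: "weight_tower C w M T"
  shows "pure_homological.theta C w D H' T \<cdot>\<^bsub>D\<^esub> pure_map C D (restrict_functor C w H) T (restrict_functor C w H') T
      (restrict t (weq C w 0) (wc_obj C T 0)) = t M \<cdot>\<^bsub>D\<^esub> pure_homological.theta C w D H T"
proof -
  interpret H: pure_homological C w D H by unfold_locales (use H in simp_all)
  interpret H': pure_homological C w D H' by unfold_locales (use H' in simp_all)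
  interpret R: heart_transformation C w D "restrict_functor C w H" "restrict_functor C w H'" "restrict t (weq C w 0)"
    by (rule heart_transformationI[OF H.R.A_additive H'.R.A_additive restrict_nat[OF n]])
  note sH = H.subquotient_pure[OF T] and sH' = H'.subquotient_pure[OF T]
  note s = H.R.subquotient(1)[OF T] and s' = H'.R.subquotient(1)[OF T]
  note th = weight_towerD_th[OF T] and tc = weight_towerD_tc[OF T, of 0]
  note t = is_natD(1-3)[OF n] and tn = is_natD(4)[OF n]
  have "sq_map D (farr H (tc T 0)) (farr H (th T 0)) (farr H' (tc T 0)) (farr H' (th T 0)) (t (tgt C (tc T 0))) (t M)"
  proof (rule D.sq_mapI[where u = "t (src C (th T 0))"])
    show "farr H' (tc T 0) \<cdot>\<^bsub>D\<^esub> t (src C (th T 0)) = t (tgt C (tc T 0)) \<cdot>\<^bsub>D\<^esub> farr H (tc T 0)"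
      using tn[OF tc(1)] tc by simp
    show "t M \<cdot>\<^bsub>D\<^esub> farr H (th T 0) = farr H' (th T 0) \<cdot>\<^bsub>D\<^esub> t (src C (th T 0))"
      using tn[OF th(1)[of 0]] th by simp
  qed (use t th tc in simp_all)
  note r1 = D.sq_map_cmp[OF s sH sH' H.theta(1)[OF T] this]
  have w: "tgt C (tc T 0) \<in> weq C w 0" by (rule H.R.term_weq[OF T])
  note r2 = D.sq_map_cmp[OF s s' sH' R.sq_map_nmap[OF T] H'.theta(1)[OF T]]
  have "t (tgt C (tc T 0)) \<cdot>\<^bsub>D\<^esub> idt D (fobj H (tgt C (tc T 0))) = idt D (fobj H' (tgt C (tc T 0))) \<cdot>\<^bsub>D\<^esub> restrict t (weq C w 0) (tgt C (tc T 0))"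
    using t w tc by simp
  then have "H'.theta T \<cdot>\<^bsub>D\<^esub> R.nmap T = t M \<cdot>\<^bsub>D\<^esub> H.theta T"
    using D.sq_map_unique[OF s sH' r2] r1 by simp
  then show ?thesis unfolding R.nmap_def .
qed

lemma equivalence_pure_assignment:
  assumes T: "tower_choice C w T"
  shows "equivalence_of_categories (additive_functor_cat C w D) (pure_functor_cat C w D) (pure_assignment C w D T)"
proof -
  let ?F = "pure_assignment C w D T" and ?X = "additive_functor_cat C w D" and ?Y = "pure_functor_cat C w D"
  note tT = tower_choice_weight_tower[OF T]
  have o: "X \<in> obj C" if "X \<in> weq C w 0" for X using that weq_obj by blast
  have YS: "pure_functor C D T A \<in> {H \<in> homological_functors C D. is_pure C w D H}"
    if "A \<in> additive_functors (heart C w) D" for A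
  proof -
    interpret A: heart_functor C w D A by (rule heart_functorI[OF that])
    show ?thesis using A.pure_functor_homological[OF T] A.pure_functor_pure[OF T] by simp
  qed
  have F: "is_functor ?X ?Y ?F" by (rule is_functor_pure_assignment[OF T YS])
  note G = is_functor_restriction
  note FD = is_functorD[OF F] and GD = is_functorD[OF G]
  interpret X: category ?X
    by (rule category_functor_cat[OF category_heart D.category_axioms additive_functors_is_functor])
  interpret Y: category ?Y
    by (rule category_functor_cat[OF category_axioms D.category_axioms]) (simp add: homological_is_functor)
  have GF: "is_functor ?X ?X (comp_functor ?X restriction ?F)" by (rule is_functor_comp[OF X.category_axioms F G])
  have FG: "is_functor ?Y ?Y (comp_functor ?Y ?F restriction)" by (rule is_functor_comp[OF Y.category_axioms G F])
  have I: "is_functor ?X ?X (id_functor ?X)" by (rule is_functor_id[OF X.category_axioms])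
  have fF: "fobj ?F A = pure_functor C D T A" if "A \<in> obj ?X" for A
    using that by (simp add: pure_assignment_simps)
  have fG: "fobj restriction H = restrict_functor C w H" if "H \<in> obj ?Y" for H
    using that by (simp add: restriction_def)
  have aG: "farr restriction t = \<lparr>nsrc = restrict_functor C w (nsrc t),
      ntgt = restrict_functor C w (ntgt t), ncomp = restrict (ncomp t) (weq C w 0)\<rparr>" if "t \<in> arr ?Y" for t
    using that by (simp add: restriction_def del: functor_cat_simps)
  \<comment> \<open>The comparison on the side of the heart, assembled from \<open>rho\<close>. It
    points towards \<open>A\<close>, so its inverse is taken below to match the direction asked for
    in an equivalence.\<close>
  define r where "r = (\<lambda>A \<in> obj ?X. \<lparr>nsrc = restrict_functor C w (pure_functor C D T A), ntgt = A,
    ncomp = (\<lambda>P \<in> weq C w 0. heart_functor.rho C D A (T P))\<rparr>)"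
  have r1: "is_nat_iso (heart C w) D (restrict_functor C w (pure_functor C D T A)) A (\<lambda>P \<in> weq C w 0. heart_functor.rho C D A (T P))"
    if A: "A \<in> obj ?X" for A
  proof -
    interpret A: heart_functor C w D A by (rule heart_functorI) (use A in simp)
    show ?thesis unfolding is_nat_iso_def is_nat_def
    proof (intro conjI ballI)
      fix P assume "P \<in> obj (heart C w)"
      then have P: "P \<in> weq C w 0" by simp
      show "(\<lambda>P \<in> weq C w 0. A.rho (T P)) P \<in> homs D (fobj (restrict_functor C w (pure_functor C D T A)) P) (fobj A P)"
        using D.sq_mapD[OF A.sq_map_rho[OF tT[OF o[OF P]] P]] P o[OF P]
        by (simp add: in_homs restrict_functor_def A.pure_functor_simps)
      show "is_iso D ((\<lambda>P \<in> weq C w 0. A.rho (T P)) P)" using A.rho_iso[OF tT[OF o[OF P]] P] P by simp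
    next
      fix f assume "f \<in> arr (heart C w)"
      then have f: "f \<in> arr C" "src C f \<in> weq C w 0" "tgt C f \<in> weq C w 0" by simp_all
      show "(\<lambda>P \<in> weq C w 0. A.rho (T P)) (tgt (heart C w) f) \<cdot>\<^bsub>D\<^esub> farr (restrict_functor C w (pure_functor C D T A)) f =
        farr A f \<cdot>\<^bsub>D\<^esub> (\<lambda>P \<in> weq C w 0. A.rho (T P)) (src (heart C w) f)"
        using A.rho_natural[OF tT[OF o[OF f(2)]] tT[OF o[OF f(3)]] f(2,3,1) refl refl] f
        by (simp add: restrict_functor_def A.pure_functor_simps)
    qed simp
  qed
  have gA: "restrict_functor C w (pure_functor C D T A) \<in> obj ?X" if "A \<in> obj ?X" for A
    using GD(1)[OF FD(1)[OF that]] fF[OF that] fG[OF FD(1)[OF that]] by (simp del: functor_cat_simps)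
  have r2: "is_nat_iso ?X ?X (comp_functor ?X restriction ?F) (id_functor ?X) r"
    unfolding is_nat_iso_def is_nat_def
  proof (intro conjI ballI)
    fix A assume A: "A \<in> obj ?X"
    have n: "is_nat (heart C w) D (restrict_functor C w (pure_functor C D T A)) A (\<lambda>P \<in> weq C w 0. heart_functor.rho C D A (T P))"
      using r1[OF A] by (simp add: is_nat_iso_def)
    have rA: "r A = \<lparr>nsrc = restrict_functor C w (pure_functor C D T A), ntgt = A,
      ncomp = (\<lambda>P \<in> weq C w 0. heart_functor.rho C D A (T P))\<rparr>" using A by (simp add: r_def del: functor_cat_simps)
    show "r A \<in> homs ?X (fobj (comp_functor ?X restriction ?F) A) (fobj (id_functor ?X) A)"
      unfolding rA using n A gA[OF A] fF[OF A] fG[OF FD(1)[OF A]]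
      by (simp add: in_homs comp_functor_def compose_def id_functor_def)
    show "is_iso ?X (r A)"
      unfolding rA by (rule functor_cat_iso[OF category_heart D.category_axioms _ _ additive_functors_is_functor r1[OF A]])
        (use A gA[OF A] in simp_all)
  next
    fix t assume t: "t \<in> arr ?X"
    then have n: "nsrc t \<in> additive_functors (heart C w) D" "ntgt t \<in> additive_functors (heart C w) D"
      "is_nat (heart C w) D (nsrc t) (ntgt t) (ncomp t)" by simp_all
    interpret t: heart_transformation C w D "nsrc t" "ntgt t" "ncomp t" by (rule heart_transformationI[OF n])
    note Ft = FD(2)[OF t]
    have c: "farr (comp_functor ?X restriction ?F) t = \<lparr>nsrc = restrict_functor C w (pure_functor C D T (nsrc t)),
      ntgt = restrict_functor C w (pure_functor C D T (ntgt t)), ncomp = restrict (ncomp (farr ?F t)) (weq C w 0)\<rparr>"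
      using t aG[OF Ft] pure_assignment_simps(2,3)[OF t] by (simp add: comp_functor_def compose_def del: functor_cat_simps)
    have i: "farr (id_functor ?X) t = t" using t by (simp add: id_functor_def del: functor_cat_simps)
    show "r (tgt ?X t) \<cdot>\<^bsub>?X\<^esub> farr (comp_functor ?X restriction ?F) t = farr (id_functor ?X) t \<cdot>\<^bsub>?X\<^esub> r (src ?X t)"
      unfolding c i
    proof (rule nattrans_eqI[where A = "weq C w 0"])
      fix P assume P: "P \<in> weq C w 0"
      show "ncomp (r (tgt ?X t) \<cdot>\<^bsub>?X\<^esub> \<lparr>nsrc = restrict_functor C w (pure_functor C D T (nsrc t)),
        ntgt = restrict_functor C w (pure_functor C D T (ntgt t)), ncomp = restrict (ncomp (farr ?F t)) (weq C w 0)\<rparr>) P =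
        ncomp (t \<cdot>\<^bsub>?X\<^esub> r (src ?X t)) P"
        using P o[OF P] n t.rho_natural_transformation[OF tT[OF o[OF P]] P] pure_assignment_simps(4)[OF t]
        by (simp add: r_def t.nmap_def)
    qed (use n in \<open>simp_all add: r_def\<close>)
  qed (simp add: r_def)
  obtain s where s: "is_nat_iso ?X ?X (id_functor ?X) (comp_functor ?X restriction ?F) s"
    by (rule is_nat_iso_inverse[OF X.category_axioms X.category_axioms GF I r2])
  \<comment> \<open>The comparison on the side of pure functors, assembled from
    \<open>theta\<close>; its direction is already the required one.\<close>
  define u where "u = (\<lambda>H \<in> obj ?Y. \<lparr>nsrc = pure_functor C D T (restrict_functor C w H), ntgt = H,
    ncomp = (\<lambda>M \<in> obj C. pure_homological.theta C w D H (T M))\<rparr>)"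
  have u1: "is_nat_iso C D (pure_functor C D T (restrict_functor C w H)) H (\<lambda>M \<in> obj C. pure_homological.theta C w D H (T M))"
    if H: "H \<in> obj ?Y" for H
  proof -
    interpret H: pure_homological C w D H by unfold_locales (use H in simp_all)
    show ?thesis unfolding is_nat_iso_def is_nat_def
    proof (intro conjI ballI)
      fix M assume M: "M \<in> obj C"
      show "(\<lambda>M \<in> obj C. H.theta (T M)) M \<in> homs D (fobj (pure_functor C D T (restrict_functor C w H)) M) (fobj H M)"
        using H.theta(3-5)[OF tT[OF M]] M by (simp add: in_homs H.R.pure_functor_simps)
      show "is_iso D ((\<lambda>M \<in> obj C. H.theta (T M)) M)" using H.theta(2)[OF tT[OF M]] M by simp
    next
      fix f assume f: "f \<in> arr C"
      show "(\<lambda>M \<in> obj C. H.theta (T M)) (tgt C f) \<cdot>\<^bsub>D\<^esub> farr (pure_functor C D T (restrict_functor C w H)) f =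
        farr H f \<cdot>\<^bsub>D\<^esub> (\<lambda>M \<in> obj C. H.theta (T M)) (src C f)"
        using H.theta_natural[OF tT[OF src_obj[OF f]] tT[OF tgt_obj[OF f]] f refl refl] f
        by (simp add: H.R.pure_functor_simps)
    qed simp
  qed
  have u2: "is_nat_iso ?Y ?Y (comp_functor ?Y ?F restriction) (id_functor ?Y) u"
    unfolding is_nat_iso_def is_nat_def
  proof (intro conjI ballI)
    fix H assume H: "H \<in> obj ?Y"
    have gH: "restrict_functor C w H \<in> obj ?X" using GD(1)[OF H] fG[OF H] by simp
    have gH': "pure_functor C D T (restrict_functor C w H) \<in> obj ?Y" using YS gH by simp
    have n: "is_nat C D (pure_functor C D T (restrict_functor C w H)) H (\<lambda>M \<in> obj C. pure_homological.theta C w D H (T M))"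
      using u1[OF H] by (simp add: is_nat_iso_def)
    have uH: "u H = \<lparr>nsrc = pure_functor C D T (restrict_functor C w H), ntgt = H,
      ncomp = (\<lambda>M \<in> obj C. pure_homological.theta C w D H (T M))\<rparr>" using H by (simp add: u_def)
    show "u H \<in> homs ?Y (fobj (comp_functor ?Y ?F restriction) H) (fobj (id_functor ?Y) H)"
      unfolding uH using n H gH' fF[OF gH] fG[OF H]
      by (simp add: in_homs comp_functor_def compose_def id_functor_def)
    show "is_iso ?Y (u H)"
      unfolding uH by (rule functor_cat_iso[OF category_axioms D.category_axioms _ _ _ u1[OF H]])
        (use H gH' in \<open>simp_all add: homological_is_functor\<close>)
  next
    fix t assume t: "t \<in> arr ?Y"
    then have n: "nsrc t \<in> obj ?Y" "ntgt t \<in> obj ?Y" "is_nat C D (nsrc t) (ntgt t) (ncomp t)" by simp_all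
    note Gt = GD(2)[OF t]
    have c: "farr (comp_functor ?Y ?F restriction) t = farr ?F (farr restriction t)"
      using t by (simp add: comp_functor_def compose_def del: functor_cat_simps)
    have i: "farr (id_functor ?Y) t = t" using t by (simp add: id_functor_def del: functor_cat_simps)
    show "u (tgt ?Y t) \<cdot>\<^bsub>?Y\<^esub> farr (comp_functor ?Y ?F restriction) t = farr (id_functor ?Y) t \<cdot>\<^bsub>?Y\<^esub> u (src ?Y t)"
      unfolding c i
    proof (rule nattrans_eqI[where A = "obj C"])
      fix M assume M: "M \<in> obj C"
      have w: "wc_obj C (T M) 0 \<in> weq C w 0" by (rule wc_obj_weq[OF tT[OF M]])
      have "ncomp (farr ?F (farr restriction t)) M = pure_map C D (restrict_functor C w (nsrc t)) (T M)
          (restrict_functor C w (ntgt t)) (T M) (restrict (ncomp t) (weq C w 0) (wc_obj C (T M) 0))"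
        using M pure_assignment_simps(4)[OF Gt] aG[OF t] by simp
      then show "ncomp (u (tgt ?Y t) \<cdot>\<^bsub>?Y\<^esub> farr ?F (farr restriction t)) M = ncomp (t \<cdot>\<^bsub>?Y\<^esub> u (src ?Y t)) M"
        using M n theta_natural_transformation[OF _ _ n(3) tT[OF M]] by (simp add: u_def)
    qed (use n pure_assignment_simps(2,3)[OF Gt] aG[OF t] in \<open>simp_all add: u_def\<close>)
  qed (simp add: u_def)
  show ?thesis unfolding equivalence_of_categories_def using F G s u2 by blast
qed

end

section \<open>Bounded weight structures\<close>

context weight_structure
begin

text \<open>The identity of \<open>X\<close> is an arrow between orthogonal classes.\<close>

lemma identity_zero_if_wle_wge:
  assumes "X \<in> wle C w i" "X \<in> wge C w j" "i < j"
  shows "zero_object C X"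
proof -
  have X: "X \<in> obj C" using assms(1) by (rule wle_obj)
  have "idt C X = pzero C X X" by (rule weight_orthogonal[OF assms]) (use X in simp_all)
  then show ?thesis using X by (simp add: zero_object_iff)
qed

text \<open>An object of weights \<open>1\<close> to \<open>n + 1\<close> is cut by a decomposition
  at \<open>n\<close> into a piece of weight exactly \<open>n + 1\<close> and one of weights
  \<open>1\<close> to \<open>n\<close>; boundedness places every object of positive weight in such a
  range. On the negative side the lowest weight is cut off instead.\<close>

lemma bounded_induction:
  assumes b: "bounded_weights C w"
    and ext: "\<And>f g h. (f, g, h) \<in> tri C \<Longrightarrow> P (src C f) \<Longrightarrow> P (tgt C g) \<Longrightarrow> P (tgt C f)"
    and zero: "\<And>X. zero_object C X \<Longrightarrow> P X"
    and weq: "\<And>i X. i \<noteq> 0 \<Longrightarrow> X \<in> weq C w i \<Longrightarrow> P X"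
  shows "X \<in> wge C w 1 \<Longrightarrow> P X" "X \<in> wle C w (-1) \<Longrightarrow> P X"
proof -
  have up: "P X" if "X \<in> wge C w 1" "X \<in> wle C w (int n)" for n X
    using that
  proof (induction n arbitrary: X)
    case 0
    then have X: "X \<in> wle C w 0" by simp
    show ?case by (rule zero[OF identity_zero_if_wle_wge[OF X "0.prems"(1)]]) simp
  next
    case (Suc n)
    show ?case
    proof (cases "n = 0")
      case True
      then show ?thesis using Suc.prems by (intro weq[of 1]) (simp_all add: weq_def)
    next
      case False
      have X: "X \<in> obj C" using Suc.prems(1) by (rule wge_obj)
      obtain h r k where d: "weight_decomposition C w (int n) X h r k" by (rule ex_weight_decomposition[OF X])
      note d = weight_decompositionD[OF d]
      note t = triD[OF d(1)]
      \<comment> \<open>The decomposition bounds each piece on one side only. The other bounds come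
        from rotated triangles, in which a piece is an extension of \<open>X\<close> and a shift of
        the other piece.\<close>
      have h1: "shO C 1 (src C h) \<in> wle C w (int (Suc n))" using d(2) t by (simp add: shO_wle_iff)
      have "tgt C r \<in> wle C w (int (Suc n))"
        by (rule wle_extension[OF tri_rot[OF d(1)]]) (use Suc.prems(2) d(3) t h1 in simp_all)
      then have r: "P (tgt C r)" using d(4) by (intro weq[of "int (Suc n)"]) (simp_all add: weq_def add.commute)
      have "shO C (-1) (tgt C r) \<in> wge C w (int n)" using d(4) t by (simp add: shO_wge_iff)
      \<comment> \<open>Here \<open>n \<noteq> 0\<close> enters: the desuspended complement has
        weight at least \<open>n\<close>, and this must still be at least \<open>1\<close>.\<close>
      then have "shO C (-1) (tgt C r) \<in> wge C w 1" by (rule wge_mono) (use False in simp)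
      then have "tgt C (pneg C (shA C (-1) k)) \<in> wge C w 1"
        by (intro wge_extension[OF tri_unrot[OF d(1)]]) (use Suc.prems(1) d(3) t in simp_all)
      then have "src C h \<in> wge C w 1" using t by simp
      then have "P (src C h)" using d(2) by (rule Suc.IH)
      then show ?thesis using ext[OF d(1) _ r] d(3) by simp
    qed
  qed
  have down: "P X" if "X \<in> wle C w (-1)" "X \<in> wge C w (- int n)" for n X
    using that
  proof (induction n arbitrary: X)
    case 0
    then have X: "X \<in> wge C w 0" by simp
    show ?case by (rule zero[OF identity_zero_if_wle_wge[OF "0.prems"(1) X]]) simp
  next
    case (Suc n)
    show ?case
    proof (cases "n = 0")
      case True
      then show ?thesis using Suc.prems by (intro weq[of "-1"]) (simp_all add: weq_def)
    next
      case False
      have X: "X \<in> obj C" using Suc.prems(1) by (rule wle_obj)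
      obtain h r k where d: "weight_decomposition C w (- int (Suc n)) X h r k" by (rule ex_weight_decomposition[OF X])
      note d = weight_decompositionD[OF d]
      note t = triD[OF d(1)]
      have R: "tgt C r \<in> wge C w (- int n)" using d(4) by simp
      have "shO C (-1) (tgt C r) \<in> wge C w (- int (Suc n))" using R t by (simp add: shO_wge_iff)
      then have "tgt C (pneg C (shA C (-1) k)) \<in> wge C w (- int (Suc n))"
        by (intro wge_extension[OF tri_unrot[OF d(1)]]) (use Suc.prems(2) d(3) t in simp_all)
      then have "src C h \<in> wge C w (- int (Suc n))" using t by simp
      then have l: "P (src C h)" using d(2) by (intro weq[of "- int (Suc n)"]) (simp_all add: weq_def)
      \<comment> \<open>One spare degree is obtained from \<open>n \<noteq> 0\<close>, so that the
        shifted truncation still has weight at most \<open>-1\<close>.\<close>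
      have "src C h \<in> wle C w (- 2)" by (rule wle_mono[OF d(2)]) (use False in simp)
      then have h1: "shO C 1 (src C h) \<in> wle C w (- 1)" using t by (simp add: shO_wle_iff)
      have "tgt C r \<in> wle C w (- 1)"
        by (rule wle_extension[OF tri_rot[OF d(1)]]) (use Suc.prems(1) d(3) t h1 in simp_all)
      then have "P (tgt C r)" using R by (rule Suc.IH)
      then show ?thesis using ext[OF d(1) l] d(3) by simp
    qed
  qed
  show "P X" if X: "X \<in> wge C w 1"
  proof -
    have "X \<in> (\<Union>i. wle C w i)" using b wge_obj[OF X] by (simp add: bounded_weights_def)
    then obtain i where "X \<in> wle C w i" by blast
    then have "X \<in> wle C w (int (nat i))" by (rule wle_mono) simp
    then show ?thesis by (rule up[OF X])
  qed
  show "P X" if X: "X \<in> wle C w (-1)"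
  proof -
    have "X \<in> (\<Union>i. wge C w i)" using b wle_obj[OF X] by (simp add: bounded_weights_def)
    then obtain i where "X \<in> wge C w i" by blast
    then have "X \<in> wge C w (- int (nat (- i)))" by (rule wge_mono) simp
    then show ?thesis by (rule down[OF X])
  qed
qed

end

context pure_setting
begin

text \<open>Both variances are treated together, as on endomorphisms of one object the opposite
  category has the same addition and identity. Since the identity of \<open>X\<close> is zero,
  additivity at \<open>0 + 0\<close> shows that the identity of its value equals its own
  double.\<close>

lemma fobj_zero_object:
  assumes H: "H \<in> homological_functors C D \<union> cohomological_functors C D" and X: "zero_object C X"
  shows "zero_object D (fobj H X)"
proof -
  have X': "X \<in> obj C" "idt C X = pzero C X X" using X by (simp_all add: zero_object_iff)
  have add: "farr H (f \<boxplus> g) = farr H f \<boxplus>\<^bsub>D\<^esub> farr H g" if fg: "f \<in> homs C X X" "g \<in> homs C X X" for f g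
    using H
  proof
    assume "H \<in> homological_functors C D"
    then have "\<forall>X \<in> obj C. \<forall>Y \<in> obj C. \<forall>f \<in> homs C X Y. \<forall>g \<in> homs C X Y.
        farr H (f \<boxplus> g) = farr H f \<boxplus>\<^bsub>D\<^esub> farr H g"
      by (simp add: homological_functors_def additive_functors_def)
    then show ?thesis using fg X'(1) by blast
  next
    assume "H \<in> cohomological_functors C D"
    then have "\<forall>X \<in> obj (op_cat C). \<forall>Y \<in> obj (op_cat C). \<forall>f \<in> homs (op_cat C) X Y. \<forall>g \<in> homs (op_cat C) X Y.
        farr H (f \<boxplus>\<^bsub>op_cat C\<^esub> g) = farr H f \<boxplus>\<^bsub>D\<^esub> farr H g"
      by (simp add: cohomological_functors_def additive_functors_def)
    moreover have "X \<in> obj (op_cat C)" "f \<in> homs (op_cat C) X X" "g \<in> homs (op_cat C) X X"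
      using fg X'(1) by (simp_all add: in_homs op_cat_def)
    ultimately have "farr H (f \<boxplus>\<^bsub>op_cat C\<^esub> g) = farr H f \<boxplus>\<^bsub>D\<^esub> farr H g" by blast
    then show ?thesis by (simp add: op_cat_def)
  qed
  have "farr H (pzero C X X \<boxplus> pzero C X X) = farr H (pzero C X X) \<boxplus>\<^bsub>D\<^esub> farr H (pzero C X X)"
    by (rule add) (use X' in \<open>simp_all add: in_homs\<close>)
  moreover have "fobj H X \<in> obj D" "farr H (idt C X) = idt D (fobj H X)"
    using H X'(1) unfolding homological_functors_def cohomological_functors_def additive_functors_def is_functor_def
    by (auto simp: op_cat_def)
  ultimately have *: "fobj H X \<in> obj D" "farr H (idt C X) = idt D (fobj H X)"
    "farr H (pzero C X X \<boxplus> pzero C X X) = farr H (pzero C X X) \<boxplus>\<^bsub>D\<^esub> farr H (pzero C X X)"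
    by simp_all
  have "idt D (fobj H X) \<boxplus>\<^bsub>D\<^esub> idt D (fobj H X) = idt D (fobj H X) \<boxplus>\<^bsub>D\<^esub> pzero D (fobj H X) (fobj H X)"
    using * X' by simp
  then have "idt D (fobj H X) = pzero D (fobj H X) (fobj H X)"
    by (rule D.padd_left_cancel) (use * in simp_all)
  then show ?thesis using * by (simp add: D.zero_object_iff)
qed

lemma fobj_extension:
  assumes H: "H \<in> homological_functors C D \<union> cohomological_functors C D" and T: "(f, g, h) \<in> tri C"
    and z: "zero_object D (fobj H (src C f))" "zero_object D (fobj H (tgt C g))"
  shows "zero_object D (fobj H (tgt C f))"
  using H
proof
  assume H: "H \<in> homological_functors C D"
  note F = is_functorD[OF homological_is_functor[OF H]] and t = triD[OF T]
  have "exact_pair D (farr H (shA C 0 f)) (farr H (shA C 0 g))"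
    using H T unfolding homological_functors_def by blast
  then have "exact_pair D (farr H f) (farr H g)" by simp
  from D.exact_zero_zero[OF this] show ?thesis using z F t by simp
next
  assume H: "H \<in> cohomological_functors C D"
  then have "is_functor (op_cat C) D H" by (simp add: cohomological_functors_def additive_functors_def)
  note F = is_functorD[OF this, unfolded op_cat_def, simplified] and t = triD[OF T]
  have "exact_pair D (farr H (shA C 0 g)) (farr H (shA C 0 f))"
    using H T unfolding cohomological_functors_def by blast
  then have "exact_pair D (farr H g) (farr H f)" by simp
  from D.exact_zero_zero[OF this] show ?thesis using z F t by simp
qed

text \<open>Nonzero weights lie strictly on one side of zero, which gives one direction by
  monotonicity. For the other, vanishing of the value holds at zero objects and is stable under
  extensions, as \<open>bounded_induction\<close> asks.\<close>

lemma bounded_pure_iff: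
  assumes b: "bounded_weights C w" and H: "H \<in> homological_functors C D \<union> cohomological_functors C D"
  shows "is_pure C w D H \<longleftrightarrow> (\<forall>i. i \<noteq> 0 \<longrightarrow> kills D H (weq C w i))"
proof
  assume p: "is_pure C w D H"
  show "\<forall>i. i \<noteq> 0 \<longrightarrow> kills D H (weq C w i)"
  proof (intro allI impI)
    fix i :: int assume "i \<noteq> 0"
    then consider "1 \<le> i" | "i \<le> -1" by linarith
    then show "kills D H (weq C w i)"
    proof cases
      case 1
      then show ?thesis using p wge_mono[of _ i 1] by (auto simp: is_pure_def kills_def weq_def)
    next
      case 2
      then show ?thesis using p wle_mono[of _ i "-1"] by (auto simp: is_pure_def kills_def weq_def)
    qed
  qed
next
  assume k: "\<forall>i. i \<noteq> 0 \<longrightarrow> kills D H (weq C w i)"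
  note ind = bounded_induction[OF b, of "\<lambda>X. zero_object D (fobj H X)"]
  have "zero_object D (fobj H X)" if "X \<in> wge C w 1" for X
    by (rule ind(1)[OF fobj_extension[OF H] fobj_zero_object[OF H]]) (use k that in \<open>auto simp: kills_def\<close>)
  moreover have "zero_object D (fobj H X)" if "X \<in> wle C w (-1)" for X
    by (rule ind(2)[OF fobj_extension[OF H] fobj_zero_object[OF H]]) (use k that in \<open>auto simp: kills_def\<close>)
  ultimately show "is_pure C w D H" by (simp add: is_pure_def kills_def)
qed

end

theorem theorem2p1p2:
  fixes C :: "('o, 'm) tricat" and w :: "'o weights" and D :: "('a, 'b) precat"
  assumes "weight_structure C w" and "abelian_category D"
  shows
    "(\<exists>T. tower_choice C w T) \<and>
     (\<forall>T. tower_choice C w T \<longrightarrow>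
        (\<forall>A \<in> additive_functors (heart C w) D.
           pure_functor C D T A \<in> homological_functors C D \<and>
           (\<forall>g \<in> arr C.
              (\<exists>a b. tower_morphism C (T (src C g)) (T (tgt C g)) g a b) \<and>
              (\<forall>a b. tower_morphism C (T (src C g)) (T (tgt C g)) g a b \<longrightarrow>
                 farr (pure_functor C D T A) g =
                 pure_map C D A (T (src C g)) A (T (tgt C g)) (farr A (wc_map C b 0)))) \<and>
           (\<forall>T'. tower_choice C w T' \<longrightarrow>
              (\<exists>t. is_nat_iso C D (pure_functor C D T A) (pure_functor C D T' A) t \<and>
                 (\<forall>M \<in> obj C. \<forall>a b. tower_morphism C (T M) (T' M) (idt C M) a b \<longrightarrow>
                    t M = pure_map C D A (T M) A (T' M) (farr A (wc_map C b 0)))))) \<and>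
        is_functor (additive_functor_cat C w D) (homological_functor_cat C D)
          (pure_assignment C w D T) \<and>
        equivalence_of_categories (additive_functor_cat C w D) (pure_functor_cat C w D)
          (pure_assignment C w D T)) \<and>
     (bounded_weights C w \<longrightarrow>
        (\<forall>H \<in> homological_functors C D \<union> cohomological_functors C D.
           is_pure C w D H \<longleftrightarrow> (\<forall>i. i \<noteq> 0 \<longrightarrow> kills D H (weq C w i))))"
proof -
  interpret pure_setting C w D
    using assms by (simp add: pure_setting_def)
  have "pure_functor C D T A \<in> homological_functors C D \<and>
       (\<forall>g \<in> arr C.
          (\<exists>a b. tower_morphism C (T (src C g)) (T (tgt C g)) g a b) \<and>
          (\<forall>a b. tower_morphism C (T (src C g)) (T (tgt C g)) g a b \<longrightarrow>
             farr (pure_functor C D T A) g =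
             pure_map C D A (T (src C g)) A (T (tgt C g)) (farr A (wc_map C b 0)))) \<and>
       (\<forall>T'. tower_choice C w T' \<longrightarrow>
          (\<exists>t. is_nat_iso C D (pure_functor C D T A) (pure_functor C D T' A) t \<and>
             (\<forall>M \<in> obj C. \<forall>a b. tower_morphism C (T M) (T' M) (idt C M) a b \<longrightarrow>
                t M = pure_map C D A (T M) A (T' M) (farr A (wc_map C b 0)))))"
    if T: "tower_choice C w T" and A: "A \<in> additive_functors (heart C w) D" for T A
  proof -
    interpret A: heart_functor C w D A by (rule heart_functorI[OF A])
    note tT = tower_choice_weight_tower[OF T]
    show ?thesis
    proof (intro conjI ballI allI impI)
      show "pure_functor C D T A \<in> homological_functors C D" by (rule A.pure_functor_homological[OF T])
    next
      fix g assume g: "g \<in> arr C"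
      note t = tT[OF src_obj[OF g]] tT[OF tgt_obj[OF g]]
      show "\<exists>a b. tower_morphism C (T (src C g)) (T (tgt C g)) g a b"
        using ex_tower_morphism[OF t g refl refl] by blast
      fix a b assume "tower_morphism C (T (src C g)) (T (tgt C g)) g a b"
      from A.pmap_eq[OF t g refl refl this]
      show "farr (pure_functor C D T A) g = pure_map C D A (T (src C g)) A (T (tgt C g)) (farr A (wc_map C b 0))"
        using g by (simp add: A.pure_functor_simps)
    next
      fix T' assume T': "tower_choice C w T'"
      show "\<exists>t. is_nat_iso C D (pure_functor C D T A) (pure_functor C D T' A) t \<and>
             (\<forall>M \<in> obj C. \<forall>a b. tower_morphism C (T M) (T' M) (idt C M) a b \<longrightarrow>
                t M = pure_map C D A (T M) A (T' M) (farr A (wc_map C b 0)))"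
      proof (intro exI conjI ballI allI impI)
        show "is_nat_iso C D (pure_functor C D T A) (pure_functor C D T' A) (\<lambda>M \<in> obj C. A.pmap (T M) (T' M) (idt C M))"
          by (rule A.pure_functor_choice_iso[OF T T'])
        fix M a b assume M: "M \<in> obj C" and ab: "tower_morphism C (T M) (T' M) (idt C M) a b"
        show "(\<lambda>M \<in> obj C. A.pmap (T M) (T' M) (idt C M)) M = pure_map C D A (T M) A (T' M) (farr A (wc_map C b 0))"
          using A.pmap_eq[OF tT[OF M] tower_choice_weight_tower[OF T' M] _ _ _ ab] M by simp
      qed
    qed
  qed
  moreover have "is_functor (additive_functor_cat C w D) (homological_functor_cat C D) (pure_assignment C w D T)"
    if T: "tower_choice C w T" for T
    by (rule is_functor_pure_assignment[OF T]) (rule heart_functor.pure_functor_homological[OF heart_functorI T])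
  ultimately show ?thesis
    using ex_tower_choice equivalence_pure_assignment bounded_pure_iff by blast
qed

end
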